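(* Let $d\ge 1$, let $V\in C^\infty(\mathbb{T}^d)$ be real-valued, let $o\in C^\infty(\mathbb{T}^{2d})$, and fix an evolution time $t>0$ (of order $1$, i.e. independent of $h$). For $N\in\mathbb{N}$, $N\geq 1$, put $h=\frac1{2\pi N}$, let $A$ and $B$ be the $N^d\times N^d$ central finite difference discretizations of $-\frac{h^2}{2}\Delta$ and of multiplication by $V$ on the periodic unit cube with $N$ equidistant nodes per dimension, let $H=A+B$, and let $O=\mathrm{op}_N(o)$. For $n\ge 1$ and $s=t/n$ define $$T(t)=e^{\mathrm{i}Ht/h}Oe^{-\mathrm{i}Ht/h},\qquad T_{1,n}(s)=\big(e^{\mathrm{i}As/h}e^{\mathrm{i}Bs/h}\big)^nO\big(e^{-\mathrm{i}Bs/h}e^{-\mathrm{i}As/h}\big)^n,$$ $$T_{2,n}(s)=\big(e^{\mathrm{i}As/(2h)}e^{\mathrm{i}Bs/h}e^{\mathrm{i}As/(2h)}\big)^nO\big(e^{-\mathrm{i}As/(2h)}e^{-\mathrm{i}Bs/h}e^{-\mathrm{i}As/(2h)}\big)^n.$$ For $\epsilon>0$ and $k\in\{1,2\}$ let $L_k=L_k(\epsilon,h)$ be the number of time steps required by the $k$-th order Trotter formula for precision $\epsilon$, that is, the least $n\ge 1$ such that $\|T_{k,n}(t/n)-T(t)\|\le\epsilon$ in the spectral norm. Then, for all sufficiently small $\epsilon$, $$L_1=\mathcal{O}(1/\epsilon),\qquad L_2=\mathcal{O}(1/\epsilon^{1/2}),$$ independently of $h$: there are constants $C,\epsilon_0>0$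 not depending on $h$ (equivalently, on $N$) such that $L_1\le C\epsilon^{-1}$ and $L_2\le C\epsilon^{-1/2}$ for all $0<\epsilon\le\epsilon_0$ and all $N\ge 1$.
   Context: $\mathbb{T}=\mathbb{R}/\mathbb{Z}$. The underlying equation is the semiclassical Schrödinger equation $\mathrm{i}h\partial_t u=-\frac{h^2}{2}\Delta u+V(x)u$. Finite difference discretization: in one dimension let $$A^0=\frac{h^2N^2}{2}\,M_N ,$$ where $M_N$ is the $N\times N$ circulant matrix of the periodic second difference, $(M_Nv)_j=2v_j-v_{j-1}-v_{j+1}$ with indices mod $N$; in $d$ dimensions $A=A^0\otimes I_N^{\otimes(d-1)}+\dots+I_N^{\otimes(d-1)}\otimes A^0$. $B$ is the diagonal matrix with entries $V(j/N)$, $j\in\{0,\dots,N-1\}^d$. Quantized torus: let $H_N$ be the $N^d$-dimensional space of tempered distributions on $\mathbb{R}^d$ with orthonormal basis (by definition) $$Q_j=N^{-d/2}\sum_{k\in\mathbb{Z}^d}\delta_{x=k+\frac jN},\qquad j\in\{0,\dots,N-1\}^d,$$ $\delta_{x=y}$ being the Dirac distribution at $y$; operators on $H_N$ are identified with $N^d\times N^d$ matrices in this basis. For $o\in C^\infty(\mathbb{T}^{2d})$ with $\mathbb{Z}^{2d}$-periodic lift $\tilde o$ to $\mathbb{R}^{2d}$, and $h=\frac{1}{2\pi N}$, set $\mathrm{op}_N(o):=\mathrm{op}_h(\tilde o)|_{H_N}:H_N\to H_N$, where $$(\mathrm{op}_h(\tilde o)u)(x)=\frac{1}{(2\pi h)^d}\iint_{\mathbb{R}^{2d}}e^{\frac{\mathrm{i}}{h}\langle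 x-y,\xi\rangle}\tilde o\Big(\frac{x+y}{2},\xi\Big)u(y)\,dy\,d\xi$$ is the semiclassical Weyl quantization, extended by duality to tempered distributions. *)

theory Defs
  imports "HOL-Analysis.Analysis"
begin

section \<open>Smooth periodic functions and Schwartz functions\<close>

fun iter_deriv ::
  "'a list \<Rightarrow> ('a::real_normed_vector \<Rightarrow> 'b::real_normed_vector) \<Rightarrow> 'a \<Rightarrow> 'b"
where
  "iter_deriv [] f = f"
| "iter_deriv (v # vs) f = (\<lambda>x. frechet_derivative (iter_deriv vs f) (at x) v)"

text \<open>
  Class \<open>C\<^sup>\<infinity>\<close>: all iterated partial derivatives exist and are (totally) differentiable everywhere,
  hence continuous.
\<close>

definition smooth :: "('a::euclidean_space \<Rightarrow> 'b::real_normed_vector) \<Rightarrow> bool" where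
  "smooth f \<longleftrightarrow> (\<forall>vs. set vs \<subseteq> Basis \<longrightarrow> (\<forall>x. iter_deriv vs f differentiable (at x)))"

text \<open>
  A function on the torus \<open>\<real>\<^sup>m/\<int>\<^sup>m\<close> is represented by its periodic lift.  On
  \<open>(real ^ 'd) \<times> (real ^ 'd)\<close> the basis consists of the vectors \<open>(b, 0)\<close> and \<open>(0, b)\<close>, so there
  periodicity is with respect to \<open>\<int>\<^sup>2\<^sup>d\<close>.
\<close>

definition torus_periodic :: "('a::euclidean_space \<Rightarrow> 'b) \<Rightarrow> bool" where
  "torus_periodic f \<longleftrightarrow> (\<forall>x. \<forall>b\<in>Basis. f (x + b) = f x)"

definition schwartz :: "('a::euclidean_space \<Rightarrow> complex) \<Rightarrow> bool" where
  "schwartz \<phi> \<longleftrightarrow> smooth \<phi> \<and>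
     (\<forall>m::nat. \<forall>vs. set vs \<subseteq> Basis \<longrightarrow> (\<exists>C. \<forall>x. norm x ^ m * norm (iter_deriv vs \<phi> x) \<le> C))"


section \<open>Semiclassical Weyl quantization\<close>

text \<open>
  For a bounded symbol with bounded derivatives the double integral defining the Weyl quantization
  is oscillatory.  On a Schwartz function \<open>u\<close> it is the iterated integral below: the inner
  integral converges absolutely and decays rapidly in \<open>\<xi>\<close>.
\<close>

definition weyl ::
  "real \<Rightarrow> ((real ^ 'd) \<times> (real ^ 'd) \<Rightarrow> complex) \<Rightarrow>
    (real ^ 'd \<Rightarrow> complex) \<Rightarrow> real ^ 'd \<Rightarrow> complex"
where
  "weyl h a u x = complex_of_real (1 / (2 * pi * h) ^ CARD('d)) *
     (LINT \<xi>|lborel. LINT y|lborel. cis (((x - y) \<bullet> \<xi>) / h) * a ((1/2) *\<^sub>R (x + y), \<xi>) * u y)"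

text \<open>
  A tempered distribution is a functional on test functions; only its values on Schwartz functions
  are meaningful, so equality of distributions means agreement on Schwartz functions.
\<close>

type_synonym 'd distribution = "(real ^ 'd \<Rightarrow> complex) \<Rightarrow> complex"

text \<open>
  The extension by duality is \<open>\<langle>op\<^sub>h(a) T, \<phi>\<rangle> = \<langle>T, op\<^sub>h(a)\<^sup>t \<phi>\<rangle>\<close>, where the transpose is taken with
  respect to the bilinear pairing \<open>\<langle>u, \<phi>\<rangle> = \<integral> u \<phi>\<close>, that is, the two arguments of the Schwartz
  kernel are interchanged.  This amounts to replacing the symbol \<open>a(x, \<xi>)\<close> by \<open>a(x, -\<xi>)\<close>; see
  the lemma \<open>weyl_reflect\<close> below.
\<close>

definition weyl_distribution ::
  "real \<Rightarrow> ((real ^ 'd) \<times> (real ^ 'd) \<Rightarrow> complex) \<Rightarrow> 'd distribution \<Rightarrow> 'd distribution"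
where
  "weyl_distribution h a T \<phi> = T (weyl h (\<lambda>(x, \<xi>). a (x, - \<xi>)) \<phi>)"

lemma integral_lborel_uminus:
  fixes f :: "'a::euclidean_space \<Rightarrow> complex"
  shows "(LINT x|lborel. f (- x)) = (LINT x|lborel. f x)"
proof -
  have "integral\<^sup>L lborel f = integral\<^sup>L (distr lborel borel uminus) f"
  proof -
    have "(lborel :: 'a measure) =
        density (distr lborel borel (\<lambda>x. 0 + (-1) *\<^sub>R x)) (\<lambda>_. ennreal (\<bar>-1\<bar> ^ DIM('a)))"
      by (rule lborel_affine) simp
    also have "\<dots> = distr lborel borel uminus"
      by (simp add: density_1)
    finally show ?thesis by simp
  qed
  also have "\<dots> = (LINT x|lborel. f (- x))"
  proof (cases "f \<in> borel_measurable borel")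
    case True
    then show ?thesis by (subst integral_distr) auto
  next
    case False
    have "\<not> integrable (distr lborel borel uminus) f"
      using False by (auto dest: borel_measurable_integrable)
    moreover have "\<not> integrable lborel (\<lambda>x. f (- x))"
    proof
      assume "integrable lborel (\<lambda>x. f (- x))"
      then have "(\<lambda>x. f (- x)) \<in> borel_measurable borel"
        by (auto dest: borel_measurable_integrable)
      then have "(\<lambda>x. (\<lambda>x. f (- x)) (- x)) \<in> borel_measurable borel"
        by (rule measurable_compose[rotated]) simp
      with False show False by simp
    qed
    ultimately show ?thesis by (simp add: not_integrable_integral_eq)
  qed
  finally show ?thesis by simp
qed

lemma weyl_reflect:
  "weyl h (\<lambda>(x, \<xi>). a (x, - \<xi>)) \<phi> (y :: real ^ 'd) = complex_of_real (1 / (2 * pi * h) ^ CARD('d)) *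
     (LINT \<xi>|lborel. LINT x|lborel. cis (((x - y) \<bullet> \<xi>) / h) * a ((1/2) *\<^sub>R (x + y), \<xi>) * \<phi> x)"
proof -
  let ?F = "\<lambda>\<xi>. LINT x|lborel. cis (((x - y) \<bullet> \<xi>) / h) * a ((1/2) *\<^sub>R (x + y), \<xi>) * \<phi> x"
  have "(x - y) \<bullet> (- \<xi>) = (y - x) \<bullet> \<xi>" for x \<xi>
    by (simp add: inner_diff_left)
  then have "weyl h (\<lambda>(x, \<xi>). a (x, - \<xi>)) \<phi> y =
      complex_of_real (1 / (2 * pi * h) ^ CARD('d)) * (LINT \<xi>|lborel. ?F (- \<xi>))"
    by (simp add: weyl_def add.commute)
  then show ?thesis
    by (simp only: integral_lborel_uminus[of ?F])
qed


section \<open>Matrices over a finite index set\<close>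

text \<open>
  The dimension \<open>N\<^sup>d\<close> varies with \<open>N\<close>, so matrices are functions of two indices, of which only
  the entries with both indices in a finite set \<open>I\<close> matter.
\<close>

type_synonym 'i cmatrix = "'i \<Rightarrow> 'i \<Rightarrow> complex"

definition mat_id :: "'i cmatrix" where
  "mat_id j k = of_bool (j = k)"

definition mat_mul :: "'i set \<Rightarrow> 'i cmatrix \<Rightarrow> 'i cmatrix \<Rightarrow> 'i cmatrix" where
  "mat_mul I X Y j k = (\<Sum>l\<in>I. X j l * Y l k)"

fun mat_pow :: "'i set \<Rightarrow> 'i cmatrix \<Rightarrow> nat \<Rightarrow> 'i cmatrix" where
  "mat_pow I X 0 = mat_id"
| "mat_pow I X (Suc n) = mat_mul I X (mat_pow I X n)"

definition mat_exp :: "'i set \<Rightarrow> 'i cmatrix \<Rightarrow> 'i cmatrix" where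
  "mat_exp I X j k = (\<Sum>m. mat_pow I X m j k / fact m)"

definition spectral_norm :: "'i set \<Rightarrow> 'i cmatrix \<Rightarrow> real" where
  "spectral_norm I X =
     (SUP v \<in> {v. L2_set (\<lambda>k. norm (v k)) I \<le> 1}. L2_set (\<lambda>j. norm (\<Sum>k\<in>I. X j k * v k)) I)"

definition tensor :: "('d::finite \<Rightarrow> nat cmatrix) \<Rightarrow> ('d \<Rightarrow> nat) cmatrix" where
  "tensor M j k = (\<Prod>i\<in>UNIV. M i (j i) (k i))"


section \<open>Finite difference discretization\<close>

definition grid :: "nat \<Rightarrow> ('d::finite \<Rightarrow> nat) set" where
  "grid N = {j. \<forall>i. j i < N}"

definition node :: "nat \<Rightarrow> ('d::finite \<Rightarrow> nat) \<Rightarrow> real ^ 'd" where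
  "node N j = (\<chi> i. real (j i) / real N)"

definition planck :: "nat \<Rightarrow> real" where
  "planck N = 1 / (2 * pi * real N)"

text \<open>
  The matrix of \<open>(M v)\<^sub>j = 2 v\<^sub>j - v\<^sub>j\<^sub>-\<^sub>1 - v\<^sub>j\<^sub>+\<^sub>1\<close> with indices modulo \<open>N\<close>.  Entries that coincide for
  \<open>N \<le> 2\<close> add up.
\<close>

definition second_difference :: "nat \<Rightarrow> nat cmatrix" where
  "second_difference N j k =
     2 * of_bool (k = j) - of_bool ((k + 1) mod N = j) - of_bool (k = (j + 1) mod N)"

definition kinetic_1d :: "nat \<Rightarrow> nat cmatrix" where
  "kinetic_1d N j k = complex_of_real ((planck N)\<^sup>2 * (real N)\<^sup>2 / 2) * second_difference N j k"

definition kinetic :: "nat \<Rightarrow> ('d::finite \<Rightarrow> nat) cmatrix" where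
  "kinetic N j k = (\<Sum>i\<in>UNIV. tensor (\<lambda>l. if l = i then kinetic_1d N else mat_id) j k)"

definition potential :: "(real ^ 'd \<Rightarrow> real) \<Rightarrow> nat \<Rightarrow> ('d::finite \<Rightarrow> nat) cmatrix" where
  "potential V N j k = (if j = k then complex_of_real (V (node N j)) else 0)"


section \<open>Quantized torus\<close>

text \<open>The distribution \<open>Q\<^sub>j\<close>, a normalized sum of Dirac distributions over \<open>j/N + \<int>\<^sup>d\<close>.\<close>

definition dirac_comb :: "nat \<Rightarrow> ('d::finite \<Rightarrow> nat) \<Rightarrow> 'd distribution" where
  "dirac_comb N j \<phi> = complex_of_real (real N powr (- real CARD('d) / 2)) *
     (\<Sum>\<^sub>\<infinity>k::int ^ 'd. \<phi> ((\<chi> i. real_of_int (k $ i)) + node N j))"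

text \<open>
  The matrix, in the basis \<open>(Q\<^sub>j)\<close>, of the restriction of \<open>op\<^sub>h(a)\<close> to the span of the \<open>Q\<^sub>j\<close>.  The
  restriction maps this span to itself and the \<open>Q\<^sub>j\<close> are linearly independent, so the entries with
  indices in \<open>grid N\<close> are uniquely determined; the irrelevant ones are set to 0 to make the matrix
  unique.
\<close>

definition torus_quantization ::
  "nat \<Rightarrow> ((real ^ 'd) \<times> (real ^ 'd) \<Rightarrow> complex) \<Rightarrow> ('d::finite \<Rightarrow> nat) cmatrix"
where
  "torus_quantization N a = (THE M.
     (\<forall>j k. j \<notin> grid N \<or> k \<notin> grid N \<longrightarrow> M j k = 0) \<and>
     (\<forall>k\<in>grid N. \<forall>\<phi>. schwartz \<phi> \<longrightarrow>
        weyl_distribution (planck N) a (dirac_comb N k) \<phi> = (\<Sum>j\<in>grid N. M j k * dirac_comb N j \<phi>)))"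


section \<open>Exact and Trotterized observables\<close>

text \<open>\<open>propagator I h X \<tau>\<close> is \<open>e\<^bsup>iX\<tau>/h\<^esup>\<close>.\<close>

definition propagator :: "'i set \<Rightarrow> real \<Rightarrow> 'i cmatrix \<Rightarrow> real \<Rightarrow> 'i cmatrix" where
  "propagator I h X \<tau> = mat_exp I (\<lambda>j k. \<i> * complex_of_real (\<tau> / h) * X j k)"

definition heisenberg ::
  "'i set \<Rightarrow> real \<Rightarrow> 'i cmatrix \<Rightarrow> 'i cmatrix \<Rightarrow> 'i cmatrix \<Rightarrow> real \<Rightarrow> 'i cmatrix"
where
  "heisenberg I h A B Ob t =
     (let H = (\<lambda>j k. A j k + B j k)
      in mat_mul I (mat_mul I (propagator I h H t) Ob) (propagator I h H (- t)))"

definition trotter1 ::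
  "'i set \<Rightarrow> real \<Rightarrow> 'i cmatrix \<Rightarrow> 'i cmatrix \<Rightarrow> 'i cmatrix \<Rightarrow> nat \<Rightarrow> real \<Rightarrow> 'i cmatrix"
where
  "trotter1 I h A B Ob n s =
     (let P = mat_mul I (propagator I h A s) (propagator I h B s);
          P' = mat_mul I (propagator I h B (- s)) (propagator I h A (- s))
      in mat_mul I (mat_mul I (mat_pow I P n) Ob) (mat_pow I P' n))"

definition trotter2 ::
  "'i set \<Rightarrow> real \<Rightarrow> 'i cmatrix \<Rightarrow> 'i cmatrix \<Rightarrow> 'i cmatrix \<Rightarrow> nat \<Rightarrow> real \<Rightarrow> 'i cmatrix"
where
  "trotter2 I h A B Ob n s =
     (let P = mat_mul I (mat_mul I (propagator I h A (s / 2)) (propagator I h B s)) (propagator I h A (s / 2));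
          P' = mat_mul I (mat_mul I (propagator I h A (- s / 2)) (propagator I h B (- s)))
                 (propagator I h A (- s / 2))
      in mat_mul I (mat_mul I (mat_pow I P n) Ob) (mat_pow I P' n))"

definition trotter_error1 ::
  "(real ^ 'd \<Rightarrow> real) \<Rightarrow> ((real ^ 'd) \<times> (real ^ 'd) \<Rightarrow> complex) \<Rightarrow> real \<Rightarrow> nat \<Rightarrow> nat \<Rightarrow> real"
where
  "trotter_error1 V a t N n =
     (let I = (grid N :: ('d \<Rightarrow> nat) set); h = planck N;
          A = kinetic N; B = potential V N; Ob = torus_quantization N a
      in spectral_norm I
           (\<lambda>j k. trotter1 I h A B Ob n (t / real n) j k - heisenberg I h A B Ob t j k))"

definition trotter_error2 ::
  "(real ^ 'd \<Rightarrow> real) \<Rightarrow> ((real ^ 'd) \<times> (real ^ 'd) \<Rightarrow> complex) \<Rightarrow> real \<Rightarrow> nat \<Rightarrow> nat \<Rightarrow> real"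
where
  "trotter_error2 V a t N n =
     (let I = (grid N :: ('d \<Rightarrow> nat) set); h = planck N;
          A = kinetic N; B = potential V N; Ob = torus_quantization N a
      in spectral_norm I
           (\<lambda>j k. trotter2 I h A B Ob n (t / real n) j k - heisenberg I h A B Ob t j k))"

text \<open>
  The least number \<open>n \<ge> 1\<close> of steps with error at most \<open>\<epsilon>\<close>; it is \<open>\<infinity>\<close> if no such \<open>n\<close> exists, so
  a finite upper bound includes existence.
\<close>

definition required_steps :: "(nat \<Rightarrow> real) \<Rightarrow> real \<Rightarrow> enat" where
  "required_steps err \<epsilon> = Inf (enat ` {n. n \<ge> 1 \<and> err n \<le> \<epsilon>})"

end

theory Submission
  imports Defs
begin

text \<open>
  All operators involved are absolutely convergent combinations of the Weyl operators \<open>U\<^sub>b\<close>, \<open>b \<in> \<int>\<^sup>2\<^sup>d\<close>,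
  whose coefficients are the Fourier coefficients of the symbols: rapidly decreasing and independent of \<open>N\<close>.
  The \<open>U\<^sub>b\<close> are unitary and \<open>[U\<^sub>b, U\<^sub>c]/h\<close> is \<open>U\<^sub>b\<^sub>+\<^sub>c\<close> up to a factor bounded by a multiple of \<open>|b| |c|\<close>.  So the
  norms of iterated commutators with Weyl operators, each divided by \<open>h\<close>, act as \<open>C\<^sup>k\<close> norms: the scaled commutator
  with an operator of this class loses one derivative, with an \<open>N\<close>-independent constant, and Gronwall's
  argument shows that the exact evolution increases these norms by a factor independent of \<open>N\<close>
  (Egorov's theorem).  The error of one Trotter step consists of nested scaled commutators with \<open>A\<close> and
  \<open>B\<close> times \<open>s\<^sup>2\<close> or \<open>s\<^sup>3\<close>; in the telescoping sum the splitting step is applied after the exact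
  evolution, so it suffices that it is a contraction.
\<close>

section \<open>Lattice sums and integrals over the unit cube\<close>

text \<open>The obstacle is that \<open>H/h\<close> has norm of order 1/h in general, so the
  propagators themselves admit no uniform Trotter bound. Only the conjugated observable does,
  because its commutators gain the missing factor h. The discrete Laplacian fits the class without
  any continuum limit: since h N = 1/(2 pi), \<open>A\<close> is exactly the quantization of the sum
  over i of (1 - cos(2 pi xi_i))/(4 pi^2), a trigonometric polynomial free of N. Gronwall closes for
  the following reason. Moving a word of scaled commutators past the generator leaves, by the Jacobi
  identity, remainders with no more commutators than the word has. The remaining top-order term is
  itself of commutator form and is removed by conjugating with the flow. Three commutators are
  carried throughout because the local error of the second-order formula contains three nested ones.
  The Fourier analysis is there for the observable alone in one respect: its matrix is defined by
  duality on Dirac combs. Fourier inversion computes the action of a single character on a test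
  function, and test functions separating the combs make the matrix unique.\<close>

definition int_lattice :: "'a::euclidean_space set" where
  "int_lattice = {m. \<forall>b\<in>Basis. m \<bullet> b \<in> \<int>}"

definition character :: "'a::euclidean_space \<Rightarrow> 'a \<Rightarrow> complex" where
  "character m x = cis (2 * pi * (m \<bullet> x))"

definition unit_cube :: "'a::euclidean_space set" where
  "unit_cube = {x. \<forall>b\<in>Basis. 0 \<le> x \<bullet> b \<and> x \<bullet> b < 1}"

text \<open>One majorant for sums over the lattice and for integrals over the whole space. The
  product form reduces summability to dimension one.\<close>

definition decay :: "'a::euclidean_space \<Rightarrow> real" where
  "decay x = (\<Prod>b\<in>Basis. 1 / (1 + (x \<bullet> b)\<^sup>2))"

text \<open>Fubini for counting measure times \<open>M\<close>, obtained by enumerating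
  \<open>K\<close>. Summability is required at every point of the space, because
  \<open>infsum\<close> takes the default value 0 where it fails.\<close>

lemma sum_integral_interchange:
  fixes f :: "'k \<Rightarrow> 'm \<Rightarrow> 'b::{banach,second_countable_topology}"
  assumes K: "countable K" and int: "\<And>k. k \<in> K \<Longrightarrow> integrable M (f k)"
    and sum: "(\<lambda>k. \<integral>x. norm (f k x) \<partial>M) summable_on K"
    and pt: "\<And>x. x \<in> space M \<Longrightarrow> (\<lambda>k. norm (f k x)) summable_on K"
  shows "integrable M (\<lambda>x. \<Sum>\<^sub>\<infinity>k\<in>K. f k x)"
    and "((\<lambda>k. \<integral>x. f k x \<partial>M) has_sum (\<integral>x. (\<Sum>\<^sub>\<infinity>k\<in>K. f k x) \<partial>M)) K"
proof -
  have "integrable M (\<lambda>x. \<Sum>\<^sub>\<infinity>k\<in>K. f k x) \<and>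
    ((\<lambda>k. \<integral>x. f k x \<partial>M) has_sum (\<integral>x. (\<Sum>\<^sub>\<infinity>k\<in>K. f k x) \<partial>M)) K"
  proof (cases "finite K")
    case True
    then show ?thesis using int by (auto intro!: has_sum_finiteI)
  next
    case False
    define e where "e = from_nat_into K"
    have e: "bij_betw e UNIV K"
      unfolding e_def using K False by (rule bij_betw_from_nat_into)
    then have eK: "e n \<in> K" for n by (auto simp: bij_betw_def)
    have s1: "summable (\<lambda>n. \<integral>x. norm (f (e n) x) \<partial>M)"
      using sum summable_on_reindex_bij_betw[OF e, of "\<lambda>k. \<integral>x. norm (f k x) \<partial>M"]
      by (auto intro: summable_on_imp_summable)
    have s2: "summable (\<lambda>n. norm (f (e n) x))" if "x \<in> space M" for x
      using pt[OF that] summable_on_reindex_bij_betw[OF e, of "\<lambda>k. norm (f k x)"]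
      by (auto intro: summable_on_imp_summable)
    have eq: "(\<Sum>n. f (e n) x) = (\<Sum>\<^sub>\<infinity>k\<in>K. f k x)" if "x \<in> space M" for x
    proof -
      have "((\<lambda>n. f (e n) x) has_sum (\<Sum>n. f (e n) x)) UNIV"
        by (intro norm_summable_imp_has_sum s2[OF that] summable_sums summable_norm_cancel[OF s2[OF that]])
      then show ?thesis
        by (simp add: has_sum_reindex_bij_betw[OF e, of "\<lambda>k. f k x"] infsumI)
    qed
    have i: "integrable M (\<lambda>x. \<Sum>n. f (e n) x)"
      using int eK s1 s2 by (intro integrable_suminf) auto
    have s: "(\<lambda>n. \<integral>x. f (e n) x \<partial>M) sums (\<integral>x. (\<Sum>n. f (e n) x) \<partial>M)"
      using int eK s1 s2 by (intro sums_integral) auto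
    have "((\<lambda>n. \<integral>x. f (e n) x \<partial>M) has_sum (\<integral>x. (\<Sum>n. f (e n) x) \<partial>M)) UNIV"
    proof (rule norm_summable_imp_has_sum[OF _ s])
      show "summable (\<lambda>n. norm (\<integral>x. f (e n) x \<partial>M))"
        by (rule summable_comparison_test[OF _ s1]) (auto intro!: integral_norm_bound)
    qed
    then have "((\<lambda>k. \<integral>x. f k x \<partial>M) has_sum (\<integral>x. (\<Sum>n. f (e n) x) \<partial>M)) K"
      by (simp add: has_sum_reindex_bij_betw[OF e, of "\<lambda>k. \<integral>x. f k x \<partial>M"])
    moreover have "(\<integral>x. (\<Sum>n. f (e n) x) \<partial>M) = (\<integral>x. (\<Sum>\<^sub>\<infinity>k\<in>K. f k x) \<partial>M)"
      using eq by (intro Bochner_Integration.integral_cong) auto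
    moreover have "integrable M (\<lambda>x. \<Sum>\<^sub>\<infinity>k\<in>K. f k x)"
      using i eq by (subst Bochner_Integration.integrable_cong[OF refl, of _ _ "\<lambda>x. \<Sum>n. f (e n) x"]) auto
    ultimately show ?thesis by simp
  qed
  then show "integrable M (\<lambda>x. \<Sum>\<^sub>\<infinity>k\<in>K. f k x)"
    and "((\<lambda>k. \<integral>x. f k x \<partial>M) has_sum (\<integral>x. (\<Sum>\<^sub>\<infinity>k\<in>K. f k x) \<partial>M)) K" by auto
qed

lemma decay_pos: "decay x > 0"
  unfolding decay_def by (intro prod_pos) (simp add: add_pos_nonneg)

lemma decay_le_1: "decay x \<le> 1"
  unfolding decay_def by (intro prod_le_1) (auto simp: divide_le_eq_1 add_pos_nonneg)

text \<open>Peetre's inequality, coordinate by coordinate.\<close>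

lemma decay_shift: "decay (x + y) \<le> (\<Prod>b\<in>Basis. 2 + 2 * (y \<bullet> b)\<^sup>2) * decay x"
proof -
  have *: "1 / (1 + (s + t)\<^sup>2) \<le> (2 + 2 * t\<^sup>2) * (1 / (1 + s\<^sup>2))" for s t :: real
  proof -
    have "1 + s\<^sup>2 \<le> (2 + 2 * t\<^sup>2) * (1 + (s + t)\<^sup>2)"
    proof -
      \<comment> \<open>This sum of squares is exactly the difference of the two sides.\<close>
      have "0 \<le> (s + 2 * t)\<^sup>2 + 1 + 2 * t\<^sup>2 * (s + t)\<^sup>2"
        by (intro add_nonneg_nonneg mult_nonneg_nonneg) auto
      then show ?thesis by (simp add: power2_eq_square algebra_simps)
    qed
    then show ?thesis by (simp add: field_simps add_pos_nonneg)
  qed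
  have "decay (x + y) \<le> (\<Prod>b\<in>Basis. (2 + 2 * (y \<bullet> b)\<^sup>2) * (1 / (1 + (x \<bullet> b)\<^sup>2)))"
    unfolding decay_def by (intro prod_mono conjI) (use * in \<open>auto simp: inner_add_left\<close>)
  then show ?thesis by (simp add: decay_def prod.distrib prod_dividef)
qed

lemma continuous_decay: "continuous_on UNIV decay"
  unfolding decay_def
  by (intro continuous_intros) (auto simp: add_nonneg_eq_0_iff)

lemma borel_measurable_decay [measurable]: "decay \<in> borel_measurable borel"
  by (rule borel_measurable_continuous_onI[OF continuous_decay])

lemma zero_in_int_lattice [simp]: "0 \<in> int_lattice"
  by (simp add: int_lattice_def)

lemma int_lattice_add: "x \<in> int_lattice \<Longrightarrow> y \<in> int_lattice \<Longrightarrow> x + y \<in> int_lattice"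
  by (simp add: int_lattice_def inner_add_left)

lemma int_lattice_minus: "x \<in> int_lattice \<Longrightarrow> - x \<in> int_lattice"
  by (simp add: int_lattice_def)

lemma int_lattice_diff: "x \<in> int_lattice \<Longrightarrow> y \<in> int_lattice \<Longrightarrow> x - y \<in> int_lattice"
  by (simp add: int_lattice_def inner_diff_left)

lemma int_lattice_add_iff: "y \<in> int_lattice \<Longrightarrow> x + y \<in> int_lattice \<longleftrightarrow> x \<in> int_lattice"
  using int_lattice_add[of x y] int_lattice_diff[of "x + y" y] by auto

lemma int_lattice_Basis: "b \<in> Basis \<Longrightarrow> b \<in> int_lattice"
  by (auto simp: int_lattice_def inner_Basis)

text \<open>The lattice is a set of real vectors, so that one theory serves both the space and the
  phase space. This bijection recovers the product structure, through which
  \<open>summable_decay\<close> reduces to the one-dimensional series.\<close>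

lemma bij_betw_int_lattice:
  "bij_betw (\<lambda>g. \<Sum>b\<in>Basis. g b *\<^sub>R b) (PiE Basis (\<lambda>_. \<int>)) (int_lattice :: 'a::euclidean_space set)"
proof (rule bij_betwI[where g = "\<lambda>m. \<lambda>b\<in>Basis. m \<bullet> b"])
  show "(\<lambda>g. \<Sum>b\<in>Basis. g b *\<^sub>R b) \<in> PiE Basis (\<lambda>_. \<int>) \<rightarrow> (int_lattice :: 'a set)"
    by (auto simp: int_lattice_def PiE_iff)
  show "(\<lambda>m. \<lambda>b\<in>Basis. m \<bullet> b) \<in> (int_lattice :: 'a set) \<rightarrow> PiE Basis (\<lambda>_. \<int>)"
    by (auto simp: int_lattice_def)
  show "(\<lambda>b\<in>Basis. (\<Sum>b\<in>Basis. g b *\<^sub>R b) \<bullet> b) = g" if "g \<in> PiE Basis (\<lambda>_. \<int>)" for g :: "'a \<Rightarrow> real"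
    using that by (auto simp: fun_eq_iff PiE_iff extensional_def)
  show "(\<Sum>b\<in>Basis. (\<lambda>b\<in>Basis. m \<bullet> b) b *\<^sub>R b) = m" if "m \<in> int_lattice" for m :: 'a
    using euclidean_representation[of m] by (simp cong: sum.cong)
qed

lemma countable_Ints_real: "countable (\<int> :: real set)"
  by (auto simp: Ints_def)

lemma countable_int_lattice: "countable (int_lattice :: 'a::euclidean_space set)"
proof -
  have "countable (PiE (Basis::'a set) (\<lambda>_. \<int> :: real set))"
    by (intro countable_PiE) (auto simp: countable_Ints_real)
  then show ?thesis
    unfolding bij_betw_imp_surj_on[OF bij_betw_int_lattice, symmetric] by (rule countable_image)
qed

lemma summable_on_Ints_inverse_squares: "(\<lambda>n::real. 1 / (1 + n\<^sup>2)) summable_on \<int>"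
proof -
  have nat: "summable (\<lambda>n. 1 / (1 + (real n)\<^sup>2))"
  proof (rule summable_comparison_test)
    show "summable (\<lambda>n. 1 / (real n) ^ 2)"
      using inverse_power_summable[of 2, where 'a = real] by (simp add: inverse_eq_divide)
    show "\<exists>N. \<forall>n\<ge>N. norm (1 / (1 + (real n)\<^sup>2)) \<le> 1 / (real n) ^ 2"
    proof (intro exI[of _ 1] allI impI)
      fix n :: nat assume "n \<ge> 1"
      then show "norm (1 / (1 + (real n)\<^sup>2)) \<le> 1 / (real n) ^ 2"
        by (auto intro!: divide_left_mono mult_pos_pos add_pos_nonneg)
    qed
  qed
  have 1: "(\<lambda>n. 1 / (1 + (real n)\<^sup>2)) summable_on UNIV"
    using nat by (intro norm_summable_imp_summable_on) (simp add: add_nonneg_nonneg)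
  have 2: "(\<lambda>n::real. 1 / (1 + n\<^sup>2)) summable_on (real ` UNIV)"
    by (subst summable_on_reindex) (use 1 in \<open>auto simp: o_def intro: inj_of_nat\<close>)
  have 3: "(\<lambda>n::real. 1 / (1 + n\<^sup>2)) summable_on ((\<lambda>n. - real n) ` UNIV)"
    by (subst summable_on_reindex) (use 1 in \<open>auto simp: o_def inj_def\<close>)
  have "\<int> = (real ` UNIV) \<union> ((\<lambda>n. - real n) ` UNIV)"
  proof (intro equalityI subsetI)
    fix x :: real assume "x \<in> \<int>"
    then obtain z where z: "x = of_int z" by (rule Ints_cases)
    show "x \<in> (real ` UNIV) \<union> ((\<lambda>n. - real n) ` UNIV)"
    proof (cases "z \<ge> 0")
      case True
      then have "x = real (nat z)" using z by simp
      then show ?thesis by blast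
    next
      case False
      then have "x = - real (nat (- z))" using z by simp
      then show ?thesis by blast
    qed
  qed auto
  then show ?thesis using summable_on_union[OF 2 3] by simp
qed

lemma summable_decay: "decay summable_on (int_lattice :: 'a::euclidean_space set)"
proof -
  let ?B = "Basis :: 'a set"
  have "Infinite_Set_Sum.abs_summable_on (\<lambda>n::real. 1 / (1 + n\<^sup>2)) \<int>"
    unfolding abs_summable_equivalent[symmetric]
    using summable_on_Ints_inverse_squares by (simp add: add_nonneg_nonneg)
  then have "Infinite_Set_Sum.abs_summable_on (\<lambda>g. \<Prod>b\<in>?B. 1 / (1 + (g b)\<^sup>2) :: real) (PiE ?B (\<lambda>_. \<int>))"
    by (intro abs_summable_on_prod_PiE[where f = "\<lambda>_ n. 1 / (1 + n\<^sup>2)"]) (auto simp: countable_Ints_real)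
  then have "(\<lambda>g. \<Prod>b\<in>?B. 1 / (1 + (g b)\<^sup>2) :: real) summable_on PiE ?B (\<lambda>_. \<int>)"
    unfolding abs_summable_equivalent[symmetric] by (rule abs_summable_summable)
  also have "?this \<longleftrightarrow> (\<lambda>g. decay (\<Sum>b\<in>?B. g b *\<^sub>R b)) summable_on PiE ?B (\<lambda>_. \<int>)"
    by (intro summable_on_cong) (simp add: decay_def)
  finally show ?thesis
    by (simp add: summable_on_reindex_bij_betw[OF bij_betw_int_lattice])
qed

lemma unit_cube_decomposition: "\<exists>!k. k \<in> int_lattice \<and> x - k \<in> unit_cube"
proof (rule ex1I)
  let ?k = "\<Sum>b\<in>Basis. of_int \<lfloor>x \<bullet> b\<rfloor> *\<^sub>R b"
  show "?k \<in> int_lattice \<and> x - ?k \<in> unit_cube"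
    by (auto simp: int_lattice_def unit_cube_def inner_diff_left) linarith+
  fix k assume k: "k \<in> int_lattice \<and> x - k \<in> unit_cube"
  show "k = ?k"
  proof (rule euclidean_eqI)
    fix b :: 'a assume b: "b \<in> Basis"
    with k obtain z where z: "k \<bullet> b = of_int z" by (auto simp: int_lattice_def elim: Ints_cases)
    have "0 \<le> x \<bullet> b - of_int z" "x \<bullet> b - of_int z < 1"
      using k b z by (auto simp: unit_cube_def inner_diff_left)
    then have "\<lfloor>x \<bullet> b\<rfloor> = z" by linarith
    then show "k \<bullet> b = ?k \<bullet> b" using b z by simp
  qed
qed

text \<open>The mean value inequality needs no completeness, unlike the integral form of the
  remainder. All later Taylor estimates in the matrix algebra, which is only a
  \<open>real_normed_algebra\<close>, rest on it.\<close>

lemma vector_derivative_bound: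
  fixes f :: "real \<Rightarrow> 'b::real_normed_vector"
  assumes "a \<le> b"
    and der: "\<And>t. a \<le> t \<Longrightarrow> t \<le> b \<Longrightarrow> (f has_vector_derivative f' t) (at t)"
    and bound: "\<And>t. a \<le> t \<Longrightarrow> t \<le> b \<Longrightarrow> norm (f' t) \<le> B"
  shows "norm (f b - f a) \<le> B * (b - a)"
proof -
  have "norm (f b - f a) \<le> B * norm (b - a)"
  proof (rule differentiable_bound[of "{a..b}" f "\<lambda>t h. h *\<^sub>R f' t"])
    show "(f has_derivative (\<lambda>h. h *\<^sub>R f' t)) (at t within {a..b})" if "t \<in> {a..b}" for t
      using der[of t] that by (auto simp: has_vector_derivative_def intro: has_derivative_at_withinI)
    show "onorm (\<lambda>h. h *\<^sub>R f' t) \<le> B" if "t \<in> {a..b}" for t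
      using bound[of t] that onorm_scaleR_left[OF bounded_linear_ident, of "f' t"] onorm_id[where 'a = real]
      by (auto simp: id_def)
  qed (use assms(1) in auto)
  then show ?thesis using assms(1) by simp
qed

lemma integral_lborel_translate:
  fixes f :: "'a::euclidean_space \<Rightarrow> 'b::{banach,second_countable_topology}"
  assumes [measurable]: "f \<in> borel_measurable borel"
  shows "(LINT x|lborel. f (x + a)) = (LINT x|lborel. f x)"
proof -
  have "integral\<^sup>L lborel f = integral\<^sup>L (distr lborel borel ((+) a)) f"
    by (simp add: lborel_distr_plus)
  also have "\<dots> = (LINT x|lborel. f (a + x))"
    by (rule integral_distr) auto
  finally show ?thesis by (simp add: add.commute)
qed

lemma integrable_lborel_translate:
  fixes f :: "'a::euclidean_space \<Rightarrow> 'b::{banach,second_countable_topology}"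
  assumes "integrable lborel f"
  shows "integrable lborel (\<lambda>x. f (x + a))"
proof -
  have [measurable]: "f \<in> borel_measurable borel"
    using borel_measurable_integrable[OF assms] by simp
  have "integrable (distr lborel borel ((+) a)) f"
    using assms by (simp add: lborel_distr_plus)
  then have "integrable lborel (\<lambda>x. f (a + x))"
    by (subst (asm) integrable_distr_eq) auto
  then show ?thesis by (simp add: add.commute)
qed

section \<open>The half-open unit cube as a fundamental domain of the lattice\<close>

lemma unit_cube_subset: "unit_cube \<subseteq> cbox 0 (One :: 'a::euclidean_space)"
  by (auto simp: unit_cube_def mem_box less_imp_le)

lemma unit_cube_measurable [measurable]: "(unit_cube :: 'a::euclidean_space set) \<in> sets borel"
proof -
  have "unit_cube = (\<Inter>b\<in>Basis. {x::'a. 0 \<le> x \<bullet> b} \<inter> {x. x \<bullet> b < 1})"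
    by (auto simp: unit_cube_def)
  also have "\<dots> \<in> sets borel"
    by (intro sets.finite_INT) auto
  finally show ?thesis .
qed

lemma set_integrable_unit_cube:
  fixes f :: "'a::euclidean_space \<Rightarrow> 'b::{banach,second_countable_topology}"
  assumes "continuous_on UNIV f"
  shows "set_integrable lborel unit_cube f"
proof (rule set_integrable_subset)
  show "set_integrable lborel (cbox 0 One) f"
    unfolding set_integrable_def
    using assms continuous_on_subset by (intro borel_integrable_compact) auto
qed (use unit_cube_subset in auto)

lemma emeasure_unit_cube_finite: "emeasure lborel (unit_cube :: 'a::euclidean_space set) < \<infinity>"
proof -
  have "emeasure lborel (unit_cube :: 'a set) \<le> emeasure lborel (cbox 0 (One::'a))"
    by (intro emeasure_mono unit_cube_subset) auto
  also have "\<dots> < \<infinity>" by (rule emeasure_lborel_cbox_finite)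
  finally show ?thesis .
qed

lemma decay_unit_cube:
  fixes x :: "'a::euclidean_space"
  assumes "x \<in> unit_cube"
  shows "decay (k + x) \<le> 4 ^ DIM('a) * decay k"
proof -
  have "(\<Prod>b\<in>Basis. 2 + 2 * (x \<bullet> b)\<^sup>2) \<le> (\<Prod>b\<in>(Basis::'a set). 4)"
  proof (rule prod_mono, safe)
    fix b :: 'a assume "b \<in> Basis"
    then have "0 \<le> x \<bullet> b" "x \<bullet> b \<le> 1" using assms by (auto simp: unit_cube_def less_imp_le)
    then have "(x \<bullet> b)\<^sup>2 \<le> 1" by (simp add: power_le_one)
    then show "2 + 2 * (x \<bullet> b)\<^sup>2 \<le> 4" by simp
  qed (simp add: add_nonneg_nonneg)
  then have "(\<Prod>b\<in>Basis. 2 + 2 * (x \<bullet> b)\<^sup>2) * decay k \<le> 4 ^ DIM('a) * decay k"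
    using decay_pos[of k] by (intro mult_right_mono) auto
  with decay_shift[of k x] show ?thesis by simp
qed

lemma has_sum_indicator_unit_cube:
  fixes x :: "'a::euclidean_space" and f :: "'a \<Rightarrow> 'b::real_normed_vector"
  shows "((\<lambda>k. indicator unit_cube (x - k) *\<^sub>R f k) has_sum f (THE k. k \<in> int_lattice \<and> x - k \<in> unit_cube)) int_lattice"
proof -
  define k0 where "k0 = (THE k. k \<in> int_lattice \<and> x - k \<in> unit_cube)"
  have k0: "k0 \<in> int_lattice \<and> x - k0 \<in> unit_cube"
    unfolding k0_def by (rule theI'[OF unit_cube_decomposition])
  have "((\<lambda>k. indicator unit_cube (x - k) *\<^sub>R f k) has_sum
      (\<Sum>k\<in>{k0}. indicator unit_cube (x - k) *\<^sub>R f k)) int_lattice"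
  proof (rule has_sum_finite_neutralI)
    fix k assume "k \<in> int_lattice - {k0}"
    then have "x - k \<notin> unit_cube" using unit_cube_decomposition[of x] k0 by auto
    then show "indicator unit_cube (x - k) *\<^sub>R f k = 0" by simp
  qed (use k0 in auto)
  moreover have "(\<Sum>k\<in>{k0}. indicator unit_cube (x - k) *\<^sub>R f k) = f k0"
    using k0 by (simp only: sum.insert finite.emptyI empty_iff sum.empty not_False_eq_True) simp
  ultimately show ?thesis unfolding k0_def by simp
qed

text \<open>At each point exactly one lattice translate of the cube has a nonzero indicator, so the
  localized pieces \<open>g k\<close> sum to \<open>f\<close>. Interchanging sum and integral then
  proves integrability together with the formula.\<close>

lemma tiling:
  fixes f :: "'a::euclidean_space \<Rightarrow> 'b::{banach,second_countable_topology}"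
  assumes [measurable]: "f \<in> borel_measurable borel"
    and int: "\<And>k. k \<in> int_lattice \<Longrightarrow> set_integrable lborel unit_cube (\<lambda>x. f (x + k))"
    and sum: "(\<lambda>k. LINT x:unit_cube|lborel. norm (f (x + k))) summable_on int_lattice"
  shows "integrable lborel f"
    and "((\<lambda>k. LINT x:unit_cube|lborel. f (x + k)) has_sum (LINT x|lborel. f x)) int_lattice"
proof -
  define g where "g k x = indicator unit_cube (x - k) *\<^sub>R f x" for k x
  have [measurable]: "(\<lambda>x. indicator unit_cube (x - k) *\<^sub>R f x) \<in> borel_measurable borel" for k :: 'a
    by measurable
  have gm [measurable]: "g k \<in> borel_measurable borel" for k :: 'a
    unfolding g_def by measurable
  have tr: "(LINT x|lborel. g k x) = (LINT x:unit_cube|lborel. f (x + k))" for k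
    using integral_lborel_translate[OF gm, of k k] by (simp add: g_def set_lebesgue_integral_def)
  have trn: "(LINT x|lborel. norm (g k x)) = (LINT x:unit_cube|lborel. norm (f (x + k)))" for k
    using integral_lborel_translate[of "\<lambda>x. norm (g k x)" k] by (simp add: g_def set_lebesgue_integral_def)
  have int': "integrable lborel (g k)" if "k \<in> int_lattice" for k
    using integrable_lborel_translate[OF int[OF that, unfolded set_integrable_def], of "-k"]
    by (simp add: g_def[abs_def])
  have f_eq: "(\<Sum>\<^sub>\<infinity>k\<in>int_lattice. g k x) = f x" for x
    using has_sum_indicator_unit_cube[of x "\<lambda>_. f x"] by (auto simp: g_def intro: infsumI)
  have pt: "(\<lambda>k. norm (g k x)) summable_on int_lattice" for x
    using has_sum_indicator_unit_cube[of x "\<lambda>_. norm (f x)"]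
    by (auto simp: g_def intro: has_sum_imp_summable)
  have "integrable lborel (\<lambda>x. \<Sum>\<^sub>\<infinity>k\<in>int_lattice. g k x)"
    "((\<lambda>k. LINT x|lborel. g k x) has_sum (LINT x|lborel. (\<Sum>\<^sub>\<infinity>k\<in>int_lattice. g k x))) int_lattice"
    using sum_integral_interchange[OF countable_int_lattice, of lborel g] int' sum pt
    by (auto simp: trn)
  then show "integrable lborel f"
    "((\<lambda>k. LINT x:unit_cube|lborel. f (x + k)) has_sum (LINT x|lborel. f x)) int_lattice"
    by (auto simp: f_eq tr)
qed

text \<open>Here summability is deduced: finitely many disjoint pieces of the integral of
  \<open>norm f\<close> never exceed the whole, so the partial sums are bounded.\<close>

lemma tiling_integrable:
  fixes f :: "'a::euclidean_space \<Rightarrow> 'b::{banach,second_countable_topology}"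
  assumes f: "integrable lborel f"
  shows "(\<lambda>k. LINT x:unit_cube|lborel. norm (f (x + k))) summable_on int_lattice" (is ?S)
    and "((\<lambda>k. LINT x:unit_cube|lborel. f (x + k)) has_sum (LINT x|lborel. f x)) int_lattice" (is ?T)
proof -
  have [measurable]: "f \<in> borel_measurable borel"
    using borel_measurable_integrable[OF f] by simp
  have int: "set_integrable lborel unit_cube (\<lambda>x. f (x + k))" for k
    unfolding set_integrable_def
    by (rule integrable_mult_indicator) (auto intro: integrable_lborel_translate f)
  have norm_f: "integrable lborel (\<lambda>x. norm (f x))" using f by simp
  define g where "g k x = indicator unit_cube (x - k) *\<^sub>R norm (f x)" for k x
  have gm [measurable]: "g k \<in> borel_measurable borel" for k
    unfolding g_def by measurable
  have trn: "(LINT x|lborel. g k x) = (LINT x:unit_cube|lborel. norm (f (x + k)))" for k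
    using integral_lborel_translate[OF gm, of k k] by (simp add: g_def set_lebesgue_integral_def)
  have gi: "integrable lborel (g k)" for k
    unfolding g_def
    by (rule Bochner_Integration.integrable_bound[OF norm_f]) (auto simp: indicator_def)
  show S: ?S
  proof (rule nonneg_bdd_above_summable_on)
    show "0 \<le> (LINT x:unit_cube|lborel. norm (f (x + k)))" for k
      by (auto simp: set_lebesgue_integral_def intro!: integral_nonneg_AE)
    show "bdd_above (sum (\<lambda>k. LINT x:unit_cube|lborel. norm (f (x + k))) ` {F. F \<subseteq> int_lattice \<and> finite F})"
    proof (rule bdd_aboveI2)
      fix F :: "'a set" assume F: "F \<in> {F. F \<subseteq> int_lattice \<and> finite F}"
      have "(\<Sum>k\<in>F. LINT x:unit_cube|lborel. norm (f (x + k))) = (LINT x|lborel. (\<Sum>k\<in>F. g k x))"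
        by (simp add: trn[symmetric] gi)
      also have "\<dots> \<le> (LINT x|lborel. norm (f x))"
      proof (rule integral_mono)
        show "(\<Sum>k\<in>F. g k x) \<le> norm (f x)" for x
        proof (rule finite_sum_le_has_sum[OF has_sum_indicator_unit_cube[of x "\<lambda>_. norm (f x)"], folded g_def])
          show "finite F" "F \<subseteq> int_lattice" using F by auto
          show "0 \<le> g k x" for k by (simp add: g_def)
        qed
      qed (use norm_f gi in auto)
      finally show "(\<Sum>k\<in>F. LINT x:unit_cube|lborel. norm (f (x + k))) \<le> (LINT x|lborel. norm (f x))" .
    qed
  qed
  show ?T by (rule tiling(2)) (use int S in auto)
qed

lemma set_integral_unit_cube_bound:
  fixes f :: "'a::euclidean_space \<Rightarrow> real"
  assumes "set_integrable lborel unit_cube f" and "\<And>x. x \<in> unit_cube \<Longrightarrow> f x \<le> B" and "0 \<le> B"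
  shows "(LINT x:unit_cube|lborel. f x) \<le> B * measure lborel (unit_cube :: 'a set)"
proof -
  have "integrable lborel (\<lambda>x::'a. indicator unit_cube x *\<^sub>R B)"
    using emeasure_unit_cube_finite[where 'a = 'a] by simp
  then have "(LINT x:unit_cube|lborel. f x) \<le> (LINT x:(unit_cube :: 'a set)|lborel. B)"
    unfolding set_lebesgue_integral_def
    using assms unfolding set_integrable_def
    by (intro Bochner_Integration.integral_mono) (auto simp: indicator_def)
  also have "\<dots> = B * measure lborel (unit_cube :: 'a set)"
    by (simp add: set_lebesgue_integral_def)
  finally show ?thesis .
qed

text \<open>Inherited from summability over the lattice: on the cube translated by \<open>k\<close>
  the function is comparable to its value at \<open>k\<close>.\<close>

lemma integrable_decay: "integrable lborel (decay :: 'a::euclidean_space \<Rightarrow> real)"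
proof (rule tiling(1))
  have si: "set_integrable lborel unit_cube (\<lambda>x::'a. decay (x + k))" for k
    by (intro set_integrable_unit_cube continuous_on_compose2[OF continuous_decay] continuous_intros) auto
  then show "set_integrable lborel unit_cube (\<lambda>x::'a. decay (x + k))" for k .
  let ?c = "4 ^ DIM('a) * measure lborel (unit_cube :: 'a set)"
  show "(\<lambda>k. LINT x:unit_cube|lborel. norm (decay (x + k :: 'a))) summable_on int_lattice"
  proof (rule summable_on_comparison_test[where f = "\<lambda>k. ?c * decay k"])
    show "(\<lambda>k::'a. ?c * decay k) summable_on int_lattice"
      by (intro summable_on_cmult_right summable_decay)
    fix k :: 'a
    have "(LINT x:unit_cube|lborel. decay (x + k)) \<le> 4 ^ DIM('a) * decay k * measure lborel (unit_cube :: 'a set)"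
      using decay_unit_cube[of _ k] less_imp_le[OF decay_pos[of k]]
      by (intro set_integral_unit_cube_bound si) (auto simp: add.commute)
    then show "(LINT x:unit_cube|lborel. norm (decay (x + k))) \<le> ?c * decay k"
      using abs_of_pos[OF decay_pos[where 'a = 'a]] by (simp add: algebra_simps)
    show "0 \<le> (LINT x:unit_cube|lborel. norm (decay (x + k)))"
      by (auto simp: set_lebesgue_integral_def intro!: integral_nonneg_AE)
  qed
qed auto

lemma integrable_decay_bound:
  fixes f :: "'a::euclidean_space \<Rightarrow> 'b::{banach,second_countable_topology}"
  assumes [measurable]: "f \<in> borel_measurable borel" and "\<And>x. norm (f x) \<le> C * decay x"
  shows "integrable lborel f"
  by (rule Bochner_Integration.integrable_bound[OF integrable_mult_right[OF integrable_decay, of C]])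
     (use assms(2) order_trans[OF _ abs_ge_self] in auto)

lemma torus_periodic_lattice:
  fixes f :: "'a::euclidean_space \<Rightarrow> 'b"
  assumes f: "torus_periodic f" and k: "k \<in> int_lattice"
  shows "f (x + k) = f x"
proof -
  have nat: "f (x + real n *\<^sub>R b) = f x" if "b \<in> Basis" for b n x
  proof (induction n)
    case (Suc n)
    have "f (x + real (Suc n) *\<^sub>R b) = f ((x + real n *\<^sub>R b) + b)"
      by (simp add: algebra_simps)
    also have "\<dots> = f x" using f that Suc by (simp add: torus_periodic_def)
    finally show ?case .
  qed simp
  have int: "f (x + of_int z *\<^sub>R b) = f x" if "b \<in> Basis" for b z x
  proof (cases "z \<ge> 0")
    case True
    then show ?thesis using nat[OF that, of x "nat z"] by simp
  next
    case False
    then show ?thesis using nat[OF that, of "x + of_int z *\<^sub>R b" "nat (- z)"] by simp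
  qed
  have "f (x + (\<Sum>b\<in>S. (k \<bullet> b) *\<^sub>R b)) = f x" if "finite S" "S \<subseteq> Basis" for S
    using that
  proof (induction S)
    case (insert b S)
    then have "k \<bullet> b \<in> \<int>" using k by (simp add: int_lattice_def)
    then obtain z where "k \<bullet> b = of_int z" by (rule Ints_cases)
    then show ?case
      using insert int[of b "x + (\<Sum>b\<in>S. (k \<bullet> b) *\<^sub>R b)" z] by (simp add: algebra_simps)
  qed simp
  from this[of Basis] show ?thesis by (simp add: euclidean_representation)
qed

lemma torus_periodic_bounded:
  fixes f :: "'a::euclidean_space \<Rightarrow> 'b::real_normed_vector"
  assumes "torus_periodic f" and "continuous_on UNIV f"
  obtains B where "\<And>x. norm (f x) \<le> B"
proof -
  have "bounded (f ` cbox 0 One)"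
    using assms(2) continuous_on_subset by (intro compact_imp_bounded compact_continuous_image) auto
  then obtain B where B: "\<And>x. x \<in> cbox 0 One \<Longrightarrow> norm (f x) \<le> B"
    by (auto simp: bounded_iff)
  have "norm (f x) \<le> B" for x
  proof -
    obtain k where k: "k \<in> int_lattice" "x - k \<in> unit_cube" using unit_cube_decomposition[of x] by auto
    then have "norm (f (x - k)) \<le> B" using B unit_cube_subset by auto
    then show ?thesis using torus_periodic_lattice[OF assms(1) k(1), of "x - k"] by simp
  qed
  then show ?thesis by (rule that)
qed

text \<open>The translated cube is cut along the lattice, and by periodicity its pieces reassemble
  to the original cube.\<close>

lemma set_integral_unit_cube_translate:
  fixes f :: "'a::euclidean_space \<Rightarrow> 'b::{banach,second_countable_topology}"
  assumes per: "torus_periodic f" and cont: "continuous_on UNIV f"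
  shows "(LINT x:unit_cube|lborel. f (x + v)) = (LINT x:unit_cube|lborel. f x)"
proof -
  have [measurable]: "f \<in> borel_measurable borel"
    by (rule borel_measurable_continuous_onI[OF cont])
  have ic: "integrable lborel (\<lambda>x. indicator unit_cube x *\<^sub>R f x)"
    using set_integrable_unit_cube[OF cont] by (simp add: set_integrable_def)
  have contv: "continuous_on UNIV (\<lambda>x. f (x + v))"
    by (intro continuous_on_compose2[OF cont] continuous_intros) auto
  let ?g = "\<lambda>x. indicator unit_cube (x - v) *\<^sub>R f x"
  have gi: "integrable lborel ?g"
    using integrable_lborel_translate[OF set_integrable_unit_cube[OF contv, unfolded set_integrable_def], of "-v"]
    by simp
  have shift: "(\<Sum>\<^sub>\<infinity>k\<in>int_lattice. indicator unit_cube (x + k - v) *\<^sub>R c) = c" 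
    "(\<lambda>k. indicator unit_cube (x + k - v) *\<^sub>R c) summable_on int_lattice"
    for x and c :: "'c::real_normed_vector"
  proof -
    have bij: "bij_betw uminus int_lattice (int_lattice :: 'a set)"
      by (rule bij_betwI[where g = uminus]) (auto intro: int_lattice_minus)
    have "((\<lambda>k. indicator unit_cube (x - v - k) *\<^sub>R c) has_sum c) int_lattice"
      by (rule has_sum_indicator_unit_cube[of "x - v" "\<lambda>_. c"])
    then have "((\<lambda>k. indicator unit_cube (x + k - v) *\<^sub>R c) has_sum c) int_lattice"
      by (subst (asm) has_sum_reindex_bij_betw[OF bij, symmetric]) (simp add: algebra_simps)
    then show "(\<Sum>\<^sub>\<infinity>k\<in>int_lattice. indicator unit_cube (x + k - v) *\<^sub>R c) = c" 
      "(\<lambda>k. indicator unit_cube (x + k - v) *\<^sub>R c) summable_on int_lattice"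
      by (auto intro: infsumI has_sum_imp_summable)
  qed
  \<comment> \<open>The piece of the cube that the lattice vector \<open>k\<close> carries into the
    translated cube. Summing the integrals of all pieces gives the integral over the translated cube
    by tiling, and the one over the cube because the second indicators sum to 1.\<close>
  define q where "q k x = indicator unit_cube x *\<^sub>R indicator unit_cube (x + k - v) *\<^sub>R f x" for k x
  have q: "indicator unit_cube x *\<^sub>R ?g (x + k) = q k x" if "k \<in> int_lattice" for x k
    using torus_periodic_lattice[OF per that] by (simp add: q_def)
  have [measurable]: "q k \<in> borel_measurable borel" for k
    unfolding q_def by measurable
  have qi: "integrable lborel (q k)" for k
    by (rule Bochner_Integration.integrable_bound[OF ic]) (auto simp: q_def indicator_def)
  have "(LINT x:unit_cube|lborel. f (x + v)) = (LINT x|lborel. ?g x)"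
    using integral_lborel_translate[of ?g v] by (simp add: set_lebesgue_integral_def)
  moreover have "((\<lambda>k. LINT x|lborel. q k x) has_sum (LINT x|lborel. ?g x)) int_lattice"
    using tiling_integrable(2)[OF gi] q
    by (simp add: set_lebesgue_integral_def cong: has_sum_cong)
  moreover have "((\<lambda>k. LINT x|lborel. q k x) has_sum (LINT x|lborel. (\<Sum>\<^sub>\<infinity>k\<in>int_lattice. q k x))) int_lattice"
  proof (rule sum_integral_interchange(2)[OF countable_int_lattice])
    have "(\<lambda>k. LINT x:unit_cube|lborel. norm (?g (x + k))) summable_on int_lattice"
      by (rule tiling_integrable(1)[OF gi])
    also have "?this \<longleftrightarrow> (\<lambda>k. LINT x|lborel. norm (q k x)) summable_on int_lattice"
      by (intro summable_on_cong) (simp add: set_lebesgue_integral_def q[symmetric] mult.assoc)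
    finally show "(\<lambda>k. LINT x|lborel. norm (q k x)) summable_on int_lattice" .
    show "(\<lambda>k. norm (q k x)) summable_on int_lattice" for x
      using shift(2)[of x "norm (indicator unit_cube x *\<^sub>R f x)"] by (simp add: q_def mult.left_commute mult.assoc)
  qed (use qi in auto)
  moreover have "(\<Sum>\<^sub>\<infinity>k\<in>int_lattice. q k x) = indicator unit_cube x *\<^sub>R f x" for x
    using shift(1)[of x "indicator unit_cube x *\<^sub>R f x"] by (simp add: q_def mult.commute)
  ultimately show ?thesis
    by (simp add: set_lebesgue_integral_def has_sum_unique)
qed

lemma continuous_infsum:
  fixes f :: "'k \<Rightarrow> 'a::topological_space \<Rightarrow> 'b::banach"
  assumes "\<And>k. k \<in> K \<Longrightarrow> continuous_on S (f k)"
    and "\<And>k x. k \<in> K \<Longrightarrow> x \<in> S \<Longrightarrow> norm (f k x) \<le> M k" and "M summable_on K"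
  shows "continuous_on S (\<lambda>x. \<Sum>\<^sub>\<infinity>k\<in>K. f k x)"
proof (rule uniform_limit_theorem)
  show "uniform_limit S (\<lambda>F x. \<Sum>k\<in>F. f k x) (\<lambda>x. \<Sum>\<^sub>\<infinity>k\<in>K. f k x) (finite_subsets_at_top K)"
    by (rule Weierstrass_m_test_general) (use assms in auto)
  show "\<forall>\<^sub>F F in finite_subsets_at_top K. continuous_on S (\<lambda>x. \<Sum>k\<in>F. f k x)"
    using assms(1) by (intro eventually_finite_subsets_at_top_weakI continuous_on_sum) auto
qed simp

section \<open>Fourier series of smooth periodic functions\<close>

lemma character_0 [simp]: "character 0 x = 1" "character m 0 = 1"
  by (simp_all add: character_def)

lemma norm_character [simp]: "norm (character m x) = 1"
  by (simp add: character_def)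

lemma character_add_left: "character (m + n) x = character m x * character n x"
  by (simp add: character_def cis_mult inner_add_left algebra_simps)

lemma character_add_right: "character m (x + y) = character m x * character m y"
  by (simp add: character_def cis_mult inner_add_right algebra_simps)

lemma character_minus: "character (- m) x = cnj (character m x)" "character m (- x) = cnj (character m x)"
  by (simp_all add: character_def cis_cnj)

lemma character_commute: "character m x = character x m"
  by (simp add: character_def inner_commute)

lemma character_mult_cnj [simp]: "character m x * cnj (character m x) = 1" "cnj (character m x) * character m x = 1"
  by (simp_all add: complex_norm_square[symmetric] mult.commute[of "cnj _"])

lemma continuous_character [continuous_intros]:
  "continuous_on S f \<Longrightarrow> continuous_on S (\<lambda>x. character m (f x))"
  unfolding character_def by (intro continuous_intros)

lemma borel_measurable_character [measurable]: "character m \<in> borel_measurable borel"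
  using continuous_character[OF continuous_on_id, of UNIV m]
  by (auto intro: borel_measurable_continuous_onI)

lemma int_lattice_inner: "m \<in> int_lattice \<Longrightarrow> k \<in> int_lattice \<Longrightarrow> m \<bullet> k \<in> \<int>"
  by (subst euclidean_inner) (auto simp: int_lattice_def)

lemma character_lattice [simp]:
  "m \<in> int_lattice \<Longrightarrow> k \<in> int_lattice \<Longrightarrow> character m k = 1"
  using int_lattice_inner[of m k] by (auto simp: character_def elim!: Ints_cases)

lemma torus_periodic_character: "m \<in> int_lattice \<Longrightarrow> torus_periodic (character m)"
  by (auto simp: torus_periodic_def character_add_right int_lattice_Basis)

lemma character_has_vector_derivative:
  "((\<lambda>s. character m (x + s *\<^sub>R b)) has_vector_derivative
     (2 * pi * \<i> * (m \<bullet> b)) * character m (x + s *\<^sub>R b)) (at s)"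
proof -
  have "((\<lambda>s. \<i> * of_real (2 * pi * (m \<bullet> (x + s *\<^sub>R b)))) has_vector_derivative
      2 * pi * \<i> * (m \<bullet> b)) (at s)"
    unfolding has_vector_derivative_def
    by (auto intro!: derivative_eq_intros simp: inner_add_right scaleR_conv_of_real algebra_simps)
  from field_vector_diff_chain_at[OF this DERIV_exp] show ?thesis
    by (simp add: character_def cis_conv_exp o_def)
qed

lemma has_vector_derivative_at_0_tendsto:
  fixes f :: "real \<Rightarrow> 'b::real_normed_vector"
  assumes "(f has_vector_derivative v) (at 0)"
  shows "((\<lambda>s. inverse s *\<^sub>R (f s - f 0)) \<longlongrightarrow> v) (at 0)"
proof -
  have "((\<lambda>s. (1 / norm (s - 0)) *\<^sub>R (f s - (f 0 + (s - 0) *\<^sub>R v))) \<longlongrightarrow> 0) (at 0)"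
    using assms unfolding has_vector_derivative_def has_derivative_at2 by blast
  then have "((\<lambda>s. norm ((1 / norm (s - 0)) *\<^sub>R (f s - (f 0 + (s - 0) *\<^sub>R v)))) \<longlongrightarrow> 0) (at 0)"
    by (rule tendsto_norm_zero)
  moreover have "\<forall>\<^sub>F s in at (0::real). norm ((1 / norm (s - 0)) *\<^sub>R (f s - (f 0 + (s - 0) *\<^sub>R v)))
      = norm (inverse s *\<^sub>R (f s - f 0) - v)"
  proof (rule eventually_at_topological[THEN iffD2], intro exI[of _ UNIV] conjI ballI impI)
    fix s :: real assume "s \<noteq> 0"
    then have "inverse s *\<^sub>R (f s - f 0) - v = inverse s *\<^sub>R (f s - (f 0 + (s - 0) *\<^sub>R v))"
      by (simp add: scaleR_diff_right scaleR_add_right)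
    then show "norm ((1 / norm (s - 0)) *\<^sub>R (f s - (f 0 + (s - 0) *\<^sub>R v))) = norm (inverse s *\<^sub>R (f s - f 0) - v)"
      by (simp add: divide_inverse)
  qed auto
  ultimately have "((\<lambda>s. norm (inverse s *\<^sub>R (f s - f 0) - v)) \<longlongrightarrow> 0) (at 0)"
    by (rule Lim_transform_eventually)
  then show ?thesis
    using LIM_zero_cancel[OF tendsto_norm_zero_cancel] by fast
qed

text \<open>Difference quotients have integral zero by translation invariance and converge to the
  derivative under the majorant \<open>w\<close>. Applied to a product with a character this is
  integration by parts. The set \<open>A\<close> will be the cube, where periodicity gives the
  invariance, or the whole space.\<close>

lemma integral_line_derivative_zero:
  fixes g dg :: "'a::euclidean_space \<Rightarrow> 'b::{banach,second_countable_topology}"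
  assumes [measurable]: "A \<in> sets borel" "dg \<in> borel_measurable borel"
    and der: "\<And>x s. ((\<lambda>s. g (x + s *\<^sub>R b)) has_vector_derivative dg (x + s *\<^sub>R b)) (at s)"
    and int: "\<And>s. set_integrable lborel A (\<lambda>x. g (x + s *\<^sub>R b))"
    and inv: "\<And>s. (LINT x:A|lborel. g (x + s *\<^sub>R b)) = (LINT x:A|lborel. g x)"
    and w: "set_integrable lborel A w"
    and bound: "\<And>x s. 0 \<le> s \<Longrightarrow> s \<le> 1 \<Longrightarrow> norm (dg (x + s *\<^sub>R b)) \<le> w x"
  shows "(LINT x:A|lborel. dg x) = 0"
proof -
  define q where "q n x = real (Suc n) *\<^sub>R (g (x + (1 / real (Suc n)) *\<^sub>R b) - g x)" for n x
  have int0: "set_integrable lborel A g" using int[of 0] by simp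
  have qi: "integrable lborel (\<lambda>x. indicator A x *\<^sub>R q n x)" for n
  proof -
    have "integrable lborel (\<lambda>x. real (Suc n) *\<^sub>R
        (indicator A x *\<^sub>R g (x + (1 / real (Suc n)) *\<^sub>R b) - indicator A x *\<^sub>R g x))"
      using int int0 unfolding set_integrable_def
      by (intro integrable_scaleR_right Bochner_Integration.integrable_diff) auto
    then show ?thesis by (simp add: q_def scaleR_diff_right scaleR_scaleR mult.commute)
  qed
  have q0: "(LINT x|lborel. indicator A x *\<^sub>R q n x) = 0" for n
  proof -
    have "(LINT x|lborel. indicator A x *\<^sub>R q n x) = (LINT x|lborel. real (Suc n) *\<^sub>R
        (indicator A x *\<^sub>R g (x + (1 / real (Suc n)) *\<^sub>R b) - indicator A x *\<^sub>R g x))"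
      by (simp add: q_def scaleR_diff_right scaleR_scaleR mult.commute)
    also have "\<dots> = real (Suc n) *\<^sub>R
        ((LINT x:A|lborel. g (x + (1 / real (Suc n)) *\<^sub>R b)) - (LINT x:A|lborel. g x))"
      unfolding set_lebesgue_integral_def
      using int[unfolded set_integrable_def, of "1 / real (Suc n)"] int0[unfolded set_integrable_def]
      by (simp add: Bochner_Integration.integral_diff)
    finally show ?thesis using inv by simp
  qed
  have "(\<lambda>n. LINT x|lborel. indicator A x *\<^sub>R q n x) \<longlonglongrightarrow> (LINT x|lborel. indicator A x *\<^sub>R dg x)"
  proof (rule integral_dominated_convergence[where w = "\<lambda>x. indicator A x *\<^sub>R w x"])
    show "AE x in lborel. (\<lambda>n. indicator A x *\<^sub>R q n x) \<longlonglongrightarrow> indicator A x *\<^sub>R dg x"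
    proof (rule AE_I2, rule tendsto_scaleR[OF tendsto_const])
      fix x
      have "((\<lambda>s. g (x + s *\<^sub>R b)) has_vector_derivative dg x) (at 0)"
        using der[of x 0] by simp
      then have lim: "((\<lambda>s. inverse s *\<^sub>R (g (x + s *\<^sub>R b) - g (x + 0 *\<^sub>R b))) \<longlongrightarrow> dg x) (at 0)"
        by (rule has_vector_derivative_at_0_tendsto)
      have "filterlim (\<lambda>n. 1 / real (Suc n)) (at 0) sequentially"
        unfolding filterlim_at by (auto intro: LIMSEQ_Suc[OF lim_1_over_n, simplified])
      from filterlim_compose[OF lim this] show "(\<lambda>n. q n x) \<longlonglongrightarrow> dg x"
        by (simp add: q_def inverse_eq_divide)
    qed
    show "AE x in lborel. norm (indicator A x *\<^sub>R q n x) \<le> indicator A x *\<^sub>R w x" for n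
    proof (rule AE_I2)
      fix x
      have "norm (g (x + (1 / real (Suc n)) *\<^sub>R b) - g (x + 0 *\<^sub>R b)) \<le> w x * (1 / real (Suc n) - 0)"
      proof (rule vector_derivative_bound)
        show "norm (dg (x + t *\<^sub>R b)) \<le> w x" if "0 \<le> t" "t \<le> 1 / real (Suc n)" for t
        proof -
          have "1 / real (Suc n) \<le> 1" by simp
          then have "t \<le> 1" using that by linarith
          then show ?thesis using bound that by blast
        qed
      qed (use der in auto)
      then have "norm (q n x) \<le> w x"
        by (simp add: q_def pos_le_divide_eq mult.commute del: of_nat_Suc)
      then show "norm (indicator A x *\<^sub>R q n x) \<le> indicator A x *\<^sub>R w x"
        by (simp add: indicator_def)
    qed
  qed (use w qi in \<open>auto simp: set_integrable_def dest: borel_measurable_integrable\<close>)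
  then have "(LINT x|lborel. indicator A x *\<^sub>R dg x) = 0"
    by (simp add: q0 LIMSEQ_const_iff)
  then show ?thesis by (simp add: set_lebesgue_integral_def)
qed

definition fourier_coeff :: "('a::euclidean_space \<Rightarrow> complex) \<Rightarrow> 'a \<Rightarrow> complex" where
  "fourier_coeff f m = (LINT x:unit_cube|lborel. f x * character (- m) x)"

lemma torus_periodic_mult:
  "torus_periodic f \<Longrightarrow> torus_periodic g \<Longrightarrow> torus_periodic (\<lambda>x. f x * g x)"
  by (simp add: torus_periodic_def)

lemma torus_periodic_line_derivative:
  fixes g dg :: "'a::euclidean_space \<Rightarrow> 'b::real_normed_vector"
  assumes "torus_periodic g"
    and der: "\<And>x s. ((\<lambda>s. g (x + s *\<^sub>R b)) has_vector_derivative dg (x + s *\<^sub>R b)) (at s)"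
  shows "torus_periodic dg"
  unfolding torus_periodic_def
proof (intro allI ballI)
  fix x c :: 'a assume "c \<in> Basis"
  then have "(\<lambda>s. g (x + c + s *\<^sub>R b)) = (\<lambda>s. g (x + s *\<^sub>R b))"
    using assms(1) by (metis (no_types, opaque_lifting) torus_periodic_def add.assoc add.commute)
  then show "dg (x + c) = dg x"
    using der[of "x + c" 0] der[of x 0] by (auto dest: vector_derivative_unique_at)
qed

lemma integral_unit_cube_line_derivative:
  fixes g dg :: "'a::euclidean_space \<Rightarrow> complex"
  assumes per: "torus_periodic g" and cont: "continuous_on UNIV g" "continuous_on UNIV dg"
    and der: "\<And>x s. ((\<lambda>s. g (x + s *\<^sub>R b)) has_vector_derivative dg (x + s *\<^sub>R b)) (at s)"
  shows "(LINT x:unit_cube|lborel. dg x) = 0"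
proof -
  have "torus_periodic dg" by (rule torus_periodic_line_derivative[OF per der])
  then obtain B where B: "\<And>x. norm (dg x) \<le> B"
    using torus_periodic_bounded cont(2) by metis
  show ?thesis
  proof (rule integral_line_derivative_zero[where w = "\<lambda>_. B" and g = g and b = b])
    show "set_integrable lborel unit_cube (\<lambda>x. g (x + s *\<^sub>R b))" for s
      by (intro set_integrable_unit_cube continuous_on_compose2[OF cont(1)] continuous_intros) auto
    show "(LINT x:unit_cube|lborel. g (x + s *\<^sub>R b)) = (LINT x:unit_cube|lborel. g x)" for s
      by (rule set_integral_unit_cube_translate[OF per cont(1)])
    show "set_integrable lborel unit_cube (\<lambda>_::'a. B)"
      by (intro set_integrable_unit_cube continuous_intros)
  qed (use B der in \<open>auto intro: borel_measurable_continuous_onI[OF cont(2)]\<close>)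
qed

text \<open>Integration by parts: the derivative of \<open>f\<close> times a character has mean
  zero. Periodicity of the product is where \<open>m\<close> must be a lattice vector.\<close>

lemma fourier_coeff_line_derivative:
  fixes f df :: "'a::euclidean_space \<Rightarrow> complex"
  assumes per: "torus_periodic f" and cont: "continuous_on UNIV f" "continuous_on UNIV df"
    and der: "\<And>x s. ((\<lambda>s. f (x + s *\<^sub>R b)) has_vector_derivative df (x + s *\<^sub>R b)) (at s)"
    and m: "m \<in> int_lattice"
  shows "fourier_coeff df m = 2 * pi * \<i> * (m \<bullet> b) * fourier_coeff f m"
proof -
  let ?e = "character (- m)"
  have ce: "continuous_on UNIV ?e" by (intro continuous_intros)
  define c where "c = 2 * pi * \<i> * (- m \<bullet> b)"
  have "(LINT x:unit_cube|lborel. f x * (c * ?e x) + df x * ?e x) = 0"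
  proof (rule integral_unit_cube_line_derivative[where b = b])
    show "torus_periodic (\<lambda>x. f x * ?e x)"
      by (intro torus_periodic_mult per torus_periodic_character int_lattice_minus m)
    show "((\<lambda>s. f (x + s *\<^sub>R b) * ?e (x + s *\<^sub>R b)) has_vector_derivative
        f (x + s *\<^sub>R b) * (c * ?e (x + s *\<^sub>R b)) + df (x + s *\<^sub>R b) * ?e (x + s *\<^sub>R b)) (at s)" for x s
      unfolding c_def by (rule has_vector_derivative_mult[OF der character_has_vector_derivative])
  qed (use cont ce in \<open>auto intro!: continuous_intros\<close>)
  moreover have "(LINT x:unit_cube|lborel. f x * (c * ?e x) + df x * ?e x)
     = c * fourier_coeff f m + fourier_coeff df m"
  proof -
    have "(LINT x:unit_cube|lborel. f x * (c * ?e x) + df x * ?e x) =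
      (LINT x:unit_cube|lborel. c * (f x * ?e x)) + (LINT x:unit_cube|lborel. df x * ?e x)"
      by (subst set_integral_add(2)[symmetric])
         (use cont ce in \<open>auto intro!: set_integrable_unit_cube continuous_intros simp: mult.left_commute\<close>)
    then show ?thesis unfolding fourier_coeff_def by simp
  qed
  ultimately have "fourier_coeff df m = - c * fourier_coeff f m" by (simp add: add_eq_0_iff2)
  then show ?thesis by (simp add: c_def)
qed

lemma fourier_coeff_bound:
  fixes f :: "'a::euclidean_space \<Rightarrow> complex"
  assumes "continuous_on UNIV f" and "\<And>x. norm (f x) \<le> B"
  shows "norm (fourier_coeff f m) \<le> B * measure lborel (unit_cube :: 'a set)"
proof -
  have "0 \<le> B" using assms(2) norm_ge_zero order_trans by blast
  have "norm (fourier_coeff f m) \<le> (LINT x:unit_cube|lborel. norm (f x * character (- m) x))"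
    unfolding fourier_coeff_def
    by (intro set_integral_norm_bound set_integrable_unit_cube continuous_intros assms)
  also have "\<dots> \<le> B * measure lborel (unit_cube :: 'a set)"
    using assms \<open>0 \<le> B\<close>
    by (intro set_integral_unit_cube_bound set_integrable_unit_cube continuous_intros) (auto simp: norm_mult)
  finally show ?thesis .
qed

lemma measure_unit_cube: "measure lborel (unit_cube :: 'a::euclidean_space set) = 1"
proof -
  have "emeasure lborel (box 0 (One::'a)) \<le> emeasure lborel (unit_cube :: 'a set)"
    by (rule emeasure_mono) (auto simp: unit_cube_def mem_box less_imp_le)
  moreover have "emeasure lborel (unit_cube :: 'a set) \<le> emeasure lborel (cbox 0 (One::'a))"
    by (intro emeasure_mono unit_cube_subset) auto
  ultimately have "emeasure lborel (unit_cube :: 'a set) = 1"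
    by (simp add: emeasure_lborel_box emeasure_lborel_cbox)
  then show ?thesis by (simp add: measure_def)
qed

section \<open>Uniqueness of Fourier coefficients and convergence of Fourier series\<close>

lemma fourier_coeff_translate:
  assumes per: "torus_periodic g" and cont: "continuous_on UNIV g" and m: "m \<in> int_lattice"
  shows "fourier_coeff (\<lambda>x. g (x + v)) m = character m v * fourier_coeff g m"
proof -
  have e: "g (x + v) * character (- m) x = character m v * (g (x + v) * character (- m) (x + v))" for x
    by (simp add: character_add_right character_minus)
  have "fourier_coeff (\<lambda>x. g (x + v)) m =
      character m v * (LINT x:unit_cube|lborel. g (x + v) * character (- m) (x + v))"
    unfolding fourier_coeff_def by (subst e) simp
  also have "(LINT x:unit_cube|lborel. g (x + v) * character (- m) (x + v)) = fourier_coeff g m"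
    unfolding fourier_coeff_def
    by (rule set_integral_unit_cube_translate[where f = "\<lambda>x. g x * character (- m) x"])
       (intro torus_periodic_mult per torus_periodic_character int_lattice_minus m continuous_intros cont)+
  finally show ?thesis .
qed

text \<open>A trigonometric polynomial with values in [0,1] that equals 1 on the lattice and nowhere
  else. Its powers act as an approximate identity at the lattice and need no normalization for the
  argument by contradiction in \<open>fourier_unique_at_0\<close>.\<close>

definition cos_kernel :: "'a::euclidean_space \<Rightarrow> real" where
  "cos_kernel x = (\<Prod>b\<in>Basis. (1 + cos (2 * pi * (x \<bullet> b))) / 2)"

lemma one_plus_cos_nonneg: "0 \<le> 1 + cos (y::real)"
  using cos_ge_minus_one[of y] by linarith

lemma cos_kernel_nonneg: "0 \<le> cos_kernel x"
  unfolding cos_kernel_def by (intro prod_nonneg ballI divide_nonneg_nonneg one_plus_cos_nonneg) auto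

lemma cos_kernel_le_1: "cos_kernel x \<le> 1"
  unfolding cos_kernel_def by (intro prod_le_1) (auto simp: one_plus_cos_nonneg)

lemma cos_kernel_eq_1D:
  assumes "cos_kernel x = 1"
  shows "x \<in> int_lattice"
  unfolding int_lattice_def
proof safe
  fix b :: 'a assume b: "b \<in> Basis"
  have nn: "0 \<le> (1 + cos (2 * pi * (x \<bullet> c))) / 2" and le: "(1 + cos (2 * pi * (x \<bullet> c))) / 2 \<le> 1" for c
    using one_plus_cos_nonneg[of "2 * pi * (x \<bullet> c)"] cos_le_one[of "2 * pi * (x \<bullet> c)"] by simp_all
  have "(\<Prod>c\<in>Basis - {b}. (1 + cos (2 * pi * (x \<bullet> c))) / 2) \<le> 1"
    using nn le by (intro prod_le_1) auto
  then have "cos_kernel x \<le> (1 + cos (2 * pi * (x \<bullet> b))) / 2 * 1"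
    unfolding cos_kernel_def prod.remove[OF finite_Basis b] by (intro mult_left_mono nn)
  then have "1 \<le> cos (2 * pi * (x \<bullet> b))" using assms by simp
  then have "cos (2 * pi * (x \<bullet> b)) = 1" using cos_le_one antisym by blast
  then obtain n :: int where "2 * pi * (x \<bullet> b) = of_int n * 2 * pi" unfolding cos_one_2pi_int by blast
  then show "x \<bullet> b \<in> \<int>" by simp
qed

lemma continuous_cos_kernel: "continuous_on S cos_kernel"
  unfolding cos_kernel_def by (intro continuous_intros) auto

lemma cos_eq_characters:
  "complex_of_real ((1 + cos (2 * pi * (x \<bullet> b))) / 2) = (character b x + character (- b) x) / 4 + 1 / 2"
  by (simp add: complex_eq_iff character_def add_divide_distrib inner_commute)

text \<open>The powers of \<^const>\<open>cos_kernel\<close> are trigonometric polynomials, and they concentrate at the lattice.\<close>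

lemma fourier_coeff_cos_kernel_power:
  fixes g :: "'a::euclidean_space \<Rightarrow> complex"
  assumes cont: "continuous_on UNIV g" and zero: "\<And>m. m \<in> int_lattice \<Longrightarrow> fourier_coeff g m = 0"
  shows "m \<in> int_lattice \<Longrightarrow> fourier_coeff (\<lambda>x. g x * complex_of_real (cos_kernel x ^ n)) m = 0"
proof -
  \<comment> \<open>The multipliers that keep all Fourier coefficients of \<open>g\<close> zero.
    Multiplying by a cosine factor merely shifts frequencies by a basis vector in both directions,
    so the class is closed under it.\<close>
  define Z where "Z u \<longleftrightarrow> continuous_on UNIV u \<and> (\<forall>m\<in>int_lattice. fourier_coeff (\<lambda>x. g x * u x) m = 0)"
    for u :: "'a \<Rightarrow> complex"
  let ?c = "\<lambda>b x. complex_of_real ((1 + cos (2 * pi * (x \<bullet> b))) / 2)"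
  have step: "Z (\<lambda>x. u x * ?c b x)" if Z: "Z u" and b: "b \<in> Basis" for u and b :: 'a
    unfolding Z_def
  proof (intro conjI ballI)
    have u: "continuous_on UNIV u" and uz: "\<And>m. m \<in> int_lattice \<Longrightarrow> fourier_coeff (\<lambda>x. g x * u x) m = 0"
      using Z by (auto simp: Z_def)
    show "continuous_on UNIV (\<lambda>x. u x * ?c b x)" by (intro continuous_intros u) auto
    fix m :: 'a assume m: "m \<in> int_lattice"
    let ?h = "\<lambda>m x. g x * u x * character (- m) x"
    have i: "set_integrable lborel unit_cube (?h m)" for m
      by (intro set_integrable_unit_cube continuous_intros u cont)
    have i': "set_integrable lborel unit_cube (\<lambda>x. c * ?h m x)" for m c
      by (rule set_integrable_mult_right) (rule i)
    have z: "(LINT x:unit_cube|lborel. ?h m x) = 0" if "m \<in> int_lattice" for m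
      using uz[OF that] by (simp add: fourier_coeff_def)
    have bl: "b \<in> int_lattice" by (rule int_lattice_Basis[OF b])
    have eq: "g x * (u x * ?c b x) * character (- m) x =
        (1/4) * ?h (m - b) x + ((1/4) * ?h (m + b) x + (1/2) * ?h m x)" for x
      unfolding cos_eq_characters
      using character_add_left[of "-m" b x] character_add_left[of "-m" "-b" x] by (simp add: algebra_simps)
    have "fourier_coeff (\<lambda>x. g x * (u x * ?c b x)) m =
        (LINT x:unit_cube|lborel. (1/4) * ?h (m - b) x + ((1/4) * ?h (m + b) x + (1/2) * ?h m x))"
      unfolding fourier_coeff_def
      by (rule arg_cong[where f = "set_lebesgue_integral lborel unit_cube"]) (rule ext, rule eq)
    also have "\<dots> = (LINT x:unit_cube|lborel. (1/4) * ?h (m - b) x) +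
        ((LINT x:unit_cube|lborel. (1/4) * ?h (m + b) x) + (LINT x:unit_cube|lborel. (1/2) * ?h m x))"
      by (simp only: set_integral_add i')
    also have "\<dots> = (1/4) * (LINT x:unit_cube|lborel. ?h (m - b) x) +
        ((1/4) * (LINT x:unit_cube|lborel. ?h (m + b) x) + (1/2) * (LINT x:unit_cube|lborel. ?h m x))"
      by (simp only: set_integral_mult_right)
    also have "\<dots> = 0"
      using z m bl by (simp only: z int_lattice_add int_lattice_diff) simp
    finally show "fourier_coeff (\<lambda>x. g x * (u x * ?c b x)) m = 0" .
  qed
  have prod: "Z (\<lambda>x. u x * (\<Prod>b\<in>S. ?c b x))" if "finite S" "S \<subseteq> Basis" "Z u" for S u
    using that
  proof (induction S)
    case (insert b S)
    then have "Z (\<lambda>x. u x * (\<Prod>b\<in>S. ?c b x) * ?c b x)" by (intro step) auto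
    then show ?case using insert by (simp add: mult_ac)
  qed simp
  have "Z (\<lambda>x. complex_of_real (cos_kernel x ^ n))"
  proof (induction n)
    case 0
    then show ?case using zero by (simp add: Z_def)
  next
    case (Suc n)
    from prod[OF finite_Basis subset_refl this] show ?case by (simp add: cos_kernel_def mult.commute)
  qed
  then show "m \<in> int_lattice \<Longrightarrow> fourier_coeff (\<lambda>x. g x * complex_of_real (cos_kernel x ^ n)) m = 0"
    by (simp add: Z_def)
qed

text \<open>If \<open>g 0\<close> were nonzero, the normalized real part \<open>u\<close> would
  equal 1 at the origin, while its integral against every power of the kernel vanishes. But the mass
  near the origin decays at most like \<open>r' ^ n\<close>, and the negative part lives where the
  kernel is at most \<open>r\<close>, with \<open>r < r'\<close>.\<close>

lemma fourier_unique_at_0: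
  fixes g :: "'a::euclidean_space \<Rightarrow> complex"
  assumes per: "torus_periodic g" and cont: "continuous_on UNIV g"
    and zero: "\<And>m. m \<in> int_lattice \<Longrightarrow> fourier_coeff g m = 0"
  shows "g 0 = 0"
proof (rule ccontr)
  assume g0: "g 0 \<noteq> 0"
  define u where "u y = Re (g y / g 0)" for y
  have cu: "continuous_on UNIV u" unfolding u_def by (intro continuous_intros cont) (use g0 in auto)
  have perg: "torus_periodic u" using per by (simp add: torus_periodic_def u_def)
  then obtain M where M: "\<And>y. norm (u y) \<le> M" using torus_periodic_bounded cu by metis
  then have M0: "0 \<le> M" using norm_ge_zero order_trans by blast
  let ?k = "cos_kernel :: 'a \<Rightarrow> real"
  have intn: "(LINT y:unit_cube|lborel. u y * ?k y ^ n) = 0" for n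
  proof -
    have ci: "integrable lborel (\<lambda>y. indicator unit_cube y *\<^sub>R (g y * complex_of_real (?k y ^ n)))"
      unfolding set_integrable_def[symmetric]
      by (intro set_integrable_unit_cube continuous_intros cont continuous_cos_kernel)
    have "(LINT y:unit_cube|lborel. g y * complex_of_real (?k y ^ n)) = 0"
      using fourier_coeff_cos_kernel_power[OF cont zero zero_in_int_lattice, of n] by (simp add: fourier_coeff_def)
    then have "0 = Re ((LINT y:unit_cube|lborel. g y * complex_of_real (?k y ^ n)) / g 0)" by simp
    also have "\<dots> = Re (LINT y|lborel. indicator unit_cube y *\<^sub>R (g y * complex_of_real (?k y ^ n)) / g 0)"
      by (simp add: set_lebesgue_integral_def)
    also have "\<dots> = (LINT y|lborel. Re (indicator unit_cube y *\<^sub>R (g y * complex_of_real (?k y ^ n)) / g 0))"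
      by (rule integral_Re[symmetric]) (use ci in auto)
    also have "(\<lambda>y. Re (indicator unit_cube y *\<^sub>R (g y * complex_of_real (?k y ^ n)) / g 0)) =
        (\<lambda>y. indicator unit_cube y *\<^sub>R (u y * ?k y ^ n))"
    proof
      fix y
      have "indicator unit_cube y *\<^sub>R (g y * complex_of_real (?k y ^ n)) / g 0 =
          (indicator unit_cube y * ?k y ^ n) *\<^sub>R (g y / g 0)"
        by (simp add: scaleR_conv_of_real)
      then show "Re (indicator unit_cube y *\<^sub>R (g y * complex_of_real (?k y ^ n)) / g 0) =
          indicator unit_cube y *\<^sub>R (u y * ?k y ^ n)"
        by (simp only: u_def) simp
    qed
    finally show ?thesis by (simp add: set_lebesgue_integral_def)
  qed
  \<comment> \<open>All points of the closed cube that can contribute negatively. The set is compact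
    and contains no lattice point, since \<open>u\<close> is 1 there, so the kernel stays below some
    \<open>r < 1\<close> on it.\<close>
  define S where "S = {y \<in> cbox 0 One. u y \<le> 1/2}"
  have "compact S"
  proof -
    have "closed {y. u y \<le> 1/2}"
      by (intro closed_Collect_le cu continuous_intros)
    then have "compact (cbox 0 One \<inter> {y. u y \<le> 1/2})" by (intro compact_Int_closed) auto
    then show ?thesis by (simp add: S_def Int_def)
  qed
  have kS: "?k y < 1" if "y \<in> S" for y
  proof (rule ccontr)
    assume "\<not> ?k y < 1"
    then have "y \<in> int_lattice" using cos_kernel_le_1[of y] cos_kernel_eq_1D by force
    then have "u y = u 0" using torus_periodic_lattice[OF perg, of y 0] by simp
    then show False using that g0 by (simp add: S_def u_def)
  qed
  obtain r where r: "0 \<le> r" "r < 1" "\<And>y. y \<in> S \<Longrightarrow> ?k y \<le> r"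
  proof (cases "S = {}")
    case False
    from continuous_attains_sup[OF \<open>compact S\<close> False continuous_cos_kernel]
    obtain y0 where "y0 \<in> S" "\<And>y. y \<in> S \<Longrightarrow> ?k y \<le> ?k y0" by auto
    then show ?thesis using that[of "?k y0"] kS cos_kernel_nonneg by auto
  qed (use that[of 0] in auto)
  define r' where "r' = (1 + r) / 2"
  have r': "r < r'" "r' < 1" "0 < r'" using r by (auto simp: r'_def)
  have "?k 0 = 1" by (simp add: cos_kernel_def)
  have "open {y. r' < ?k y}" by (intro open_Collect_less continuous_intros continuous_cos_kernel)
  moreover have "0 \<in> {y. r' < ?k y}" using r' \<open>?k 0 = 1\<close> by simp
  ultimately obtain e where e: "e > 0" "ball 0 e \<subseteq> {y. r' < ?k y}" by (meson openE)
  \<comment> \<open>Small enough that the box \<open>W\<close> lies in the ball of radius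
    \<open>e\<close>, as seen through the sum of the coordinates. The box has a corner at the
    origin, so that it also lies in the half-open cube.\<close>
  define \<delta> where "\<delta> = min 1 (e / (real DIM('a) + 1))"
  have \<delta>: "0 < \<delta>" "\<delta> \<le> 1" "real DIM('a) * \<delta> < e"
  proof -
    show "0 < \<delta>" "\<delta> \<le> 1" using e by (auto simp: \<delta>_def)
    have "(real DIM('a) + 1) * \<delta> \<le> (real DIM('a) + 1) * (e / (real DIM('a) + 1))"
      unfolding \<delta>_def by (intro mult_left_mono) auto
    then have "(real DIM('a) + 1) * \<delta> \<le> e" by simp
    then show "real DIM('a) * \<delta> < e" using \<open>0 < \<delta>\<close> by (simp add: algebra_simps)
  qed
  define W where "W = box 0 (\<delta> *\<^sub>R One :: 'a)"
  have WC: "W \<subseteq> unit_cube" using \<delta> by (fastforce simp: W_def unit_cube_def mem_box)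
  have Wk: "r' < ?k y" if "y \<in> W" for y
  proof -
    have "norm y \<le> (\<Sum>b\<in>Basis. \<bar>y \<bullet> b\<bar>)" by (rule norm_le_l1)
    also have "\<dots> \<le> (\<Sum>b\<in>(Basis::'a set). \<delta>)" using that by (intro sum_mono) (auto simp: W_def mem_box less_imp_le)
    also have "\<dots> < e" using \<delta> by simp
    finally show ?thesis using e by auto
  qed
  define \<mu> where "\<mu> = measure lborel W"
  have "\<mu> = \<delta> ^ DIM('a)" unfolding \<mu>_def W_def using \<delta> by (simp add: measure_lborel_box_eq)
  then have \<mu>: "\<mu> > 0" using \<delta> by simp
  \<comment> \<open>Pointwise on the cube, \<open>u\<close> times the n-th power of the kernel is at
    least \<open>- M * r ^ n\<close> on \<open>S\<close>, nonnegative elsewhere, and at least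
    \<open>r' ^ n / 2\<close> on \<open>W\<close>. Its integral is zero.\<close>
  have main: "r' ^ n / 2 * \<mu> \<le> M * r ^ n" for n
  proof -
    have W_int: "integrable lborel (\<lambda>y. indicator W y * (r' ^ n / 2) :: real)"
      unfolding W_def by (intro integrable_mult_left integrable_real_indicator emeasure_lborel_box_finite) auto
    have C_int: "integrable lborel (\<lambda>y::'a. indicator unit_cube y * (M * r ^ n) :: real)"
      using emeasure_unit_cube_finite[where 'a = 'a] by simp
    have "set_integrable lborel unit_cube (\<lambda>y. u y * ?k y ^ n)"
      by (intro set_integrable_unit_cube continuous_intros cu continuous_cos_kernel)
    then have uk: "integrable lborel (\<lambda>y. indicator unit_cube y * (u y * ?k y ^ n))"
      by (simp add: set_integrable_def)
    have "(LINT y|lborel. indicator W y * (r' ^ n / 2) - indicator unit_cube y * (M * r ^ n))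
        \<le> (LINT y|lborel. indicator unit_cube y * (u y * ?k y ^ n))"
    proof (rule Bochner_Integration.integral_mono)
      fix y :: 'a
      show "indicator W y * (r' ^ n / 2) - indicator unit_cube y * (M * r ^ n)
          \<le> indicator unit_cube y * (u y * ?k y ^ n)"
      proof (cases "y \<in> unit_cube")
        case True
        have Mr: "0 \<le> M * r ^ n" using M0 r by simp
        have k0: "0 \<le> ?k y ^ n" by (intro zero_le_power cos_kernel_nonneg)
        show ?thesis
        proof (cases "u y \<le> 1/2")
          case le: True
          then have "y \<in> S" using True unit_cube_subset by (auto simp: S_def)
          then have kr: "?k y \<le> r" by (rule r)
          then have "y \<notin> W" using Wk r' by fastforce
          have "?k y ^ n \<le> r ^ n" using kr cos_kernel_nonneg by (intro power_mono) auto
          moreover have "- u y \<le> M" using M[of y] by auto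
          ultimately have "(- u y) * ?k y ^ n \<le> M * r ^ n"
            using M0 k0 by (intro mult_mono) auto
          then show ?thesis using True \<open>y \<notin> W\<close> by simp
        next
          case False
          have "indicator W y * (r' ^ n / 2) \<le> u y * ?k y ^ n"
          proof (cases "y \<in> W")
            case yW: True
            have "r' ^ n \<le> ?k y ^ n" using Wk[OF yW] r' by (intro power_mono) auto
            then have "1/2 * r' ^ n \<le> u y * ?k y ^ n"
              using False r' by (intro mult_mono) auto
            then show ?thesis using yW by simp
          next
            case yW: False
            then show ?thesis using False k0 by simp
          qed
          then show ?thesis using True Mr by simp
        qed
      next
        case False
        then have "y \<notin> W" using WC by auto
        then show ?thesis using False by simp
      qed
    qed (use W_int C_int uk in auto)
    also have "\<dots> = 0" using intn[of n] by (simp add: set_lebesgue_integral_def)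
    also have "(LINT y|lborel. indicator W y * (r' ^ n / 2) - indicator unit_cube y * (M * r ^ n)) =
        r' ^ n / 2 * \<mu> - M * r ^ n"
      using W_int C_int measure_unit_cube[where 'a = 'a]
      by (subst Bochner_Integration.integral_diff) (auto simp: \<mu>_def)
    finally show ?thesis by simp
  qed
  have "(\<lambda>n. M * (r / r') ^ n) \<longlonglongrightarrow> M * 0"
    using r r' by (intro tendsto_mult tendsto_const LIMSEQ_power_zero) auto
  moreover have "\<mu> / 2 \<le> M * (r / r') ^ n" for n
    using main[of n] r' by (simp add: power_divide field_simps)
  ultimately have "\<mu> / 2 \<le> M * 0" by (intro LIMSEQ_le_const) auto
  then show False using \<mu> by simp
qed

theorem fourier_unique:
  fixes g :: "'a::euclidean_space \<Rightarrow> complex"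
  assumes per: "torus_periodic g" and cont: "continuous_on UNIV g"
    and zero: "\<And>m. m \<in> int_lattice \<Longrightarrow> fourier_coeff g m = 0"
  shows "g x = 0"
proof -
  have "(\<lambda>y. g (y + x)) 0 = 0"
  proof (rule fourier_unique_at_0[of "\<lambda>y. g (y + x)"])
    have "y + b + x = y + x + b" for y b by simp
    then show "torus_periodic (\<lambda>y. g (y + x))"
      using per unfolding torus_periodic_def by metis
    show "continuous_on UNIV (\<lambda>y. g (y + x))"
      by (intro continuous_on_compose2[OF cont] continuous_intros) auto
  qed (simp add: fourier_coeff_translate[OF per cont] zero)
  then show ?thesis by simp
qed

lemma fourier_coeff_character:
  fixes k m :: "'a::euclidean_space"
  assumes k: "k \<in> int_lattice" and m: "m \<in> int_lattice"
  shows "fourier_coeff (character k) m = of_bool (k = m)"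
proof (cases "k = m")
  case True
  then have "fourier_coeff (character k) m = (LINT x:(unit_cube :: 'a set)|lborel. 1)"
    by (simp add: fourier_coeff_def character_minus)
  also have "\<dots> = 1"
    unfolding set_lebesgue_integral_def
    by (subst integral_scaleR_left)
       (use emeasure_unit_cube_finite[where 'a = 'a] in \<open>auto simp: measure_unit_cube\<close>)
  finally show ?thesis using True by simp
next
  case False
  then obtain b where b: "b \<in> Basis" "(k - m) \<bullet> b \<noteq> 0"
    by (metis euclidean_eq_iff inner_zero_left right_minus_eq)
  let ?n = "k - m"
  \<comment> \<open>Half a period in a direction along which the frequency is nonzero. The
    translation changes the sign of the character but not its integral.\<close>
  define v where "v = (1 / (2 * (?n \<bullet> b))) *\<^sub>R b"
  have eq: "character k x * character (- m) x = character ?n x" for x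
    using character_add_left[of k "-m" x] by simp
  have "character ?n v = -1" using b by (simp add: character_def v_def)
  have "(LINT x:unit_cube|lborel. character ?n (x + v)) = (LINT x:unit_cube|lborel. character ?n x)"
    by (rule set_integral_unit_cube_translate)
       (intro torus_periodic_character int_lattice_diff k m continuous_intros)+
  then have "- (LINT x:unit_cube|lborel. character ?n x) = (LINT x:unit_cube|lborel. character ?n x)"
    by (simp add: character_add_right \<open>character ?n v = -1\<close> set_lebesgue_integral_def)
  then show ?thesis using False by (simp add: fourier_coeff_def eq)
qed

text \<open>Absolute summability makes the sum of the series continuous with the same coefficients
  as \<open>f\<close>, so uniqueness applies to the difference. Pointwise convergence is thus
  obtained without studying partial sums.\<close>

theorem fourier_series:
  fixes f :: "'a::euclidean_space \<Rightarrow> complex"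
  assumes per: "torus_periodic f" and cont: "continuous_on UNIV f"
    and sum: "(\<lambda>m. norm (fourier_coeff f m)) summable_on int_lattice"
  shows "((\<lambda>m. fourier_coeff f m * character m x) has_sum f x) int_lattice"
proof -
  let ?c = "fourier_coeff f"
  have abs: "(\<lambda>m. norm (?c m * character m x)) summable_on int_lattice" for x
    using sum by (simp add: norm_mult)
  define S where "S x = (\<Sum>\<^sub>\<infinity>m\<in>int_lattice. ?c m * character m x)" for x
  have contS: "continuous_on UNIV S"
    unfolding S_def
    by (rule continuous_infsum[OF _ _ sum]) (auto intro!: continuous_intros simp: norm_mult)
  have perS: "torus_periodic S"
    unfolding torus_periodic_def S_def
    by (intro allI ballI infsum_cong) (simp add: character_add_right int_lattice_Basis)
  have coeffS: "fourier_coeff S n = ?c n" if n: "n \<in> int_lattice" for n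
  proof -
    define q where "q m x = indicator unit_cube x *\<^sub>R (?c m * character m x * character (- n) x)" for m x
    have qi: "integrable lborel (q m)" for m
      unfolding q_def set_integrable_def[symmetric]
      by (intro set_integrable_unit_cube continuous_intros)
    have nq: "norm (q m x) = indicator unit_cube x * norm (?c m)" for m x
      by (simp add: q_def norm_mult)
    have int_q: "(LINT x|lborel. q m x) = ?c m * of_bool (m = n)" if "m \<in> int_lattice" for m
    proof -
      have "(LINT x|lborel. q m x) = (LINT x|lborel. ?c m * (indicator unit_cube x *\<^sub>R (character m x * character (- n) x)))"
        unfolding q_def mult.assoc mult_scaleR_right ..
      also have "\<dots> = ?c m * (LINT x|lborel. indicator unit_cube x *\<^sub>R (character m x * character (- n) x))"
        by (rule integral_mult_right_zero)
      also have "(LINT x|lborel. indicator unit_cube x *\<^sub>R (character m x * character (- n) x)) =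
          fourier_coeff (character m) n"
        by (simp add: fourier_coeff_def set_lebesgue_integral_def)
      finally show ?thesis using that n by (simp add: fourier_coeff_character)
    qed
    have "((\<lambda>m. LINT x|lborel. q m x) has_sum (LINT x|lborel. (\<Sum>\<^sub>\<infinity>m\<in>int_lattice. q m x))) int_lattice"
    proof (rule sum_integral_interchange(2)[OF countable_int_lattice])
      show "(\<lambda>m. LINT x|lborel. norm (q m x)) summable_on int_lattice"
        unfolding nq using sum measure_unit_cube[where 'a = 'a] by simp
      show "(\<lambda>m. norm (q m x)) summable_on int_lattice" for x
        unfolding nq using sum by (intro summable_on_cmult_right)
    qed (use qi in auto)
    moreover have "(\<Sum>\<^sub>\<infinity>m\<in>int_lattice. q m x) = indicator unit_cube x *\<^sub>R (S x * character (- n) x)" for x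
    proof -
      have "(\<Sum>\<^sub>\<infinity>m\<in>int_lattice. q m x) =
          (\<Sum>\<^sub>\<infinity>m\<in>int_lattice. (indicator unit_cube x * character (- n) x) * (?c m * character m x))"
        by (intro infsum_cong) (simp add: q_def scaleR_conv_of_real indicator_def)
      also have "\<dots> = (indicator unit_cube x * character (- n) x) * S x"
        unfolding S_def by (rule infsum_cmult_right[OF abs_summable_summable[OF abs]])
      finally show ?thesis by (simp add: scaleR_conv_of_real indicator_def mult_ac)
    qed
    ultimately have "((\<lambda>m. LINT x|lborel. q m x) has_sum fourier_coeff S n) int_lattice"
      by (simp add: fourier_coeff_def[of S] set_lebesgue_integral_def)
    then have "((\<lambda>m. ?c m * of_bool (m = n)) has_sum fourier_coeff S n) int_lattice"
      using int_q by (simp cong: has_sum_cong)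
    moreover have "((\<lambda>m. ?c m * of_bool (m = n)) has_sum (\<Sum>m\<in>{n}. ?c m * of_bool (m = n))) int_lattice"
      by (rule has_sum_finite_neutralI[where B = "{n}"]) (use n in auto)
    ultimately show ?thesis using has_sum_unique by fastforce
  qed
  have "(\<lambda>x. f x - S x) x = 0"
  proof (rule fourier_unique[of "\<lambda>x. f x - S x"])
    show "torus_periodic (\<lambda>x. f x - S x)" using per perS by (simp add: torus_periodic_def)
    show "continuous_on UNIV (\<lambda>x. f x - S x)" by (intro continuous_intros cont contS)
    fix m :: 'a assume m: "m \<in> int_lattice"
    have "fourier_coeff (\<lambda>x. f x - S x) m = fourier_coeff f m - fourier_coeff S m"
      unfolding fourier_coeff_def left_diff_distrib
      by (rule set_integral_diff(2)) (intro set_integrable_unit_cube continuous_intros cont contS)+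
    then show "fourier_coeff (\<lambda>x. f x - S x) m = 0" using coeffS[OF m] by simp
  qed
  then have "S x = f x" by simp
  then show ?thesis using has_sum_infsum[OF abs_summable_summable[OF abs[of x]]] by (simp add: S_def)
qed

section \<open>Rapid decay of the Fourier coefficients of smooth functions\<close>

definition l1_norm :: "'a::euclidean_space \<Rightarrow> real" where
  "l1_norm x = (\<Sum>b\<in>Basis. \<bar>x \<bullet> b\<bar>)"

lemma l1_norm_nonneg: "0 \<le> l1_norm x"
  by (simp add: l1_norm_def sum_nonneg)

text \<open>Bounds in each coordinate separately are enough, so only pure derivatives along a single
  axis have to be taken later. The power 2d pays for \<open>decay\<close>, whose factors are at
  least 1/(2 M^2), and p pays for the weight.\<close>

lemma decay_from_powers:
  fixes x :: "'a::euclidean_space"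
  assumes u: "0 \<le> u" "u \<le> C" and pow: "\<And>b. b \<in> Basis \<Longrightarrow> u * \<bar>x \<bullet> b\<bar> ^ (2 * DIM('a) + p) \<le> C"
  shows "u * (1 + l1_norm x) ^ p \<le> (1 + real DIM('a)) ^ p * 2 ^ DIM('a) * C * decay x"
proof -
  let ?d = "DIM('a)"
  \<comment> \<open>The maximum is attained at 1 or at one coordinate, so
    \<open>u * M ^ (2 * ?d + p)\<close> is covered by one of the assumed bounds.\<close>
  define M where "M = Max (insert 1 ((\<lambda>b. \<bar>x \<bullet> b\<bar>) ` Basis))"
  have "M \<in> insert 1 ((\<lambda>b. \<bar>x \<bullet> b\<bar>) ` Basis)" unfolding M_def by (intro Max_in) auto
  then have uM: "u * M ^ (2 * ?d + p) \<le> C" using u pow by auto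
  have M1: "1 \<le> M" unfolding M_def by (intro Max_ge) auto
  have bM: "\<bar>x \<bullet> b\<bar> \<le> M" if "b \<in> Basis" for b unfolding M_def using that by (intro Max_ge) auto
  have "l1_norm x \<le> real ?d * M"
    unfolding l1_norm_def using sum_mono[of Basis "\<lambda>b. \<bar>x \<bullet> b\<bar>" "\<lambda>_. M"] bM by simp
  then have "1 + l1_norm x \<le> (1 + real ?d) * M" using M1 by (simp add: algebra_simps)
  then have l: "(1 + l1_norm x) ^ p \<le> (1 + real ?d) ^ p * M ^ p"
    using l1_norm_nonneg[of x] by (subst power_mult_distrib[symmetric], intro power_mono) auto
  have "1 / (2 * M\<^sup>2) ^ ?d = (\<Prod>b\<in>(Basis::'a set). 1 / (2 * M\<^sup>2))"
    by (simp add: power_one_over)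
  also have "\<dots> \<le> decay x"
    unfolding decay_def
  proof (intro prod_mono conjI)
    fix b :: 'a assume b: "b \<in> Basis"
    have "(x \<bullet> b)\<^sup>2 \<le> M\<^sup>2" using bM[OF b] M1 by (simp add: abs_le_square_iff[symmetric])
    moreover have "1 \<le> M\<^sup>2" using M1 by (simp add: one_le_power)
    ultimately show "1 / (2 * M\<^sup>2) \<le> 1 / (1 + (x \<bullet> b)\<^sup>2)"
      by (intro divide_left_mono) (auto intro!: mult_pos_pos add_pos_nonneg)
  qed (use M1 in auto)
  finally have "1 \<le> (2 * M\<^sup>2) ^ ?d * decay x"
    using M1 by (simp add: divide_le_eq mult.commute)
  then have d: "1 \<le> 2 ^ ?d * M ^ (2 * ?d) * decay x"
    by (simp add: power_mult_distrib power_mult)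
  have "u * (1 + l1_norm x) ^ p * 1 \<le> u * ((1 + real ?d) ^ p * M ^ p) * (2 ^ ?d * M ^ (2 * ?d) * decay x)"
    using u l d M1 l1_norm_nonneg[of x] by (intro mult_mono) auto
  also have "\<dots> = (1 + real ?d) ^ p * 2 ^ ?d * decay x * (u * M ^ (2 * ?d + p))"
    by (simp add: power_add mult_ac)
  also have "\<dots> \<le> (1 + real ?d) ^ p * 2 ^ ?d * decay x * C"
    using uM decay_pos[of x] by (intro mult_left_mono) auto
  finally show ?thesis by (simp add: mult_ac)
qed

lemma smooth_iter_deriv_differentiable:
  "smooth f \<Longrightarrow> set vs \<subseteq> Basis \<Longrightarrow> iter_deriv vs f differentiable (at x)"
  by (simp add: smooth_def)

lemma smooth_iter_deriv_continuous:
  "smooth f \<Longrightarrow> set vs \<subseteq> Basis \<Longrightarrow> continuous_on UNIV (iter_deriv vs f)"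
  by (auto intro!: continuous_at_imp_continuous_on differentiable_imp_continuous_within
      smooth_iter_deriv_differentiable)

lemma iter_deriv_line:
  fixes f :: "'a::euclidean_space \<Rightarrow> 'b::real_normed_vector"
  assumes "smooth f" "set vs \<subseteq> Basis"
  shows "((\<lambda>s. iter_deriv vs f (x + s *\<^sub>R b)) has_vector_derivative iter_deriv (b # vs) f (x + s *\<^sub>R b)) (at s)"
proof -
  let ?g = "iter_deriv vs f" and ?y = "x + s *\<^sub>R b"
  have d: "(?g has_derivative frechet_derivative ?g (at ?y)) (at ?y)"
    using smooth_iter_deriv_differentiable[OF assms] by (simp add: frechet_derivative_works)
  have l: "((\<lambda>s. x + s *\<^sub>R b) has_derivative (\<lambda>h. h *\<^sub>R b)) (at s)"
    by (auto intro!: derivative_eq_intros)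
  have "((\<lambda>s. ?g (x + s *\<^sub>R b)) has_derivative (\<lambda>h. frechet_derivative ?g (at ?y) (h *\<^sub>R b))) (at s)"
    using has_derivative_compose[OF l d] by simp
  then show ?thesis
    using linear_cmul[OF has_derivative_linear[OF d]] by (simp add: has_vector_derivative_def)
qed

lemma torus_periodic_iter_deriv:
  assumes "smooth f" "torus_periodic f" "set vs \<subseteq> Basis"
  shows "torus_periodic (iter_deriv vs f)"
  using assms(3)
proof (induction vs)
  case (Cons b vs)
  then show ?case
    using torus_periodic_line_derivative[of "iter_deriv vs f" b "iter_deriv (b # vs) f"]
      iter_deriv_line[OF assms(1), of vs] by auto
qed (use assms in simp)

lemma fourier_coeff_iter_deriv:
  assumes "smooth f" "torus_periodic f" "b \<in> Basis" "m \<in> int_lattice"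
  shows "fourier_coeff (iter_deriv (replicate n b) f) m = (2 * pi * \<i> * (m \<bullet> b)) ^ n * fourier_coeff f m"
proof (induction n)
  case (Suc n)
  let ?vs = "replicate n b"
  have vs: "set ?vs \<subseteq> Basis" "set (b # ?vs) \<subseteq> Basis" using assms(3) by auto
  have "fourier_coeff (iter_deriv (b # ?vs) f) m = 2 * pi * \<i> * (m \<bullet> b) * fourier_coeff (iter_deriv ?vs f) m"
    by (rule fourier_coeff_line_derivative)
       (intro torus_periodic_iter_deriv smooth_iter_deriv_continuous iter_deriv_line assms vs)+
  then show ?case using Suc by (simp add: mult.assoc)
qed simp

text \<open>Differentiating 2d + p times along one axis multiplies the coefficient by a power of
  that coordinate of \<open>m\<close>, while the coefficients of the derivative stay
  bounded.\<close>

lemma smooth_fourier_coeff_decay: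
  fixes f :: "'a::euclidean_space \<Rightarrow> complex"
  assumes f: "smooth f" "torus_periodic f"
  shows "\<exists>C. \<forall>m\<in>int_lattice. norm (fourier_coeff f m) * (1 + l1_norm m) ^ p \<le> C * decay m"
proof -
  let ?K = "2 * DIM('a) + p"
  have "\<exists>B. \<forall>x. norm (iter_deriv (replicate n b) f x) \<le> B" if "b \<in> Basis" for b :: 'a and n
  proof -
    have vs: "set (replicate n b) \<subseteq> Basis" using that by auto
    show ?thesis
      by (rule torus_periodic_bounded[OF torus_periodic_iter_deriv[OF f vs] smooth_iter_deriv_continuous[OF f(1) vs]]) blast
  qed
  then have "\<forall>n. \<forall>b\<in>Basis. \<exists>B. \<forall>x. norm (iter_deriv (replicate n b) f x) \<le> B" by blast
  then obtain B where B: "\<And>n b x. b \<in> Basis \<Longrightarrow> norm (iter_deriv (replicate n b) f x) \<le> B n b"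
    by (subst (asm) bchoice_iff, subst (asm) choice_iff) blast
  obtain b0 :: 'a where b0: "b0 \<in> Basis" using nonempty_Basis by blast
  define C where "C = B 0 b0 + (\<Sum>b\<in>Basis. B ?K b)"
  have Bnn: "0 \<le> B n b" if "b \<in> Basis" for b n
    using B[OF that] norm_ge_zero order_trans by blast
  have bd: "norm (fourier_coeff (iter_deriv (replicate n b) f) m) \<le> B n b" if "b \<in> Basis" for n b m
  proof -
    have "set (replicate n b) \<subseteq> Basis" using that by auto
    from fourier_coeff_bound[OF smooth_iter_deriv_continuous[OF f(1) this] B[OF that]] show ?thesis
      by (simp add: measure_unit_cube)
  qed
  have "norm (fourier_coeff f m) * (1 + l1_norm m) ^ p \<le> (1 + real DIM('a)) ^ p * 2 ^ DIM('a) * C * decay m"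
    if m: "m \<in> int_lattice" for m
  proof (rule decay_from_powers)
    have "norm (fourier_coeff f m) \<le> B 0 b0" using bd[OF b0, of 0 m] by simp
    then show "norm (fourier_coeff f m) \<le> C"
      using sum_nonneg[of Basis "B ?K"] Bnn by (simp add: C_def)
    fix b :: 'a assume b: "b \<in> Basis"
    have "norm (fourier_coeff f m) * \<bar>m \<bullet> b\<bar> ^ ?K \<le> norm (fourier_coeff f m) * (2 * pi * \<bar>m \<bullet> b\<bar>) ^ ?K"
      using pi_ge_two by (intro mult_left_mono power_mono) (auto simp: mult_le_cancel_right1)
    also have "\<dots> = norm (fourier_coeff (iter_deriv (replicate ?K b) f) m)"
      by (simp add: fourier_coeff_iter_deriv[OF f b m] norm_mult norm_power mult.commute)
    also have "\<dots> \<le> B ?K b" by (rule bd[OF b])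
    also have "\<dots> \<le> (\<Sum>b\<in>Basis. B ?K b)" using Bnn b by (intro member_le_sum) auto
    also have "\<dots> \<le> C" using Bnn[OF b0] by (simp add: C_def)
    finally show "norm (fourier_coeff f m) * \<bar>m \<bullet> b\<bar> ^ ?K \<le> C" .
  qed simp
  then show ?thesis by blast
qed

lemma smooth_fourier_coeff_summable:
  fixes f :: "'a::euclidean_space \<Rightarrow> complex"
  assumes f: "smooth f" "torus_periodic f"
  shows "(\<lambda>m. norm (fourier_coeff f m) * (1 + l1_norm m) ^ p) summable_on int_lattice"
proof -
  obtain C where C: "\<And>m. m \<in> int_lattice \<Longrightarrow> norm (fourier_coeff f m) * (1 + l1_norm m) ^ p \<le> C * decay m"
    using smooth_fourier_coeff_decay[OF f] by blast
  show ?thesis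
    by (rule summable_on_comparison_test[OF summable_on_cmult_right[OF summable_decay, of C]])
       (use C l1_norm_nonneg in \<open>auto intro!: mult_nonneg_nonneg zero_le_power add_nonneg_nonneg\<close>)
qed

theorem smooth_fourier_series:
  fixes f :: "'a::euclidean_space \<Rightarrow> complex"
  assumes "smooth f" "torus_periodic f"
  shows "((\<lambda>m. fourier_coeff f m * character m x) has_sum f x) int_lattice"
  using smooth_fourier_coeff_summable[OF assms, of 0] smooth_iter_deriv_continuous[OF assms(1), of "[]"] assms(2)
  by (intro fourier_series) auto

lemma schwartz_decay:
  fixes \<phi> :: "'a::euclidean_space \<Rightarrow> complex"
  assumes "schwartz \<phi>" "set vs \<subseteq> Basis"
  shows "\<exists>C. \<forall>x. norm (iter_deriv vs \<phi> x) \<le> C * decay x"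
proof -
  let ?g = "iter_deriv vs \<phi>" and ?K = "2 * DIM('a)"
  obtain C0 C1 where "\<And>x. norm x ^ 0 * norm (?g x) \<le> C0" and C1: "\<And>x. norm x ^ ?K * norm (?g x) \<le> C1"
    using assms unfolding schwartz_def by metis
  then have C0: "norm (?g x) \<le> C0" for x by simp
  have "norm (?g x) * (1 + l1_norm x) ^ 0 \<le> (1 + real DIM('a)) ^ 0 * 2 ^ DIM('a) * max C0 C1 * decay x" for x
  proof (rule decay_from_powers)
    show "norm (?g x) \<le> max C0 C1" using C0[of x] by simp
    fix b :: 'a assume b: "b \<in> Basis"
    have "norm (?g x) * \<bar>x \<bullet> b\<bar> ^ (?K + 0) \<le> norm (?g x) * norm x ^ ?K"
      using Basis_le_norm[OF b] by (intro mult_left_mono) (auto intro!: power_mono)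
    also have "\<dots> \<le> max C0 C1" using C1[of x] by (simp add: mult.commute)
    finally show "norm (?g x) * \<bar>x \<bullet> b\<bar> ^ (?K + 0) \<le> max C0 C1" .
  qed simp
  then show ?thesis by auto
qed

section \<open>Fourier inversion for Schwartz functions\<close>

definition fourier_transform :: "('a::euclidean_space \<Rightarrow> complex) \<Rightarrow> 'a \<Rightarrow> complex" where
  "fourier_transform f \<eta> = (LINT x|lborel. f x * character (- \<eta>) x)"

lemma integrable_mult_character:
  fixes f :: "'a::euclidean_space \<Rightarrow> complex"
  assumes cont: "continuous_on UNIV f" and dec: "\<And>x. norm (f x) \<le> C * decay x"
  shows "integrable lborel (\<lambda>x. f x * character m x)"
proof (rule integrable_decay_bound[where C = C])
  show "(\<lambda>x. f x * character m x) \<in> borel_measurable borel"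
    by (intro borel_measurable_continuous_onI continuous_intros cont)
qed (simp add: norm_mult dec)

lemma fourier_transform_bound:
  fixes f :: "'a::euclidean_space \<Rightarrow> complex"
  assumes cont: "continuous_on UNIV f" and dec: "\<And>x. norm (f x) \<le> C * decay x"
  shows "norm (fourier_transform f \<eta>) \<le> C * (LINT x|lborel. decay (x::'a))"
proof -
  have "norm (fourier_transform f \<eta>) \<le> (LINT x|lborel. norm (f x * character (- \<eta>) x))"
    unfolding fourier_transform_def by (rule integral_norm_bound)
  also have "\<dots> \<le> (LINT x|lborel. C * decay (x::'a))"
    by (rule Bochner_Integration.integral_mono)
       (use integrable_norm[OF integrable_mult_character[OF cont dec]] integrable_decay dec in \<open>auto simp: norm_mult\<close>)
  finally show ?thesis by simp
qed

lemma fourier_transform_measurable: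
  assumes [measurable]: "f \<in> borel_measurable borel"
  shows "fourier_transform f \<in> borel_measurable borel"
proof -
  have "(\<lambda>\<eta>. LINT x|lborel. f x * character (- \<eta>) x) \<in> borel_measurable borel"
    unfolding character_def cis_conv_exp by measurable
  then show ?thesis by (simp add: fourier_transform_def[abs_def])
qed

text \<open>The periodic argument again, with translation invariance of the Lebesgue integral in
  place of periodicity. For shifts of length at most 1 along an axis, \<open>decay_shift\<close>
  costs at most 4 per coordinate, which gives the factor in the majorant.\<close>

lemma fourier_transform_line_derivative:
  fixes f df :: "'a::euclidean_space \<Rightarrow> complex"
  assumes cont: "continuous_on UNIV f" "continuous_on UNIV df"
    and dec: "\<And>x. norm (f x) \<le> C * decay x" "\<And>x. norm (df x) \<le> C' * decay x"
    and der: "\<And>x s. ((\<lambda>s. f (x + s *\<^sub>R b)) has_vector_derivative df (x + s *\<^sub>R b)) (at s)"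
    and b: "b \<in> Basis"
  shows "fourier_transform df \<eta> = 2 * pi * \<i> * (\<eta> \<bullet> b) * fourier_transform f \<eta>"
proof -
  let ?e = "character (- \<eta>)"
  have ce: "continuous_on UNIV ?e" by (intro continuous_intros)
  define c where "c = 2 * pi * \<i> * (- \<eta> \<bullet> b)"
  define g where "g x = f x * ?e x" for x
  define dg where "dg x = f x * (c * ?e x) + df x * ?e x" for x
  have cg: "continuous_on UNIV g" "continuous_on UNIV dg"
    unfolding g_def dg_def by (intro continuous_intros cont)+
  have C: "0 \<le> C" "0 \<le> C'"
    using dec(1)[of 0] dec(2)[of 0] norm_ge_zero order_trans decay_pos[of "0::'a"] zero_le_mult_iff
    by (metis less_eq_real_def not_le)+
  have gi: "integrable lborel g" unfolding g_def by (rule integrable_mult_character[OF cont(1) dec(1)])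
  let ?D = "norm c * C + C'"
  have bdg: "norm (dg x) \<le> ?D * decay x" for x
  proof -
    have "norm (dg x) \<le> norm (f x) * norm c + norm (df x)"
      unfolding dg_def by (rule order_trans[OF norm_triangle_ineq]) (simp add: norm_mult)
    also have "\<dots> \<le> (C * decay x) * norm c + C' * decay x" using dec by (intro add_mono mult_right_mono) auto
    finally show ?thesis by (simp add: algebra_simps)
  qed
  have "(LINT x:UNIV|lborel. dg x) = 0"
  proof (rule integral_line_derivative_zero[where g = g and b = b and w = "\<lambda>x. ?D * (4 ^ DIM('a) * decay x)"])
    show "dg \<in> borel_measurable borel" by (rule borel_measurable_continuous_onI[OF cg(2)])
    show "((\<lambda>s. g (x + s *\<^sub>R b)) has_vector_derivative dg (x + s *\<^sub>R b)) (at s)" for x s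
      unfolding g_def dg_def c_def by (rule has_vector_derivative_mult[OF der character_has_vector_derivative])
    show "set_integrable lborel UNIV (\<lambda>x. g (x + s *\<^sub>R b))" for s
      using integrable_lborel_translate[OF gi] by (simp add: set_integrable_def)
    show "(LINT x:UNIV|lborel. g (x + s *\<^sub>R b)) = (LINT x:UNIV|lborel. g x)" for s
      using integral_lborel_translate[OF borel_measurable_continuous_onI[OF cg(1)]]
      by (simp add: set_lebesgue_integral_def)
    show "set_integrable lborel UNIV (\<lambda>x::'a. ?D * (4 ^ DIM('a) * decay x))"
      by (simp add: set_integrable_def integrable_decay)
    fix x :: 'a and s :: real assume s: "0 \<le> s" "s \<le> 1"
    have "decay (x + s *\<^sub>R b) \<le> (\<Prod>c\<in>Basis. 2 + 2 * ((s *\<^sub>R b) \<bullet> c)\<^sup>2) * decay x"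
      by (rule decay_shift)
    also have "\<dots> \<le> (\<Prod>c\<in>(Basis::'a set). 4) * decay x"
    proof (intro mult_right_mono prod_mono conjI)
      fix c :: 'a assume "c \<in> Basis"
      have "((s *\<^sub>R b) \<bullet> c)\<^sup>2 \<le> 1"
        using s b \<open>c \<in> Basis\<close> by (auto simp: inner_Basis power_le_one)
      then show "2 + 2 * ((s *\<^sub>R b) \<bullet> c)\<^sup>2 \<le> 4" by simp
    qed (auto simp: less_imp_le[OF decay_pos])
    finally have "decay (x + s *\<^sub>R b) \<le> 4 ^ DIM('a) * decay x" by simp
    then show "norm (dg (x + s *\<^sub>R b)) \<le> ?D * (4 ^ DIM('a) * decay x)"
      using bdg[of "x + s *\<^sub>R b"] C by (meson add_nonneg_nonneg mult_left_mono mult_nonneg_nonneg norm_ge_zero order_trans)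
  qed auto
  moreover have "(LINT x:UNIV|lborel. dg x) = c * fourier_transform f \<eta> + fourier_transform df \<eta>"
  proof -
    have "(LINT x:UNIV|lborel. dg x) = (LINT x|lborel. c * (f x * ?e x) + df x * ?e x)"
      by (simp add: set_lebesgue_integral_def dg_def mult.left_commute)
    also have "\<dots> = (LINT x|lborel. c * (f x * ?e x)) + (LINT x|lborel. df x * ?e x)"
      using integrable_mult_character[OF cont(1) dec(1)] integrable_mult_character[OF cont(2) dec(2)]
      by (intro Bochner_Integration.integral_add) auto
    finally show ?thesis unfolding fourier_transform_def by simp
  qed
  ultimately have "fourier_transform df \<eta> = - c * fourier_transform f \<eta>" by (simp add: add_eq_0_iff2)
  then show ?thesis by (simp add: c_def)
qed

lemma schwartz_smooth: "schwartz \<phi> \<Longrightarrow> smooth \<phi>"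
  by (simp add: schwartz_def)

lemma fourier_transform_iter_deriv:
  fixes \<phi> :: "'a::euclidean_space \<Rightarrow> complex"
  assumes \<phi>: "schwartz \<phi>" and b: "b \<in> Basis"
  shows "fourier_transform (iter_deriv (replicate n b) \<phi>) \<eta> = (2 * pi * \<i> * (\<eta> \<bullet> b)) ^ n * fourier_transform \<phi> \<eta>"
proof (induction n)
  case (Suc n)
  let ?vs = "replicate n b"
  have vs: "set ?vs \<subseteq> Basis" "set (b # ?vs) \<subseteq> Basis" using b by auto
  obtain C C' where C: "\<And>x. norm (iter_deriv ?vs \<phi> x) \<le> C * decay x"
      "\<And>x. norm (iter_deriv (b # ?vs) \<phi> x) \<le> C' * decay x"
    using schwartz_decay[OF \<phi>] vs by metis
  have "fourier_transform (iter_deriv (b # ?vs) \<phi>) \<eta> = 2 * pi * \<i> * (\<eta> \<bullet> b) * fourier_transform (iter_deriv ?vs \<phi>) \<eta>"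
    by (rule fourier_transform_line_derivative[OF _ _ C])
       (intro smooth_iter_deriv_continuous iter_deriv_line schwartz_smooth[OF \<phi>] vs b)+
  then show ?case using Suc by (simp add: mult.assoc)
qed simp

lemma fourier_transform_decay:
  fixes \<phi> :: "'a::euclidean_space \<Rightarrow> complex"
  assumes \<phi>: "schwartz \<phi>"
  shows "\<exists>C. \<forall>\<eta>. norm (fourier_transform \<phi> \<eta>) \<le> C * decay \<eta>"
proof -
  let ?K = "2 * DIM('a)"
  have "\<exists>B. \<forall>\<eta>. norm (fourier_transform (iter_deriv (replicate n b) \<phi>) \<eta>) \<le> B" if b: "b \<in> Basis" for b :: 'a and n
  proof -
    have vs: "set (replicate n b) \<subseteq> Basis" using b by auto
    obtain C where "\<And>x. norm (iter_deriv (replicate n b) \<phi> x) \<le> C * decay x"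
      using schwartz_decay[OF \<phi> vs] by blast
    from fourier_transform_bound[OF smooth_iter_deriv_continuous[OF schwartz_smooth[OF \<phi>] vs] this]
    show ?thesis by blast
  qed
  then have "\<forall>n. \<forall>b\<in>Basis. \<exists>B. \<forall>\<eta>. norm (fourier_transform (iter_deriv (replicate n b) \<phi>) \<eta>) \<le> B" by blast
  then obtain B where bd: "\<And>n b \<eta>. b \<in> Basis \<Longrightarrow> norm (fourier_transform (iter_deriv (replicate n b) \<phi>) \<eta>) \<le> B n b"
    by (subst (asm) bchoice_iff, subst (asm) choice_iff) blast
  obtain b0 :: 'a where b0: "b0 \<in> Basis" using nonempty_Basis by blast
  define C where "C = B 0 b0 + (\<Sum>b\<in>Basis. B ?K b)"
  have Bnn: "0 \<le> B n b" if "b \<in> Basis" for b n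
    using bd[OF that] norm_ge_zero order_trans by blast
  have "norm (fourier_transform \<phi> m) * (1 + l1_norm m) ^ 0 \<le> (1 + real DIM('a)) ^ 0 * 2 ^ DIM('a) * C * decay m" for m
  proof (rule decay_from_powers)
    have "norm (fourier_transform \<phi> m) \<le> B 0 b0" using bd[OF b0, of 0 m] by simp
    then show "norm (fourier_transform \<phi> m) \<le> C"
      using sum_nonneg[of Basis "B ?K"] Bnn by (simp add: C_def)
    fix b :: 'a assume b: "b \<in> Basis"
    have "norm (fourier_transform \<phi> m) * \<bar>m \<bullet> b\<bar> ^ (?K + 0) \<le> norm (fourier_transform \<phi> m) * (2 * pi * \<bar>m \<bullet> b\<bar>) ^ (?K + 0)"
      using pi_ge_two by (intro mult_left_mono power_mono) (auto simp: mult_le_cancel_right1)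
    also have "\<dots> = norm (fourier_transform (iter_deriv (replicate ?K b) \<phi>) m)"
      by (simp add: fourier_transform_iter_deriv[OF \<phi> b] norm_mult norm_power mult.commute)
    also have "\<dots> \<le> B ?K b" by (rule bd[OF b])
    also have "\<dots> \<le> (\<Sum>b\<in>Basis. B ?K b)" using Bnn b by (intro member_le_sum) auto
    also have "\<dots> \<le> C" using Bnn[OF b0] by (simp add: C_def)
    finally show "norm (fourier_transform \<phi> m) * \<bar>m \<bullet> b\<bar> ^ (?K + 0) \<le> C" .
  qed simp
  then show ?thesis by auto
qed

lemma sum_set_integral_unit_cube:
  fixes f :: "'k \<Rightarrow> 'a::euclidean_space \<Rightarrow> complex"
  assumes K: "countable K" and meas: "\<And>k. k \<in> K \<Longrightarrow> f k \<in> borel_measurable borel"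
    and bound: "\<And>k x. k \<in> K \<Longrightarrow> x \<in> unit_cube \<Longrightarrow> norm (f k x) \<le> M k" and M: "M summable_on K"
  shows "((\<lambda>k. LINT x:unit_cube|lborel. f k x) has_sum (LINT x:unit_cube|lborel. (\<Sum>\<^sub>\<infinity>k\<in>K. f k x))) K"
proof -
  let ?q = "\<lambda>k x. indicator unit_cube x *\<^sub>R f k x"
  have one: "integrable lborel (\<lambda>x::'a. indicator unit_cube x :: real)"
    using emeasure_unit_cube_finite by (intro integrable_real_indicator) auto
  have nb: "norm (?q k x) \<le> indicator unit_cube x * M k" if "k \<in> K" for k x
    using bound[OF that] by (auto simp: indicator_def)
  have iM: "integrable lborel (\<lambda>x::'a. indicator unit_cube x * M k)" for k
    by (rule integrable_mult_left) (rule one)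
  have qi: "integrable lborel (?q k)" if k: "k \<in> K" for k
  proof (rule Bochner_Integration.integrable_bound[OF iM[of k]])
    show "?q k \<in> borel_measurable lborel" using meas[OF k] by measurable
    show "AE x in lborel. norm (?q k x) \<le> norm (indicator unit_cube x * M k)"
      using nb[OF k] order_trans[OF _ abs_ge_self] by auto
  qed
  have pt: "(\<lambda>k. norm (?q k x)) summable_on K" for x
    by (rule summable_on_comparison_test[OF summable_on_cmult_right[OF M, of "indicator unit_cube x"]])
       (use nb in auto)
  have "((\<lambda>k. LINT x|lborel. ?q k x) has_sum (LINT x|lborel. (\<Sum>\<^sub>\<infinity>k\<in>K. ?q k x))) K"
  proof (rule sum_integral_interchange(2)[OF K qi _ pt])
    show "(\<lambda>k. LINT x|lborel. norm (?q k x)) summable_on K"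
    proof (rule summable_on_comparison_test[OF M])
      fix k assume k: "k \<in> K"
      have "(LINT x|lborel. norm (?q k x)) \<le> (LINT x|lborel. indicator (unit_cube :: 'a set) x * M k)"
        by (rule Bochner_Integration.integral_mono) (use integrable_norm[OF qi[OF k]] iM nb[OF k] in auto)
      then show "(LINT x|lborel. norm (?q k x)) \<le> M k" by (simp add: measure_unit_cube)
    qed (auto intro!: integral_nonneg_AE)
  qed
  moreover have "(\<Sum>\<^sub>\<infinity>k\<in>K. ?q k x) = indicator unit_cube x *\<^sub>R (\<Sum>\<^sub>\<infinity>k\<in>K. f k x)" for x
    by (rule infsum_scaleR_right)
  ultimately show ?thesis by (simp add: set_lebesgue_integral_def)
qed

lemma summable_decay_shift: "(\<lambda>k. decay (k + x)) summable_on int_lattice"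
  by (rule summable_on_comparison_test[OF summable_on_cmult_right[OF summable_decay]])
     (use decay_shift[of _ x] less_imp_le[OF decay_pos] in auto)

lemma infsum_lattice_shift:
  assumes "k \<in> int_lattice"
  shows "(\<Sum>\<^sub>\<infinity>l\<in>int_lattice. f (l + k)) = (\<Sum>\<^sub>\<infinity>l\<in>int_lattice. f l)"
proof (rule infsum_reindex_bij_betw)
  show "bij_betw (\<lambda>l. l + k) int_lattice int_lattice"
    using assms by (intro bij_betwI[where g = "\<lambda>l. l - k"]) (auto intro: int_lattice_add int_lattice_diff)
qed

text \<open>Poisson summation: the periodization of \<open>\<phi>\<close>, twisted by \<open>\<xi>\<close>, has the values of the Fourier transform
  on \<open>\<xi> + \<int>\<^sup>d\<close> as Fourier coefficients.  Integrating over \<open>\<xi>\<close> then gives the inversion formula.\<close>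

lemma poisson_summation:
  fixes \<phi> :: "'a::euclidean_space \<Rightarrow> complex"
  assumes cont: "continuous_on UNIV \<phi>" and dec: "\<And>x. norm (\<phi> x) \<le> C * decay x"
    and ft: "\<And>\<eta>. norm (fourier_transform \<phi> \<eta>) \<le> C' * decay \<eta>"
  shows "((\<lambda>k. fourier_transform \<phi> (\<xi> + k) * character k x) has_sum
      (\<Sum>\<^sub>\<infinity>l\<in>int_lattice. \<phi> (x + l) * character (- \<xi>) (x + l))) int_lattice"
proof -
  define P where "P x = (\<Sum>\<^sub>\<infinity>l\<in>int_lattice. \<phi> (x + l) * character (- \<xi>) (x + l))" for x
  have C: "0 \<le> C" using dec[of 0] norm_ge_zero order_trans decay_pos[of "0::'a"] zero_le_mult_iff
    by (metis less_eq_real_def not_le)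
  have cx: "continuous_on UNIV (\<lambda>x. \<phi> (x + l) * character (- \<xi>) (x + l))" for l
    by (intro continuous_intros continuous_on_compose2[OF cont]) auto
  \<comment> \<open>The majorant of the terms depends on the size of \<open>x\<close>, so the
    Weierstrass test applies only locally; balls of all radii cover the space.\<close>
  have "continuous_on (ball 0 R) P" if R: "R > 0" for R
    unfolding P_def
  proof (rule continuous_infsum[where M = "\<lambda>l. C * ((2 + 2 * R\<^sup>2) ^ DIM('a) * decay l)"])
    fix l x :: 'a assume "x \<in> ball 0 R"
    then have xR: "norm x \<le> R" by simp
    have "(\<Prod>b\<in>Basis. 2 + 2 * (x \<bullet> b)\<^sup>2) \<le> (\<Prod>b\<in>(Basis::'a set). 2 + 2 * R\<^sup>2)"
    proof (intro prod_mono conjI)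
      fix b :: 'a assume "b \<in> Basis"
      then have "\<bar>x \<bullet> b\<bar> \<le> R" using xR Basis_le_norm order_trans by blast
      then have "(x \<bullet> b)\<^sup>2 \<le> R\<^sup>2" using R by (simp add: abs_le_square_iff[symmetric])
      then show "2 + 2 * (x \<bullet> b)\<^sup>2 \<le> 2 + 2 * R\<^sup>2" by simp
    qed (simp add: add_nonneg_nonneg)
    then have "(\<Prod>b\<in>Basis. 2 + 2 * (x \<bullet> b)\<^sup>2) * decay l \<le> (2 + 2 * R\<^sup>2) ^ DIM('a) * decay l"
      using decay_pos[of l] by (intro mult_right_mono) auto
    with decay_shift[of l x] have "decay (x + l) \<le> (2 + 2 * R\<^sup>2) ^ DIM('a) * decay l"
      by (simp add: add.commute)
    then have "C * decay (x + l) \<le> C * ((2 + 2 * R\<^sup>2) ^ DIM('a) * decay l)" using C by (intro mult_left_mono)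
    then show "norm (\<phi> (x + l) * character (- \<xi>) (x + l)) \<le> C * ((2 + 2 * R\<^sup>2) ^ DIM('a) * decay l)"
      using dec[of "x + l"] by (simp add: norm_mult)
  qed (intro continuous_on_subset[OF cx] summable_on_cmult_right summable_decay subset_UNIV)+
  then have contP: "continuous_on UNIV P"
    by (metis UNIV_I continuous_at_imp_continuous_on continuous_on_interior interior_ball mem_ball_0 
        norm_ge_zero less_add_one order_le_less_trans)
  have perP: "torus_periodic P"
    unfolding torus_periodic_def
  proof (intro allI ballI)
    fix x b :: 'a assume "b \<in> Basis"
    then show "P (x + b) = P x"
      unfolding P_def
      using infsum_lattice_shift[OF int_lattice_Basis, of b "\<lambda>l. \<phi> (x + l) * character (- \<xi>) (x + l)"]
      by (simp add: add_ac)
  qed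
  have coeff: "fourier_coeff P k = fourier_transform \<phi> (\<xi> + k)" if k: "k \<in> int_lattice" for k
  proof -
    let ?f = "\<lambda>l x. \<phi> (x + l) * character (- \<xi>) (x + l) * character (- k) x"
    have "((\<lambda>l. LINT x:unit_cube|lborel. \<phi> (x + l) * character (- (\<xi> + k)) (x + l)) has_sum
        fourier_transform \<phi> (\<xi> + k)) int_lattice"
      unfolding fourier_transform_def
      by (rule tiling_integrable(2)) (rule integrable_mult_character[OF cont dec])
    also have "?this \<longleftrightarrow> ((\<lambda>l. LINT x:unit_cube|lborel. ?f l x) has_sum fourier_transform \<phi> (\<xi> + k)) int_lattice"
    proof (rule has_sum_cong)
      fix l :: 'a assume l: "l \<in> int_lattice"
      have "character (- (\<xi> + k)) (x + l) = character (- \<xi>) (x + l) * character (- k) x" for x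
        using character_add_left[of "-\<xi>" "-k" "x + l"] l k
        by (simp add: character_add_right int_lattice_minus)
      then show "(LINT x:unit_cube|lborel. \<phi> (x + l) * character (- (\<xi> + k)) (x + l)) = (LINT x:unit_cube|lborel. ?f l x)"
        by (simp add: mult.assoc)
    qed
    finally have 1: "((\<lambda>l. LINT x:unit_cube|lborel. ?f l x) has_sum fourier_transform \<phi> (\<xi> + k)) int_lattice" .
    have 2: "((\<lambda>l. LINT x:unit_cube|lborel. ?f l x) has_sum
        (LINT x:unit_cube|lborel. (\<Sum>\<^sub>\<infinity>l\<in>int_lattice. ?f l x))) int_lattice"
    proof (rule sum_set_integral_unit_cube[OF countable_int_lattice])
      show "?f l \<in> borel_measurable borel" for l
        by (intro borel_measurable_continuous_onI continuous_intros cx)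
      show "(\<lambda>l. C * (4 ^ DIM('a) * decay (l::'a))) summable_on int_lattice"
        by (intro summable_on_cmult_right summable_decay)
      fix l x :: 'a assume "x \<in> unit_cube"
      then have "C * decay (x + l) \<le> C * (4 ^ DIM('a) * decay l)"
        using C decay_unit_cube[of x l] by (intro mult_left_mono) (auto simp: add.commute)
      then show "norm (?f l x) \<le> C * (4 ^ DIM('a) * decay l)"
        using dec[of "x + l"] by (simp add: norm_mult)
    qed
    have 3: "(\<Sum>\<^sub>\<infinity>l\<in>int_lattice. ?f l x) = P x * character (- k) x" for x
      unfolding P_def by (rule infsum_cmult_left')
    show ?thesis using has_sum_unique[OF 2 1] by (simp add: fourier_coeff_def 3)
  qed
  have "((\<lambda>m. fourier_coeff P m * character m x) has_sum P x) int_lattice"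
  proof (rule fourier_series[OF perP contP])
    have "(\<lambda>m. C' * decay (m + \<xi>)) summable_on int_lattice"
      by (intro summable_on_cmult_right summable_decay_shift)
    then show "(\<lambda>m. norm (fourier_coeff P m)) summable_on int_lattice"
      by (rule summable_on_comparison_test) (use ft in \<open>auto simp: coeff add.commute\<close>)
  qed
  then show ?thesis unfolding P_def[symmetric] by (simp add: coeff cong: has_sum_cong)
qed

theorem fourier_inversion:
  fixes \<phi> :: "'a::euclidean_space \<Rightarrow> complex"
  assumes cont: "continuous_on UNIV \<phi>" and dec: "\<And>x. norm (\<phi> x) \<le> C * decay x"
    and ft: "\<And>\<eta>. norm (fourier_transform \<phi> \<eta>) \<le> C' * decay \<eta>"
  shows "(LINT \<eta>|lborel. fourier_transform \<phi> \<eta> * character x \<eta>) = \<phi> x"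
proof -
  have C: "0 \<le> C" "0 \<le> C'" using dec[of 0] ft[of 0] norm_ge_zero order_trans decay_pos[of "0::'a"] zero_le_mult_iff
    by (metis less_eq_real_def not_le)+
  have [measurable]: "\<phi> \<in> borel_measurable borel" by (rule borel_measurable_continuous_onI[OF cont])
  have [measurable]: "fourier_transform \<phi> \<in> borel_measurable borel" by (rule fourier_transform_measurable) simp
  let ?F = "\<lambda>\<eta>. fourier_transform \<phi> \<eta> * character x \<eta>"
  have Fi: "integrable lborel ?F"
    by (rule integrable_decay_bound[where C = C']) (use ft in \<open>auto simp: norm_mult\<close>)
  have bd4: "decay (y + k) \<le> 4 ^ DIM('a) * decay k" if "y \<in> unit_cube" for y k :: 'a
    using decay_unit_cube[OF that, of k] by (simp add: add.commute)
  have 1: "((\<lambda>k. LINT \<xi>:unit_cube|lborel. ?F (\<xi> + k)) has_sum (LINT \<eta>|lborel. ?F \<eta>)) int_lattice"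
    by (rule tiling_integrable(2)[OF Fi])
  have 2: "((\<lambda>k. LINT \<xi>:unit_cube|lborel. ?F (\<xi> + k)) has_sum
      (LINT \<xi>:unit_cube|lborel. (\<Sum>\<^sub>\<infinity>k\<in>int_lattice. ?F (\<xi> + k)))) int_lattice"
  proof (rule sum_set_integral_unit_cube[OF countable_int_lattice])
    show "(\<lambda>l. C' * (4 ^ DIM('a) * decay (l::'a))) summable_on int_lattice"
      by (intro summable_on_cmult_right summable_decay)
    fix l y :: 'a assume "y \<in> unit_cube"
    then have "C' * decay (y + l) \<le> C' * (4 ^ DIM('a) * decay l)" using C bd4 by (intro mult_left_mono) auto
    then show "norm (?F (y + l)) \<le> C' * (4 ^ DIM('a) * decay l)" using ft[of "y + l"] by (simp add: norm_mult)
  qed measurable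
  \<comment> \<open>Poisson summation times the character \<open>character x \<xi>\<close>, which
    cancels the twist by \<open>\<xi>\<close> up to \<open>character (- l) \<xi>\<close>. The right
    side is a Fourier series in \<open>\<xi>\<close>.\<close>
  have inner: "(\<Sum>\<^sub>\<infinity>k\<in>int_lattice. ?F (\<xi> + k)) = (\<Sum>\<^sub>\<infinity>l\<in>int_lattice. \<phi> (x + l) * character (- l) \<xi>)" for \<xi>
  proof -
    have "(\<Sum>\<^sub>\<infinity>k\<in>int_lattice. ?F (\<xi> + k)) = (\<Sum>\<^sub>\<infinity>k\<in>int_lattice. character x \<xi> * (fourier_transform \<phi> (\<xi> + k) * character k x))"
      by (intro infsum_cong) (simp add: character_add_right character_commute[of x] mult_ac)
    also have "\<dots> = character x \<xi> * (\<Sum>\<^sub>\<infinity>k\<in>int_lattice. fourier_transform \<phi> (\<xi> + k) * character k x)"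
      by (rule infsum_cmult_right')
    also have "(\<Sum>\<^sub>\<infinity>k\<in>int_lattice. fourier_transform \<phi> (\<xi> + k) * character k x) =
        (\<Sum>\<^sub>\<infinity>l\<in>int_lattice. \<phi> (x + l) * character (- \<xi>) (x + l))"
      by (rule infsumI) (rule poisson_summation[OF cont dec ft])
    also have "character x \<xi> * \<dots> = (\<Sum>\<^sub>\<infinity>l\<in>int_lattice. character x \<xi> * (\<phi> (x + l) * character (- \<xi>) (x + l)))"
      by (rule infsum_cmult_right'[symmetric])
    also have "\<dots> = (\<Sum>\<^sub>\<infinity>l\<in>int_lattice. \<phi> (x + l) * character (- l) \<xi>)"
      by (intro infsum_cong) (simp add: character_add_right character_minus character_commute[of x] character_commute[of _ \<xi>] mult_ac)
    finally show ?thesis .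
  qed
  have 3: "((\<lambda>l. LINT \<xi>:unit_cube|lborel. \<phi> (x + l) * character (- l) \<xi>) has_sum
      (LINT \<xi>:unit_cube|lborel. (\<Sum>\<^sub>\<infinity>l\<in>int_lattice. \<phi> (x + l) * character (- l) \<xi>))) int_lattice"
  proof (rule sum_set_integral_unit_cube[OF countable_int_lattice])
    show "(\<lambda>l. C * decay (l + x)) summable_on int_lattice"
      by (intro summable_on_cmult_right summable_decay_shift)
  qed (use dec in \<open>auto simp: norm_mult add.commute\<close>)
  \<comment> \<open>Orthogonality of characters: integrating over the cube extracts the constant
    term, which is the value at \<open>x\<close> itself.\<close>
  have 4: "(LINT \<xi>:unit_cube|lborel. \<phi> (x + l) * character (- l) \<xi>) = \<phi> (x + l) * of_bool (l = 0)" if "l \<in> int_lattice" for l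
    using fourier_coeff_character[OF zero_in_int_lattice that] by (auto simp: fourier_coeff_def character_def[of 0])
  have "((\<lambda>l. \<phi> (x + l) * of_bool (l = 0)) has_sum (\<Sum>l\<in>{0}. \<phi> (x + l) * of_bool (l = 0))) int_lattice"
    by (rule has_sum_finite_neutralI[where B = "{0}"]) auto
  then have 5: "((\<lambda>l. LINT \<xi>:unit_cube|lborel. \<phi> (x + l) * character (- l) \<xi>) has_sum \<phi> x) int_lattice"
    by (subst has_sum_cong[OF 4]) auto
  show ?thesis
    using has_sum_unique[OF 1 2] has_sum_unique[OF 3 5] by (simp add: inner)
qed

corollary schwartz_fourier_inversion:
  assumes "schwartz \<phi>"
  shows "(LINT \<eta>|lborel. fourier_transform \<phi> \<eta> * character x \<eta>) = \<phi> x"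
proof -
  obtain C C' where "\<And>x. norm (\<phi> x) \<le> C * decay x" "\<And>\<eta>. norm (fourier_transform \<phi> \<eta>) \<le> C' * decay \<eta>"
    using schwartz_decay[OF assms, of "[]"] fourier_transform_decay[OF assms] by auto
  then show ?thesis
    using smooth_iter_deriv_continuous[OF schwartz_smooth[OF assms], of "[]"] by (intro fourier_inversion) auto
qed

section \<open>Weyl quantization on the torus\<close>

lemma lborel_affine_integral:
  fixes f :: "'a::euclidean_space \<Rightarrow> complex"
  assumes c: "c > 0" and f: "integrable lborel f"
  shows "integrable lborel (\<lambda>x. f (t + c *\<^sub>R x))"
    and "(LINT x|lborel. f (t + c *\<^sub>R x)) = (LINT x|lborel. f x) / c ^ DIM('a)"
proof -
  have [measurable]: "f \<in> borel_measurable borel" using borel_measurable_integrable[OF f] by simp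
  let ?M = "distr lborel borel (\<lambda>x. t + c *\<^sub>R x) :: 'a measure"
  have eq: "lborel = density ?M (\<lambda>_. ennreal (c ^ DIM('a)))"
    using lborel_affine[of c t] c by simp
  have "integrable (density ?M (\<lambda>_. ennreal (c ^ DIM('a)))) f" using f eq by simp
  then have "integrable ?M (\<lambda>x. c ^ DIM('a) *\<^sub>R f x)"
    using c by (subst (asm) integrable_density) auto
  then have "integrable lborel (\<lambda>x. c ^ DIM('a) *\<^sub>R f (t + c *\<^sub>R x))"
    by (subst (asm) integrable_distr_eq) auto
  then have "integrable lborel (\<lambda>x. inverse (c ^ DIM('a)) *\<^sub>R (c ^ DIM('a) *\<^sub>R f (t + c *\<^sub>R x)))"
    by (rule integrable_scaleR_right)
  then show "integrable lborel (\<lambda>x. f (t + c *\<^sub>R x))"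
    using c unfolding scaleR_scaleR by simp
  have "(LINT x|lborel. f x) = (LINT x|density ?M (\<lambda>_. ennreal (c ^ DIM('a))). f x)"
    using eq by simp
  also have "\<dots> = (LINT x|?M. c ^ DIM('a) *\<^sub>R f x)"
    using c by (subst integral_density) auto
  also have "\<dots> = (LINT x|lborel. c ^ DIM('a) *\<^sub>R f (t + c *\<^sub>R x))"
    by (rule integral_distr) auto
  also have "\<dots> = c ^ DIM('a) * (LINT x|lborel. f (t + c *\<^sub>R x))"
    by (simp add: scaleR_conv_of_real)
  finally show "(LINT x|lborel. f (t + c *\<^sub>R x)) = (LINT x|lborel. f x) / c ^ DIM('a)"
    using c by simp
qed

lemma int_lattice_Pair_iff:
  fixes p :: "'a::euclidean_space" and q :: "'b::euclidean_space"
  shows "(p, q) \<in> int_lattice \<longleftrightarrow> p \<in> int_lattice \<and> q \<in> int_lattice"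
  by (auto simp: int_lattice_def Basis_prod_def ball_Un inner_prod_def)

text \<open>For a single character b = (p,q) the oscillatory integral can be computed: the integral
  over y is a Fourier transform and the one over \<open>\<xi>\<close> its inversion. What remains is
  a translation by q/N, with the character of frequency p evaluated midway between the two points,
  as Weyl's symmetric ordering demands. Reflecting \<open>\<xi>\<close> gives the transpose needed
  for duality.\<close>

lemma weyl_fourier:
  fixes a :: "(real ^ 'd) \<times> (real ^ 'd) \<Rightarrow> complex" and \<phi> :: "real ^ 'd \<Rightarrow> complex"
  assumes N: "N \<ge> 1"
    and ser: "\<And>z. ((\<lambda>b. c b * character b z) has_sum a z) int_lattice"
    and sum: "(\<lambda>b. norm (c b)) summable_on int_lattice"
    and \<phi>: "schwartz \<phi>"
  shows "((\<lambda>b. c b * character (fst b) (x - (1 / (2 * real N)) *\<^sub>R snd b) * \<phi> (x - (1 / real N) *\<^sub>R snd b))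
      has_sum weyl (planck N) (\<lambda>(x, \<xi>). a (x, - \<xi>)) \<phi> x) int_lattice"
proof -
  let ?L = "int_lattice :: ((real ^ 'd) \<times> (real ^ 'd)) set"
  let ?n = "real N"
  have n: "?n > 0" using N by simp
  obtain C where C: "\<And>x. norm (\<phi> x) \<le> C * decay x" using schwartz_decay[OF \<phi>, of "[]"] by auto
  obtain C' where C': "\<And>\<eta>. norm (fourier_transform \<phi> \<eta>) \<le> C' * decay \<eta>" using fourier_transform_decay[OF \<phi>] by auto
  have cont: "continuous_on UNIV \<phi>" using smooth_iter_deriv_continuous[OF schwartz_smooth[OF \<phi>], of "[]"] by simp
  have [measurable]: "\<phi> \<in> borel_measurable borel" by (rule borel_measurable_continuous_onI[OF cont])
  have [measurable]: "fourier_transform \<phi> \<in> borel_measurable borel" by (rule fourier_transform_measurable) simp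
  have int\<phi>: "integrable lborel (\<lambda>y. norm (\<phi> y))"
    using integrable_mult_character[OF cont C, of 0] by (intro integrable_norm) simp
  have C'0: "0 \<le> C'" using C'[of 0] norm_ge_zero order_trans decay_pos[of "0::real^'d"] zero_le_mult_iff
    by (metis less_eq_real_def not_le)
  have ft_bd: "norm (fourier_transform \<phi> \<eta>) \<le> C'" for \<eta>
    using C'[of \<eta>] mult_left_mono[OF decay_le_1[of \<eta>] C'0] by simp
  have intft: "integrable lborel (fourier_transform \<phi>)"
    by (rule integrable_decay_bound[OF _ C']) simp
  define E where "E \<xi> b y = c b * (cis (((x - y) \<bullet> \<xi>) / planck N) * character b ((1/2) *\<^sub>R (x + y), - \<xi>) * \<phi> y)" for \<xi> b y
  define G where "G b \<xi> = c b * (character (fst b) ((1/2) *\<^sub>R x) * character (?n *\<^sub>R x - snd b) \<xi> *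
      fourier_transform \<phi> (- (1/2) *\<^sub>R fst b + ?n *\<^sub>R \<xi>))" for b \<xi>
  have cis_eq: "cis (((x - y) \<bullet> \<xi>) / planck N) = character (?n *\<^sub>R \<xi>) x * character (- (?n *\<^sub>R \<xi>)) y" for y \<xi>
    using N by (simp add: planck_def character_def cis_mult inner_diff_left inner_commute algebra_simps)
  \<comment> \<open>With the phases in \<open>y\<close> collected, the integral over
    \<open>y\<close> is the Fourier transform of \<open>\<phi>\<close> at N \<open>\<xi>\<close> -
    p/2.\<close>
  have E_eq: "E \<xi> b y = (c b * (character (fst b) ((1/2) *\<^sub>R x) * character (?n *\<^sub>R x - snd b) \<xi>)) *
      (\<phi> y * character (- (- (1/2) *\<^sub>R fst b + ?n *\<^sub>R \<xi>)) y)" for \<xi> b y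
    unfolding E_def cis_eq by (cases b) (simp add: character_def cis_mult inner_add_left inner_add_right
          inner_diff_left inner_commute algebra_simps)
  have nE: "norm (E \<xi> b y) = norm (c b) * norm (\<phi> y)" for \<xi> b y by (simp add: E_eq norm_mult)
  have intE: "(LINT y|lborel. E \<xi> b y) = G b \<xi>" for \<xi> b
    unfolding E_eq G_def fourier_transform_def by (simp add: mult.assoc)
  have E_sum: "(\<Sum>\<^sub>\<infinity>b\<in>?L. E \<xi> b y) =
      cis (((x - y) \<bullet> \<xi>) / planck N) * (\<lambda>(x, \<xi>). a (x, - \<xi>)) ((1/2) *\<^sub>R (x + y), \<xi>) * \<phi> y" for \<xi> y
  proof -
    let ?k = "cis (((x - y) \<bullet> \<xi>) / planck N) * \<phi> y"
    have "((\<lambda>b. ?k * (c b * character b ((1/2) *\<^sub>R (x + y), - \<xi>))) has_sum ?k * a ((1/2) *\<^sub>R (x + y), - \<xi>)) ?L"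
      by (rule has_sum_cmult_right[OF ser])
    then have "((\<lambda>b. E \<xi> b y) has_sum ?k * a ((1/2) *\<^sub>R (x + y), - \<xi>)) ?L"
      by (simp add: E_def mult_ac)
    then show ?thesis by (simp add: infsumI mult_ac)
  qed
  have inner: "(LINT y|lborel. cis (((x - y) \<bullet> \<xi>) / planck N) * (\<lambda>(x, \<xi>). a (x, - \<xi>)) ((1/2) *\<^sub>R (x + y), \<xi>) * \<phi> y) =
      (\<Sum>\<^sub>\<infinity>b\<in>?L. G b \<xi>)" for \<xi>
  proof -
    have "((\<lambda>b. LINT y|lborel. E \<xi> b y) has_sum (LINT y|lborel. (\<Sum>\<^sub>\<infinity>b\<in>?L. E \<xi> b y))) ?L"
    proof (rule sum_integral_interchange(2)[OF countable_int_lattice])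
      show "integrable lborel (E \<xi> b)" for b
        unfolding E_eq by (intro integrable_mult_right integrable_mult_character[OF cont C])
      show "(\<lambda>b. LINT y|lborel. norm (E \<xi> b y)) summable_on ?L"
        unfolding nE using summable_on_cmult_left[OF sum] by simp
      show "(\<lambda>b. norm (E \<xi> b y)) summable_on ?L" for y
        unfolding nE by (intro summable_on_cmult_left sum)
    qed
    then show ?thesis by (simp add: intE E_sum infsumI)
  qed
  \<comment> \<open>The substitution of the argument of the Fourier transform as new variable
    \<open>\<eta>\<close> turns the integral over \<open>\<xi>\<close> into Fourier inversion at the
    point x - q/N.\<close>
  have G_eq: "G b \<xi> = (\<lambda>\<eta>. c b * (character (fst b) (x - (1 / (2 * ?n)) *\<^sub>R snd b)) *
      (fourier_transform \<phi> \<eta> * character (x - (1 / ?n) *\<^sub>R snd b) \<eta>)) (- (1/2) *\<^sub>R fst b + ?n *\<^sub>R \<xi>)" for b \<xi>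
  proof -
    have "character (x - (1 / ?n) *\<^sub>R snd b) (- (1/2) *\<^sub>R fst b + ?n *\<^sub>R \<xi>) * character (fst b) (x - (1 / (2 * ?n)) *\<^sub>R snd b)
       = character (fst b) ((1/2) *\<^sub>R x) * character (?n *\<^sub>R x - snd b) \<xi>"
      using n by (simp add: character_def cis_mult inner_add_left inner_add_right inner_diff_left inner_diff_right
          inner_commute algebra_simps)
    then show ?thesis unfolding G_def by (simp add: mult_ac)
  qed
  have Fi: "integrable lborel (\<lambda>\<eta>. fourier_transform \<phi> \<eta> * character m \<eta>)" for m
    by (rule integrable_decay_bound[where C = C']) (use C' in \<open>auto simp: norm_mult\<close>)
  have Gi: "integrable lborel (G b)" for b
    unfolding G_eq[abs_def] by (rule lborel_affine_integral(1)[OF n]) (intro integrable_mult_right Fi)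
  have intG: "(LINT \<xi>|lborel. G b \<xi>) =
      c b * character (fst b) (x - (1 / (2 * ?n)) *\<^sub>R snd b) * \<phi> (x - (1 / ?n) *\<^sub>R snd b) / ?n ^ CARD('d)" for b
    unfolding G_eq[abs_def]
    by (subst lborel_affine_integral(2)[OF n]) (use Fi schwartz_fourier_inversion[OF \<phi>] in auto)
  have nG: "norm (G b \<xi>) = norm (c b) * norm (fourier_transform \<phi> (- (1/2) *\<^sub>R fst b + ?n *\<^sub>R \<xi>))" for b \<xi>
    by (simp add: G_def norm_mult)
  have "((\<lambda>b. LINT \<xi>|lborel. G b \<xi>) has_sum (LINT \<xi>|lborel. (\<Sum>\<^sub>\<infinity>b\<in>?L. G b \<xi>))) ?L"
  proof (rule sum_integral_interchange(2)[OF countable_int_lattice Gi])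
    \<comment> \<open>The integral of the norm does not see the shift by p/2, so the integrals of
      \<open>norm (G b \<xi>)\<close> are dominated by one constant times
      \<open>norm (c b)\<close>.\<close>
    define K where "K = norm ((LINT \<eta>|lborel. complex_of_real (norm (fourier_transform \<phi> \<eta>))) / ?n ^ CARD('d))"
    have nrm: "(LINT \<xi>|lborel. norm (fourier_transform \<phi> (t + ?n *\<^sub>R \<xi>))) = K" for t
    proof -
      have "(LINT \<xi>|lborel. norm (fourier_transform \<phi> (t + ?n *\<^sub>R \<xi>))) =
        norm (LINT \<xi>|lborel. complex_of_real (norm (fourier_transform \<phi> (t + ?n *\<^sub>R \<xi>))))"
        by (simp add: integral_nonneg_AE)
      also have "\<dots> = K"
        unfolding K_def
        by (subst lborel_affine_integral(2)[OF n, where f = "\<lambda>\<eta>. complex_of_real (norm (fourier_transform \<phi> \<eta>))"])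
           (use intft in auto)
      finally show ?thesis .
    qed
    show "(\<lambda>b. LINT \<xi>|lborel. norm (G b \<xi>)) summable_on ?L"
      unfolding nG integral_mult_right_zero nrm by (intro summable_on_cmult_left sum)
    show "(\<lambda>b. norm (G b \<xi>)) summable_on ?L" for \<xi>
      by (rule summable_on_comparison_test[OF summable_on_cmult_left[OF sum, of C']])
         (auto simp: nG intro!: mult_left_mono ft_bd)
  qed
  then have "((\<lambda>b. complex_of_real (?n ^ CARD('d)) * (LINT \<xi>|lborel. G b \<xi>)) has_sum
      complex_of_real (?n ^ CARD('d)) * (LINT \<xi>|lborel. (\<Sum>\<^sub>\<infinity>b\<in>?L. G b \<xi>))) ?L"
    by (rule has_sum_cmult_right)
  moreover have "weyl (planck N) (\<lambda>(x, \<xi>). a (x, - \<xi>)) \<phi> x =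
      complex_of_real (?n ^ CARD('d)) * (LINT \<xi>|lborel. (\<Sum>\<^sub>\<infinity>b\<in>?L. G b \<xi>))"
  proof -
    \<comment> \<open>The prefactor of the quantization is exactly the inverse of the Jacobian
      factor of the substitution.\<close>
    have "1 / (2 * pi * planck N) ^ CARD('d) = ?n ^ CARD('d)"
      using N by (simp add: planck_def field_simps power_divide)
    then show ?thesis unfolding weyl_def inner by simp
  qed
  ultimately show ?thesis using n by (simp add: intG)
qed

text \<open>A class just large enough to contain the trigonometric polynomials needed as test
  functions and to be stable under differentiating a product with a Gaussian, which brings in linear
  factors. Polynomial growth follows by the same induction.\<close>

inductive tempered :: "('a::euclidean_space \<Rightarrow> complex) \<Rightarrow> bool" where
  const: "tempered (\<lambda>_. c)"
| inner: "tempered (\<lambda>x. complex_of_real (x \<bullet> v))"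
| character: "tempered (character m)"
| add: "tempered p \<Longrightarrow> tempered q \<Longrightarrow> tempered (\<lambda>x. p x + q x)"
| mult: "tempered p \<Longrightarrow> tempered q \<Longrightarrow> tempered (\<lambda>x. p x * q x)"

lemma tempered_has_derivative:
  "tempered p \<Longrightarrow> \<exists>p'. (\<forall>x. (p has_derivative p' x) (at x)) \<and> (\<forall>v. tempered (\<lambda>x. p' x v))"
proof (induction rule: tempered.induct)
  case (const c)
  show ?case by (rule exI[of _ "\<lambda>_ _. 0"]) (auto intro: tempered.const)
next
  case (inner v)
  have "((\<lambda>x. complex_of_real (x \<bullet> v)) has_derivative (\<lambda>h. complex_of_real (h \<bullet> v))) (at x)" for x
    by (auto intro!: derivative_eq_intros)
  then show ?case
    by (intro exI[of _ "\<lambda>_ h. complex_of_real (h \<bullet> v)"]) (auto intro: tempered.const)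
next
  case (character m)
  let ?D = "\<lambda>x h. 2 * pi * \<i> * (m \<bullet> h) * character m x"
  have "((\<lambda>x. \<i> * complex_of_real (2 * pi * (m \<bullet> x))) has_derivative
      (\<lambda>h. \<i> * complex_of_real (2 * pi * (m \<bullet> h)))) (at x)" for x
    by (intro derivative_intros)
  from has_derivative_compose[OF this DERIV_exp[unfolded has_field_derivative_def]]
  have "(character m has_derivative ?D x) (at x)" for x
    by (simp add: character_def[abs_def] cis_conv_exp mult_ac)
  then show ?case
    by (intro exI[of _ ?D]) (auto intro: tempered.intros)
next
  case (add p q)
  then obtain p' q' where "\<forall>x. (p has_derivative p' x) (at x)" "\<forall>v. tempered (\<lambda>x. p' x v)"
    "\<forall>x. (q has_derivative q' x) (at x)" "\<forall>v. tempered (\<lambda>x. q' x v)" by blast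
  then show ?case
    by (intro exI[of _ "\<lambda>x h. p' x h + q' x h"]) (auto intro: tempered.add has_derivative_add)
next
  case (mult p q)
  then obtain p' q' where "\<forall>x. (p has_derivative p' x) (at x)" "\<forall>v. tempered (\<lambda>x. p' x v)"
    "\<forall>x. (q has_derivative q' x) (at x)" "\<forall>v. tempered (\<lambda>x. q' x v)" by blast
  with mult.hyps show ?case
    by (intro exI[of _ "\<lambda>x h. p x * q' x h + p' x h * q x"])
       (auto intro!: tempered.add tempered.mult has_derivative_mult)
qed

lemma tempered_growth: "tempered p \<Longrightarrow> \<exists>C n. 0 \<le> C \<and> (\<forall>x. norm (p x) \<le> C * (1 + norm x) ^ n)"
proof (induction rule: tempered.induct)
  case (const c)
  show ?case by (rule exI[of _ "norm c"], rule exI[of _ 0]) auto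
next
  case (inner v)
  have "norm (complex_of_real (x \<bullet> v)) \<le> norm v * (1 + norm x) ^ 1" for x
  proof -
    have "norm (complex_of_real (x \<bullet> v)) \<le> norm x * norm v"
      unfolding norm_of_real real_norm_def by (rule Cauchy_Schwarz_ineq2)
    also have "\<dots> \<le> norm v * (1 + norm x) ^ 1" by (simp add: algebra_simps)
    finally show ?thesis .
  qed
  then show ?case by (intro exI[of _ "norm v"] exI[of _ 1]) auto
next
  case (character m)
  show ?case by (rule exI[of _ 1], rule exI[of _ 0]) auto
next
  case (add p q)
  then obtain C n D m where *: "0 \<le> C" "0 \<le> D" "\<And>x. norm (p x) \<le> C * (1 + norm x) ^ n"
    "\<And>x. norm (q x) \<le> D * (1 + norm x) ^ m" by blast
  have "norm (p x + q x) \<le> (C + D) * (1 + norm x) ^ (n + m)" for x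
  proof -
    have "norm (p x + q x) \<le> norm (p x) + norm (q x)" by (rule norm_triangle_ineq)
    also have "\<dots> \<le> C * (1 + norm x) ^ n + D * (1 + norm x) ^ m" using * by (intro add_mono) auto
    also have "\<dots> \<le> C * (1 + norm x) ^ (n + m) + D * (1 + norm x) ^ (n + m)"
      using * by (intro add_mono mult_left_mono power_increasing) auto
    finally show ?thesis by (simp add: algebra_simps)
  qed
  then show ?case using * by (intro exI[of _ "C + D"] exI[of _ "n + m"]) auto
next
  case (mult p q)
  then obtain C n D m where *: "0 \<le> C" "0 \<le> D" "\<And>x. norm (p x) \<le> C * (1 + norm x) ^ n"
    "\<And>x. norm (q x) \<le> D * (1 + norm x) ^ m" by blast
  have "norm (p x * q x) \<le> (C * D) * (1 + norm x) ^ (n + m)" for x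
  proof -
    have "norm (p x * q x) \<le> (C * (1 + norm x) ^ n) * (D * (1 + norm x) ^ m)"
      unfolding norm_mult using * by (intro mult_mono) auto
    then show ?thesis by (simp add: power_add mult_ac)
  qed
  then show ?case using * by (intro exI[of _ "C * D"] exI[of _ "n + m"]) auto
qed

definition gaussian :: "'a::euclidean_space \<Rightarrow> complex" where
  "gaussian x = exp (of_real (- (x \<bullet> x)))"

lemma norm_gaussian: "norm (gaussian x) = exp (- (norm x)\<^sup>2)"
  by (simp add: gaussian_def norm_exp_eq_Re power2_norm_eq_inner)

lemma tempered_gaussian_has_derivative:
  assumes "tempered p"
  shows "\<exists>p'. (\<forall>x. ((\<lambda>x. p x * gaussian x) has_derivative (\<lambda>v. p' v x * gaussian x)) (at x)) \<and> (\<forall>v. tempered (p' v))"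
proof -
  obtain p' where p': "\<And>x. (p has_derivative p' x) (at x)" "\<And>v. tempered (\<lambda>x. p' x v)"
    using tempered_has_derivative[OF assms] by blast
  have g: "(gaussian has_derivative (\<lambda>h. gaussian x * (- 2 * complex_of_real (x \<bullet> h)))) (at x)" for x :: 'a
  proof -
    have "((\<lambda>x::'a. complex_of_real (- (x \<bullet> x))) has_derivative
       (\<lambda>h. complex_of_real (- (x \<bullet> h + h \<bullet> x)))) (at x)"
      by (intro derivative_intros)
    from has_derivative_compose[OF this DERIV_exp[unfolded has_field_derivative_def]] show ?thesis by (simp add: gaussian_def[abs_def] inner_commute)
  qed
  have eq: "p x * (gaussian x * (- 2 * complex_of_real (x \<bullet> v))) + p' x v * gaussian x =
      (p x * (- 2 * complex_of_real (x \<bullet> v)) + p' x v) * gaussian x" for x v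
    by (simp add: algebra_simps)
  show ?thesis
  proof (intro exI[of _ "\<lambda>v x. p x * (- 2 * complex_of_real (x \<bullet> v)) + p' x v"] conjI allI)
    show "((\<lambda>x. p x * gaussian x) has_derivative
        (\<lambda>v. (p x * (- 2 * complex_of_real (x \<bullet> v)) + p' x v) * gaussian x)) (at x)" for x
      using has_derivative_mult[OF p'(1)[of x] g] unfolding eq .
    show "tempered (\<lambda>x. p x * (- 2 * complex_of_real (x \<bullet> v)) + p' x v)" for v
      by (intro tempered.add tempered.mult tempered.inner assms p' tempered.const)
  qed
qed

lemma iter_deriv_tempered_gaussian:
  assumes "tempered p"
  shows "\<exists>q. tempered q \<and> iter_deriv vs (\<lambda>x. p x * gaussian x) = (\<lambda>x. q x * gaussian x)"
proof (induction vs)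
  case Nil
  then show ?case using assms by auto
next
  case (Cons v vs)
  then obtain q where q: "tempered q" "iter_deriv vs (\<lambda>x. p x * gaussian x) = (\<lambda>x. q x * gaussian x)" by blast
  obtain q' where q': "\<And>x. ((\<lambda>x. q x * gaussian x) has_derivative (\<lambda>v. q' v x * gaussian x)) (at x)" "\<And>v. tempered (q' v)"
    using tempered_gaussian_has_derivative[OF q(1)] by blast
  have "iter_deriv (v # vs) (\<lambda>x. p x * gaussian x) = (\<lambda>x. q' v x * gaussian x)"
    by (simp add: q(2) frechet_derivative_at[OF q'(1), symmetric])
  then show ?case using q'(2) by blast
qed

lemma schwartz_tempered_gaussian:
  fixes p :: "'a::euclidean_space \<Rightarrow> complex"
  assumes "tempered p"
  shows "schwartz (\<lambda>x. p x * gaussian x)"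
  unfolding schwartz_def smooth_def
proof (intro conjI allI impI)
  fix vs :: "'a list" and x m
  obtain q where q: "tempered q" "iter_deriv vs (\<lambda>x. p x * gaussian x) = (\<lambda>x. q x * gaussian x)"
    using iter_deriv_tempered_gaussian[OF assms] by blast
  show "iter_deriv vs (\<lambda>x. p x * gaussian x) differentiable at x"
    unfolding q(2) using tempered_gaussian_has_derivative[OF q(1)] by (auto simp: differentiable_def)
  obtain C n where C: "0 \<le> C" "\<And>x. norm (q x) \<le> C * (1 + norm x) ^ n" using tempered_growth[OF q(1)] by blast
  have "norm x ^ m * norm (q x * gaussian x) \<le> C * exp ((real (n + m))\<^sup>2 / 4)" for x
  proof -
    let ?r = "norm x" and ?k = "real (n + m)"
    have "?r ^ m * norm (q x * gaussian x) \<le> (1 + ?r) ^ m * (C * (1 + ?r) ^ n * exp (- ?r\<^sup>2))"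
      unfolding norm_mult norm_gaussian using C by (intro mult_mono power_mono) auto
    also have "\<dots> = C * ((1 + ?r) ^ (n + m) * exp (- ?r\<^sup>2))" by (simp add: power_add mult_ac)
    \<comment> \<open>Replacing 1 + r by its exponential leaves a quadratic exponent, whose maximum
      is found by completing the square.\<close>
    also have "\<dots> \<le> C * (exp ?r ^ (n + m) * exp (- ?r\<^sup>2))"
      using C by (intro mult_left_mono mult_right_mono power_mono) auto
    also have "exp ?r ^ (n + m) * exp (- ?r\<^sup>2) = exp (?k * ?r - ?r\<^sup>2)"
      by (simp add: exp_of_nat_mult[symmetric] exp_add[symmetric] exp_diff exp_minus divide_inverse)
    also have "C * exp (?k * ?r - ?r\<^sup>2) \<le> C * exp (?k\<^sup>2 / 4)"
    proof -
      have "0 \<le> (?k / 2 - ?r)\<^sup>2" by simp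
      then have "?k * ?r - ?r\<^sup>2 \<le> ?k\<^sup>2 / 4" by (simp add: power2_eq_square field_simps)
      then show ?thesis using C by (intro mult_left_mono) auto
    qed
    finally show ?thesis .
  qed
  then show "\<exists>C. \<forall>x. norm x ^ m * norm (iter_deriv vs (\<lambda>x. p x * gaussian x) x) \<le> C"
    unfolding q(2) by blast
qed

lemma tempered_prod: "finite S \<Longrightarrow> (\<And>i. i \<in> S \<Longrightarrow> tempered (f i)) \<Longrightarrow> tempered (\<lambda>x. \<Prod>i\<in>S. f i x)"
  by (induction S rule: finite_induct) (auto intro: tempered.const tempered.mult)

section \<open>Grid nodes modulo the lattice and the Dirac combs on them\<close>

lemma grid_eq_PiE: "grid N = PiE UNIV (\<lambda>_. {..<N})"
  by (auto simp: grid_def PiE_iff)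

lemma finite_grid [simp]: "finite (grid N :: ('d::finite \<Rightarrow> nat) set)"
  unfolding grid_eq_PiE by (intro finite_PiE) auto

lemma vec_in_int_lattice_iff: "(x :: real ^ 'd) \<in> int_lattice \<longleftrightarrow> (\<forall>i. x $ i \<in> \<int>)"
  by (auto simp: int_lattice_def Basis_vec_def inner_axis)

lemma node_diff_int_lattice:
  assumes N: "N \<ge> 1" and "j \<in> grid N" "k \<in> grid N"
  shows "node N j - node N k \<in> int_lattice \<longleftrightarrow> j = (k :: 'd::finite \<Rightarrow> nat)"
proof
  assume l: "node N j - node N k \<in> int_lattice"
  show "j = k"
  proof
    fix i
    have "real (j i) / real N - real (k i) / real N \<in> \<int>"
      using l by (auto simp: vec_in_int_lattice_iff node_def)
    then obtain z where "real (j i) / real N - real (k i) / real N = of_int z" by (rule Ints_cases)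
    then have z: "real (j i) - real (k i) = of_int z * real N" using N by (simp add: field_simps)
    have b: "j i < N" "k i < N" using assms by (auto simp: grid_def)
    have zi: "int (j i) - int (k i) = z * int N"
      using z by (metis of_int_diff of_int_eq_iff of_int_mult of_int_of_nat_eq)
    have "z = 0"
    proof (rule ccontr)
      assume "z \<noteq> 0"
      then have "int N \<le> \<bar>z\<bar> * int N" using N by (simp add: mult_le_cancel_right1)
      then have "int N \<le> \<bar>int (j i) - int (k i)\<bar>" using zi by (simp add: abs_mult)
      then show False using b by linarith
    qed
    then show "j i = k i" using zi by simp
  qed
qed simp

lemma grid_representative:
  assumes N: "N \<ge> 1" and q: "q \<in> int_lattice"
  shows "\<exists>!j. j \<in> grid N \<and> node N (j :: 'd::finite \<Rightarrow> nat) - (1 / real N) *\<^sub>R q \<in> int_lattice"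
proof -
  have "\<forall>i. \<exists>z::int. q $ i = of_int z" using q by (auto simp: vec_in_int_lattice_iff elim: Ints_cases)
  then obtain z :: "'d \<Rightarrow> int" where z: "\<And>i. q $ i = of_int (z i)" by metis
  define j where "j i = nat (z i mod int N)" for i
  have jg: "j \<in> grid N" using N by (auto simp: grid_def j_def nat_less_iff)
  have "node N j - (1 / real N) *\<^sub>R q \<in> int_lattice"
    unfolding vec_in_int_lattice_iff
  proof
    fix i
    have "real (j i) = of_int (z i mod int N)" using N by (simp add: j_def)
    also have "z i mod int N = z i - int N * (z i div int N)" by (simp add: minus_mult_div_eq_mod)
    finally have "real (j i) / real N - of_int (z i) / real N = of_int (- (z i div int N))"
      using N by (simp add: field_simps)
    then show "(node N j - (1 / real N) *\<^sub>R q) $ i \<in> \<int>"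
      using z by (metis Ints_of_int divide_inverse inverse_eq_divide mult.commute node_def
          real_scaleR_def vec_lambda_beta vector_minus_component vector_scaleR_component)
  qed
  moreover have "j' = j" if "j' \<in> grid N \<and> node N j' - (1 / real N) *\<^sub>R q \<in> int_lattice" for j'
  proof -
    have "(node N j' - (1 / real N) *\<^sub>R q) - (node N j - (1 / real N) *\<^sub>R q) \<in> int_lattice"
      using int_lattice_diff[OF conjunct2[OF that] calculation] .
    then show ?thesis using node_diff_int_lattice[OF N, of j' j] that jg by simp
  qed
  ultimately show ?thesis using jg by blast
qed

lemma node_scaled_in_int_lattice: "N \<ge> 1 \<Longrightarrow> real N *\<^sub>R node N (k :: 'd::finite \<Rightarrow> nat) \<in> int_lattice"
  by (auto simp: vec_in_int_lattice_iff node_def)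

definition comb_normalization :: "'d::finite itself \<Rightarrow> nat \<Rightarrow> complex" where
  "comb_normalization _ N = complex_of_real (real N powr (- real CARD('d) / 2))"

lemma dirac_comb_eq:
  "dirac_comb N (j :: 'd::finite \<Rightarrow> nat) \<phi> = comb_normalization TYPE('d) N * (\<Sum>\<^sub>\<infinity>l\<in>int_lattice. \<phi> (l + node N j))"
proof -
  have "bij_betw (\<lambda>k::int^'d. (\<chi> i. real_of_int (k $ i))) UNIV int_lattice"
    by (rule bij_betwI[where g = "\<lambda>x. \<chi> i. \<lfloor>x $ i\<rfloor>"])
       (auto simp: vec_in_int_lattice_iff vec_eq_iff Ints_def)
  from infsum_reindex_bij_betw[OF this, of "\<lambda>l. \<phi> (l + node N j)"] show ?thesis
    by (simp add: dirac_comb_def comb_normalization_def)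
qed

lemma comb_normalization_nonzero: "N \<ge> 1 \<Longrightarrow> comb_normalization TYPE('d::finite) N \<noteq> 0"
  by (simp add: comb_normalization_def)

text \<open>Linear independence of the combs, by a Lagrange interpolation polynomial in the
  coordinate characters. It is periodic, so it factors out of the lattice sum and vanishes on every
  comb but one. The Gaussian makes it a Schwartz function and leaves a positive sum.\<close>

lemma dirac_comb_test_function:
  fixes j :: "'d::finite \<Rightarrow> nat"
  assumes N: "N \<ge> 1" and j: "j \<in> grid N"
  shows "\<exists>\<phi>. schwartz \<phi> \<and> dirac_comb N j \<phi> \<noteq> 0 \<and> (\<forall>k\<in>grid N. k \<noteq> j \<longrightarrow> dirac_comb N k \<phi> = 0)"
proof -
  define p where "p x = (\<Prod>i\<in>UNIV. \<Prod>l\<in>{..<N} - {j i}. character (axis i 1) x + (- cis (2 * pi * (real l / real N))))"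
    for x :: "real ^ 'd"
  have "tempered p"
    unfolding p_def[abs_def] by (intro tempered_prod finite tempered.add tempered.character tempered.const) auto
  then have schw: "schwartz (\<lambda>x. p x * gaussian x)" by (rule schwartz_tempered_gaussian)
  have p_node: "p (l + node N k) = (\<Prod>i\<in>UNIV. \<Prod>n\<in>{..<N} - {j i}. cis (2 * pi * (real (k i) / real N)) - cis (2 * pi * (real n / real N)))"
    if "l \<in> int_lattice" for l k
  proof -
    have "axis i 1 \<in> (int_lattice :: (real ^ 'd) set)" for i by (simp add: vec_in_int_lattice_iff axis_def)
    moreover have "character (axis i 1) (node N k) = cis (2 * pi * (real (k i) / real N))" for i
      by (simp add: character_def inner_axis' node_def)
    ultimately show ?thesis using that by (simp add: p_def character_add_right)
  qed
  define c where "c k = (\<Prod>i\<in>UNIV. \<Prod>n\<in>{..<N} - {j i}. cis (2 * pi * (real (k i) / real N)) - cis (2 * pi * (real n / real N)))" for k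
  have comb: "dirac_comb N k (\<lambda>x. p x * gaussian x) =
      comb_normalization TYPE('d) N * (c k * (\<Sum>\<^sub>\<infinity>l\<in>int_lattice. gaussian (l + node N k)))" for k
    unfolding dirac_comb_eq infsum_cmult_right'[symmetric]
    by (intro arg_cong2[where f = "(*)"] refl infsum_cong) (simp add: p_node c_def infsum_cmult_right')
  have zero: "dirac_comb N k (\<lambda>x. p x * gaussian x) = 0" if k: "k \<in> grid N" "k \<noteq> j" for k
  proof -
    obtain i where i: "k i \<noteq> j i" using k by auto
    have "k i \<in> {..<N} - {j i}" using k i by (auto simp: grid_def)
    then have "(\<Prod>n\<in>{..<N} - {j i}. cis (2 * pi * (real (k i) / real N)) - cis (2 * pi * (real n / real N))) = 0"
      by (intro prod_zero) auto
    then have "c k = 0" unfolding c_def by (intro prod_zero) auto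
    then show ?thesis by (simp add: comb)
  qed
  \<comment> \<open>Each factor is a difference of two distinct N-th roots of unity.\<close>
  have "c j \<noteq> 0"
  proof -
    have "cis (2 * pi * (real (j i) / real N)) \<noteq> cis (2 * pi * (real n / real N))"
      if "n < N" "n \<noteq> j i" for n i
    proof
      assume eq: "cis (2 * pi * (real (j i) / real N)) = cis (2 * pi * (real n / real N))"
      have "j i < N" using j by (auto simp: grid_def)
      have "cis (2 * pi * (real (j i) / real N - real n / real N)) = 1"
        using eq by (simp add: right_diff_distrib cis_divide[symmetric])
      then have "cos (2 * pi * (real (j i) / real N - real n / real N)) = 1"
        by (metis Re_complex_of_real cis.simps(1) of_real_1 one_complex.simps(1))
      then obtain z :: int where "2 * pi * (real (j i) / real N - real n / real N) = of_int z * 2 * pi"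
        unfolding cos_one_2pi_int by blast
      then have "real (j i) / real N - real n / real N = of_int z" by simp
      then have z: "real (j i) - real n = of_int z * real N" using N by (simp add: field_simps)
      then have zi: "int (j i) - int n = z * int N"
        by (metis of_int_diff of_int_eq_iff of_int_mult of_int_of_nat_eq)
      have "z \<noteq> 0" using zi that by auto
      then have "int N \<le> \<bar>z\<bar> * int N" using N by (simp add: mult_le_cancel_right1)
      then have "int N \<le> \<bar>int (j i) - int n\<bar>" using zi by (simp add: abs_mult)
      then show False using that \<open>j i < N\<close> by linarith
    qed
    then show ?thesis by (auto simp: c_def)
  qed
  moreover have "(\<Sum>\<^sub>\<infinity>l\<in>int_lattice. gaussian (l + node N j)) \<noteq> 0"
  proof -
    obtain C where C: "\<And>x :: real ^ 'd. norm (gaussian x) \<le> C * decay x"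
      using schwartz_decay[OF schwartz_tempered_gaussian[OF tempered.const[of 1]], of "[]"] by auto
    have s: "(\<lambda>l. norm (gaussian (l + node N j))) summable_on int_lattice"
      by (rule summable_on_comparison_test[OF summable_on_cmult_right[OF summable_decay_shift, of C "node N j"]])
         (use C in auto)
    have g: "gaussian x = complex_of_real (norm (gaussian x))" for x :: "real ^ 'd"
      unfolding norm_gaussian power2_norm_eq_inner unfolding gaussian_def by (rule exp_of_real)
    have eq: "(\<Sum>\<^sub>\<infinity>l\<in>int_lattice. gaussian (l + node N j)) =
        complex_of_real (\<Sum>\<^sub>\<infinity>l\<in>int_lattice. norm (gaussian (l + node N j)))"
    proof (rule infsumI)
      have "((\<lambda>l. complex_of_real (norm (gaussian (l + node N j)))) has_sum
          complex_of_real (\<Sum>\<^sub>\<infinity>l\<in>int_lattice. norm (gaussian (l + node N j)))) int_lattice"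
        by (rule has_sum_of_real[OF has_sum_infsum[OF s]])
      then show "((\<lambda>l. gaussian (l + node N j)) has_sum
          complex_of_real (\<Sum>\<^sub>\<infinity>l\<in>int_lattice. norm (gaussian (l + node N j)))) int_lattice"
        unfolding g[symmetric] .
    qed
    have "0 < (\<Sum>l\<in>{0}. norm (gaussian (l + node N j)))"
      by (simp add: norm_gaussian del: zero_less_norm_iff)
    also have "\<dots> \<le> (\<Sum>\<^sub>\<infinity>l\<in>int_lattice. norm (gaussian (l + node N j)))"
      by (rule finite_sum_le_infsum[OF s]) auto
    finally show ?thesis unfolding eq by (simp del: of_real_sum)
  qed
  ultimately have "dirac_comb N j (\<lambda>x. p x * gaussian x) \<noteq> 0"
    by (simp add: comb comb_normalization_nonzero[OF N])
  then show ?thesis using schw zero by blast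
qed

text \<open>The matrix of the quantization of \<open>(x, \<xi>) \<mapsto> e\<^bsup>2\<pi>i(p\<sqdot>x + q\<sqdot>\<xi>)\<^esup>\<close>, where \<open>b = (p, q)\<close>.\<close>

definition weyl_matrix :: "nat \<Rightarrow> (real ^ 'd) \<times> (real ^ 'd) \<Rightarrow> ('d::finite \<Rightarrow> nat) cmatrix" where
  "weyl_matrix N b j k = (if j \<in> grid N \<and> k \<in> grid N \<and> node N j - (node N k - (1 / real N) *\<^sub>R snd b) \<in> int_lattice
     then character (fst b) (node N k - (1 / (2 * real N)) *\<^sub>R snd b) else 0)"

lemma norm_weyl_matrix: "norm (weyl_matrix N b j k) \<le> 1"
  by (simp add: weyl_matrix_def)

lemma grid_shift:
  fixes k :: "'d::finite \<Rightarrow> nat"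
  assumes N: "N \<ge> 1" and q: "q \<in> int_lattice"
  shows "\<exists>!j. j \<in> grid N \<and> node N j - (node N k - (1 / real N) *\<^sub>R q) \<in> int_lattice"
proof -
  have "node N k - (1 / real N) *\<^sub>R q = (1 / real N) *\<^sub>R (real N *\<^sub>R node N k - q)"
    using N by (simp add: scaleR_diff_right)
  then show ?thesis
    using grid_representative[OF N int_lattice_diff[OF node_scaled_in_int_lattice[OF N, of k] q]] by simp
qed

text \<open>The bound is uniform in \<open>y\<close>, because \<open>y\<close> can first be reduced
  modulo the lattice to the unit cube. This uniformity permits exchanging the sum over the lattice
  with the Fourier series of the symbol.\<close>

lemma lattice_sum_shift_bounded:
  assumes "\<And>x :: 'a::euclidean_space. norm (\<phi> x :: complex) \<le> C * decay x" and "0 \<le> C"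
  shows "(\<lambda>l. norm (\<phi> (l + y))) summable_on int_lattice"
    and "(\<Sum>\<^sub>\<infinity>l\<in>int_lattice. norm (\<phi> (l + y))) \<le> C * 4 ^ DIM('a) * (\<Sum>\<^sub>\<infinity>l\<in>(int_lattice :: 'a set). decay l)"
proof -
  have s: "(\<lambda>l. norm (\<phi> (l + z))) summable_on int_lattice" for z
    by (rule summable_on_comparison_test[OF summable_on_cmult_right[OF summable_decay_shift, of C z]])
       (use assms in auto)
  then show "(\<lambda>l. norm (\<phi> (l + y))) summable_on int_lattice" .
  obtain k where k: "k \<in> int_lattice" "y - k \<in> unit_cube" using unit_cube_decomposition[of y] by auto
  have "(\<Sum>\<^sub>\<infinity>l\<in>int_lattice. norm (\<phi> (l + y))) = (\<Sum>\<^sub>\<infinity>l\<in>int_lattice. norm (\<phi> (l + (y - k))))"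
    using infsum_lattice_shift[OF k(1), of "\<lambda>l. norm (\<phi> (l + (y - k)))"] by (simp add: add.assoc)
  also have "\<dots> \<le> (\<Sum>\<^sub>\<infinity>l\<in>(int_lattice :: 'a set). C * 4 ^ DIM('a) * decay l)"
  proof (rule infsum_mono[OF s])
    show "(\<lambda>l::'a. C * 4 ^ DIM('a) * decay l) summable_on int_lattice"
      by (intro summable_on_cmult_right summable_decay)
    fix l :: 'a
    have "C * decay (l + (y - k)) \<le> C * (4 ^ DIM('a) * decay l)"
      using assms(2) decay_unit_cube[OF k(2), of l] by (intro mult_left_mono) auto
    then show "norm (\<phi> (l + (y - k))) \<le> C * 4 ^ DIM('a) * decay l"
      using assms(1)[of "l + (y - k)"] by (simp add: mult.assoc)
  qed
  also have "\<dots> = C * 4 ^ DIM('a) * (\<Sum>\<^sub>\<infinity>l\<in>(int_lattice :: 'a set). decay l)"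
    by (rule infsum_cmult_right')
  finally show "(\<Sum>\<^sub>\<infinity>l\<in>int_lattice. norm (\<phi> (l + y))) \<le> \<dots>" .
qed

lemma has_sum_finite_sum:
  fixes f :: "'j \<Rightarrow> 'k \<Rightarrow> 'b::{comm_monoid_add, topological_comm_monoid_add, t2_space}"
  assumes "finite S" "\<And>j. j \<in> S \<Longrightarrow> f j summable_on A"
  shows "((\<lambda>b. \<Sum>j\<in>S. f j b) has_sum (\<Sum>j\<in>S. infsum (f j) A)) A"
  using assms by (induction S rule: finite_induct) (auto intro!: has_sum_add has_sum_infsum)

text \<open>A Weyl operator translates the comb at node \<open>k\<close> by a multiple of 1/N, so it
  lands on the comb of exactly one other node. Since p is integral, its phase is constant along the
  comb and can be taken out.\<close>

lemma weyl_distribution_dirac_comb: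
  fixes a :: "(real ^ 'd) \<times> (real ^ 'd) \<Rightarrow> complex" and \<phi> :: "real ^ 'd \<Rightarrow> complex"
    and k :: "'d \<Rightarrow> nat"
  assumes N: "N \<ge> 1"
    and ser: "\<And>z. ((\<lambda>b. c b * character b z) has_sum a z) int_lattice"
    and sum: "(\<lambda>b. norm (c b)) summable_on int_lattice"
    and \<phi>: "schwartz \<phi>" and k: "k \<in> grid N"
  shows "weyl_distribution (planck N) a (dirac_comb N k) \<phi> =
    (\<Sum>j\<in>grid N. (\<Sum>\<^sub>\<infinity>b\<in>int_lattice. c b * weyl_matrix N b j k) * dirac_comb N j \<phi>)"
proof -
  let ?L2 = "int_lattice :: ((real ^ 'd) \<times> (real ^ 'd)) set" and ?L = "int_lattice :: (real ^ 'd) set"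
  let ?n = "real N"
  let ?\<kappa> = "comb_normalization TYPE('d) N"
  obtain C where C: "\<And>x. norm (\<phi> x) \<le> C * decay x" using schwartz_decay[OF \<phi>, of "[]"] by auto
  have C0: "0 \<le> C" using C[of 0] norm_ge_zero order_trans decay_pos[of "0::real^'d"] zero_le_mult_iff
    by (metis less_eq_real_def not_le)
  define K where "K = C * 4 ^ DIM(real ^ 'd) * (\<Sum>\<^sub>\<infinity>l\<in>?L. decay l)"
  define s where "s b = node N k - (1 / ?n) *\<^sub>R snd b" for b :: "(real ^ 'd) \<times> (real ^ 'd)"
  define e where "e b = character (fst b) (node N k - (1 / (2 * ?n)) *\<^sub>R snd b)" for b :: "(real ^ 'd) \<times> (real ^ 'd)"
  define g where "g l b = c b * e b * \<phi> (l + s b)" for l b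
  have W: "weyl (planck N) (\<lambda>(x, \<xi>). a (x, - \<xi>)) \<phi> (l + node N k) = (\<Sum>\<^sub>\<infinity>b\<in>?L2. g l b)" if l: "l \<in> ?L" for l
  proof -
    have "((\<lambda>b. g l b) has_sum weyl (planck N) (\<lambda>(x, \<xi>). a (x, - \<xi>)) \<phi> (l + node N k)) ?L2"
    proof (rule has_sum_cong[THEN iffD1, OF _ weyl_fourier[OF N ser sum \<phi>]])
      fix b :: "(real ^ 'd) \<times> (real ^ 'd)" assume "b \<in> ?L2"
      then have "fst b \<in> int_lattice" by (cases b) (simp add: int_lattice_Pair_iff)
      then have "character (fst b) (l + node N k - (1 / (2 * ?n)) *\<^sub>R snd b) = e b"
        using l character_add_right[of "fst b" l "node N k - (1 / (2 * ?n)) *\<^sub>R snd b"] by (simp add: e_def add_diff_eq)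
      then show "c b * character (fst b) (l + node N k - (1 / (2 * ?n)) *\<^sub>R snd b) * \<phi> (l + node N k - (1 / ?n) *\<^sub>R snd b) = g l b"
        by (simp add: g_def s_def add_diff_eq)
    qed
    then show ?thesis by (simp add: infsumI)
  qed
  have ng: "norm (g l b) = norm (c b) * norm (\<phi> (l + s b))" for l b
    by (simp add: g_def e_def norm_mult)
  \<comment> \<open>For fixed b the sum of norms over l is at most \<open>norm (c b) * K\<close>
    with \<open>K\<close> independent of the shift.\<close>
  have abs: "(\<lambda>(b, l). g l b) summable_on ?L2 \<times> ?L"
  proof (rule abs_summable_summable, rule Infinite_Sum.abs_summable_on_Sigma_iff[THEN iffD2], intro conjI ballI)
    fix b assume "b \<in> ?L2"
    show "(\<lambda>l. norm ((\<lambda>(b, l). g l b) (b, l))) summable_on ?L"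
      by (simp add: ng) (intro summable_on_cmult_right lattice_sum_shift_bounded(1)[OF C C0])
  next
    have "(\<Sum>\<^sub>\<infinity>l\<in>?L. norm ((\<lambda>(b, l). g l b) (b, l))) = norm (c b) * (\<Sum>\<^sub>\<infinity>l\<in>?L. norm (\<phi> (l + s b)))" for b
      by (simp add: ng infsum_cmult_right')
    moreover have "0 \<le> (\<Sum>\<^sub>\<infinity>l\<in>?L. norm (\<phi> (l + s b)))" for b by (rule infsum_nonneg) simp
    moreover have "(\<Sum>\<^sub>\<infinity>l\<in>?L. norm (\<phi> (l + s b))) \<le> K" for b
      unfolding K_def by (rule lattice_sum_shift_bounded(2)[OF C C0])
    ultimately show "(\<lambda>b. norm (\<Sum>\<^sub>\<infinity>l\<in>?L. norm ((\<lambda>(b, l). g l b) (b, l)))) summable_on ?L2"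
      by (intro summable_on_comparison_test[OF summable_on_cmult_left[OF sum, of K]])
         (auto simp: abs_mult intro!: mult_left_mono)
  qed
  \<comment> \<open>The column of the Weyl matrix has one nonzero entry, at the node congruent to
    the shifted point; shifting the summation index by a lattice vector turns the left side into
    that comb.\<close>
  have comb_s: "?\<kappa> * (\<Sum>\<^sub>\<infinity>l\<in>?L. \<phi> (l + s b)) * e b = (\<Sum>j\<in>grid N. weyl_matrix N b j k * dirac_comb N j \<phi>)" if b: "b \<in> ?L2" for b
  proof -
    have "snd b \<in> int_lattice" using b by (cases b) (simp add: int_lattice_Pair_iff)
    from ex1E[OF grid_shift[OF N this, of k]] obtain j where j: "j \<in> grid N" "node N j - s b \<in> ?L"
      and uniq: "\<And>j'. j' \<in> grid N \<Longrightarrow> node N j' - s b \<in> ?L \<Longrightarrow> j' = j"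
      unfolding s_def by metis
    have "(\<Sum>j'\<in>grid N. weyl_matrix N b j' k * dirac_comb N j' \<phi>) = (\<Sum>j'\<in>{j}. weyl_matrix N b j' k * dirac_comb N j' \<phi>)"
    proof (rule sum.mono_neutral_right)
      show "\<forall>i\<in>grid N - {j}. weyl_matrix N b i k * dirac_comb N i \<phi> = 0"
        using uniq by (auto simp: weyl_matrix_def s_def)
    qed (use j in auto)
    also have "\<dots> = e b * dirac_comb N j \<phi>" using j k by (simp add: weyl_matrix_def e_def s_def)
    also have "dirac_comb N j \<phi> = ?\<kappa> * (\<Sum>\<^sub>\<infinity>l\<in>?L. \<phi> (l + s b))"
      unfolding dirac_comb_eq using infsum_lattice_shift[OF j(2), of "\<lambda>l. \<phi> (l + s b)"] by (simp add: add.assoc)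
    finally show ?thesis by (simp add: mult_ac)
  qed
  have summ: "(\<lambda>b. c b * weyl_matrix N b j k) summable_on ?L2" for j
  proof (rule abs_summable_summable, rule summable_on_comparison_test[OF sum])
    show "norm (c b * weyl_matrix N b j k) \<le> norm (c b)" for b
      using norm_weyl_matrix[of N b j k] by (simp add: norm_mult mult_left_le)
  qed simp
  have "weyl_distribution (planck N) a (dirac_comb N k) \<phi> =
      ?\<kappa> * (\<Sum>\<^sub>\<infinity>l\<in>?L. weyl (planck N) (\<lambda>(x, \<xi>). a (x, - \<xi>)) \<phi> (l + node N k))"
    by (simp add: weyl_distribution_def dirac_comb_eq)
  also have "(\<Sum>\<^sub>\<infinity>l\<in>?L. weyl (planck N) (\<lambda>(x, \<xi>). a (x, - \<xi>)) \<phi> (l + node N k)) = (\<Sum>\<^sub>\<infinity>l\<in>?L. \<Sum>\<^sub>\<infinity>b\<in>?L2. g l b)"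
    by (rule infsum_cong) (rule W)
  also have "\<dots> = (\<Sum>\<^sub>\<infinity>b\<in>?L2. \<Sum>\<^sub>\<infinity>l\<in>?L. g l b)"
    by (rule infsum_swap_banach[symmetric]) (rule abs)
  also have "?\<kappa> * \<dots> = (\<Sum>\<^sub>\<infinity>b\<in>?L2. ?\<kappa> * (\<Sum>\<^sub>\<infinity>l\<in>?L. g l b))" by (rule infsum_cmult_right'[symmetric])
  also have "\<dots> = (\<Sum>\<^sub>\<infinity>b\<in>?L2. \<Sum>j\<in>grid N. c b * weyl_matrix N b j k * dirac_comb N j \<phi>)"
  proof (rule infsum_cong)
    fix b assume b: "b \<in> ?L2"
    have "?\<kappa> * (\<Sum>\<^sub>\<infinity>l\<in>?L. g l b) = c b * (?\<kappa> * (\<Sum>\<^sub>\<infinity>l\<in>?L. \<phi> (l + s b)) * e b)"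
      by (simp add: g_def infsum_cmult_right' mult_ac)
    then show "?\<kappa> * (\<Sum>\<^sub>\<infinity>l\<in>?L. g l b) = (\<Sum>j\<in>grid N. c b * weyl_matrix N b j k * dirac_comb N j \<phi>)"
      unfolding comb_s[OF b] sum_distrib_left by (simp only: mult.assoc)
  qed
  also have "\<dots> = (\<Sum>j\<in>grid N. \<Sum>\<^sub>\<infinity>b\<in>?L2. c b * weyl_matrix N b j k * dirac_comb N j \<phi>)"
    by (rule infsumI[OF has_sum_finite_sum]) (auto intro: summable_on_cmult_left summ)
  also have "\<dots> = (\<Sum>j\<in>grid N. (\<Sum>\<^sub>\<infinity>b\<in>?L2. c b * weyl_matrix N b j k) * dirac_comb N j \<phi>)"
    by (simp add: infsum_cmult_left')
  finally show ?thesis .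
qed

text \<open>The definite description in \<open>torus_quantization\<close> is justified here: the
  action on combs exhibits one solution, and the separating test functions read off each entry of
  any other.\<close>

theorem torus_quantization_fourier:
  fixes a :: "(real ^ 'd) \<times> (real ^ 'd) \<Rightarrow> complex"
  assumes N: "N \<ge> 1" and a: "smooth a" "torus_periodic a"
  shows "torus_quantization N a j k = (\<Sum>\<^sub>\<infinity>b\<in>int_lattice. fourier_coeff a b * weyl_matrix N b j k)"
proof -
  define M0 where "M0 j k = (\<Sum>\<^sub>\<infinity>b\<in>int_lattice. fourier_coeff a b * weyl_matrix N b j k)" for j k
  have sum: "(\<lambda>b. norm (fourier_coeff a b)) summable_on int_lattice"
    using smooth_fourier_coeff_summable[OF a, of 0] by simp
  let ?P = "\<lambda>M. (\<forall>j k. j \<notin> grid N \<or> k \<notin> grid N \<longrightarrow> M j k = 0) \<and>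
     (\<forall>k\<in>grid N. \<forall>\<phi>. schwartz \<phi> \<longrightarrow>
        weyl_distribution (planck N) a (dirac_comb N k) \<phi> = (\<Sum>j\<in>grid N. M j k * dirac_comb N j \<phi>))"
  have P0: "?P M0"
  proof (intro conjI allI impI ballI)
    show "M0 j k = 0" if "j \<notin> grid N \<or> k \<notin> grid N" for j k
      using that by (auto simp: M0_def weyl_matrix_def)
    show "weyl_distribution (planck N) a (dirac_comb N k) \<phi> = (\<Sum>j\<in>grid N. M0 j k * dirac_comb N j \<phi>)"
      if "k \<in> grid N" "schwartz \<phi>" for k \<phi>
      unfolding M0_def by (rule weyl_distribution_dirac_comb[OF N smooth_fourier_series[OF a] sum that(2,1)])
  qed
  have "M = M0" if M: "?P M" for M
  proof (intro ext)
    fix j k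
    show "M j k = M0 j k"
    proof (cases "j \<in> grid N \<and> k \<in> grid N")
      case True
      then obtain \<phi> where \<phi>: "schwartz \<phi>" "dirac_comb N j \<phi> \<noteq> 0"
        "\<And>i. i \<in> grid N \<Longrightarrow> i \<noteq> j \<Longrightarrow> dirac_comb N i \<phi> = 0"
        using dirac_comb_test_function[OF N, of j] by blast
      have *: "(\<Sum>i\<in>grid N. M' i k * dirac_comb N i \<phi>) = M' j k * dirac_comb N j \<phi>" for M' :: "('d \<Rightarrow> nat) cmatrix"
      proof -
        have "(\<Sum>i\<in>grid N. M' i k * dirac_comb N i \<phi>) = (\<Sum>i\<in>{j}. M' i k * dirac_comb N i \<phi>)"
          by (rule sum.mono_neutral_right) (use True \<phi> in auto)
        then show ?thesis by simp
      qed
      have "(\<Sum>i\<in>grid N. M i k * dirac_comb N i \<phi>) = (\<Sum>i\<in>grid N. M0 i k * dirac_comb N i \<phi>)"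
        using M P0 True \<phi>(1) by metis
      then show ?thesis using \<phi>(2) by (simp add: *)
    qed (use M P0 in metis)
  qed
  then have "torus_quantization N a = M0"
    unfolding torus_quantization_def using P0 by (intro the_equality) blast+
  then show ?thesis by (simp add: M0_def)
qed

section \<open>Scaled commutators\<close>

definition commutator :: "'a::ring \<Rightarrow> 'a \<Rightarrow> 'a" where
  "commutator X Y = X * Y - Y * X"

lemma bounded_linear_commutator_right: "bounded_linear (commutator (X :: 'a::real_normed_algebra))"
  unfolding commutator_def[abs_def]
  by (intro bounded_linear_sub bounded_linear_mult_right bounded_linear_mult_left)

lemma bounded_linear_commutator_left: "bounded_linear (\<lambda>X. commutator X (Y :: 'a::real_normed_algebra))"
  unfolding commutator_def
  by (intro bounded_linear_sub bounded_linear_mult_right bounded_linear_mult_left)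

lemma jacobi: "commutator X (commutator Y Z) = commutator Y (commutator X Z) + commutator (commutator X Y) Z"
  by (simp add: commutator_def algebra_simps)

abbreviation weight :: "'v::euclidean_space \<Rightarrow> real" where
  "weight b \<equiv> 1 + l1_norm b"

definition generators :: "'v::euclidean_space set" where
  "generators = Basis \<union> uminus ` Basis"

lemma l1_norm_triangle: "l1_norm (x + y) \<le> l1_norm x + l1_norm y"
  unfolding l1_norm_def sum.distrib[symmetric]
  by (intro sum_mono) (simp add: inner_add_left)

lemma l1_norm_minus [simp]: "l1_norm (- x) = l1_norm x"
  by (simp add: l1_norm_def)

lemma l1_norm_Basis: "b \<in> Basis \<Longrightarrow> l1_norm b = 1"
  by (simp add: l1_norm_def inner_Basis if_distrib[of abs] cong: if_cong)

lemma l1_norm_generators: "g \<in> generators \<Longrightarrow> l1_norm g = 1"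
  by (auto simp: generators_def l1_norm_Basis)

lemma generators_int_lattice: "g \<in> generators \<Longrightarrow> g \<in> int_lattice"
  by (auto simp: generators_def intro: int_lattice_Basis int_lattice_minus)

lemma finite_generators [simp]: "finite generators"
  by (simp add: generators_def)

text \<open>On the lattice \<open>l1_norm\<close> is a natural number. A step against the sign of a
  nonzero coordinate lowers it by exactly one, so every lattice point has a shortest path of
  generators from the origin.\<close>

lemma int_lattice_induct [consumes 1, case_names zero step]:
  fixes b :: "'v::euclidean_space"
  assumes "b \<in> int_lattice" and zero: "P 0"
    and step: "\<And>b g. b \<in> int_lattice \<Longrightarrow> g \<in> generators \<Longrightarrow> l1_norm (b + g) = l1_norm b + 1 \<Longrightarrow> P b \<Longrightarrow> P (b + g)"
  shows "P b"
proof -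
  have "l1_norm b = real n \<Longrightarrow> b \<in> int_lattice \<Longrightarrow> P b" for n
  proof (induction n arbitrary: b)
    case 0
    from 0(1) have "(\<Sum>c\<in>Basis. \<bar>b \<bullet> c\<bar>) = 0" by (simp add: l1_norm_def)
    then have "\<forall>c\<in>Basis. \<bar>b \<bullet> c\<bar> = 0" by (subst (asm) sum_nonneg_eq_0_iff) auto
    then have "b = 0" by (simp add: euclidean_eq_iff[where 'a = 'v])
    then show ?case using zero by simp
  next
    case (Suc n)
    have "\<exists>c\<in>Basis. b \<bullet> c \<noteq> 0"
    proof (rule ccontr)
      assume "\<not> ?thesis"
      then have "l1_norm b = 0" by (simp add: l1_norm_def)
      then show False using Suc.prems(1) by simp
    qed
    then obtain c where c: "c \<in> Basis" "b \<bullet> c \<noteq> 0" by blast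
    define g where "g = sgn (b \<bullet> c) *\<^sub>R c"
    have g: "g \<in> generators" using c by (cases "b \<bullet> c > 0") (auto simp: g_def generators_def sgn_if)
    have "b \<bullet> c \<in> \<int>" using Suc.prems(2) c by (simp add: int_lattice_def)
    then have "\<bar>b \<bullet> c\<bar> \<ge> 1" using c(2) Ints_nonzero_abs_ge1 by blast
    then have ac: "\<bar>(b - g) \<bullet> c\<bar> = \<bar>b \<bullet> c\<bar> - 1"
      using c(1) by (auto simp: g_def inner_diff_left sgn_if abs_if)
    have "l1_norm (b - g) = \<bar>(b - g) \<bullet> c\<bar> + (\<Sum>x\<in>Basis - {c}. \<bar>(b - g) \<bullet> x\<bar>)"
      unfolding l1_norm_def by (rule sum.remove) (use c in auto)
    also have "(\<Sum>x\<in>Basis - {c}. \<bar>(b - g) \<bullet> x\<bar>) = (\<Sum>x\<in>Basis - {c}. \<bar>b \<bullet> x\<bar>)"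
      using c by (intro sum.cong) (auto simp: g_def inner_diff_left inner_Basis)
    also have "\<bar>(b - g) \<bullet> c\<bar> + (\<Sum>x\<in>Basis - {c}. \<bar>b \<bullet> x\<bar>) = l1_norm b - 1"
      unfolding ac l1_norm_def by (subst (2) sum.remove[of _ c]) (use c in auto)
    finally have l: "l1_norm (b - g) = l1_norm b - 1" .
    have "P (b - g)"
      using Suc.IH[of "b - g"] l Suc.prems generators_int_lattice[OF g] by (simp add: int_lattice_diff)
    then have "P (b - g + g)"
      using step[OF int_lattice_diff[OF Suc.prems(2) generators_int_lattice[OF g]] g] l by simp
    then show ?case by simp
  qed
  moreover have "l1_norm b \<in> \<int>"
    unfolding l1_norm_def using assms(1) by (intro Ints_sum) (auto simp: int_lattice_def)
  ultimately show ?thesis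
    using assms(1) l1_norm_nonneg[of b] by (metis Ints_cases nonneg_int_cases of_int_0_le_iff of_int_of_nat_eq)
qed

definition words :: "nat \<Rightarrow> 'v::euclidean_space list set" where
  "words k = {w. set w \<subseteq> generators \<and> length w \<le> k}"

lemma finite_words [simp]: "finite (words k)"
  unfolding words_def by (rule finite_lists_length_le) simp

lemma words_mono: "k \<le> l \<Longrightarrow> words k \<subseteq> words l"
  by (auto simp: words_def)

text \<open>The recursion is that of \<open>norm_Dw_D\<close>. A further letter g yields a main term
  and a correction at frequency b + g; the doubled weight there, raised to the power k + 1, gives
  the power of 2.\<close>

fun tame_const :: "real \<Rightarrow> nat \<Rightarrow> real" where
  "tame_const \<kappa> 0 = 1"
| "tame_const \<kappa> (Suc k) = (1 + \<kappa> * 2 ^ (k + 1)) * tame_const \<kappa> k"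

text \<open>Collects only the corrections of \<open>norm_Dw_D_commutator\<close>, one for each
  letter; the main terms cancel, so the empty word starts at 0.\<close>

fun commutation_const :: "real \<Rightarrow> nat \<Rightarrow> real" where
  "commutation_const \<kappa> 0 = 0"
| "commutation_const \<kappa> (Suc k) = commutation_const \<kappa> k + \<kappa> * 2 ^ (k + 1) * tame_const \<kappa> k"

lemma tame_const_ge_1: "0 \<le> \<kappa> \<Longrightarrow> 1 \<le> tame_const \<kappa> k"
proof (induction k)
  case (Suc k)
  have "1 * 1 \<le> (1 + \<kappa> * 2 ^ (k + 1)) * tame_const \<kappa> k"
    using Suc by (intro mult_mono) auto
  then show ?case by simp
qed simp

lemma tame_const_nonneg: "0 \<le> \<kappa> \<Longrightarrow> 0 \<le> tame_const \<kappa> k"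
  by (rule order_trans[OF zero_le_one tame_const_ge_1])

lemma tame_const_mono: "0 \<le> \<kappa> \<Longrightarrow> k \<le> l \<Longrightarrow> tame_const \<kappa> k \<le> tame_const \<kappa> l"
proof (rule lift_Suc_mono_le[of "tame_const \<kappa>"])
  fix k assume "0 \<le> \<kappa>"
  then have "1 * tame_const \<kappa> k \<le> (1 + \<kappa> * 2 ^ (k + 1)) * tame_const \<kappa> k"
    using tame_const_ge_1[of \<kappa> k] by (intro mult_right_mono) auto
  then show "tame_const \<kappa> k \<le> tame_const \<kappa> (Suc k)" by simp
qed

lemma commutation_const_nonneg: "0 \<le> \<kappa> \<Longrightarrow> 0 \<le> commutation_const \<kappa> k"
  by (induction k) (auto simp: tame_const_nonneg)

lemma commutation_const_mono: "0 \<le> \<kappa> \<Longrightarrow> k \<le> l \<Longrightarrow> commutation_const \<kappa> k \<le> commutation_const \<kappa> l"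
  by (rule lift_Suc_mono_le[of "commutation_const \<kappa>"]) (auto simp: tame_const_nonneg)

text \<open>Everything that the error analysis uses about the matrices. The size N is visible only
  through \<open>h\<close>, and the estimates to follow depend on \<open>\<kappa>\<close> and the
  dimension. Complex scaling is a parameter because the type class provides real scalars
  only.\<close>

locale weyl_algebra =
  fixes cscale :: "complex \<Rightarrow> 'a::real_normed_algebra \<Rightarrow> 'a"
    and U :: "'v::euclidean_space \<Rightarrow> 'a" and h \<kappa> :: real
  assumes cscale_mult_left: "cscale c X * Y = cscale c (X * Y)"
    and cscale_mult_right: "X * cscale c Y = cscale c (X * Y)"
    and cscale_add: "cscale c (X + Y) = cscale c X + cscale c Y"
    and cscale_of_real: "cscale (complex_of_real r) X = r *\<^sub>R X"
    and cscale_cscale: "cscale c (cscale c' X) = cscale (c * c') X"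
    and cscale_plus_left: "cscale (c + c') X = cscale c X + cscale c' X"
    and norm_cscale: "norm (cscale c X) = norm c * norm X"
    and h_pos: "h > 0" and \<kappa>_nonneg: "\<kappa> \<ge> 0"
    and norm_U: "b \<in> int_lattice \<Longrightarrow> norm (U b) \<le> 1"
    and U_add: "b \<in> int_lattice \<Longrightarrow> b' \<in> int_lattice \<Longrightarrow> \<exists>\<theta>. norm \<theta> = 1 \<and> U (b + b') = cscale \<theta> (U b * U b')"
    and U_commutator: "b \<in> int_lattice \<Longrightarrow> b' \<in> int_lattice \<Longrightarrow>
      \<exists>l. norm l \<le> h * \<kappa> * l1_norm b * l1_norm b' \<and> commutator (U b) (U b') = cscale l (U (b + b'))"
begin

lemma cscale_scaleR: "cscale c (r *\<^sub>R X) = r *\<^sub>R cscale c X"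
  by (simp add: cscale_of_real[symmetric] cscale_cscale mult.commute)

lemma cscale_minus: "cscale c (- X) = - cscale c X"
  using cscale_scaleR[of c "-1" X] by simp

lemma cscale_diff: "cscale c (X - Y) = cscale c X - cscale c Y"
  using cscale_add[of c X "-Y"] by (simp add: cscale_minus)

text \<open>Up to the factor \<open>\<i>\<close> and lower order terms, \<open>D b\<close> quantizes the Poisson bracket with the character \<open>b\<close>.\<close>

definition D :: "'v \<Rightarrow> 'a \<Rightarrow> 'a" where
  "D b Y = (1 / h) *\<^sub>R commutator (U b) Y"

lemma D_cscale: "D b (cscale c Y) = cscale c (D b Y)"
  by (simp add: D_def commutator_def cscale_mult_left cscale_mult_right cscale_diff cscale_scaleR)

lemma bounded_linear_D: "bounded_linear (D b)"
  unfolding D_def[abs_def] by (rule bounded_linear_compose[OF bounded_linear_scaleR_right bounded_linear_commutator_right])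

lemma D_U:
  assumes "b \<in> int_lattice" "c \<in> int_lattice"
  shows "\<exists>l. norm l \<le> \<kappa> * l1_norm b * l1_norm c \<and> D b (U c) = cscale l (U (b + c))"
proof -
  obtain l where l: "norm l \<le> h * \<kappa> * l1_norm b * l1_norm c" "commutator (U b) (U c) = cscale l (U (b + c))"
    using U_commutator[OF assms] by blast
  have "norm (of_real (1 / h) * l) = norm l / h" using h_pos by (simp add: norm_mult norm_divide)
  then have "norm (of_real (1 / h) * l) \<le> \<kappa> * l1_norm b * l1_norm c"
    using l(1) h_pos by (simp add: pos_divide_le_eq mult_ac)
  moreover have "D b (U c) = cscale (of_real (1 / h) * l) (U (b + c))"
    unfolding D_def l(2) cscale_cscale[symmetric] cscale_of_real ..
  ultimately show ?thesis by (intro exI conjI)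
qed

text \<open>The Jacobi identity turns the commutator of two such derivations into the derivation by
  the scaled commutator of the two Weyl operators, which is a multiple of a third one. The powers of
  h balance, so the multiple is free of h.\<close>

lemma D_D:
  assumes "b \<in> int_lattice" "c \<in> int_lattice"
  shows "\<exists>l. norm l \<le> \<kappa> * l1_norm b * l1_norm c \<and>
    (\<forall>Y. D b (D c Y) = D c (D b Y) + cscale l (D (b + c) Y))"
proof -
  obtain l where l: "norm l \<le> \<kappa> * l1_norm b * l1_norm c" "D b (U c) = cscale l (U (b + c))"
    using D_U[OF assms] by blast
  have "D b (D c Y) = D c (D b Y) + cscale l (D (b + c) Y)" for Y
  proof -
    have sc: "commutator X (r *\<^sub>R Z) = r *\<^sub>R commutator X Z" "commutator (r *\<^sub>R X) Z = r *\<^sub>R commutator X Z" for X Z :: 'a and r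
      by (simp_all add: commutator_def scaleR_diff_right)
    have "D b (D c Y) = (1 / h) *\<^sub>R (1 / h) *\<^sub>R commutator (U b) (commutator (U c) Y)" by (simp add: D_def sc)
    also have "\<dots> = D c (D b Y) + (1 / h) *\<^sub>R commutator (D b (U c)) Y"
      by (subst jacobi) (simp add: D_def sc scaleR_add_right)
    also have "(1 / h) *\<^sub>R commutator (D b (U c)) Y = cscale l (D (b + c) Y)"
      unfolding l(2) by (simp add: D_def commutator_def cscale_mult_left cscale_mult_right cscale_diff cscale_scaleR)
    finally show ?thesis .
  qed
  with l(1) show ?thesis by (intro exI conjI allI)
qed

text \<open>The head of the list acts first. Induction on the list thus splits off the derivation
  next to the argument, the one that meets \<open>D b\<close> when a word is moved past it.\<close>

fun Dw :: "'v list \<Rightarrow> 'a \<Rightarrow> 'a" where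
  "Dw [] Y = Y"
| "Dw (g # w) Y = Dw w (D g Y)"

lemma bounded_linear_Dw: "bounded_linear (Dw w)"
proof (induction w)
  case Nil
  then show ?case by (simp add: bounded_linear_ident)
next
  case (Cons g w)
  then show ?case using bounded_linear_compose[OF Cons bounded_linear_D] by simp
qed

lemma Dw_cscale: "Dw w (cscale c Y) = cscale c (Dw w Y)"
  by (induction w arbitrary: Y) (simp_all add: D_cscale)

lemma Dw_add: "Dw w (X + Y) = Dw w X + Dw w Y"
  by (rule linear_add[OF bounded_linear.linear[OF bounded_linear_Dw]])

text \<open>The discrete analogue of the \<open>C\<^sup>k\<close> norm of a symbol.\<close>

definition dnorm :: "nat \<Rightarrow> 'a \<Rightarrow> real" where
  "dnorm k Y = (\<Sum>w\<in>words k. norm (Dw w Y))"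

lemma dnorm_nonneg: "0 \<le> dnorm k Y"
  by (simp add: dnorm_def sum_nonneg)

lemma Dw_le_dnorm: "w \<in> words k \<Longrightarrow> norm (Dw w Y) \<le> dnorm k Y"
  unfolding dnorm_def by (intro member_le_sum) auto

lemma norm_le_dnorm: "norm Y \<le> dnorm k Y"
  using Dw_le_dnorm[of "[]" k Y] by (simp add: words_def)

lemma dnorm_mono: "k \<le> l \<Longrightarrow> dnorm k Y \<le> dnorm l Y"
  unfolding dnorm_def by (intro sum_mono2 words_mono) auto

lemma dnorm_le:
  assumes "\<And>w. w \<in> words k \<Longrightarrow> norm (Dw w Y) \<le> (B :: real)"
  shows "dnorm k Y \<le> real (card (words k :: 'v list set)) * B"
  unfolding dnorm_def using sum_bounded_above[of "words k :: 'v list set" "\<lambda>w. norm (Dw w Y)" B] assms by simp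

lemma dnorm_D:
  assumes "g \<in> generators"
  shows "dnorm k (D g Y) \<le> dnorm (Suc k) Y"
proof -
  have "dnorm k (D g Y) = (\<Sum>w\<in>(#) g ` words k. norm (Dw w Y))"
    unfolding dnorm_def by (subst sum.reindex) auto
  also have "\<dots> \<le> dnorm (Suc k) Y"
    unfolding dnorm_def using assms by (intro sum_mono2 finite_words) (auto simp: words_def)
  finally show ?thesis .
qed

lemma norm_commutator_mult:
  fixes X Y Z :: 'a
  assumes "norm X \<le> 1" "norm Z \<le> 1"
  shows "norm (commutator (X * Z) Y) \<le> norm (commutator X Y) + norm (commutator Z Y)"
proof -
  have eq: "commutator (X * Z) Y = X * commutator Z Y + commutator X Y * Z" by (simp add: commutator_def algebra_simps)
  have "norm (commutator (X * Z) Y) \<le> norm X * norm (commutator Z Y) + norm (commutator X Y) * norm Z"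
    unfolding eq by (rule order_trans[OF norm_triangle_ineq add_mono[OF norm_mult_ineq norm_mult_ineq]])
  also have "\<dots> \<le> 1 * norm (commutator Z Y) + norm (commutator X Y) * 1"
    by (rule add_mono[OF mult_right_mono[OF assms(1) norm_ge_zero] mult_left_mono[OF assms(2) norm_ge_zero]])
  finally show ?thesis by simp
qed

text \<open>A commutator with a product of two contractions is at most the sum of the two
  commutators, and the phase relating the product to \<open>U (b + c)\<close> has modulus 1.\<close>

lemma norm_D_add:
  assumes "b \<in> int_lattice" "c \<in> int_lattice"
  shows "norm (D (b + c) Y) \<le> norm (D b Y) + norm (D c Y)"
proof -
  obtain \<theta> where \<theta>: "norm \<theta> = 1" "U (b + c) = cscale \<theta> (U b * U c)" using U_add[OF assms] by blast
  have "commutator (U (b + c)) Y = cscale \<theta> (commutator (U b * U c) Y)"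
    unfolding \<theta>(2) by (simp add: commutator_def cscale_mult_left cscale_mult_right cscale_diff)
  then have "norm (commutator (U (b + c)) Y) \<le> norm (commutator (U b) Y) + norm (commutator (U c) Y)"
    using norm_commutator_mult[OF norm_U[OF assms(1)] norm_U[OF assms(2)]] by (simp add: norm_cscale \<theta>(1))
  then show ?thesis using h_pos by (simp add: D_def divide_right_mono add_divide_distrib[symmetric])
qed

text \<open>Subadditivity along a path of generators from the origin: every step costs at most one
  first-order norm, so the growth in b is linear and does not involve h.\<close>

lemma norm_D:
  assumes b: "b \<in> int_lattice"
  shows "norm (D b Y) \<le> weight b * dnorm 1 Y"
  using b
proof (induction rule: int_lattice_induct)
  case zero
  \<comment> \<open>The locale does not say that \<open>U 0\<close> is a unit, so 0 is written as g
    + (-g). The two generators are distinct one-letter words, hence both terms fit into the same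
    \<open>dnorm 1\<close>.\<close>
  obtain g :: 'v where g: "g \<in> Basis" using nonempty_Basis by blast
  then have ne: "g \<noteq> - g" by (metis add_eq_0_iff nonzero_Basis scaleR_2 scaleR_eq_0_iff zero_neq_numeral)
  have gg: "g \<in> generators" "- g \<in> generators" using g by (auto simp: generators_def)
  have "norm (D (g + - g) Y) \<le> norm (D g Y) + norm (D (- g) Y)"
    using gg by (intro norm_D_add generators_int_lattice)
  also have "\<dots> = (\<Sum>w\<in>{[g], [- g]}. norm (Dw w Y))" using ne by simp
  also have "\<dots> \<le> dnorm 1 Y" unfolding dnorm_def using gg by (intro sum_mono2 finite_words) (auto simp: words_def)
  finally show ?case by (simp add: l1_norm_def)
next
  case (step b g)
  have "norm (D (b + g) Y) \<le> norm (D b Y) + norm (D g Y)"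
    using step by (intro norm_D_add) (auto intro: generators_int_lattice)
  moreover have "norm (D g Y) \<le> dnorm 1 Y" using Dw_le_dnorm[of "[g]" 1 Y] step by (simp add: words_def)
  ultimately show ?case using step by (simp add: algebra_simps)
qed

lemma D_generator_D:
  assumes b: "b \<in> int_lattice" and g: "g \<in> generators"
  obtains l where "norm l \<le> \<kappa> * weight b" "\<And>Y. D g (D b Y) = D b (D g Y) + cscale l (D (b + g) Y)"
proof -
  obtain l where l: "norm l \<le> \<kappa> * l1_norm g * l1_norm b" "\<And>Y. D g (D b Y) = D b (D g Y) + cscale l (D (g + b) Y)"
    using D_D[OF generators_int_lattice[OF g] b] by blast
  have "\<kappa> * l1_norm g * l1_norm b \<le> \<kappa> * weight b"
    using l1_norm_generators[OF g] \<kappa>_nonneg by (simp add: mult_left_mono)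
  with l show ?thesis by (intro that[of l]) (auto simp: add.commute)
qed

lemma weight_ge_1: "1 \<le> weight b"
  using l1_norm_nonneg[of b] by simp

lemma weight_generator:
  assumes "g \<in> generators"
  shows "weight (b + g) ^ n \<le> 2 ^ n * weight b ^ n"
proof -
  have "weight (b + g) \<le> 2 * weight b"
    using l1_norm_triangle[of b g] l1_norm_generators[OF assms] l1_norm_nonneg[of b] by simp
  then have "weight (b + g) ^ n \<le> (2 * weight b) ^ n"
    using l1_norm_nonneg[of "b + g"] by (intro power_mono) auto
  then show ?thesis unfolding power_mult_distrib .
qed

text \<open>Turns an estimate at the shifted frequency b + g into one at b: the scalar contributes
  one more weight, and the shift at most doubles each weight already there.\<close>

lemma correction_bound:
  assumes l: "norm l \<le> \<kappa> * weight b" and g: "g \<in> generators"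
    and X: "norm X \<le> T * weight (b + g) ^ n * s" and T: "0 \<le> T" and s: "0 \<le> s"
  shows "norm (cscale l X) \<le> \<kappa> * 2 ^ n * T * weight b ^ Suc n * s"
proof -
  have "norm X \<le> T * (2 ^ n * weight b ^ n) * s"
    using X weight_generator[OF g, of b n] T s by (meson mult_left_mono mult_right_mono order_trans)
  then have "norm (cscale l X) \<le> (\<kappa> * weight b) * (T * (2 ^ n * weight b ^ n) * s)"
    unfolding norm_cscale using l \<kappa>_nonneg weight_ge_1[of b] by (intro mult_mono) auto
  then show ?thesis by (simp add: mult_ac)
qed

text \<open>The letter g is moved past \<open>D b\<close>. The main term has \<open>D g Y\<close> as
  new argument, and the correction has one commutator fewer, so both are covered by the norm of
  order one above the length of the word.\<close>

lemma norm_Dw_D: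
  assumes "set w \<subseteq> generators" "b \<in> int_lattice"
  shows "norm (Dw w (D b Y)) \<le> tame_const \<kappa> (length w) * weight b ^ Suc (length w) * dnorm (Suc (length w)) Y"
  using assms
proof (induction w arbitrary: b Y)
  case Nil
  then show ?case using norm_D[of b Y] by simp
next
  case (Cons g w)
  let ?k = "length w" and ?T = "tame_const \<kappa> (length w)"
  have g: "g \<in> generators" and w: "set w \<subseteq> generators" using Cons.prems by auto
  note b = Cons.prems(2)
  have T: "0 \<le> ?T" using tame_const_ge_1[OF \<kappa>_nonneg, of ?k] by simp
  obtain l where l: "norm l \<le> \<kappa> * weight b" "\<And>Y. D g (D b Y) = D b (D g Y) + cscale l (D (b + g) Y)"
    using D_generator_D[OF b g] by blast
  have 1: "norm (Dw w (D b (D g Y))) \<le> ?T * weight b ^ Suc (Suc ?k) * dnorm (Suc (Suc ?k)) Y"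
  proof -
    have "norm (Dw w (D b (D g Y))) \<le> ?T * weight b ^ Suc ?k * dnorm (Suc ?k) (D g Y)"
      by (rule Cons.IH[OF w b])
    also have "\<dots> \<le> ?T * weight b ^ Suc (Suc ?k) * dnorm (Suc (Suc ?k)) Y"
      using T dnorm_D[OF g, of "Suc ?k" Y] dnorm_nonneg weight_ge_1[of b]
      by (intro mult_mono mult_left_mono power_increasing mult_nonneg_nonneg zero_le_power) auto
    finally show ?thesis .
  qed
  have "norm (Dw w (D (b + g) Y)) \<le> ?T * weight (b + g) ^ Suc ?k * dnorm (Suc ?k) Y"
    using Cons.IH[OF w] int_lattice_add[OF b generators_int_lattice[OF g]] by blast
  from correction_bound[OF l(1) g this T dnorm_nonneg]
  have "norm (cscale l (Dw w (D (b + g) Y))) \<le> \<kappa> * 2 ^ Suc ?k * ?T * weight b ^ Suc (Suc ?k) * dnorm (Suc ?k) Y" .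
  also have "\<dots> \<le> \<kappa> * 2 ^ Suc ?k * ?T * weight b ^ Suc (Suc ?k) * dnorm (Suc (Suc ?k)) Y"
    using \<kappa>_nonneg T weight_ge_1[of b] dnorm_mono[of "Suc ?k" "Suc (Suc ?k)" Y]
    by (intro mult_left_mono mult_nonneg_nonneg) auto
  finally have 2: "norm (cscale l (Dw w (D (b + g) Y))) \<le> \<kappa> * 2 ^ Suc ?k * ?T * weight b ^ Suc (Suc ?k) * dnorm (Suc (Suc ?k)) Y" .
  have "Dw (g # w) (D b Y) = Dw w (D b (D g Y)) + cscale l (Dw w (D (b + g) Y))"
    by (simp add: l(2) Dw_add Dw_cscale)
  then have "norm (Dw (g # w) (D b Y)) \<le> norm (Dw w (D b (D g Y))) + norm (cscale l (Dw w (D (b + g) Y)))"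
    by (metis norm_triangle_ineq)
  also have "\<dots> \<le> tame_const \<kappa> (length (g # w)) * weight b ^ Suc (length (g # w)) * dnorm (Suc (length (g # w))) Y"
    using add_mono[OF 1 2] by (simp add: algebra_simps)
  finally show ?case .
qed

text \<open>The decisive gain over \<open>norm_Dw_D\<close>: the right side has the order of the
  word itself, not one more. All terms of top order cancel, and this makes the differential
  inequality for \<open>dnorm\<close> closed.\<close>

lemma norm_Dw_D_commutator:
  assumes "set w \<subseteq> generators" "b \<in> int_lattice"
  shows "norm (Dw w (D b Y) - D b (Dw w Y)) \<le>
    commutation_const \<kappa> (length w) * weight b ^ Suc (length w) * dnorm (length w) Y"
  using assms
proof (induction w arbitrary: b Y)
  case (Cons g w)
  let ?k = "length w" and ?T = "tame_const \<kappa> (length w)" and ?R = "commutation_const \<kappa> (length w)"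
  have g: "g \<in> generators" and w: "set w \<subseteq> generators" using Cons.prems by auto
  note b = Cons.prems(2)
  have T: "0 \<le> ?T" using tame_const_ge_1[OF \<kappa>_nonneg, of ?k] by simp
  have R: "0 \<le> ?R" by (rule commutation_const_nonneg[OF \<kappa>_nonneg])
  obtain l where l: "norm l \<le> \<kappa> * weight b" "\<And>Y. D g (D b Y) = D b (D g Y) + cscale l (D (b + g) Y)"
    using D_generator_D[OF b g] by blast
  have 1: "norm (Dw w (D b (D g Y)) - D b (Dw w (D g Y))) \<le> ?R * weight b ^ Suc (Suc ?k) * dnorm (Suc ?k) Y"
  proof -
    have "norm (Dw w (D b (D g Y)) - D b (Dw w (D g Y))) \<le> ?R * weight b ^ Suc ?k * dnorm ?k (D g Y)"
      by (rule Cons.IH[OF w b])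
    also have "\<dots> \<le> ?R * weight b ^ Suc (Suc ?k) * dnorm (Suc ?k) Y"
      using R dnorm_D[OF g, of ?k Y] dnorm_nonneg weight_ge_1[of b]
      by (intro mult_mono mult_left_mono power_increasing mult_nonneg_nonneg zero_le_power) auto
    finally show ?thesis .
  qed
  have "norm (Dw w (D (b + g) Y)) \<le> ?T * weight (b + g) ^ Suc ?k * dnorm (Suc ?k) Y"
    using norm_Dw_D[OF w] int_lattice_add[OF b generators_int_lattice[OF g]] by blast
  from correction_bound[OF l(1) g this T dnorm_nonneg]
  have 2: "norm (cscale l (Dw w (D (b + g) Y))) \<le> \<kappa> * 2 ^ Suc ?k * ?T * weight b ^ Suc (Suc ?k) * dnorm (Suc ?k) Y" .
  have "Dw (g # w) (D b Y) - D b (Dw (g # w) Y) = (Dw w (D b (D g Y)) - D b (Dw w (D g Y))) + cscale l (Dw w (D (b + g) Y))"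
    by (simp add: l(2) Dw_add Dw_cscale)
  then have "norm (Dw (g # w) (D b Y) - D b (Dw (g # w) Y)) \<le>
      norm (Dw w (D b (D g Y)) - D b (Dw w (D g Y))) + norm (cscale l (Dw w (D (b + g) Y)))"
    by (metis norm_triangle_ineq)
  also have "\<dots> \<le> commutation_const \<kappa> (length (g # w)) * weight b ^ Suc (length (g # w)) * dnorm (length (g # w)) Y"
    using add_mono[OF 1 2] by (simp add: algebra_simps)
  finally show ?case .
qed simp

lemma norm_Dw_U:
  assumes "set w \<subseteq> generators" "b \<in> int_lattice"
  shows "norm (Dw w (U b)) \<le> tame_const \<kappa> (length w) * weight b ^ length w"
  using assms
proof (induction w arbitrary: b)
  case Nil
  then show ?case using norm_U by simp
next
  case (Cons g w)
  let ?k = "length w" and ?T = "tame_const \<kappa> (length w)"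
  have g: "g \<in> generators" and w: "set w \<subseteq> generators" using Cons.prems by auto
  note b = Cons.prems(2)
  have T: "0 \<le> ?T" using tame_const_ge_1[OF \<kappa>_nonneg, of ?k] by simp
  obtain l where l: "norm l \<le> \<kappa> * l1_norm g * l1_norm b" "D g (U b) = cscale l (U (g + b))"
    using D_U[OF generators_int_lattice[OF g] b] by blast
  have l': "norm l \<le> \<kappa> * weight b"
    using l(1) l1_norm_generators[OF g] mult_left_mono[OF _ \<kappa>_nonneg, of "l1_norm b" "weight b"] by simp
  have "norm (Dw w (U (b + g))) \<le> ?T * weight (b + g) ^ ?k * 1"
    using Cons.IH[OF w] int_lattice_add[OF b generators_int_lattice[OF g]] by simp
  from correction_bound[OF l' g this T]
  have "norm (Dw (g # w) (U b)) \<le> \<kappa> * 2 ^ ?k * ?T * weight b ^ Suc ?k"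
    by (simp add: l(2) Dw_cscale add.commute)
  \<comment> \<open>Only the correction term is present here; its constant is enlarged so that
    \<open>tame_const\<close> can be reused.\<close>
  also have "\<dots> \<le> (1 + \<kappa> * 2 ^ (?k + 1)) * ?T * weight b ^ Suc ?k"
  proof (intro mult_right_mono T)
    have "\<kappa> * 2 ^ ?k \<le> \<kappa> * 2 ^ (?k + 1)" using \<kappa>_nonneg by (intro mult_left_mono power_increasing) auto
    then show "\<kappa> * 2 ^ ?k \<le> 1 + \<kappa> * 2 ^ (?k + 1)" by simp
  qed (use weight_ge_1[of b] in auto)
  finally show ?case by simp
qed

end

section \<open>Egorov's theorem with constants independent of h\<close>

text \<open>Every word in the sum \<open>dnorm\<close> obeys the same bound, whence the number of
  words as a factor. The type argument supplies the dimension; together with \<open>\<kappa>\<close>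
  and the symbol bound it determines the constant, so N cannot enter.\<close>

definition step_const :: "'v::euclidean_space itself \<Rightarrow> real \<Rightarrow> real \<Rightarrow> real" where
  "step_const _ \<kappa> S = real (card (words 3 :: 'v list set)) * (tame_const \<kappa> 3 * S)"

definition growth_const :: "'v::euclidean_space itself \<Rightarrow> real \<Rightarrow> real \<Rightarrow> real" where
  "growth_const _ \<kappa> S = real (card (words 3 :: 'v list set)) * (commutation_const \<kappa> 3 * S)"

text \<open>An abstract one-parameter group with generator \<open>x\<close>. Contractivity in both
  time directions replaces unitarity, and the idempotent \<open>e\<close> replaces the unit.\<close>

locale unitary_flow =
  fixes P :: "real \<Rightarrow> 'a::real_normed_algebra" and x e :: 'a
  assumes P_deriv: "(P has_vector_derivative x * P s) (at s)"
    and P_commute: "x * P s = P s * x"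
    and norm_P: "norm (P s) \<le> 1"
    and P_add: "P (s + r) = P s * P r"
    and P_zero: "P 0 = e"
begin

definition E :: "real \<Rightarrow> 'a \<Rightarrow> 'a" where
  "E s Y = P s * Y * P (- s)"

text \<open>Since the algebra has no unit, the evolution is invertible only on this corner.\<close>

definition K :: "'a set" where
  "K = {Y. e * Y = Y \<and> Y * e = Y}"

lemma P_inverse: "P s * P (- s) = e" "P (- s) * P s = e"
  using P_add[of s "-s"] P_add[of "-s" s] by (simp_all add: P_zero)

lemma P_unit: "e * P s = P s" "P s * e = P s"
  using P_add[of 0 s] P_add[of s 0] by (simp_all add: P_zero)

lemma x_e: "x * e = e * x"
  using P_commute[of 0] by (simp add: P_zero)

lemma E_zero: "Y \<in> K \<Longrightarrow> E 0 Y = Y"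
  by (simp add: E_def K_def P_zero)

lemma E_in_K: "E s Y \<in> K"
  by (simp add: E_def K_def mult.assoc P_unit) (simp add: mult.assoc[symmetric] P_unit)

lemma commutator_in_K: "Y \<in> K \<Longrightarrow> commutator x Y \<in> K"
proof -
  assume "Y \<in> K"
  then have Y: "e * Y = Y" "Y * e = Y" by (auto simp: K_def)
  have "e * (x * Y) = x * Y" by (metis Y(1) mult.assoc x_e)
  moreover have "e * (Y * x) = Y * x" by (metis Y(1) mult.assoc)
  moreover have "(x * Y) * e = x * Y" by (metis Y(2) mult.assoc)
  moreover have "(Y * x) * e = Y * x" by (metis Y(2) mult.assoc x_e)
  ultimately show ?thesis by (simp add: K_def commutator_def left_diff_distrib right_diff_distrib)
qed

lemma E_add_time: "E (s + r) Y = E s (E r Y)"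
proof -
  have "P (- (s + r)) = P (- r) * P (- s)" using P_add[of "-r" "-s"] by (simp add: add.commute)
  then show ?thesis by (simp add: E_def P_add mult.assoc)
qed

lemma norm_E: "norm (E s Y) \<le> norm Y"
proof -
  have "norm (E s Y) \<le> norm (P s * Y) * norm (P (- s))" unfolding E_def by (rule norm_mult_ineq)
  also have "\<dots> \<le> (norm (P s) * norm Y) * norm (P (- s))" by (intro mult_right_mono norm_mult_ineq norm_ge_zero)
  also have "\<dots> \<le> (1 * norm Y) * 1" by (intro mult_mono mult_nonneg_nonneg norm_P norm_ge_zero order_refl) auto
  finally show ?thesis by simp
qed

lemma E_add: "E s (X + Y) = E s X + E s Y"
  by (simp add: E_def distrib_left distrib_right)

lemma E_diff: "E s (X - Y) = E s X - E s Y"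
  by (simp add: E_def left_diff_distrib right_diff_distrib)

lemma E_scaleR: "E s (r *\<^sub>R X) = r *\<^sub>R E s X"
  by (simp add: E_def)

lemma E_commutator: "commutator x (E s Y) = E s (commutator x Y)"
proof -
  have "x * (P s * Y * P (- s)) = P s * (x * Y) * P (- s)"
    by (simp add: mult.assoc[symmetric] P_commute)
  moreover have "P s * Y * P (- s) * x = P s * (Y * x) * P (- s)"
    by (simp add: mult.assoc P_commute)
  ultimately show ?thesis by (simp add: commutator_def E_def left_diff_distrib right_diff_distrib)
qed

lemma P_minus_deriv: "((\<lambda>s. P (- s)) has_vector_derivative - (P (- s) * x)) (at s)"
proof -
  have "((\<lambda>s. P (- s)) has_vector_derivative (-1) *\<^sub>R (x * P (- s))) (at s)"
    by (rule vector_diff_chain_at[of uminus "-1" s P, unfolded o_def])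
       (auto intro!: derivative_eq_intros P_deriv)
  then show ?thesis by (simp add: P_commute)
qed

lemma E_deriv: "((\<lambda>s. E s Y) has_vector_derivative E s (commutator x Y)) (at s)"
proof -
  have "((\<lambda>s. P s * Y * P (- s)) has_vector_derivative
      (P s * Y) * (- (P (- s) * x)) + (P s * 0 + (x * P s) * Y) * P (- s)) (at s)"
    by (intro has_vector_derivative_mult P_deriv P_minus_deriv has_vector_derivative_const)
  also have "(P s * Y) * (- (P (- s) * x)) + (P s * 0 + (x * P s) * Y) * P (- s) = commutator x (E s Y)"
    by (simp add: commutator_def E_def mult.assoc)
  finally show ?thesis by (simp add: E_def[abs_def] E_commutator[unfolded E_def])
qed

text \<open>Passing to the interaction picture: after undoing the flow, a path moves only by the
  amount in which its derivative deviates from the evolution equation.\<close>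

lemma conj_deriv:
  assumes Z: "(Z has_vector_derivative Z') (at r)"
  shows "((\<lambda>r. P (- r) * Z r * P r) has_vector_derivative P (- r) * (Z' - commutator x (Z r)) * P r) (at r)"
proof -
  have "((\<lambda>r. P (- r) * Z r * P r) has_vector_derivative
      (P (- r) * Z r) * (x * P r) + (P (- r) * Z' + (- (P (- r) * x)) * Z r) * P r) (at r)"
    by (intro has_vector_derivative_mult P_deriv P_minus_deriv Z)
  then show ?thesis by (simp add: commutator_def algebra_simps)
qed

lemma norm_conj: "norm (P (- r) * Y * P r) \<le> norm Y"
  using norm_E[of "-r" Y] by (simp add: E_def)

lemma taylor1:
  assumes "Y \<in> K" "0 \<le> s"
  shows "norm (E s Y - Y) \<le> s * norm (commutator x Y)"
  using vector_derivative_bound[of 0 s "\<lambda>s. E s Y" "\<lambda>s. E s (commutator x Y)" "norm (commutator x Y)"]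
    E_deriv norm_E E_zero assms by (simp add: mult.commute)

text \<open>The derivative of the remainder is the remainder of the preceding order for
  \<open>commutator x Y\<close>, so the mean value inequality lifts the order by one. The factorial
  in the denominator is given away; only the power of s matters.\<close>

lemma taylor2:
  assumes "Y \<in> K" "0 \<le> s"
  shows "norm (E s Y - Y - s *\<^sub>R commutator x Y) \<le> s\<^sup>2 * norm (commutator x (commutator x Y))"
proof -
  let ?g = "\<lambda>s. E s Y - Y - s *\<^sub>R commutator x Y"
  have "norm (?g s - ?g 0) \<le> (s * norm (commutator x (commutator x Y))) * (s - 0)"
  proof (rule vector_derivative_bound)
    show "(?g has_vector_derivative E r (commutator x Y) - commutator x Y) (at r)" for r
      by (auto intro!: derivative_eq_intros E_deriv)
    show "norm (E r (commutator x Y) - commutator x Y) \<le> s * norm (commutator x (commutator x Y))" if "0 \<le> r" "r \<le> s" for r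
      using taylor1[OF commutator_in_K[OF assms(1)] that(1)] mult_right_mono[OF that(2) norm_ge_zero[of "commutator x (commutator x Y)"]]
      by linarith
  qed (use assms in auto)
  then show ?thesis using assms by (simp add: E_zero power2_eq_square mult_ac)
qed

lemma taylor3:
  assumes "Y \<in> K" "0 \<le> s"
  shows "norm (E s Y - Y - s *\<^sub>R commutator x Y - (s\<^sup>2 / 2) *\<^sub>R commutator x (commutator x Y)) \<le> s ^ 3 * norm (commutator x (commutator x (commutator x Y)))"
proof -
  let ?g = "\<lambda>s. E s Y - Y - s *\<^sub>R commutator x Y - (s\<^sup>2 / 2) *\<^sub>R commutator x (commutator x Y)"
  have "norm (?g s - ?g 0) \<le> (s\<^sup>2 * norm (commutator x (commutator x (commutator x Y)))) * (s - 0)"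
  proof (rule vector_derivative_bound)
    show "(?g has_vector_derivative E r (commutator x Y) - commutator x Y - r *\<^sub>R commutator x (commutator x Y)) (at r)" for r
      by (auto intro!: derivative_eq_intros E_deriv)
    show "norm (E r (commutator x Y) - commutator x Y - r *\<^sub>R commutator x (commutator x Y)) \<le> s\<^sup>2 * norm (commutator x (commutator x (commutator x Y)))"
      if "0 \<le> r" "r \<le> s" for r
    proof -
      have "r\<^sup>2 \<le> s\<^sup>2" using that by (intro power_mono) auto
      then show ?thesis
        using taylor2[OF commutator_in_K[OF assms(1)] that(1)] mult_right_mono[of "r\<^sup>2" "s\<^sup>2" "norm (commutator x (commutator x (commutator x Y)))"]
        by (meson norm_ge_zero order_trans)
    qed
  qed (use assms in auto)
  then show ?thesis using assms by (simp add: E_zero power2_eq_square power3_eq_cube mult_ac)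
qed

end

context weyl_algebra
begin

text \<open>
  The fourth power is what three nested commutators with generators and one with \<open>U b\<close> cost.
\<close>

definition symbol :: "real \<Rightarrow> 'a \<Rightarrow> bool" where
  "symbol S X \<longleftrightarrow> (\<exists>f T. ((\<lambda>b. cscale (f b) (U b)) has_sum X) int_lattice \<and>
     ((\<lambda>b. norm (f b) * weight b ^ 4) has_sum T) int_lattice \<and> T \<le> S)"

lemma symbol_nonneg: "symbol S X \<Longrightarrow> 0 \<le> S"
  unfolding symbol_def using weight_ge_1
  by (elim exE conjE) (erule order_trans[rotated], erule has_sum_nonneg, auto intro!: mult_nonneg_nonneg zero_le_power order_trans[OF zero_le_one])

lemma bounded_linear_cscale: "bounded_linear (cscale c)"
  by (rule bounded_linear_intro[of _ "norm c"]) (simp_all add: cscale_add cscale_scaleR norm_cscale mult.commute)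

text \<open>An estimate on Weyl operators passes to all symbols by summation. Boundedness of the map
  serves only to carry it through the infinite sum; its operator norm, which may depend on h, does
  not enter the result.\<close>

lemma symbol_bound:
  assumes X: "symbol S X" and \<Lambda>: "bounded_linear \<Lambda>"
    and \<Lambda>_cscale: "\<And>c b. b \<in> int_lattice \<Longrightarrow> \<Lambda> (cscale c (U b)) = cscale c (\<Lambda> (U b))"
    and bd: "\<And>b. b \<in> int_lattice \<Longrightarrow> norm (\<Lambda> (U b)) \<le> B * weight b ^ 4" and B: "0 \<le> B"
  shows "norm (\<Lambda> X) \<le> B * S"
proof -
  obtain f T where f: "((\<lambda>b. cscale (f b) (U b)) has_sum X) int_lattice"
    "((\<lambda>b. norm (f b) * weight b ^ 4) has_sum T) int_lattice" "T \<le> S"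
    using X by (auto simp: symbol_def)
  have "norm (\<Lambda> X) \<le> B * T"
  proof (rule norm_infsum_le)
    show "((\<lambda>b. \<Lambda> (cscale (f b) (U b))) has_sum \<Lambda> X) int_lattice" by (rule has_sum_bounded_linear[OF \<Lambda> f(1)])
    show "((\<lambda>b. B * (norm (f b) * weight b ^ 4)) has_sum B * T) int_lattice" by (rule has_sum_cmult_right[OF f(2)])
    show "norm (\<Lambda> (cscale (f b) (U b))) \<le> B * (norm (f b) * weight b ^ 4)" if "b \<in> int_lattice" for b
      using mult_left_mono[OF bd[OF that] norm_ge_zero[of "f b"]] by (simp add: \<Lambda>_cscale[OF that] norm_cscale mult_ac)
  qed
  also have "\<dots> \<le> B * S" using f(3) B by (intro mult_left_mono)
  finally show ?thesis .
qed

lemma symbol_add: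
  assumes "symbol S X" "symbol S' X'"
  shows "symbol (S + S') (X + X')"
proof -
  obtain f T where f: "((\<lambda>b. cscale (f b) (U b)) has_sum X) int_lattice"
    "((\<lambda>b. norm (f b) * weight b ^ 4) has_sum T) int_lattice" "T \<le> S"
    using assms(1) by (auto simp: symbol_def)
  obtain f' T' where f': "((\<lambda>b. cscale (f' b) (U b)) has_sum X') int_lattice"
    "((\<lambda>b. norm (f' b) * weight b ^ 4) has_sum T') int_lattice" "T' \<le> S'"
    using assms(2) by (auto simp: symbol_def)
  let ?g = "\<lambda>b. f b + f' b"
  have cscale_plus: "cscale (c + c') (U b) = cscale c (U b) + cscale c' (U b)" for c c' b
    by (rule cscale_plus_left)
  have 1: "((\<lambda>b. cscale (?g b) (U b)) has_sum X + X') int_lattice"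
    unfolding cscale_plus by (rule has_sum_add[OF f(1) f'(1)])
  have 2: "((\<lambda>b. norm (f b) * weight b ^ 4 + norm (f' b) * weight b ^ 4) has_sum T + T') int_lattice"
    by (rule has_sum_add[OF f(2) f'(2)])
  have le: "norm (?g b) * weight b ^ 4 \<le> norm (f b) * weight b ^ 4 + norm (f' b) * weight b ^ 4" for b
    unfolding distrib_right[symmetric] using weight_ge_1[of b] by (intro mult_right_mono norm_triangle_ineq) auto
  have nn: "0 \<le> norm (?g b) * weight b ^ 4" for b using weight_ge_1[of b] by (intro mult_nonneg_nonneg) auto
  have 3: "(\<lambda>b. norm (?g b) * weight b ^ 4) summable_on int_lattice"
    by (rule summable_on_comparison_test[OF has_sum_imp_summable[OF 2]]) (use le nn in auto)
  have 4: "(\<Sum>\<^sub>\<infinity>b\<in>int_lattice. norm (?g b) * weight b ^ 4) \<le> T + T'"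
    by (rule has_sum_mono[OF has_sum_infsum[OF 3] 2]) (rule le)
  show ?thesis
    unfolding symbol_def
    using 1 has_sum_infsum[OF 3] 4 f(3) f'(3)
    by (intro exI[of _ ?g] exI[of _ "\<Sum>\<^sub>\<infinity>b\<in>int_lattice. norm (?g b) * weight b ^ 4"]) auto
qed

text \<open>The factor 1/h sits inside, so that \<open>L X\<close> is literally the commutator with
  the generator of the flow in \<open>weyl_flow\<close>.\<close>

definition L :: "'a \<Rightarrow> 'a \<Rightarrow> 'a" where
  "L X Y = commutator ((1 / h) *\<^sub>R X) Y"

lemma L_U: "L (U b) Y = D b Y"
  by (simp add: L_def D_def commutator_def scaleR_diff_right)

lemma L_cscale: "L (cscale c X) Y = cscale c (L X Y)"
  by (simp add: L_def commutator_def cscale_mult_left cscale_mult_right cscale_diff cscale_scaleR)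

lemma L_add_left: "L (X + X') Y = L X Y + L X' Y"
  by (simp add: L_def commutator_def algebra_simps)

lemma bounded_linear_L_left: "bounded_linear (\<lambda>X. L X Y)"
  unfolding L_def by (rule bounded_linear_compose[OF bounded_linear_commutator_left bounded_linear_scaleR_right])

lemma bounded_linear_L_right: "bounded_linear (L X)"
  unfolding L_def[abs_def] by (rule bounded_linear_commutator_right)

lemma card_words_mono: "k \<le> 3 \<Longrightarrow> card (words k :: 'v list set) \<le> card (words 3 :: 'v list set)"
  by (intro card_mono words_mono) auto

lemma dnorm_le_3:
  assumes "k \<le> 3" "\<And>w. w \<in> words k \<Longrightarrow> norm (Dw w Y) \<le> B" "0 \<le> B"
  shows "dnorm k Y \<le> real (card (words 3 :: 'v list set)) * B"
proof -
  have "dnorm k Y \<le> real (card (words k :: 'v list set)) * B" by (rule dnorm_le) (rule assms(2))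
  also have "\<dots> \<le> real (card (words 3 :: 'v list set)) * B"
    using card_words_mono[OF assms(1)] assms(3) by (intro mult_right_mono) auto
  finally show ?thesis .
qed

text \<open>One derivative is lost, as for a first-order differential operator. Orders up to 2
  suffice, because three applications start from order 3.\<close>

lemma dnorm_L:
  assumes X: "symbol S X" and k: "k \<le> 2"
  shows "dnorm k (L X Y) \<le> step_const TYPE('v) \<kappa> S * dnorm (Suc k) Y"
proof -
  note S = symbol_nonneg[OF X]
  have T: "0 \<le> tame_const \<kappa> 3" by (rule tame_const_nonneg[OF \<kappa>_nonneg])
  have "dnorm k (L X Y) \<le> real (card (words 3 :: 'v list set)) * (tame_const \<kappa> 3 * dnorm (Suc k) Y * S)"
  proof (rule dnorm_le_3)
    fix w :: "'v list" assume "w \<in> words k"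
    then have w: "set w \<subseteq> generators" "length w \<le> k" by (auto simp: words_def)
    show "norm (Dw w (L X Y)) \<le> tame_const \<kappa> 3 * dnorm (Suc k) Y * S"
    proof (rule symbol_bound[OF X])
      show "bounded_linear (\<lambda>X. Dw w (L X Y))" by (rule bounded_linear_compose[OF bounded_linear_Dw bounded_linear_L_left])
      show "Dw w (L (cscale c (U b)) Y) = cscale c (Dw w (L (U b) Y))" for c b by (simp add: L_cscale Dw_cscale)
      fix b :: 'v assume b: "b \<in> int_lattice"
      have "norm (Dw w (D b Y)) \<le> tame_const \<kappa> (length w) * weight b ^ Suc (length w) * dnorm (Suc (length w)) Y"
        by (rule norm_Dw_D[OF w(1) b])
      also have "\<dots> \<le> tame_const \<kappa> 3 * weight b ^ 4 * dnorm (Suc k) Y"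
        using w(2) k weight_ge_1[of b] tame_const_nonneg[OF \<kappa>_nonneg]
        by (intro mult_mono tame_const_mono \<kappa>_nonneg power_increasing dnorm_mono dnorm_nonneg mult_nonneg_nonneg zero_le_power) auto
      finally show "norm (Dw w (L (U b) Y)) \<le> tame_const \<kappa> 3 * dnorm (Suc k) Y * weight b ^ 4"
        by (simp add: L_U mult_ac)
    qed (intro mult_nonneg_nonneg T dnorm_nonneg)
  qed (use k T S dnorm_nonneg in \<open>auto intro!: mult_nonneg_nonneg\<close>)
  then show ?thesis by (simp add: step_const_def mult_ac)
qed

text \<open>The estimate without loss of order, summed over the Fourier coefficients. Words of
  length 3 use the full fourth power of the weight in \<open>symbol\<close>.\<close>

lemma Dw_L_commutator:
  assumes X: "symbol S X" and w: "w \<in> words 3"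
  shows "norm (Dw w (L X Y) - L X (Dw w Y)) \<le> commutation_const \<kappa> 3 * S * dnorm 3 Y"
proof -
  have w': "set w \<subseteq> generators" "length w \<le> 3" using w by (auto simp: words_def)
  have R: "0 \<le> commutation_const \<kappa> k" for k by (rule commutation_const_nonneg[OF \<kappa>_nonneg])
  have "norm (Dw w (L X Y) - L X (Dw w Y)) \<le> (commutation_const \<kappa> 3 * dnorm 3 Y) * S"
  proof (rule symbol_bound[OF X, where \<Lambda> = "\<lambda>X. Dw w (L X Y) - L X (Dw w Y)"])
    show "bounded_linear (\<lambda>X. Dw w (L X Y) - L X (Dw w Y))"
      by (rule bounded_linear_sub[OF bounded_linear_compose[OF bounded_linear_Dw bounded_linear_L_left] bounded_linear_L_left])
    show "Dw w (L (cscale c (U b)) Y) - L (cscale c (U b)) (Dw w Y) = cscale c (Dw w (L (U b) Y) - L (U b) (Dw w Y))" for c b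
      by (simp add: L_cscale Dw_cscale cscale_diff)
    fix b :: 'v assume b: "b \<in> int_lattice"
    have "norm (Dw w (D b Y) - D b (Dw w Y)) \<le> commutation_const \<kappa> (length w) * weight b ^ Suc (length w) * dnorm (length w) Y"
      by (rule norm_Dw_D_commutator[OF w'(1) b])
    also have "\<dots> \<le> commutation_const \<kappa> 3 * weight b ^ 4 * dnorm 3 Y"
      using w'(2) weight_ge_1[of b] R
      by (intro mult_mono commutation_const_mono \<kappa>_nonneg power_increasing dnorm_mono dnorm_nonneg mult_nonneg_nonneg zero_le_power) auto
    finally show "norm (Dw w (L (U b) Y) - L (U b) (Dw w Y)) \<le> commutation_const \<kappa> 3 * dnorm 3 Y * weight b ^ 4"
      by (simp add: L_U mult_ac)
  qed (intro mult_nonneg_nonneg R dnorm_nonneg)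
  then show ?thesis by (simp add: mult_ac)
qed

lemma dnorm_symbol:
  assumes X: "symbol S X"
  shows "dnorm 3 X \<le> step_const TYPE('v) \<kappa> S"
  unfolding step_const_def
proof (rule dnorm_le_3)
  have T: "0 \<le> tame_const \<kappa> 3" by (rule tame_const_nonneg[OF \<kappa>_nonneg])
  then show "0 \<le> tame_const \<kappa> 3 * S" using symbol_nonneg[OF X] by simp
  fix w :: "'v list" assume "w \<in> words 3"
  then have w: "set w \<subseteq> generators" "length w \<le> 3" by (auto simp: words_def)
  show "norm (Dw w X) \<le> tame_const \<kappa> 3 * S"
  proof (rule symbol_bound[OF X bounded_linear_Dw Dw_cscale _ T])
    fix b :: 'v assume b: "b \<in> int_lattice"
    have "norm (Dw w (U b)) \<le> tame_const \<kappa> (length w) * weight b ^ length w" by (rule norm_Dw_U[OF w(1) b])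
    also have "\<dots> \<le> tame_const \<kappa> 3 * weight b ^ 4"
      using w(2) weight_ge_1[of b] T
      by (intro mult_mono tame_const_mono \<kappa>_nonneg power_increasing zero_le_power) auto
    finally show "norm (Dw w (U b)) \<le> tame_const \<kappa> 3 * weight b ^ 4" .
  qed
qed simp

end

locale weyl_flow = weyl_algebra cscale U h \<kappa> + unitary_flow P "(1 / h) *\<^sub>R X" e
  for cscale :: "complex \<Rightarrow> 'a::real_normed_algebra \<Rightarrow> 'a" and U :: "'v::euclidean_space \<Rightarrow> 'a"
    and h \<kappa> :: real and P :: "real \<Rightarrow> 'a" and X e :: 'a +
  fixes S :: real
  assumes X_symbol: "symbol S X"
    and U_unit: "b \<in> int_lattice \<Longrightarrow> e * U b = U b" "b \<in> int_lattice \<Longrightarrow> U b * e = U b"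
begin

lemma D_in_K:
  assumes "b \<in> int_lattice" "Y \<in> K"
  shows "D b Y \<in> K"
proof -
  have Y: "e * Y = Y" "Y * e = Y" using assms(2) by (auto simp: K_def)
  note U = U_unit[OF assms(1)]
  have "e * (U b * Y) = U b * Y" "e * (Y * U b) = Y * U b" "(U b * Y) * e = U b * Y" "(Y * U b) * e = Y * U b"
    using Y U by (metis mult.assoc)+
  then show ?thesis by (simp add: K_def D_def commutator_def left_diff_distrib right_diff_distrib)
qed

lemma Dw_in_K: "set w \<subseteq> generators \<Longrightarrow> Y \<in> K \<Longrightarrow> Dw w Y \<in> K"
  by (induction w arbitrary: Y) (auto intro!: D_in_K generators_int_lattice)

text \<open>The path \<open>Dw w (E r Y)\<close> solves the evolution equation up to the commutator
  of \<open>Dw w\<close> with \<open>L X\<close>. In the interaction picture this commutator is the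
  whole derivative, and it is of order at most 3.\<close>

lemma norm_Dw_E:
  assumes w: "w \<in> words 3" and Y: "Y \<in> K" and s: "0 \<le> s"
    and M: "\<And>r. 0 \<le> r \<Longrightarrow> r \<le> s \<Longrightarrow> dnorm 3 (E r Y) \<le> M"
  shows "norm (Dw w (E s Y)) \<le> norm (Dw w Y) + s * (commutation_const \<kappa> 3 * S * M)"
proof -
  have w': "set w \<subseteq> generators" using w by (auto simp: words_def)
  let ?x = "(1 / h) *\<^sub>R X"
  let ?Z = "\<lambda>r. Dw w (E r Y)"
  let ?F = "\<lambda>r. P (- r) * ?Z r * P r"
  have Zd: "(?Z has_vector_derivative Dw w (L X (E r Y))) (at r)" for r
    using bounded_linear.has_vector_derivative[OF bounded_linear_Dw E_deriv] by (simp add: E_commutator L_def)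
  have CS: "0 \<le> commutation_const \<kappa> 3 * S"
    using commutation_const_nonneg[OF \<kappa>_nonneg] symbol_nonneg[OF X_symbol] by simp
  have "norm (?F s - ?F 0) \<le> (commutation_const \<kappa> 3 * S * M) * (s - 0)"
  proof (rule vector_derivative_bound[OF s])
    show "(?F has_vector_derivative P (- r) * (Dw w (L X (E r Y)) - commutator ?x (?Z r)) * P r) (at r)" for r
      by (rule conj_deriv[OF Zd])
    fix r assume r: "0 \<le> r" "r \<le> s"
    have "norm (P (- r) * (Dw w (L X (E r Y)) - commutator ?x (?Z r)) * P r) \<le> norm (Dw w (L X (E r Y)) - L X (?Z r))"
      unfolding L_def by (rule norm_conj)
    also have "\<dots> \<le> commutation_const \<kappa> 3 * S * dnorm 3 (E r Y)" by (rule Dw_L_commutator[OF X_symbol w])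
    also have "\<dots> \<le> commutation_const \<kappa> 3 * S * M" using M[OF r] CS by (intro mult_left_mono)
    finally show "norm (P (- r) * (Dw w (L X (E r Y)) - commutator ?x (?Z r)) * P r) \<le> commutation_const \<kappa> 3 * S * M" .
  qed
  moreover have "?F 0 = Dw w Y"
    using Dw_in_K[OF w' Y] by (simp add: E_zero[OF Y] P_zero K_def)
  moreover have "norm (?Z s) \<le> norm (?F s)"
  proof -
    \<comment> \<open>Since \<open>e\<close> is a product of a propagator with its inverse,
      \<open>?Z s\<close> is the evolution of \<open>?F s\<close> and has no larger norm.\<close>
    have "?Z s = e * ?Z s * e" using Dw_in_K[OF w' E_in_K[of s Y]] by (simp add: K_def)
    also have "\<dots> = E s (?F s)" unfolding E_def P_inverse(1)[of s, symmetric] by (simp add: mult.assoc)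
    finally show ?thesis using norm_E[of s "?F s"] by simp
  qed
  moreover have "norm (?F s) \<le> norm (?F s - ?F 0) + norm (?F 0)" by (metis diff_add_cancel norm_triangle_ineq)
  ultimately show ?thesis by (simp add: mult.commute)
qed

lemma dnorm_E_step:
  assumes Y: "Y \<in> K" and s: "0 \<le> s" and M: "\<And>r. 0 \<le> r \<Longrightarrow> r \<le> s \<Longrightarrow> dnorm 3 (E r Y) \<le> M"
  shows "dnorm 3 (E s Y) \<le> dnorm 3 Y + s * (growth_const TYPE('v) \<kappa> S * M)"
proof -
  have "dnorm 3 (E s Y) \<le> (\<Sum>w\<in>(words 3 :: 'v list set). norm (Dw w Y) + s * (commutation_const \<kappa> 3 * S * M))"
    unfolding dnorm_def by (intro sum_mono norm_Dw_E Y s M)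
  then show ?thesis by (simp add: sum.distrib dnorm_def growth_const_def mult_ac)
qed

lemma growth_const_nonneg: "0 \<le> growth_const TYPE('v) \<kappa> S"
  using commutation_const_nonneg[OF \<kappa>_nonneg] symbol_nonneg[OF X_symbol] by (simp add: growth_const_def)

text \<open>Gronwall by absorption: a priori the supremum \<open>M\<close> is only known to be finite, but on a short time interval
  it satisfies \<open>M \<le> dnorm 3 Y + M / 2\<close>.\<close>

lemma dnorm_E_short_time:
  assumes Y: "Y \<in> K" and s: "0 \<le> s" "s * growth_const TYPE('v) \<kappa> S \<le> 1/2"
  shows "dnorm 3 (E s Y) \<le> 2 * dnorm 3 Y"
proof -
  have "\<exists>B. \<forall>Z. norm (Dw w Z) \<le> norm Z * B" for w
    using bounded_linear.bounded[OF bounded_linear_Dw] by blast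
  then obtain B where B: "\<And>w Z. norm (Dw w Z) \<le> norm Z * B w" by metis
  \<comment> \<open>A crude bound by operator norms, with no control of its dependence on h. It only
    makes the supremum \<open>M\<close> well defined and disappears afterwards.\<close>
  define M0 where "M0 = (\<Sum>w\<in>(words 3 :: 'v list set). norm Y * \<bar>B w\<bar>)"
  have M0: "dnorm 3 (E r Y) \<le> M0" for r
    unfolding dnorm_def M0_def
  proof (rule sum_mono)
    fix w :: "'v list"
    have "norm (Dw w (E r Y)) \<le> norm (E r Y) * \<bar>B w\<bar>"
      using B[of w "E r Y"] mult_left_mono[OF abs_ge_self[of "B w"] norm_ge_zero[of "E r Y"]] by linarith
    also have "\<dots> \<le> norm Y * \<bar>B w\<bar>" by (intro mult_right_mono norm_E) auto
    finally show "norm (Dw w (E r Y)) \<le> norm Y * \<bar>B w\<bar>" .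
  qed
  define M where "M = (SUP r\<in>{0..s}. dnorm 3 (E r Y))"
  have bdd: "bdd_above ((\<lambda>r. dnorm 3 (E r Y)) ` {0..s})" using M0 by (intro bdd_aboveI2)
  have le_M: "dnorm 3 (E r Y) \<le> M" if "0 \<le> r" "r \<le> s" for r
    unfolding M_def using that by (intro cSUP_upper bdd) auto
  have M_nonneg: "0 \<le> M" using le_M[of 0] dnorm_nonneg[of 3 "E 0 Y"] s by linarith
  have "M \<le> dnorm 3 Y + M / 2"
    unfolding M_def
  proof (rule cSUP_least)
    fix r assume r: "r \<in> {0..s}"
    have "dnorm 3 (E r Y) \<le> dnorm 3 Y + r * (growth_const TYPE('v) \<kappa> S * M)"
      using r by (intro dnorm_E_step Y le_M) auto
    also have "r * (growth_const TYPE('v) \<kappa> S * M) \<le> s * (growth_const TYPE('v) \<kappa> S * M)"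
      using r growth_const_nonneg M_nonneg by (intro mult_right_mono mult_nonneg_nonneg) auto
    also have "s * (growth_const TYPE('v) \<kappa> S * M) = (s * growth_const TYPE('v) \<kappa> S) * M" by (simp add: mult_ac)
    also have "\<dots> \<le> 1/2 * M" using s M_nonneg by (intro mult_right_mono)
    finally show "dnorm 3 (E r Y) \<le> dnorm 3 Y + (SUP r\<in>{0..s}. dnorm 3 (E r Y)) / 2" by (simp add: M_def)
  qed (use s in auto)
  then show ?thesis using le_M[of s] s by simp
qed

text \<open>The norm at most doubles over any time up to 1/(2G), where G is the growth constant, and
  \<open>m\<close> counts the intervals of that length that are needed.\<close>

theorem egorov:
  assumes "0 \<le> s" "s * (2 * growth_const TYPE('v) \<kappa> S) \<le> real m" "Y \<in> K"
  shows "dnorm 3 (E s Y) \<le> 2 ^ m * dnorm 3 Y"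
  using assms
proof (induction m arbitrary: s)
  case 0
  then have "s * growth_const TYPE('v) \<kappa> S \<le> 1/2" by simp
  \<comment> \<open>For \<open>m = 0\<close> the time may still be positive if the growth constant
    is 0. The doubling bound then supplies some finite \<open>M\<close>, and its coefficient
    vanishes, so the factor is 1 as claimed.\<close>
  then have "s * growth_const TYPE('v) \<kappa> S = 0" using 0 growth_const_nonneg mult_nonneg_nonneg[of s "growth_const TYPE('v) \<kappa> S"] by linarith
  then have "dnorm 3 (E s Y) \<le> dnorm 3 Y + 0"
  proof -
    obtain M where M: "\<And>r. 0 \<le> r \<Longrightarrow> r \<le> s \<Longrightarrow> dnorm 3 (E r Y) \<le> M"
    proof (rule that)
      fix r assume r: "0 \<le> r" "r \<le> s"
      have "r * growth_const TYPE('v) \<kappa> S \<le> s * growth_const TYPE('v) \<kappa> S" using r growth_const_nonneg by (intro mult_right_mono)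
      then show "dnorm 3 (E r Y) \<le> 2 * dnorm 3 Y"
        using \<open>s * growth_const TYPE('v) \<kappa> S = 0\<close> r by (intro dnorm_E_short_time 0) auto
    qed
    from dnorm_E_step[OF 0(3,1) M] have "dnorm 3 (E s Y) \<le> dnorm 3 Y + (s * growth_const TYPE('v) \<kappa> S) * M" by (simp add: mult_ac)
    then show ?thesis using \<open>s * growth_const TYPE('v) \<kappa> S = 0\<close> by simp
  qed
  then show ?case by simp
next
  case (Suc m)
  show ?case
  proof (cases "s * (2 * growth_const TYPE('v) \<kappa> S) \<le> real m")
    case True
    then have "dnorm 3 (E s Y) \<le> 2 ^ m * dnorm 3 Y" using Suc by blast
    also have "\<dots> \<le> 2 ^ Suc m * dnorm 3 Y" using dnorm_nonneg[of 3 Y] by simp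
    finally show ?thesis .
  next
    case False
    then have pos: "0 < growth_const TYPE('v) \<kappa> S" using growth_const_nonneg by (cases "growth_const TYPE('v) \<kappa> S = 0") auto
    \<comment> \<open>The last of the short intervals; the induction hypothesis covers the time
      before it.\<close>
    define r where "r = min s (1 / (2 * growth_const TYPE('v) \<kappa> S))"
    have r: "0 \<le> r" "r \<le> s" "r * growth_const TYPE('v) \<kappa> S \<le> 1/2"
      using Suc.prems(1) pos by (auto simp: r_def min_def field_simps)
    have "(s - r) * (2 * growth_const TYPE('v) \<kappa> S) \<le> real m"
      using Suc.prems(2) pos by (auto simp: r_def min_def field_simps)
    then have IH: "dnorm 3 (E (s - r) Y) \<le> 2 ^ m * dnorm 3 Y" using Suc r by auto
    have "dnorm 3 (E s Y) = dnorm 3 (E r (E (s - r) Y))" using E_add_time[of r "s - r" Y] by simp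
    also have "\<dots> \<le> 2 * dnorm 3 (E (s - r) Y)" by (rule dnorm_E_short_time[OF E_in_K r(1,3)])
    also have "\<dots> \<le> 2 ^ Suc m * dnorm 3 Y" using IH by simp
    finally show ?thesis .
  qed
qed

end

section \<open>Local and global Trotter errors\<close>

lemma norm_sum_list_le:
  fixes xs :: "'a::real_normed_vector list"
  assumes "\<And>x. x \<in> set xs \<Longrightarrow> norm x \<le> e"
  shows "norm (sum_list xs) \<le> real (length xs) * e"
  using assms
proof (induction xs)
  case (Cons x xs)
  have "norm (sum_list (x # xs)) \<le> norm x + norm (sum_list xs)" by (simp add: norm_triangle_ineq)
  also have "\<dots> \<le> e + real (length xs) * e" using Cons by (intro add_mono) auto
  finally show ?case by (simp add: algebra_simps)
qed simp

text \<open>The three flows share the idempotent. Symbol bounds add, so the full Hamiltonian has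
  bound \<open>2 * S\<close>, and the one constant \<open>C\<close> built from it serves all three
  generators.\<close>

locale weyl_trotter = weyl_algebra cscale U h \<kappa> +
    A: weyl_flow cscale U h \<kappa> PA XA e S + B: weyl_flow cscale U h \<kappa> PB XB e S +
    H: weyl_flow cscale U h \<kappa> PH "XA + XB" e "2 * S"
  for cscale :: "complex \<Rightarrow> 'a::real_normed_algebra \<Rightarrow> 'a" and U :: "'v::euclidean_space \<Rightarrow> 'a"
    and h \<kappa> :: real and PA PB PH :: "real \<Rightarrow> 'a" and XA XB e :: 'a and S :: real +
  fixes C :: real
  assumes C_eq: "C = step_const TYPE('v) \<kappa> (2 * S)"
begin

abbreviation a where "a \<equiv> L XA"
abbreviation b where "b \<equiv> L XB"

lemma S_nonneg: "0 \<le> S"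
  by (rule symbol_nonneg[OF A.X_symbol])

lemma C_nonneg: "0 \<le> C"
  using S_nonneg tame_const_nonneg[OF \<kappa>_nonneg, of 3] by (simp add: C_eq step_const_def)

lemma dnorm_L':
  assumes "symbol S' X" "S' \<le> 2 * S" "k \<le> 2"
  shows "dnorm k (L X Y) \<le> C * dnorm (Suc k) Y"
proof -
  have "step_const TYPE('v) \<kappa> S' \<le> C"
    using assms(2) tame_const_nonneg[OF \<kappa>_nonneg, of 3] unfolding C_eq step_const_def by (intro mult_left_mono) auto
  then have "step_const TYPE('v) \<kappa> S' * dnorm (Suc k) Y \<le> C * dnorm (Suc k) Y"
    by (intro mult_right_mono dnorm_nonneg)
  with dnorm_L[OF assms(1,3), of Y] show ?thesis by linarith
qed

lemma dnorm_a: "k \<le> 2 \<Longrightarrow> dnorm k (a Y) \<le> C * dnorm (Suc k) Y"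
  using S_nonneg by (intro dnorm_L'[OF A.X_symbol]) auto

lemma dnorm_b: "k \<le> 2 \<Longrightarrow> dnorm k (b Y) \<le> C * dnorm (Suc k) Y"
  using S_nonneg by (intro dnorm_L'[OF B.X_symbol]) auto

lemma dnorm_h: "k \<le> 2 \<Longrightarrow> dnorm k (L (XA + XB) Y) \<le> C * dnorm (Suc k) Y"
  by (intro dnorm_L'[OF H.X_symbol]) auto

definition bounded_step :: "('a \<Rightarrow> 'a) \<Rightarrow> bool" where
  "bounded_step \<Lambda> \<longleftrightarrow> (\<forall>k\<le>2. \<forall>Y. dnorm k (\<Lambda> Y) \<le> C * dnorm (Suc k) Y)"

lemma bounded_steps: "bounded_step a" "bounded_step b" "bounded_step (L (XA + XB))"
  using dnorm_a dnorm_b dnorm_h by (auto simp: bounded_step_def)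

text \<open>Two commutators need only the norm of order 2; it is enlarged to order 3 so that both
  formulas can use the same Egorov bound.\<close>

lemma norm_step2:
  assumes "bounded_step \<Lambda>1" "bounded_step \<Lambda>2"
  shows "norm (\<Lambda>1 (\<Lambda>2 Y)) \<le> C\<^sup>2 * dnorm 3 Y"
proof -
  have "norm (\<Lambda>1 (\<Lambda>2 Y)) \<le> dnorm 0 (\<Lambda>1 (\<Lambda>2 Y))" by (rule norm_le_dnorm)
  also have "\<dots> \<le> C * dnorm 1 (\<Lambda>2 Y)" using assms(1) unfolding bounded_step_def by fastforce
  also have "\<dots> \<le> C * (C * dnorm 2 Y)"
    using assms(2) C_nonneg unfolding bounded_step_def by (intro mult_left_mono) (auto simp: numeral_2_eq_2)
  also have "\<dots> \<le> C * (C * dnorm 3 Y)" using C_nonneg by (intro mult_left_mono dnorm_mono) auto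
  finally show ?thesis by (simp add: power2_eq_square mult.assoc)
qed

lemma norm_step3:
  assumes "bounded_step \<Lambda>1" "bounded_step \<Lambda>2" "bounded_step \<Lambda>3"
  shows "norm (\<Lambda>1 (\<Lambda>2 (\<Lambda>3 Y))) \<le> C ^ 3 * dnorm 3 Y"
proof -
  have "norm (\<Lambda>1 (\<Lambda>2 (\<Lambda>3 Y))) \<le> dnorm 0 (\<Lambda>1 (\<Lambda>2 (\<Lambda>3 Y)))" by (rule norm_le_dnorm)
  also have "\<dots> \<le> C * dnorm 1 (\<Lambda>2 (\<Lambda>3 Y))" using assms(1) unfolding bounded_step_def by fastforce
  also have "\<dots> \<le> C * (C * dnorm 2 (\<Lambda>3 Y))"
    using assms(2) C_nonneg unfolding bounded_step_def by (intro mult_left_mono) (auto simp: numeral_2_eq_2)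
  also have "\<dots> \<le> C * (C * (C * dnorm 3 Y))"
    using assms(3) C_nonneg unfolding bounded_step_def by (intro mult_left_mono) (auto simp: numeral_3_eq_3)
  finally show ?thesis by (simp add: power3_eq_cube mult.assoc)
qed

lemma a_K: "Y \<in> A.K \<Longrightarrow> a Y \<in> A.K" and b_K: "Y \<in> A.K \<Longrightarrow> b Y \<in> A.K"
  using A.commutator_in_K B.commutator_in_K by (auto simp: L_def)

lemmas tA1 = A.taylor1[folded L_def] and tA2 = A.taylor2[folded L_def] and tA3 = A.taylor3[folded L_def]
lemmas tB1 = B.taylor1[folded L_def] and tB2 = B.taylor2[folded L_def] and tB3 = B.taylor3[folded L_def]
lemmas tH2 = H.taylor2[folded L_def] and tH3 = H.taylor3[folded L_def]

text \<open>The terms of order 0 and 1 in s cancel, because the commutator with the sum is the sum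
  of the commutators. Four Taylor remainders of second order are left.\<close>

lemma local_error1:
  assumes Y: "Y \<in> A.K" and s: "0 \<le> s"
  shows "norm (A.E s (B.E s Y) - H.E s Y) \<le> 4 * (s\<^sup>2 * (C\<^sup>2 * dnorm 3 Y))"
proof -
  define e1 where "e1 = A.E s (B.E s Y - Y - s *\<^sub>R b Y)"
  define e2 where "e2 = A.E s Y - Y - s *\<^sub>R a Y"
  define e3 where "e3 = s *\<^sub>R (A.E s (b Y) - b Y)"
  define e4 where "e4 = - (H.E s Y - Y - s *\<^sub>R L (XA + XB) Y)"
  have "A.E s (B.E s Y) - H.E s Y = sum_list [e1, e2, e3, e4]"
    by (simp add: e1_def e2_def e3_def e4_def A.E_diff A.E_scaleR L_add_left scaleR_add_right scaleR_diff_right)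
  also have "norm \<dots> \<le> real (length [e1, e2, e3, e4]) * (s\<^sup>2 * (C\<^sup>2 * dnorm 3 Y))"
  proof (rule norm_sum_list_le)
    have 1: "norm e1 \<le> s\<^sup>2 * norm (b (b Y))"
      unfolding e1_def by (rule order_trans[OF A.norm_E tB2[OF Y s]])
    have 2: "norm e2 \<le> s\<^sup>2 * norm (a (a Y))"
      unfolding e2_def by (rule tA2[OF Y s])
    have 3: "norm e3 \<le> s\<^sup>2 * norm (a (b Y))"
      unfolding e3_def using mult_left_mono[OF tA1[OF b_K[OF Y] s] s] s by (simp add: power2_eq_square mult_ac)
    have 4: "norm e4 \<le> s\<^sup>2 * norm (L (XA + XB) (L (XA + XB) Y))"
      unfolding e4_def norm_minus_cancel by (rule tH2[OF Y s])
    note m = mult_left_mono[OF norm_step2 zero_le_power2[of s]]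
    fix x assume "x \<in> set [e1, e2, e3, e4]"
    then show "norm x \<le> s\<^sup>2 * (C\<^sup>2 * dnorm 3 Y)"
      using order_trans[OF 1 m[OF bounded_steps(2,2)]] order_trans[OF 2 m[OF bounded_steps(1,1)]]
        order_trans[OF 3 m[OF bounded_steps(1,2)]] order_trans[OF 4 m[OF bounded_steps(3,3)]] by auto
  qed
  finally show ?thesis by simp
qed

text \<open>The palindromic product reproduces the exact evolution through order 2, since the terms
  \<open>a (b Y)\<close> and \<open>b (a Y)\<close> occur with equal weights. Eleven remainders of
  third order are left, where \<open>R1\<close> counts twice: once carried through the later factors
  and once from the last half step.\<close>

lemma local_error2:
  assumes Y: "Y \<in> A.K" and s: "0 \<le> s"
  shows "norm (A.E (s / 2) (B.E s (A.E (s / 2) Y)) - H.E s Y) \<le> 11 * (s ^ 3 * (C ^ 3 * dnorm 3 Y))"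
proof -
  define r where "r = s / 2"
  have r: "0 \<le> r" "r \<le> s" "s = 2 * r" using s by (auto simp: r_def)
  define va where "va = r *\<^sub>R a Y"
  define q where "q = (r\<^sup>2 / 2) *\<^sub>R a (a Y)"
  define vb where "vb = s *\<^sub>R b Y"
  define vbb where "vbb = (s\<^sup>2 / 2) *\<^sub>R b (b Y)"
  define vba where "vba = (r * s) *\<^sub>R b (a Y)"
  define vab where "vab = (r * s) *\<^sub>R a (b Y)"
  define R1 where "R1 = A.E r Y - Y - r *\<^sub>R a Y - (r\<^sup>2 / 2) *\<^sub>R a (a Y)"
  define R2 where "R2 = B.E s Y - Y - s *\<^sub>R b Y - (s\<^sup>2 / 2) *\<^sub>R b (b Y)"
  define R3 where "R3 = r *\<^sub>R (B.E s (a Y) - a Y - s *\<^sub>R b (a Y))"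
  define R4 where "R4 = (r\<^sup>2 / 2) *\<^sub>R (B.E s (a (a Y)) - a (a Y))"
  define R5 where "R5 = s *\<^sub>R (A.E r (b Y) - b Y - r *\<^sub>R a (b Y))"
  define R6 where "R6 = (s\<^sup>2 / 2) *\<^sub>R (A.E r (b (b Y)) - b (b Y))"
  define R7 where "R7 = r *\<^sub>R (A.E r (a Y) - a Y - r *\<^sub>R a (a Y))"
  define R8 where "R8 = (r * s) *\<^sub>R (A.E r (b (a Y)) - b (a Y))"
  define R9 where "R9 = (r\<^sup>2 / 2) *\<^sub>R (A.E r (a (a Y)) - a (a Y))"
  define R10 where "R10 = H.E s Y - Y - s *\<^sub>R L (XA + XB) Y - (s\<^sup>2 / 2) *\<^sub>R L (XA + XB) (L (XA + XB) Y)"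
  have lin_a: "a (X + Z) = a X + a Z" and lin_b: "b (X + Z) = b X + b Z" for X Z
    using bounded_linear_L_right by (auto intro: linear_add bounded_linear.linear)
  \<comment> \<open>The double commutator with A is counted in units of \<open>q\<close>: one from
    each half step and two from their interaction, against four in the exact evolution. The
    identities \<open>E1\<close> to \<open>E10\<close> record which remainder each replacement
    leaves behind.\<close>
  have qq: "(r * r) *\<^sub>R a (a Y) = q + q"
    by (simp add: q_def scaleR_add_left[symmetric] power2_eq_square)
  have E1: "A.E r Y = Y + va + q + R1" by (simp add: R1_def va_def q_def)
  have E2: "B.E s Y = Y + vb + vbb + R2" by (simp add: R2_def vb_def vbb_def)
  have E3: "B.E s va = va + vba + R3" by (simp add: R3_def va_def vba_def B.E_scaleR scaleR_diff_right)
  have E4: "B.E s q = q + R4" by (simp add: R4_def q_def B.E_scaleR scaleR_diff_right)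
  have E5: "A.E r vb = vb + vab + R5" by (simp add: R5_def vb_def vab_def A.E_scaleR scaleR_diff_right mult.commute)
  have E6: "A.E r vbb = vbb + R6" by (simp add: R6_def vbb_def A.E_scaleR scaleR_diff_right)
  have E7: "A.E r va = va + (q + q) + R7" by (simp add: R7_def va_def qq[symmetric] A.E_scaleR scaleR_diff_right)
  have E8: "A.E r vba = vba + R8" by (simp add: R8_def vba_def A.E_scaleR scaleR_diff_right)
  have E9: "A.E r q = q + R9" by (simp add: R9_def q_def A.E_scaleR scaleR_diff_right)
  have E10: "H.E s Y = Y + (va + va + vb) + (q + q + (q + q) + vab + vba + vbb) + R10"
  proof -
    have "s *\<^sub>R L (XA + XB) Y = va + va + vb"
      by (simp add: va_def vb_def L_add_left scaleR_add_right r(3) scaleR_add_left[symmetric])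
    moreover have "(s\<^sup>2 / 2) *\<^sub>R L (XA + XB) (L (XA + XB) Y) = q + q + (q + q) + vab + vba + vbb"
    proof -
      have "(s\<^sup>2 / 2) *\<^sub>R a (a Y) = q + q + (q + q)"
        by (simp add: q_def scaleR_add_left[symmetric] r(3) power2_eq_square)
      moreover have "(s\<^sup>2 / 2) *\<^sub>R a (b Y) = vab" "(s\<^sup>2 / 2) *\<^sub>R b (a Y) = vba"
        by (simp_all add: vab_def vba_def r(3) power2_eq_square)
      ultimately show ?thesis
        by (simp add: L_add_left lin_a lin_b scaleR_add_right vbb_def add_ac)
    qed
    ultimately show ?thesis by (simp add: R10_def)
  qed
  let ?l = "[A.E r (B.E s R1), A.E r R2, A.E r R3, A.E r R4, R1, R5, R6, R7, R8, R9, - R10]"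
  have "A.E r (B.E s (A.E r Y)) - H.E s Y = sum_list ?l"
    unfolding E1 B.E_add E2 E3 E4 unfolding A.E_add unfolding E1 E5 E6 E7 E8 E9 E10 by (simp add: algebra_simps)
  also have "norm \<dots> \<le> real (length ?l) * (s ^ 3 * (C ^ 3 * dnorm 3 Y))"
  proof (rule norm_sum_list_le)
    note aY = a_K[OF Y] and bY = b_K[OF Y]
    have r3: "r ^ 3 \<le> s ^ 3" using r by (intro power_mono) auto
    have le3: "c * norm Z \<le> s ^ 3 * (C ^ 3 * dnorm 3 Y)" if "c \<le> s ^ 3" "norm Z \<le> C ^ 3 * dnorm 3 Y" for c and Z :: 'a
      using that s by (intro mult_mono) auto
    have coef: "r * s\<^sup>2 \<le> s ^ 3" "r\<^sup>2 / 2 * s \<le> s ^ 3" "s * r\<^sup>2 \<le> s ^ 3" "s\<^sup>2 / 2 * r \<le> s ^ 3" "r * r\<^sup>2 \<le> s ^ 3"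
      "r * s * r \<le> s ^ 3" "r\<^sup>2 / 2 * r \<le> s ^ 3"
      using r(1) unfolding r(3) by (auto simp: power2_eq_square power3_eq_cube)
    note st = bounded_steps
    have 1: "norm R1 \<le> s ^ 3 * (C ^ 3 * dnorm 3 Y)"
      unfolding R1_def by (rule order_trans[OF tA3[OF Y r(1)] le3[OF r3 norm_step3[OF st(1,1,1)]]])
    have 2: "norm R2 \<le> s ^ 3 * (C ^ 3 * dnorm 3 Y)"
      unfolding R2_def by (rule order_trans[OF tB3[OF Y s] le3[OF order_refl norm_step3[OF st(2,2,2)]]])
    have sc: "norm (c *\<^sub>R Z) \<le> s ^ 3 * (C ^ 3 * dnorm 3 Y)"
      if "norm Z \<le> d * norm W" "0 \<le> c" "c * d \<le> s ^ 3" "norm W \<le> C ^ 3 * dnorm 3 Y" for c d and Z W :: 'a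
    proof -
      have "norm (c *\<^sub>R Z) \<le> (c * d) * norm W" using mult_left_mono[OF that(1,2)] that(2) by (simp add: mult.assoc)
      also have "\<dots> \<le> s ^ 3 * (C ^ 3 * dnorm 3 Y)" by (rule le3[OF that(3,4)])
      finally show ?thesis .
    qed
    have 3: "norm R3 \<le> s ^ 3 * (C ^ 3 * dnorm 3 Y)"
      unfolding R3_def by (rule sc[OF tB2[OF aY s] r(1) coef(1) norm_step3[OF st(2,2,1)]])
    have 4: "norm R4 \<le> s ^ 3 * (C ^ 3 * dnorm 3 Y)"
      unfolding R4_def by (rule sc[OF tB1[OF a_K[OF aY] s] _ coef(2) norm_step3[OF st(2,1,1)]]) simp
    have 5: "norm R5 \<le> s ^ 3 * (C ^ 3 * dnorm 3 Y)"
      unfolding R5_def by (rule sc[OF tA2[OF bY r(1)] s coef(3) norm_step3[OF st(1,1,2)]])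
    have 6: "norm R6 \<le> s ^ 3 * (C ^ 3 * dnorm 3 Y)"
      unfolding R6_def by (rule sc[OF tA1[OF b_K[OF bY] r(1)] _ coef(4) norm_step3[OF st(1,2,2)]]) simp
    have 7: "norm R7 \<le> s ^ 3 * (C ^ 3 * dnorm 3 Y)"
      unfolding R7_def by (rule sc[OF tA2[OF aY r(1)] r(1) coef(5) norm_step3[OF st(1,1,1)]])
    have 8: "norm R8 \<le> s ^ 3 * (C ^ 3 * dnorm 3 Y)"
      unfolding R8_def by (rule sc[OF tA1[OF b_K[OF aY] r(1)] _ coef(6) norm_step3[OF st(1,2,1)]]) (use r s in simp)
    have 9: "norm R9 \<le> s ^ 3 * (C ^ 3 * dnorm 3 Y)"
      unfolding R9_def by (rule sc[OF tA1[OF a_K[OF aY] r(1)] _ coef(7) norm_step3[OF st(1,1,1)]]) simp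
    have 10: "norm (- R10) \<le> s ^ 3 * (C ^ 3 * dnorm 3 Y)"
      unfolding R10_def norm_minus_cancel by (rule order_trans[OF tH3[OF Y s] le3[OF order_refl norm_step3[OF st(3,3,3)]]])
    fix x assume "x \<in> set ?l"
    then show "norm x \<le> s ^ 3 * (C ^ 3 * dnorm 3 Y)"
      using 1 2 3 4 5 6 7 8 9 10 order_trans[OF A.norm_E 2] order_trans[OF A.norm_E 3] order_trans[OF A.norm_E 4]
        order_trans[OF A.norm_E order_trans[OF B.norm_E 1]] by auto
  qed
  finally show ?thesis by (simp add: r_def)
qed

lemma telescope:
  assumes diff: "\<And>X Y. \<Phi> (X - Y) = \<Phi> X - \<Phi> Y" and contr: "\<And>X. norm (\<Phi> X) \<le> norm X"
    and Y: "Y \<in> A.K" and err: "\<And>k. k < n \<Longrightarrow> norm (\<Phi> (H.E (real k * s) Y) - H.E s (H.E (real k * s) Y)) \<le> \<epsilon>"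
  shows "norm ((\<Phi> ^^ n) Y - H.E (real n * s) Y) \<le> real n * \<epsilon>"
  using err
proof (induction n)
  case 0
  then show ?case using H.E_zero[OF Y] by simp
next
  case (Suc n)
  let ?Z = "H.E (real n * s) Y"
  have "H.E (real (Suc n) * s) Y = H.E s ?Z"
    using H.E_add_time[of s "real n * s" Y] by (simp add: algebra_simps)
  then have "(\<Phi> ^^ Suc n) Y - H.E (real (Suc n) * s) Y = \<Phi> ((\<Phi> ^^ n) Y - ?Z) + (\<Phi> ?Z - H.E s ?Z)"
    by (simp add: diff)
  also have "norm \<dots> \<le> norm ((\<Phi> ^^ n) Y - ?Z) + norm (\<Phi> ?Z - H.E s ?Z)"
    by (rule order_trans[OF norm_triangle_ineq add_right_mono[OF contr]])
  also have "\<dots> \<le> real n * \<epsilon> + \<epsilon>" using Suc by (intro add_mono) auto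
  finally show ?case by (simp add: algebra_simps)
qed

text \<open>All intermediate times are at most t, so the number \<open>m\<close> of doublings chosen
  for t works for every step and every \<open>n\<close>.\<close>

lemma dnorm_H_E:
  assumes Ob: "symbol S Ob" "Ob \<in> A.K" and k: "k < n" and t: "0 < t"
    and m: "t * (2 * growth_const TYPE('v) \<kappa> (2 * S)) \<le> real m"
  shows "dnorm 3 (H.E (real k * (t / real n)) Ob) \<le> 2 ^ m * C"
proof -
  have "real k * (t / real n) \<le> t" using k t by (simp add: field_simps)
  then have "real k * (t / real n) * (2 * growth_const TYPE('v) \<kappa> (2 * S)) \<le> t * (2 * growth_const TYPE('v) \<kappa> (2 * S))"
    using H.growth_const_nonneg by (intro mult_right_mono) auto
  then have "dnorm 3 (H.E (real k * (t / real n)) Ob) \<le> 2 ^ m * dnorm 3 Ob"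
    using m t by (intro H.egorov Ob) auto
  moreover have "dnorm 3 Ob \<le> C"
  proof (rule order_trans[OF dnorm_symbol[OF Ob(1)]])
    show "step_const TYPE('v) \<kappa> S \<le> C"
      using S_nonneg tame_const_nonneg[OF \<kappa>_nonneg, of 3] unfolding C_eq step_const_def by (intro mult_left_mono) auto
  qed
  ultimately show ?thesis by (meson mult_left_mono order_trans zero_le_numeral zero_le_power)
qed

theorem trotter_error1:
  assumes Ob: "symbol S Ob" "Ob \<in> A.K" and n: "1 \<le> n" and t: "0 < t"
    and m: "t * (2 * growth_const TYPE('v) \<kappa> (2 * S)) \<le> real m"
  shows "norm (((\<lambda>Y. A.E (t / real n) (B.E (t / real n) Y)) ^^ n) Ob - H.E t Ob) \<le> 4 * t\<^sup>2 * C ^ 3 * 2 ^ m / real n"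
proof -
  let ?s = "t / real n"
  have "norm (((\<lambda>Y. A.E ?s (B.E ?s Y)) ^^ n) Ob - H.E (real n * ?s) Ob) \<le> real n * (4 * (?s\<^sup>2 * (C\<^sup>2 * (2 ^ m * C))))"
  proof (rule telescope[OF _ _ Ob(2)])
    fix k assume "k < n"
    let ?Z = "H.E (real k * ?s) Ob"
    have "norm (A.E ?s (B.E ?s ?Z) - H.E ?s ?Z) \<le> 4 * (?s\<^sup>2 * (C\<^sup>2 * dnorm 3 ?Z))"
      by (rule local_error1[OF H.E_in_K]) (use t in simp)
    also have "\<dots> \<le> 4 * (?s\<^sup>2 * (C\<^sup>2 * (2 ^ m * C)))"
      using dnorm_H_E[OF Ob \<open>k < n\<close> t m] by (intro mult_left_mono) auto
    finally show "norm (A.E ?s (B.E ?s ?Z) - H.E ?s ?Z) \<le> 4 * (?s\<^sup>2 * (C\<^sup>2 * (2 ^ m * C)))" .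
  qed (auto simp: A.E_diff B.E_diff intro: order_trans[OF A.norm_E B.norm_E])
  also have "real n * ?s = t" using n by simp
  also have "real n * (4 * (?s\<^sup>2 * (C\<^sup>2 * (2 ^ m * C)))) = 4 * t\<^sup>2 * C ^ 3 * 2 ^ m / real n"
    using n by (simp add: field_simps power2_eq_square power3_eq_cube)
  finally show ?thesis .
qed

theorem trotter_error2:
  assumes Ob: "symbol S Ob" "Ob \<in> A.K" and n: "1 \<le> n" and t: "0 < t"
    and m: "t * (2 * growth_const TYPE('v) \<kappa> (2 * S)) \<le> real m"
  shows "norm (((\<lambda>Y. A.E (t / real n / 2) (B.E (t / real n) (A.E (t / real n / 2) Y))) ^^ n) Ob - H.E t Ob)
    \<le> 11 * t ^ 3 * C ^ 4 * 2 ^ m / (real n)\<^sup>2"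
proof -
  let ?s = "t / real n"
  have "norm (((\<lambda>Y. A.E (?s / 2) (B.E ?s (A.E (?s / 2) Y))) ^^ n) Ob - H.E (real n * ?s) Ob)
      \<le> real n * (11 * (?s ^ 3 * (C ^ 3 * (2 ^ m * C))))"
  proof (rule telescope[OF _ _ Ob(2)])
    fix k assume "k < n"
    let ?Z = "H.E (real k * ?s) Ob"
    have "norm (A.E (?s / 2) (B.E ?s (A.E (?s / 2) ?Z)) - H.E ?s ?Z) \<le> 11 * (?s ^ 3 * (C ^ 3 * dnorm 3 ?Z))"
      by (rule local_error2[OF H.E_in_K]) (use t in simp)
    also have "\<dots> \<le> 11 * (?s ^ 3 * (C ^ 3 * (2 ^ m * C)))"
      using dnorm_H_E[OF Ob \<open>k < n\<close> t m] t C_nonneg by (intro mult_left_mono) auto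
    finally show "norm (A.E (?s / 2) (B.E ?s (A.E (?s / 2) ?Z)) - H.E ?s ?Z) \<le> 11 * (?s ^ 3 * (C ^ 3 * (2 ^ m * C)))" .
  qed (auto simp: A.E_diff B.E_diff intro: order_trans[OF A.norm_E order_trans[OF B.norm_E A.norm_E]])
  also have "real n * ?s = t" using n by simp
  also have "real n * (11 * (?s ^ 3 * (C ^ 3 * (2 ^ m * C)))) = 11 * t ^ 3 * C ^ 4 * 2 ^ m / (real n)\<^sup>2"
    using n by (simp add: field_simps power2_eq_square power3_eq_cube power4_eq_xxxx)
  finally show ?thesis .
qed

end

section \<open>Matrices as a normed algebra\<close>

lemma L2_set_norm_le_1_zero: "L2_set (\<lambda>k. norm ((\<lambda>_. 0 :: complex) k)) I \<le> 1"
  by (simp add: L2_set_def)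

lemma matvec_bounded:
  fixes X :: "'i cmatrix"
  assumes I: "finite I" and v: "L2_set (\<lambda>k. norm (v k)) I \<le> 1"
  shows "L2_set (\<lambda>j. norm (\<Sum>k\<in>I. X j k * v k)) I \<le> (\<Sum>j\<in>I. \<Sum>k\<in>I. norm (X j k))"
proof -
  have "L2_set (\<lambda>j. norm (\<Sum>k\<in>I. X j k * v k)) I \<le> (\<Sum>j\<in>I. norm (\<Sum>k\<in>I. X j k * v k))"
    by (rule L2_set_le_sum) simp
  also have "\<dots> \<le> (\<Sum>j\<in>I. \<Sum>k\<in>I. norm (X j k))"
  proof (intro sum_mono order_trans[OF norm_sum])
    fix j k assume k: "k \<in> I"
    have "norm (v k) \<le> L2_set (\<lambda>k. norm (v k)) I" by (rule member_le_L2_set[OF I k])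
    then have "norm (v k) \<le> 1" using v by simp
    then show "norm (X j k * v k) \<le> norm (X j k)" by (simp add: norm_mult mult_left_le)
  qed
  finally show ?thesis .
qed

lemma spectral_norm_bdd:
  fixes X :: "'i cmatrix"
  assumes "finite I"
  shows "bdd_above ((\<lambda>v. L2_set (\<lambda>j. norm (\<Sum>k\<in>I. X j k * v k)) I) ` {v. L2_set (\<lambda>k. norm (v k)) I \<le> 1})"
  using matvec_bounded[OF assms, of _ X] by (intro bdd_aboveI2) auto

lemma spectral_norm_leI:
  fixes X :: "'i cmatrix"
  assumes "\<And>v. L2_set (\<lambda>k. norm (v k)) I \<le> 1 \<Longrightarrow> L2_set (\<lambda>j. norm (\<Sum>k\<in>I. X j k * v k)) I \<le> c"
  shows "spectral_norm I X \<le> c"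
  unfolding spectral_norm_def
proof (rule cSUP_least)
  have "(\<lambda>_. 0) \<in> {v :: 'i \<Rightarrow> complex. L2_set (\<lambda>k. norm (v k)) I \<le> 1}"
    using L2_set_norm_le_1_zero[of I] by simp
  then show "{v :: 'i \<Rightarrow> complex. L2_set (\<lambda>k. norm (v k)) I \<le> 1} \<noteq> {}"
    unfolding ex_in_conv[symmetric] by (rule exI[of _ "\<lambda>_. 0"])
qed (use assms in auto)

lemma spectral_norm_upper:
  assumes "finite I" "L2_set (\<lambda>k. norm (v k)) I \<le> 1"
  shows "L2_set (\<lambda>j. norm (\<Sum>k\<in>I. X j k * v k)) I \<le> spectral_norm I X"
  unfolding spectral_norm_def
  by (rule cSUP_upper[OF _ spectral_norm_bdd[OF assms(1)]]) (use assms(2) in simp)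

lemma spectral_norm_nonneg: "finite I \<Longrightarrow> 0 \<le> spectral_norm I X"
  using spectral_norm_upper[OF _ L2_set_norm_le_1_zero, of I X] L2_set_nonneg order_trans by blast

lemma L2_set_scale: "0 \<le> c \<Longrightarrow> L2_set (\<lambda>j. c * f j) I = c * L2_set f I"
  using L2_set_right_distrib[of c f I] by simp

lemma spectral_norm_matvec:
  assumes I: "finite I"
  shows "L2_set (\<lambda>j. norm (\<Sum>k\<in>I. X j k * v k)) I \<le> spectral_norm I X * L2_set (\<lambda>k. norm (v k)) I"
proof (cases "L2_set (\<lambda>k. norm (v k)) I = 0")
  case True
  then have "\<forall>k\<in>I. v k = 0" using L2_set_eq_0_iff[OF I, of "\<lambda>k. norm (v k)"] by simp
  then show ?thesis using True by (simp add: L2_set_def)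
next
  case False
  define c where "c = L2_set (\<lambda>k. norm (v k)) I"
  have c: "c > 0" using False L2_set_nonneg[of "\<lambda>k. norm (v k)" I] by (simp add: c_def less_le)
  define w where "w k = v k / complex_of_real c" for k
  have nw: "norm (w k) = inverse c * norm (v k)" for k using c by (simp add: w_def norm_mult norm_inverse divide_inverse mult.commute)
  have "L2_set (\<lambda>k. norm (w k)) I = inverse c * c"
    unfolding nw c_def using c by (intro L2_set_scale) (simp add: c_def)
  then have w1: "L2_set (\<lambda>k. norm (w k)) I \<le> 1" using c by simp
  have "(\<Sum>k\<in>I. X j k * w k) = inverse (complex_of_real c) * (\<Sum>k\<in>I. X j k * v k)" for j
    by (simp add: w_def divide_inverse sum_distrib_left mult_ac)
  then have "norm (\<Sum>k\<in>I. X j k * w k) = inverse c * norm (\<Sum>k\<in>I. X j k * v k)" for j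
    using c by (simp add: norm_mult norm_inverse)
  then have "L2_set (\<lambda>j. norm (\<Sum>k\<in>I. X j k * w k)) I = inverse c * L2_set (\<lambda>j. norm (\<Sum>k\<in>I. X j k * v k)) I"
    using c by (simp add: L2_set_scale)
  with spectral_norm_upper[OF I w1, of X] have "inverse c * L2_set (\<lambda>j. norm (\<Sum>k\<in>I. X j k * v k)) I \<le> spectral_norm I X" by simp
  then show ?thesis using c by (simp add: c_def[symmetric] field_simps)
qed

lemma norm_entry_le_spectral_norm:
  assumes I: "finite I" and j: "j \<in> I" and k: "k \<in> I"
  shows "norm (X j k) \<le> spectral_norm I X"
proof -
  define v where "v l = (if l = k then 1 else 0 :: complex)" for l
  have "L2_set (\<lambda>l. norm (v l)) I \<le> (\<Sum>l\<in>I. norm (v l))" by (rule L2_set_le_sum) simp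
  also have "\<dots> = 1" using k I by (simp add: v_def if_distrib[of norm] cong: if_cong)
  finally have "L2_set (\<lambda>l. norm (v l)) I \<le> 1" .
  from spectral_norm_upper[OF I this, of X]
  have le: "L2_set (\<lambda>j. norm (\<Sum>l\<in>I. X j l * v l)) I \<le> spectral_norm I X" .
  have "(\<Sum>l\<in>I. X j l * v l) = X j k" for j using k I by (simp add: v_def if_distrib cong: if_cong)
  then have "L2_set (\<lambda>j. norm (X j k)) I \<le> spectral_norm I X" using le by simp
  with member_le_L2_set[OF I j, of "\<lambda>j. norm (X j k)"] show ?thesis by simp
qed

lemma spectral_norm_cong:
  assumes "\<And>j k. j \<in> I \<Longrightarrow> k \<in> I \<Longrightarrow> X j k = Y j k"
  shows "spectral_norm I X = spectral_norm I Y"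
proof -
  have "L2_set (\<lambda>j. norm (\<Sum>k\<in>I. X j k * v k)) I = L2_set (\<lambda>j. norm (\<Sum>k\<in>I. Y j k * v k)) I" for v
    using assms by (intro L2_set_cong refl arg_cong[where f = norm] sum.cong) auto
  then show ?thesis by (simp add: spectral_norm_def)
qed

lemma L2_set_subset:
  assumes "finite J" "I \<subseteq> J" "\<And>j. j \<in> J - I \<Longrightarrow> f j = 0"
  shows "L2_set f J = L2_set f I"
  unfolding L2_set_def using assms by (subst sum.mono_neutral_right[of J I]) auto

text \<open>Padding a matrix with zeros does not change its norm. The norm of an element of
  \<open>opm\<close> can therefore be computed on any finite index set containing its support, in
  particular on one shared by several elements.\<close>

lemma spectral_norm_superset:
  fixes X :: "'i cmatrix"
  assumes J: "finite J" and IJ: "I \<subseteq> J" and X: "\<And>j k. X j k \<noteq> 0 \<Longrightarrow> j \<in> I \<and> k \<in> I"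
  shows "spectral_norm J X = spectral_norm I X"
proof (rule antisym)
  have I: "finite I" using J IJ finite_subset by blast
  have mv: "L2_set (\<lambda>j. norm (\<Sum>k\<in>J. X j k * v k)) J = L2_set (\<lambda>j. norm (\<Sum>k\<in>I. X j k * v k)) I" for v
  proof -
    have "(\<Sum>k\<in>J. X j k * v k) = (\<Sum>k\<in>I. X j k * v k)" for j
      using X by (intro sum.mono_neutral_right J IJ) auto
    moreover have "L2_set (\<lambda>j. norm (\<Sum>k\<in>I. X j k * v k)) J = L2_set (\<lambda>j. norm (\<Sum>k\<in>I. X j k * v k)) I"
      using X by (intro L2_set_subset J IJ) (force intro: sum.neutral)
    ultimately show ?thesis by simp
  qed
  show "spectral_norm J X \<le> spectral_norm I X"
  proof (rule spectral_norm_leI)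
    fix v :: "'i \<Rightarrow> complex" assume v: "L2_set (\<lambda>k. norm (v k)) J \<le> 1"
    have "L2_set (\<lambda>k. norm (v k)) I \<le> L2_set (\<lambda>k. norm (v k)) J"
      unfolding L2_set_def using J IJ by (intro real_sqrt_le_mono sum_mono2) auto
    then show "L2_set (\<lambda>j. norm (\<Sum>k\<in>J. X j k * v k)) J \<le> spectral_norm I X"
      unfolding mv using v by (intro spectral_norm_upper I) auto
  qed
  show "spectral_norm I X \<le> spectral_norm J X"
  proof (rule spectral_norm_leI)
    fix v :: "'i \<Rightarrow> complex" assume v: "L2_set (\<lambda>k. norm (v k)) I \<le> 1"
    define w where "w k = (if k \<in> I then v k else 0)" for k
    have "L2_set (\<lambda>k. norm (w k)) J = L2_set (\<lambda>k. norm (w k)) I" by (intro L2_set_subset J IJ) (simp add: w_def)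
    also have "\<dots> = L2_set (\<lambda>k. norm (v k)) I" by (intro L2_set_cong) (simp_all add: w_def)
    finally have "L2_set (\<lambda>j. norm (\<Sum>k\<in>J. X j k * w k)) J \<le> spectral_norm J X"
      using v by (intro spectral_norm_upper J) simp
    moreover have "(\<Sum>k\<in>I. X j k * w k) = (\<Sum>k\<in>I. X j k * v k)" for j by (intro sum.cong) (simp_all add: w_def)
    ultimately show "L2_set (\<lambda>j. norm (\<Sum>k\<in>I. X j k * v k)) I \<le> spectral_norm J X" unfolding mv by simp
  qed
qed

lemma spectral_norm_isometry:
  fixes X :: "'i cmatrix"
  assumes I: "finite I" and iso: "\<And>j k. j \<in> I \<Longrightarrow> k \<in> I \<Longrightarrow> (\<Sum>l\<in>I. cnj (X l j) * X l k) = of_bool (j = k)"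
  shows "spectral_norm I X \<le> 1"
proof (rule spectral_norm_leI)
  fix v :: "'i \<Rightarrow> complex" assume v: "L2_set (\<lambda>k. norm (v k)) I \<le> 1"
  have "complex_of_real (\<Sum>l\<in>I. (norm (\<Sum>k\<in>I. X l k * v k))\<^sup>2) = (\<Sum>l\<in>I. (\<Sum>k\<in>I. X l k * v k) * cnj (\<Sum>j\<in>I. X l j * v j))"
    unfolding of_real_sum by (intro sum.cong refl complex_norm_square)
  also have "\<dots> = (\<Sum>l\<in>I. \<Sum>k\<in>I. \<Sum>j\<in>I. (v k * cnj (v j)) * (cnj (X l j) * X l k))"
    unfolding cnj_sum sum_distrib_left sum_distrib_right
    by (rule sum.cong[OF refl], rule trans[OF sum.swap], intro sum.cong[OF refl]) (simp add: mult_ac)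
  also have "\<dots> = (\<Sum>k\<in>I. \<Sum>l\<in>I. \<Sum>j\<in>I. (v k * cnj (v j)) * (cnj (X l j) * X l k))"
    by (rule sum.swap)
  also have "\<dots> = (\<Sum>k\<in>I. \<Sum>j\<in>I. \<Sum>l\<in>I. (v k * cnj (v j)) * (cnj (X l j) * X l k))"
    by (rule sum.cong[OF refl]) (rule sum.swap)
  also have "\<dots> = (\<Sum>k\<in>I. \<Sum>j\<in>I. v k * cnj (v j) * of_bool (j = k))"
    by (intro sum.cong refl) (simp add: sum_distrib_left[symmetric] iso)
  also have "\<dots> = (\<Sum>k\<in>I. v k * cnj (v k))"
    using I by (simp add: of_bool_def if_distrib cong: if_cong)
  also have "\<dots> = complex_of_real (\<Sum>k\<in>I. (norm (v k))\<^sup>2)"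
    unfolding of_real_sum by (intro sum.cong refl complex_norm_square[symmetric])
  finally have "(\<Sum>l\<in>I. (norm (\<Sum>k\<in>I. X l k * v k))\<^sup>2) = (\<Sum>k\<in>I. (norm (v k))\<^sup>2)"
    by (simp only: of_real_eq_iff)
  then show "L2_set (\<lambda>j. norm (\<Sum>k\<in>I. X j k * v k)) I \<le> 1" using v by (simp add: L2_set_def)
qed

text \<open>
  Matrices of all finite sizes over one index type form a normed algebra.  It has no unit; the identity
  matrix of a finite index set is only an idempotent.
\<close>

typedef 'i opm = "{X :: 'i cmatrix. finite {p. X (fst p) (snd p) \<noteq> 0}}" morphisms entry Opm
  by (rule exI[of _ "\<lambda>_ _. 0"]) simp

definition supp :: "'i opm \<Rightarrow> 'i set" where
  "supp X = {j. \<exists>k. entry X j k \<noteq> 0 \<or> entry X k j \<noteq> 0}"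

lemma finite_supp [simp]: "finite (supp X)"
proof -
  let ?S = "{p. entry X (fst p) (snd p) \<noteq> 0}"
  have "supp X \<subseteq> fst ` ?S \<union> snd ` ?S"
  proof
    fix j assume "j \<in> supp X"
    then obtain k where "(j, k) \<in> ?S \<or> (k, j) \<in> ?S" by (auto simp: supp_def)
    then show "j \<in> fst ` ?S \<union> snd ` ?S"
    proof
      assume "(j, k) \<in> ?S"
      then have "fst (j, k) \<in> fst ` ?S" by (rule imageI)
      then show ?thesis by simp
    next
      assume "(k, j) \<in> ?S"
      then have "snd (k, j) \<in> snd ` ?S" by (rule imageI)
      then show ?thesis by simp
    qed
  qed
  moreover have "finite ?S" using entry[of X] by simp
  ultimately show ?thesis using finite_subset[OF _ finite_UnI[OF finite_imageI finite_imageI]] by fast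
qed

lemma entry_supp: "entry X j k \<noteq> 0 \<Longrightarrow> j \<in> supp X \<and> k \<in> supp X"
  by (auto simp: supp_def)

lemma opm_eqI: "(\<And>j k. entry X j k = entry Y j k) \<Longrightarrow> X = Y"
  by (metis entry_inject ext)

lemma entry_Opm:
  assumes "finite I" "\<And>j k. X j k \<noteq> 0 \<Longrightarrow> j \<in> I \<and> k \<in> I"
  shows "entry (Opm X) = X"
proof (rule Opm_inverse)
  have "{p. X (fst p) (snd p) \<noteq> 0} \<subseteq> I \<times> I" using assms(2) by auto
  then have "finite {p. X (fst p) (snd p) \<noteq> 0}" using assms(1) finite_subset by blast
  then show "X \<in> {X. finite {p. X (fst p) (snd p) \<noteq> 0}}" by simp
qed

text \<open>Introduced before the class instance, which takes its real scaling and negation from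
  it.\<close>

definition cscale :: "complex \<Rightarrow> 'i opm \<Rightarrow> 'i opm" where
  "cscale c X = Opm (\<lambda>j k. c * entry X j k)"

lemma entry_cscale [simp]: "entry (cscale c X) j k = c * entry X j k"
  unfolding cscale_def by (subst entry_Opm[of "supp X"]) (auto dest: entry_supp)

instantiation opm :: (type) real_normed_algebra
begin

definition zero_opm where "0 = Opm (\<lambda>_ _. 0)"
definition plus_opm where "X + Y = Opm (\<lambda>j k. entry X j k + entry Y j k)"
definition uminus_opm where "- X = cscale (-1) X"
definition minus_opm where "X - Y = X + (- (Y :: 'a opm))"
definition times_opm where "X * Y = Opm (\<lambda>j k. \<Sum>l\<in>supp X. entry X j l * entry Y l k)"
definition scaleR_opm where "scaleR r X = cscale (complex_of_real r) X"
definition norm_opm where "norm X = spectral_norm (supp X) (entry X)"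
definition dist_opm where "dist X Y = norm (X - (Y :: 'a opm))"
definition sgn_opm where "sgn X = scaleR (inverse (norm X)) (X :: 'a opm)"
definition uniformity_opm where "(uniformity :: ('a opm \<times> 'a opm) filter) = (INF e\<in>{0 <..}. principal {(x, y). dist x y < e})"
definition open_opm where "open (U :: 'a opm set) \<longleftrightarrow> (\<forall>x\<in>U. eventually (\<lambda>(x', y). x' = x \<longrightarrow> y \<in> U) uniformity)"

lemma entry_zero: "entry (0 :: 'a opm) j k = 0"
  unfolding zero_opm_def by (subst entry_Opm[of "{}"]) auto

lemma entry_plus: "entry (X + Y :: 'a opm) j k = entry X j k + entry Y j k"
  unfolding plus_opm_def
proof (subst entry_Opm[of "supp X \<union> supp Y"])
  show "j \<in> supp X \<union> supp Y \<and> k \<in> supp X \<union> supp Y" if "entry X j k + entry Y j k \<noteq> 0" for j k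
  proof -
    have "entry X j k \<noteq> 0 \<or> entry Y j k \<noteq> 0" using that by auto
    then show ?thesis by (auto dest: entry_supp)
  qed
qed auto

lemma entry_uminus: "entry (- X :: 'a opm) j k = - entry X j k"
  by (simp add: uminus_opm_def)

lemma entry_minus: "entry (X - Y :: 'a opm) j k = entry X j k - entry Y j k"
  by (simp add: minus_opm_def entry_plus entry_uminus)

lemma entry_scaleR: "entry (r *\<^sub>R X :: 'a opm) j k = complex_of_real r * entry X j k"
  by (simp add: scaleR_opm_def)

lemma entry_times_supp: "entry (X * Y :: 'a opm) j k = (\<Sum>l\<in>supp X. entry X j l * entry Y l k)"
  unfolding times_opm_def
proof (subst entry_Opm[of "supp X \<union> supp Y"])
  fix j k assume "(\<Sum>l\<in>supp X. entry X j l * entry Y l k) \<noteq> 0"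
  then obtain l where "entry X j l * entry Y l k \<noteq> 0" by (meson sum.not_neutral_contains_not_neutral)
  then show "j \<in> supp X \<union> supp Y \<and> k \<in> supp X \<union> supp Y" by (auto dest: entry_supp)
qed auto

text \<open>A summand vanishes as soon as one factor does, so any finite set containing either
  support may serve as range of summation.\<close>

lemma entry_times:
  assumes "finite I" "supp X \<subseteq> I \<or> supp Y \<subseteq> I"
  shows "entry (X * Y :: 'a opm) j k = (\<Sum>l\<in>I. entry X j l * entry Y l k)"
proof -
  have "(\<Sum>l\<in>supp X. entry X j l * entry Y l k) = (\<Sum>l\<in>supp X \<union> I. entry X j l * entry Y l k)"
    using assms(1) by (intro sum.mono_neutral_left) (auto dest: entry_supp)
  also have "\<dots> = (\<Sum>l\<in>I. entry X j l * entry Y l k)"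
  proof (rule sum.mono_neutral_right)
    show "\<forall>l\<in>supp X \<union> I - I. entry X j l * entry Y l k = 0"
      using assms(2) by (auto dest: entry_supp)
  qed (use assms in auto)
  finally show ?thesis by (simp add: entry_times_supp)
qed

lemma norm_opm_eq: "finite I \<Longrightarrow> supp X \<subseteq> I \<Longrightarrow> norm (X :: 'a opm) = spectral_norm I (entry X)"
  unfolding norm_opm_def by (rule spectral_norm_superset[symmetric]) (auto dest: entry_supp)

lemma norm_cscale_le: "norm (cscale c X :: 'a opm) \<le> norm c * norm X"
proof -
  let ?I = "supp X"
  have s: "supp (cscale c X) \<subseteq> ?I" by (auto simp: supp_def)
  have "spectral_norm ?I (entry (cscale c X)) \<le> norm c * spectral_norm ?I (entry X)"
  proof (rule spectral_norm_leI)
    fix v :: "'a \<Rightarrow> complex" assume v: "L2_set (\<lambda>k. norm (v k)) ?I \<le> 1"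
    have "norm (\<Sum>k\<in>?I. entry (cscale c X) j k * v k) = norm c * norm (\<Sum>k\<in>?I. entry X j k * v k)" for j
      by (simp add: mult.assoc sum_distrib_left[symmetric] norm_mult)
    then show "L2_set (\<lambda>j. norm (\<Sum>k\<in>?I. entry (cscale c X) j k * v k)) ?I \<le> norm c * spectral_norm ?I (entry X)"
      using mult_left_mono[OF spectral_norm_upper[OF finite_supp v, of "entry X"] norm_ge_zero[of c]]
      by (simp add: L2_set_scale)
  qed
  then show ?thesis by (simp add: norm_opm_eq[OF finite_supp s] norm_opm_def[of X])
qed

lemma norm_cscale_opm: "norm (cscale c X :: 'a opm) = norm c * norm X"
proof (cases "c = 0")
  case True
  then have "norm (cscale c X) \<le> 0" using norm_cscale_le[of c X] by simp
  moreover have "0 \<le> norm (cscale c X)" by (simp add: norm_opm_def spectral_norm_nonneg)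
  ultimately show ?thesis using True by simp
next
  case False
  have "cscale (inverse c) (cscale c X) = X" using False by (intro opm_eqI) simp
  then have "norm X \<le> norm (inverse c) * norm (cscale c X)" using norm_cscale_le[of "inverse c" "cscale c X"] by simp
  then have "norm c * norm X \<le> norm (cscale c X)" using False by (simp add: norm_inverse norm_divide field_simps)
  with norm_cscale_le[of c X] show ?thesis by simp
qed

instance
proof
  fix X Y Z :: "'a opm" and r s :: real
  note e = entry_zero entry_plus entry_uminus entry_minus entry_scaleR
  show "X + Y + Z = X + (Y + Z)" "X + Y = Y + X" "0 + X = X" "- X + X = 0" "X - Y = X + - Y"
    "r *\<^sub>R (X + Y) = r *\<^sub>R X + r *\<^sub>R Y" "(r + s) *\<^sub>R X = r *\<^sub>R X + s *\<^sub>R X"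
    "r *\<^sub>R s *\<^sub>R X = (r * s) *\<^sub>R X" "1 *\<^sub>R X = X"
    by (auto intro!: opm_eqI simp: e algebra_simps)
  define I where "I = supp X \<union> supp Y \<union> supp Z \<union> supp (X * Y) \<union> supp (X + Y) \<union> supp (Y * Z)"
  have I: "finite I" by (simp add: I_def)
  have sI: "supp X \<subseteq> I" "supp Y \<subseteq> I" "supp Z \<subseteq> I" "supp (X * Y) \<subseteq> I" "supp (X + Y) \<subseteq> I" "supp (Y * Z) \<subseteq> I"
    by (auto simp: I_def)
  note t = entry_times[OF I]
  show "X * Y * Z = X * (Y * Z)"
  proof (rule opm_eqI)
    fix j k
    have 1: "entry (X * Y * Z) j k = (\<Sum>l\<in>I. \<Sum>m\<in>I. entry X j m * entry Y m l * entry Z l k)"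
      by (simp add: t sI sum_distrib_right)
    have 2: "entry (X * (Y * Z)) j k = (\<Sum>m\<in>I. \<Sum>l\<in>I. entry X j m * entry Y m l * entry Z l k)"
      by (simp add: t sI sum_distrib_left mult.assoc)
    show "entry (X * Y * Z) j k = entry (X * (Y * Z)) j k" unfolding 1 2 by (rule sum.swap)
  qed
  show "(X + Y) * Z = X * Z + Y * Z"
    by (rule opm_eqI) (simp add: t e distrib_right sum.distrib sI)
  show "X * (Y + Z) = X * Y + X * Z"
    by (rule opm_eqI) (simp add: t e distrib_left sum.distrib sI)
  show "r *\<^sub>R X * Y = r *\<^sub>R (X * Y)" "X * r *\<^sub>R Y = r *\<^sub>R (X * Y)"
    by (rule opm_eqI, simp add: t e sI sum_distrib_left mult_ac)+
  show "dist X Y = norm (X - Y)" by (rule dist_opm_def)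
  show "sgn X = inverse (norm X) *\<^sub>R X" by (rule sgn_opm_def)
  show "(uniformity :: ('a opm \<times> 'a opm) filter) = (INF e\<in>{0 <..}. principal {(x, y). dist x y < e})"
    by (rule uniformity_opm_def)
  show "open (U :: 'a opm set) \<longleftrightarrow> (\<forall>x\<in>U. eventually (\<lambda>(x', y). x' = x \<longrightarrow> y \<in> U) uniformity)" for U
    by (rule open_opm_def)
  show "norm (r *\<^sub>R X) = \<bar>r\<bar> * norm X" unfolding scaleR_opm_def norm_cscale_opm by simp
  show "norm X = 0 \<longleftrightarrow> X = 0"
  proof
    assume "norm X = 0"
    then have "norm (entry X j k) \<le> 0" if "j \<in> supp X" "k \<in> supp X" for j k
      using norm_entry_le_spectral_norm[OF finite_supp that, of "entry X"] by (simp add: norm_opm_def)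
    then have "entry X j k = 0" for j k using entry_supp by (metis norm_le_zero_iff)
    then show "X = 0" by (intro opm_eqI) (simp add: e)
  next
    assume "X = 0"
    then have "X = cscale 0 X" by (intro opm_eqI) (simp add: e)
    then show "norm X = 0" using norm_cscale_opm[of 0 X] by simp
  qed
  note n = norm_opm_eq[OF I]
  show "norm (X + Y) \<le> norm X + norm Y"
  proof -
    have "spectral_norm I (entry (X + Y)) \<le> spectral_norm I (entry X) + spectral_norm I (entry Y)"
    proof (rule spectral_norm_leI)
      fix v :: "'a \<Rightarrow> complex" assume v: "L2_set (\<lambda>k. norm (v k)) I \<le> 1"
      have "L2_set (\<lambda>j. norm (\<Sum>k\<in>I. entry (X + Y) j k * v k)) I \<le>
          L2_set (\<lambda>j. norm (\<Sum>k\<in>I. entry X j k * v k) + norm (\<Sum>k\<in>I. entry Y j k * v k)) I"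
        by (intro L2_set_mono) (simp_all add: e distrib_right sum.distrib norm_triangle_ineq)
      also have "\<dots> \<le> L2_set (\<lambda>j. norm (\<Sum>k\<in>I. entry X j k * v k)) I + L2_set (\<lambda>j. norm (\<Sum>k\<in>I. entry Y j k * v k)) I"
        by (rule L2_set_triangle_ineq)
      also have "\<dots> \<le> spectral_norm I (entry X) + spectral_norm I (entry Y)"
        by (intro add_mono spectral_norm_upper I v)
      finally show "L2_set (\<lambda>j. norm (\<Sum>k\<in>I. entry (X + Y) j k * v k)) I \<le> \<dots>" .
    qed
    then show ?thesis by (simp add: n sI)
  qed
  show "norm (X * Y) \<le> norm X * norm Y"
  proof -
    have "spectral_norm I (entry (X * Y)) \<le> spectral_norm I (entry X) * spectral_norm I (entry Y)"
    proof (rule spectral_norm_leI)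
      fix v :: "'a \<Rightarrow> complex" assume v: "L2_set (\<lambda>k. norm (v k)) I \<le> 1"
      have "(\<Sum>k\<in>I. entry (X * Y) j k * v k) = (\<Sum>l\<in>I. entry X j l * (\<Sum>k\<in>I. entry Y l k * v k))" for j
      proof -
        have "(\<Sum>k\<in>I. entry (X * Y) j k * v k) = (\<Sum>k\<in>I. \<Sum>l\<in>I. entry X j l * (entry Y l k * v k))"
          by (simp add: t sI sum_distrib_right mult.assoc)
        also have "\<dots> = (\<Sum>l\<in>I. \<Sum>k\<in>I. entry X j l * (entry Y l k * v k))" by (rule sum.swap)
        finally show ?thesis by (simp add: sum_distrib_left)
      qed
      then have "L2_set (\<lambda>j. norm (\<Sum>k\<in>I. entry (X * Y) j k * v k)) I \<le>
          spectral_norm I (entry X) * L2_set (\<lambda>l. norm (\<Sum>k\<in>I. entry Y l k * v k)) I"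
        using spectral_norm_matvec[OF I, of "entry X" "\<lambda>l. \<Sum>k\<in>I. entry Y l k * v k"] by simp
      also have "\<dots> \<le> spectral_norm I (entry X) * spectral_norm I (entry Y)"
        by (intro mult_left_mono spectral_norm_upper spectral_norm_nonneg I v)
      finally show "L2_set (\<lambda>j. norm (\<Sum>k\<in>I. entry (X * Y) j k * v k)) I \<le> \<dots>" .
    qed
    then show ?thesis by (simp add: n sI)
  qed
qed

end

lemma cscale_add: "cscale c (X + Y) = cscale c X + cscale c Y"
  by (rule opm_eqI) (simp add: entry_plus algebra_simps)

lemma cscale_plus_left: "cscale (c + c') X = cscale c X + cscale c' X"
  by (rule opm_eqI) (simp add: entry_plus algebra_simps)

lemma cscale_of_real: "cscale (complex_of_real r) X = r *\<^sub>R X"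
  by (rule opm_eqI) (simp add: entry_scaleR)

lemma cscale_cscale: "cscale c (cscale c' X) = cscale (c * c') X"
  by (rule opm_eqI) (simp add: mult.assoc)

lemma cscale_mult_left: "cscale c X * Y = cscale c (X * Y)"
proof (rule opm_eqI)
  fix j k
  show "entry (cscale c X * Y) j k = entry (cscale c (X * Y)) j k"
    by (simp add: entry_times[where I = "supp Y"] sum_distrib_left mult.assoc)
qed

lemma cscale_mult_right: "X * cscale c Y = cscale c (X * Y)"
proof (rule opm_eqI)
  fix j k
  show "entry (X * cscale c Y) j k = entry (cscale c (X * Y)) j k"
    by (simp add: entry_times[where I = "supp X"] sum_distrib_left mult_ac)
qed

lemma bounded_linear_cscale_left: "bounded_linear (\<lambda>c. cscale c X)"
proof (rule bounded_linear_intro)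
  show "cscale (r *\<^sub>R c) X = r *\<^sub>R cscale c X" for r c
    by (rule opm_eqI) (simp add: entry_scaleR scaleR_conv_of_real)
  show "norm (cscale c X) \<le> norm c * norm X" for c by (simp add: norm_cscale_opm)
qed (rule cscale_plus_left)

section \<open>Matrices over a fixed index set as elements of the algebra\<close>

definition opm_of :: "'i set \<Rightarrow> 'i cmatrix \<Rightarrow> 'i opm" where
  "opm_of I X = Opm (\<lambda>j k. if j \<in> I \<and> k \<in> I then X j k else 0)"

lemma entry_opm_of: "finite I \<Longrightarrow> entry (opm_of I X) j k = (if j \<in> I \<and> k \<in> I then X j k else 0)"
  unfolding opm_of_def by (subst entry_Opm[of I]) (auto split: if_splits)

lemma supp_opm_of: "finite I \<Longrightarrow> supp (opm_of I X) \<subseteq> I"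
  by (auto simp: supp_def entry_opm_of split: if_splits)

lemma opm_of_cong: "(\<And>j k. j \<in> I \<Longrightarrow> k \<in> I \<Longrightarrow> X j k = Y j k) \<Longrightarrow> opm_of I X = opm_of I Y"
  unfolding opm_of_def by (intro arg_cong[where f = Opm] ext) auto

lemma opm_of_mult: "finite I \<Longrightarrow> opm_of I (mat_mul I X Y) = opm_of I X * opm_of I Y"
  by (rule opm_eqI) (auto simp: entry_times[where I = I] supp_opm_of entry_opm_of mat_mul_def intro!: sum.neutral)

lemma opm_of_diff: "finite I \<Longrightarrow> opm_of I (\<lambda>j k. X j k - Y j k) = opm_of I X - opm_of I Y"
  by (rule opm_eqI) (simp add: entry_opm_of entry_minus)

lemma opm_of_add: "finite I \<Longrightarrow> opm_of I (\<lambda>j k. X j k + Y j k) = opm_of I X + opm_of I Y"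
  by (rule opm_eqI) (simp add: entry_opm_of entry_plus)

lemma opm_of_cscale: "finite I \<Longrightarrow> opm_of I (\<lambda>j k. c * X j k) = cscale c (opm_of I X)"
  by (rule opm_eqI) (simp add: entry_opm_of)

lemma norm_opm_of: "finite I \<Longrightarrow> norm (opm_of I X) = spectral_norm I X"
  by (simp add: norm_opm_eq[OF _ supp_opm_of]) (rule spectral_norm_cong, simp add: entry_opm_of)

lemma opm_of_id_left: "finite I \<Longrightarrow> supp X \<subseteq> I \<Longrightarrow> opm_of I mat_id * X = X"
proof (rule opm_eqI)
  fix j k assume I: "finite I" "supp X \<subseteq> I"
  show "entry (opm_of I mat_id * X) j k = entry X j k"
  proof (cases "j \<in> I")
    case True
    then show ?thesis
    proof -
      have "entry (opm_of I mat_id * X) j k = (\<Sum>l\<in>I. if j = l then entry X l k else 0)"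
        unfolding entry_times[OF I(1) disjI2[OF I(2)]] using I True
        by (intro sum.cong) (auto simp: entry_opm_of mat_id_def)
      then show ?thesis using I True by simp
    qed
  next
    case False
    then have "entry X j k = 0" using I(2) entry_supp[of X j k] by auto
    then show ?thesis using I False by (simp add: entry_times[where I = I] supp_opm_of entry_opm_of)
  qed
qed

lemma opm_of_id_right: "finite I \<Longrightarrow> supp X \<subseteq> I \<Longrightarrow> X * opm_of I mat_id = X"
proof (rule opm_eqI)
  fix j k assume I: "finite I" "supp X \<subseteq> I"
  show "entry (X * opm_of I mat_id) j k = entry X j k"
  proof (cases "k \<in> I")
    case True
    then show ?thesis
    proof -
      have "entry (X * opm_of I mat_id) j k = (\<Sum>l\<in>I. if l = k then entry X j l else 0)"
        unfolding entry_times[OF I(1) disjI1[OF I(2)]] using I True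
        by (intro sum.cong) (auto simp: entry_opm_of mat_id_def)
      then show ?thesis using I True by simp
    qed
  next
    case False
    then have "entry X j k = 0" using I(2) entry_supp[of X j k] by auto
    then show ?thesis using I False by (simp add: entry_times[where I = I] supp_opm_of entry_opm_of)
  qed
qed

lemma opm_of_pow: "finite I \<Longrightarrow> opm_of I (mat_pow I X n) = ((*) (opm_of I X) ^^ n) (opm_of I mat_id)"
  by (induction n) (simp_all add: opm_of_mult)

definition matrix_unit :: "'i \<Rightarrow> 'i \<Rightarrow> 'i opm" where
  "matrix_unit j k = Opm (\<lambda>j' k'. of_bool (j' = j \<and> k' = k))"

lemma entry_matrix_unit: "entry (matrix_unit j k) j' k' = of_bool (j' = j \<and> k' = k)"
  unfolding matrix_unit_def by (subst entry_Opm[of "{j, k}"]) auto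

lemma entry_sum: "entry (sum f A) j k = (\<Sum>a\<in>A. entry (f a) j k)"
  by (induction A rule: infinite_finite_induct) (simp_all add: entry_zero entry_plus)

text \<open>On a fixed finite support the element is a finite combination of matrix units, so
  derivatives and infinite sums in norm reduce to those of the scalar entries.\<close>

lemma opm_decomposition:
  assumes I: "finite I" "supp X \<subseteq> I"
  shows "X = (\<Sum>j\<in>I. \<Sum>k\<in>I. cscale (entry X j k) (matrix_unit j k))"
proof (rule opm_eqI)
  fix j' k'
  have "entry (\<Sum>j\<in>I. \<Sum>k\<in>I. cscale (entry X j k) (matrix_unit j k)) j' k' =
      (\<Sum>j\<in>I. \<Sum>k\<in>I. if k = k' then (if j = j' then entry X j k else 0) else 0)"
    unfolding entry_sum by (intro sum.cong refl) (auto simp: entry_matrix_unit)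
  also have "\<dots> = (\<Sum>j\<in>I. if j = j' then (if k' \<in> I then entry X j k' else 0) else 0)"
    using I by (intro sum.cong refl) (simp add: sum.delta)
  also have "\<dots> = (if j' \<in> I \<and> k' \<in> I then entry X j' k' else 0)"
    using I by (simp add: sum.delta)
  also have "\<dots> = entry X j' k'" using I entry_supp[of X j' k'] by auto
  finally show "entry X j' k' = entry (\<Sum>j\<in>I. \<Sum>k\<in>I. cscale (entry X j k) (matrix_unit j k)) j' k'" ..
qed

lemma opm_has_vector_derivative:
  assumes I: "finite I" and F: "\<And>s. supp (F s) \<subseteq> I" "supp F' \<subseteq> I"
    and der: "\<And>j k. j \<in> I \<Longrightarrow> k \<in> I \<Longrightarrow> ((\<lambda>s. entry (F s) j k) has_vector_derivative entry F' j k) (at s)"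
  shows "(F has_vector_derivative F') (at s)"
proof -
  have "((\<lambda>s. \<Sum>j\<in>I. \<Sum>k\<in>I. cscale (entry (F s) j k) (matrix_unit j k)) has_vector_derivative
      (\<Sum>j\<in>I. \<Sum>k\<in>I. cscale (entry F' j k) (matrix_unit j k))) (at s)"
    by (intro has_vector_derivative_sum bounded_linear.has_vector_derivative[OF bounded_linear_cscale_left] der)
  then show ?thesis
    using opm_decomposition[OF I F(1)] opm_decomposition[OF I F(2)] by simp
qed

lemma opm_has_sum:
  assumes I: "finite I" and F: "\<And>b. supp (F b) \<subseteq> I" "supp X \<subseteq> I"
    and sum: "\<And>j k. j \<in> I \<Longrightarrow> k \<in> I \<Longrightarrow> ((\<lambda>b. entry (F b) j k) has_sum entry X j k) A"
  shows "(F has_sum X) A"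
proof -
  have fin: "((\<lambda>b. \<Sum>j\<in>J. f j b) has_sum (\<Sum>j\<in>J. g j)) A"
    if "finite J" "\<And>j. j \<in> J \<Longrightarrow> (f j has_sum g j) A" for J :: "'a set" and f :: "'a \<Rightarrow> 'b \<Rightarrow> 'a opm" and g
    using that by (induction J rule: finite_induct) (auto intro!: has_sum_add)
  have "((\<lambda>b. \<Sum>j\<in>I. \<Sum>k\<in>I. cscale (entry (F b) j k) (matrix_unit j k)) has_sum
      (\<Sum>j\<in>I. \<Sum>k\<in>I. cscale (entry X j k) (matrix_unit j k))) A"
    by (intro fin I has_sum_bounded_linear[OF bounded_linear_cscale_left] sum)
  then show ?thesis
    using opm_decomposition[OF I F(1)] opm_decomposition[OF I F(2)] by simp
qed

lemma supp_mult: "supp X \<subseteq> I \<Longrightarrow> supp Y \<subseteq> I \<Longrightarrow> supp (X * Y) \<subseteq> I"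
proof
  fix j assume I: "supp X \<subseteq> I" "supp Y \<subseteq> I" and "j \<in> supp (X * Y)"
  then obtain k where "entry (X * Y) j k \<noteq> 0 \<or> entry (X * Y) k j \<noteq> 0" by (auto simp: supp_def)
  then obtain l where "entry X j l * entry Y l k \<noteq> 0 \<or> entry X k l * entry Y l j \<noteq> 0"
    unfolding entry_times_supp by (metis (no_types, lifting) sum.not_neutral_contains_not_neutral)
  then show "j \<in> I" using I entry_supp by (metis mult_zero_left mult_zero_right subsetD)
qed

section \<open>Propagators of Hermitian matrices as unitary flows\<close>

definition generator :: "'i set \<Rightarrow> real \<Rightarrow> 'i cmatrix \<Rightarrow> 'i opm" where
  "generator I h X = cscale (\<i> * complex_of_real (1 / h)) (opm_of I X)"

context
  fixes I :: "'i set" and h :: real and X :: "'i cmatrix"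
  assumes I: "finite I" and herm: "\<And>j k. j \<in> I \<Longrightarrow> k \<in> I \<Longrightarrow> X k j = cnj (X j k)"
begin

private abbreviation "x \<equiv> generator I h X"
private abbreviation "e \<equiv> opm_of I mat_id"
private abbreviation "P \<tau> \<equiv> opm_of I (propagator I h X \<tau>)"
text \<open>Powers are iterated multiplications starting from the idempotent, because the algebra
  has no unit to serve as zeroth power.\<close>

private definition pw :: "nat \<Rightarrow> 'i opm" where "pw n = ((*) x ^^ n) e"

private lemma supp_x: "supp x \<subseteq> I"
  using supp_opm_of[OF I, of X] by (auto simp: generator_def supp_def)

private lemma pw_Suc: "pw (Suc n) = x * pw n"
  by (simp add: pw_def)

private lemma pw_0: "pw 0 = e"
  by (simp add: pw_def)

private lemma supp_pw: "supp (pw n) \<subseteq> I"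
  by (induction n) (simp_all add: pw_Suc pw_0 supp_opm_of I supp_mult supp_x)

private lemma pw_commute: "x * pw n = pw n * x"
proof (induction n)
  case 0
  show ?case by (simp add: pw_0 opm_of_id_left opm_of_id_right I supp_x)
next
  case (Suc n)
  show ?case unfolding pw_Suc mult.assoc Suc[symmetric] ..
qed

private lemma norm_pw: "norm (pw n) \<le> norm x ^ n * norm e"
proof (induction n)
  case (Suc n)
  have "norm (pw (Suc n)) \<le> norm x * norm (pw n)" unfolding pw_Suc by (rule norm_mult_ineq)
  also have "\<dots> \<le> norm x * (norm x ^ n * norm e)" using Suc by (intro mult_left_mono) auto
  finally show ?case by simp
qed (simp add: pw_0)

private lemma entry_pw_le: "norm (entry (pw n) j k) \<le> norm x ^ n * norm e"
proof (cases "j \<in> I \<and> k \<in> I")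
  case True
  then have "norm (entry (pw n) j k) \<le> norm (pw n)"
    using norm_entry_le_spectral_norm[OF I, of j k "entry (pw n)"] by (simp add: norm_opm_eq[OF I supp_pw])
  then show ?thesis using norm_pw[of n] by simp
next
  case False
  then have "entry (pw n) j k = 0" using entry_supp[of "pw n" j k] supp_pw[of n] by auto
  then show ?thesis by simp
qed

private definition coeff :: "'i \<Rightarrow> 'i \<Rightarrow> nat \<Rightarrow> complex" where
  "coeff j k n = entry (pw n) j k / fact n"

private lemma summable_coeff: "summable (\<lambda>n. coeff j k n * z ^ n)"
proof (rule summable_comparison_test)
  show "summable (\<lambda>n. norm e * (inverse (fact n) * (norm x * norm z) ^ n))"
    by (intro summable_mult summable_exp)
  show "\<exists>N. \<forall>n\<ge>N. norm (coeff j k n * z ^ n) \<le> norm e * (inverse (fact n) * (norm x * norm z) ^ n)"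
  proof (intro exI[of _ 0] allI impI)
    fix n
    have "norm (coeff j k n * z ^ n) = norm (entry (pw n) j k) * (norm z ^ n / fact n)"
      by (simp add: coeff_def norm_mult norm_divide norm_power)
    also have "\<dots> \<le> (norm x ^ n * norm e) * (norm z ^ n / fact n)"
      by (intro mult_right_mono entry_pw_le) auto
    finally show "norm (coeff j k n * z ^ n) \<le> norm e * (inverse (fact n) * (norm x * norm z) ^ n)"
      by (simp add: power_mult_distrib divide_inverse mult_ac)
  qed
qed

private lemma opm_of_pow_scaled:
  "opm_of I (mat_pow I (\<lambda>j k. \<i> * complex_of_real (\<tau> / h) * X j k) n) = cscale (complex_of_real \<tau> ^ n) (pw n)"
proof (induction n)
  case 0
  have "cscale 1 e = e" by (rule opm_eqI) simp
  then show ?case by (simp add: pw_0)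
next
  case (Suc n)
  have "opm_of I (\<lambda>j k. \<i> * complex_of_real (\<tau> / h) * X j k) = cscale (complex_of_real \<tau>) x"
    unfolding opm_of_cscale[OF I] generator_def cscale_cscale by (simp add: mult_ac)
  then show ?case using Suc by (simp add: opm_of_mult[OF I] cscale_mult_left cscale_mult_right cscale_cscale pw_Suc mult_ac)
qed

private lemma entry_P:
  assumes "j \<in> I" "k \<in> I"
  shows "entry (P \<tau>) j k = (\<Sum>n. coeff j k n * complex_of_real \<tau> ^ n)"
proof -
  have "mat_pow I (\<lambda>j k. \<i> * complex_of_real (\<tau> / h) * X j k) n j k = complex_of_real \<tau> ^ n * entry (pw n) j k" for n
    using arg_cong[OF opm_of_pow_scaled[of \<tau> n], of "\<lambda>Z. entry Z j k"] assms by (simp add: entry_opm_of I)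
  then show ?thesis using assms by (simp add: entry_opm_of I propagator_def mat_exp_def coeff_def mult.commute)
qed

text \<open>Formal differentiation cancels n + 1 against the factorial and leaves the next power of
  the generator. The differentiated exponential series is thus the series of the product.\<close>

private lemma entry_x_P:
  assumes "j \<in> I" "k \<in> I"
  shows "entry (x * P \<tau>) j k = (\<Sum>n. diffs (coeff j k) n * complex_of_real \<tau> ^ n)"
proof -
  have d: "diffs (coeff j k) n = (\<Sum>l\<in>I. entry x j l * coeff l k n)" for n
  proof -
    have "diffs (coeff j k) n = entry (x * pw n) j k / fact n"
      by (simp add: diffs_def coeff_def pw_Suc del: of_nat_Suc)
    also have "\<dots> = (\<Sum>l\<in>I. entry x j l * entry (pw n) l k) / fact n"
      by (simp add: entry_times[OF I] supp_x)
    finally show ?thesis by (simp add: coeff_def sum_divide_distrib)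
  qed
  have "entry (x * P \<tau>) j k = (\<Sum>l\<in>I. entry x j l * (\<Sum>n. coeff l k n * complex_of_real \<tau> ^ n))"
    using assms by (simp add: entry_times[OF I] supp_x entry_P)
  also have "\<dots> = (\<Sum>l\<in>I. \<Sum>n. entry x j l * (coeff l k n * complex_of_real \<tau> ^ n))"
    by (intro sum.cong refl suminf_mult[symmetric] summable_coeff)
  also have "\<dots> = (\<Sum>n. \<Sum>l\<in>I. entry x j l * (coeff l k n * complex_of_real \<tau> ^ n))"
    by (intro suminf_sum[symmetric] summable_mult summable_coeff)
  finally show ?thesis by (simp add: d sum_distrib_right mult.assoc)
qed

lemma propagator_has_vector_derivative:
  "((\<lambda>\<tau>. opm_of I (propagator I h X \<tau>)) has_vector_derivative generator I h X * opm_of I (propagator I h X s)) (at s)"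
proof (rule opm_has_vector_derivative[OF I])
  show "supp (P s) \<subseteq> I" for s by (rule supp_opm_of[OF I])
  show "supp (x * P s) \<subseteq> I" by (intro supp_mult supp_x supp_opm_of I)
  fix j k assume jk: "j \<in> I" "k \<in> I"
  have "((\<lambda>z. \<Sum>n. coeff j k n * z ^ n) has_field_derivative (\<Sum>n. diffs (coeff j k) n * complex_of_real s ^ n)) (at (complex_of_real s))"
    by (rule termdiffs_strong_converges_everywhere) (rule summable_coeff)
  from has_vector_derivative_real_field[OF this]
  show "((\<lambda>s. entry (P s) j k) has_vector_derivative entry (x * P s) j k) (at s)"
    by (simp add: entry_P[OF jk] entry_x_P[OF jk])
qed

lemma propagator_commute:
  "generator I h X * opm_of I (propagator I h X s) = opm_of I (propagator I h X s) * generator I h X"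
proof (rule opm_eqI)
  fix j k
  show "entry (x * P s) j k = entry (P s * x) j k"
  proof (cases "j \<in> I \<and> k \<in> I")
    case True
    then have jk: "j \<in> I" "k \<in> I" by auto
    have d: "diffs (coeff j k) n = (\<Sum>l\<in>I. coeff j l n * entry x l k)" for n
    proof -
      have "diffs (coeff j k) n = entry (pw n * x) j k / fact n"
        by (simp add: diffs_def coeff_def pw_Suc pw_commute del: of_nat_Suc)
      also have "\<dots> = (\<Sum>l\<in>I. entry (pw n) j l * entry x l k) / fact n"
        by (simp add: entry_times[OF I] supp_x)
      finally show ?thesis by (simp add: coeff_def sum_divide_distrib)
    qed
    have "entry (P s * x) j k = (\<Sum>l\<in>I. (\<Sum>n. coeff j l n * complex_of_real s ^ n) * entry x l k)"
      using jk by (simp add: entry_times[OF I] supp_x entry_P)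
    also have "\<dots> = (\<Sum>l\<in>I. \<Sum>n. (coeff j l n * complex_of_real s ^ n) * entry x l k)"
      by (intro sum.cong refl suminf_mult2 summable_coeff)
    also have "\<dots> = (\<Sum>n. \<Sum>l\<in>I. (coeff j l n * complex_of_real s ^ n) * entry x l k)"
      by (intro suminf_sum[symmetric] summable_mult2 summable_coeff)
    also have "\<dots> = entry (x * P s) j k"
      unfolding entry_x_P[OF jk] d by (simp add: sum_distrib_right sum_distrib_left mult_ac)
    finally show ?thesis ..
  next
    case False
    have "supp (x * P s) \<subseteq> I" "supp (P s * x) \<subseteq> I" by (intro supp_mult supp_x supp_opm_of I)+
    then have "entry (x * P s) j k = 0" "entry (P s * x) j k = 0"
      using False entry_supp[of "x * P s" j k] entry_supp[of "P s * x" j k] by auto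
    then show ?thesis by simp
  qed
qed

lemma propagator_zero: "opm_of I (propagator I h X 0) = opm_of I mat_id"
proof (rule opm_eqI)
  fix j k
  show "entry (P 0) j k = entry e j k"
  proof (cases "j \<in> I \<and> k \<in> I")
    case True
    then have "entry (P 0) j k = coeff j k 0" by (simp add: entry_P)
    then show ?thesis by (simp add: coeff_def pw_0)
  qed (auto simp: entry_opm_of I)
qed

private lemma P_minus_deriv: "((\<lambda>s. P (- s)) has_vector_derivative - (P (- s) * x)) (at s)"
proof -
  have "((\<lambda>s. P (- s)) has_vector_derivative (-1) *\<^sub>R (x * P (- s))) (at s)"
    by (rule vector_diff_chain_at[of uminus "-1" s P, unfolded o_def])
       (auto intro!: derivative_eq_intros propagator_has_vector_derivative)
  then show ?thesis by (simp add: propagator_commute)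
qed

text \<open>As a function of r the left side has derivative zero. The group law and the inverse
  follow from this constancy, without multiplying power series.\<close>

private lemma P_shift_constant: "P (- r) * P (s + r) = P s"
proof -
  let ?F = "\<lambda>r. P (- r) * P (s + r)"
  have d: "(?F has_vector_derivative 0) (at r)" for r
  proof -
    have "((\<lambda>r. P (s + r)) has_vector_derivative 1 *\<^sub>R (x * P (s + r))) (at r)"
      by (rule vector_diff_chain_at[of "\<lambda>r. s + r" 1 r P, unfolded o_def])
         (auto intro!: derivative_eq_intros propagator_has_vector_derivative)
    from has_vector_derivative_mult[OF P_minus_deriv[of r] this]
    show ?thesis by (simp add: mult.assoc)
  qed
  obtain c where "\<And>r. ?F r = c"
    using has_vector_derivative_zero_constant[OF convex_UNIV, of ?F] d by auto
  then have "?F r = ?F 0" by metis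
  also have "\<dots> = P s" by (simp add: propagator_zero opm_of_id_left I supp_opm_of)
  finally show ?thesis .
qed

lemma propagator_add: "opm_of I (propagator I h X (s + r)) = opm_of I (propagator I h X s) * opm_of I (propagator I h X r)"
proof -
  have inv: "P s * P (- s) = e" using P_shift_constant[of "-s" 0] by (simp add: propagator_zero)
  have "P s * P r = P s * (P (- s) * P (r + s))" by (simp add: P_shift_constant)
  also have "\<dots> = e * P (r + s)" by (simp add: mult.assoc[symmetric] inv)
  also have "\<dots> = P (s + r)" by (simp add: opm_of_id_left I supp_opm_of add.commute)
  finally show ?thesis ..
qed

private lemma entry_pw_adjoint: "cnj (entry (pw n) j k) = (-1) ^ n * entry (pw n) k j"
proof (induction n arbitrary: j k)
  case 0
  show ?case by (auto simp: pw_0 entry_opm_of I mat_id_def)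
next
  case (Suc n)
  have xa: "cnj (entry x j l) = - entry x l j" for j l
    using herm[of j l] by (auto simp: generator_def entry_opm_of I)
  have "cnj (entry (pw (Suc n)) j k) = (\<Sum>l\<in>I. - entry x l j * ((-1) ^ n * entry (pw n) k l))"
    by (simp add: pw_Suc entry_times[OF I] supp_x xa Suc)
  also have "\<dots> = (-1) ^ Suc n * (\<Sum>l\<in>I. entry (pw n) k l * entry x l j)"
    by (simp add: sum_distrib_left mult_ac sum_negf)
  also have "\<dots> = (-1) ^ Suc n * entry (pw n * x) k j" by (simp add: entry_times[OF I] supp_x)
  finally show ?case by (simp add: pw_Suc pw_commute)
qed

text \<open>The factor i makes the generator skew-Hermitian, so the adjoint of the propagator is the
  one for \<open>- s\<close>. By the group law that is its inverse on the corner, and an isometry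
  has norm at most 1.\<close>

lemma propagator_norm: "norm (opm_of I (propagator I h X s)) \<le> 1"
proof -
  have adj: "cnj (entry (P s) l j) = entry (P (- s)) j l" if "j \<in> I" "l \<in> I" for j l
  proof -
    have "(\<lambda>n. coeff l j n * complex_of_real s ^ n) sums entry (P s) l j"
      using that summable_sums[OF summable_coeff[of l j "complex_of_real s"]] by (simp add: entry_P)
    then have "(\<lambda>n. cnj (coeff l j n * complex_of_real s ^ n)) sums cnj (entry (P s) l j)" by (simp only: sums_cnj)
    also have "(\<lambda>n. cnj (coeff l j n * complex_of_real s ^ n)) = (\<lambda>n. coeff j l n * complex_of_real (- s) ^ n)"
      by (rule ext) (simp add: coeff_def entry_pw_adjoint power_minus[of "complex_of_real s"])
    finally show ?thesis using that by (simp add: entry_P sums_iff)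
  qed
  have "spectral_norm I (entry (P s)) \<le> 1"
  proof (rule spectral_norm_isometry[OF I])
    fix j k assume jk: "j \<in> I" "k \<in> I"
    have "(\<Sum>l\<in>I. cnj (entry (P s) l j) * entry (P s) l k) = (\<Sum>l\<in>I. entry (P (- s)) j l * entry (P s) l k)"
      using jk by (intro sum.cong) (auto simp: adj)
    also have "\<dots> = entry (P (- s) * P s) j k" by (simp add: entry_times[OF I] supp_opm_of I)
    also have "P (- s) * P s = e" using propagator_add[of "-s" s] by (simp add: propagator_zero)
    finally show "(\<Sum>l\<in>I. cnj (entry (P s) l j) * entry (P s) l k) = of_bool (j = k)"
      using jk by (simp add: entry_opm_of I mat_id_def)
  qed
  then show ?thesis by (simp add: norm_opm_eq[OF I supp_opm_of[OF I]])
qed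

lemma unitary_flow_propagator:
  "unitary_flow (\<lambda>s. opm_of I (propagator I h X s)) (generator I h X) (opm_of I mat_id)"
  by unfold_locales
    (rule propagator_has_vector_derivative propagator_commute propagator_norm propagator_add propagator_zero)+

end

section \<open>The discretized Schroedinger equation\<close>

definition symplectic :: "(real ^ 'd) \<times> (real ^ 'd) \<Rightarrow> (real ^ 'd) \<times> (real ^ 'd) \<Rightarrow> real" where
  "symplectic b c = fst b \<bullet> snd c - fst c \<bullet> snd b"

text \<open>The Weyl relations. Only one intermediate node contributes to the product, and the phase
  is what remains when the two midpoint evaluations are combined into one.\<close>

lemma weyl_matrix_mult:
  fixes b c :: "(real ^ 'd) \<times> (real ^ 'd)"
  assumes N: "N \<ge> 1" and b: "b \<in> int_lattice" and c: "c \<in> int_lattice"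
    and j: "j \<in> grid N" and l: "l \<in> grid N"
  shows "(\<Sum>k\<in>grid N. weyl_matrix N b j k * weyl_matrix N c k l) =
    cis (- pi * symplectic b c / real N) * weyl_matrix N (b + c) j l"
proof -
  let ?n = "real N"
  obtain p q p' q' where bc: "b = (p, q)" "c = (p', q')" by (metis surj_pair)
  have lat: "p \<in> int_lattice" "q \<in> int_lattice" "p' \<in> int_lattice" "q' \<in> int_lattice"
    using b c by (auto simp: bc int_lattice_Pair_iff)
  from ex1E[OF grid_shift[OF N lat(4), of l]] obtain k where k: "k \<in> grid N"
    and kz: "node N k - (node N l - (1 / ?n) *\<^sub>R q') \<in> int_lattice"
    and uniq: "\<And>k'. k' \<in> grid N \<Longrightarrow> node N k' - (node N l - (1 / ?n) *\<^sub>R q') \<in> int_lattice \<Longrightarrow> k' = k"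
    by metis
  \<comment> \<open>The lattice vector by which the shifted point differs from its representative on
    the grid. It affects neither membership in the lattice nor characters of integral
    frequency.\<close>
  define z where "z = node N k - (node N l - (1 / ?n) *\<^sub>R q')"
  have xk: "node N k = z + (node N l - (1 / ?n) *\<^sub>R q')" by (simp add: z_def)
  have "(\<Sum>k'\<in>grid N. weyl_matrix N b j k' * weyl_matrix N c k' l) = (\<Sum>k'\<in>{k}. weyl_matrix N b j k' * weyl_matrix N c k' l)"
  proof (rule sum.mono_neutral_right)
    show "\<forall>i\<in>grid N - {k}. weyl_matrix N b j i * weyl_matrix N c i l = 0"
      using uniq by (auto simp: weyl_matrix_def bc)
  qed (use k in auto)
  also have "\<dots> = weyl_matrix N b j k * character p' (node N l - (1 / (2 * ?n)) *\<^sub>R q')"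
    using k l kz by (simp add: weyl_matrix_def bc)
  also have "weyl_matrix N b j k =
      (if node N j - (node N l - (1 / ?n) *\<^sub>R (q + q')) \<in> int_lattice
       then character p (node N l - (1 / ?n) *\<^sub>R q' - (1 / (2 * ?n)) *\<^sub>R q) else 0)"
  proof -
    have zl: "z \<in> int_lattice" using kz by (simp add: z_def)
    have eq: "node N j - (node N k - (1 / ?n) *\<^sub>R q) + z = node N j - (node N l - (1 / ?n) *\<^sub>R (q + q'))"
      by (simp add: xk scaleR_add_right)
    have "node N j - (node N k - (1 / ?n) *\<^sub>R q) \<in> int_lattice \<longleftrightarrow>
        node N j - (node N l - (1 / ?n) *\<^sub>R (q + q')) \<in> int_lattice"
      unfolding eq[symmetric] int_lattice_add_iff[OF zl] ..
    moreover have "character p (node N k - (1 / (2 * ?n)) *\<^sub>R q) =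
        character p (node N l - (1 / ?n) *\<^sub>R q' - (1 / (2 * ?n)) *\<^sub>R q)"
      using character_add_right[of p z "node N l - (1 / ?n) *\<^sub>R q' - (1 / (2 * ?n)) *\<^sub>R q"] lat(1) kz
      by (simp add: xk z_def[symmetric] add_diff_eq)
    ultimately show ?thesis using j k by (simp add: weyl_matrix_def bc)
  qed
  also have "\<dots> * character p' (node N l - (1 / (2 * ?n)) *\<^sub>R q') =
      cis (- pi * symplectic b c / ?n) * weyl_matrix N (b + c) j l"
  proof -
    have "character p (node N l - (1 / ?n) *\<^sub>R q' - (1 / (2 * ?n)) *\<^sub>R q) * character p' (node N l - (1 / (2 * ?n)) *\<^sub>R q') =
        cis (- pi * symplectic b c / ?n) * character (p + p') (node N l - (1 / (2 * ?n)) *\<^sub>R (q + q'))"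
    proof -
      have "2 * pi * (p \<bullet> (node N l - (1 / ?n) *\<^sub>R q' - (1 / (2 * ?n)) *\<^sub>R q)) + 2 * pi * (p' \<bullet> (node N l - (1 / (2 * ?n)) *\<^sub>R q')) =
          - pi * symplectic b c / ?n + 2 * pi * ((p + p') \<bullet> (node N l - (1 / (2 * ?n)) *\<^sub>R (q + q')))"
        using N by (simp add: symplectic_def bc inner_add_left inner_add_right inner_diff_right field_simps)
      then show ?thesis unfolding character_def cis_mult by simp
    qed
    then show ?thesis using j l by (simp add: weyl_matrix_def bc)
  qed
  finally show ?thesis .
qed

text \<open>The matrix is a permutation matrix with entries of modulus 1: each column has one
  nonzero entry, and different columns have theirs in different rows because nodes are distinct
  modulo the lattice.\<close>

lemma weyl_matrix_isometry:
  fixes b :: "(real ^ 'd) \<times> (real ^ 'd)"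
  assumes N: "N \<ge> 1" and b: "b \<in> int_lattice" and j: "j \<in> grid N" and k: "k \<in> grid N"
  shows "(\<Sum>l\<in>grid N. cnj (weyl_matrix N b l j) * weyl_matrix N b l k) = of_bool (j = k)"
proof -
  have q: "snd b \<in> int_lattice" using b by (cases b) (simp add: int_lattice_Pair_iff)
  from ex1E[OF grid_shift[OF N q, of j]] obtain l where l: "l \<in> grid N"
    "node N l - (node N j - (1 / real N) *\<^sub>R snd b) \<in> int_lattice"
    and uniq: "\<And>l'. l' \<in> grid N \<Longrightarrow> node N l' - (node N j - (1 / real N) *\<^sub>R snd b) \<in> int_lattice \<Longrightarrow> l' = l"
    by metis
  have "(\<Sum>l'\<in>grid N. cnj (weyl_matrix N b l' j) * weyl_matrix N b l' k) =
      (\<Sum>l'\<in>{l}. cnj (weyl_matrix N b l' j) * weyl_matrix N b l' k)"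
  proof (rule sum.mono_neutral_right)
    show "\<forall>i\<in>grid N - {l}. cnj (weyl_matrix N b i j) * weyl_matrix N b i k = 0"
      using uniq by (auto simp: weyl_matrix_def)
  qed (use l in auto)
  also have "\<dots> = cnj (weyl_matrix N b l j) * weyl_matrix N b l k" by simp
  also have "\<dots> = of_bool (j = k)"
  proof (cases "j = k")
    case True
    then show ?thesis using l k by (simp add: weyl_matrix_def)
  next
    case False
    have "node N l - (node N k - (1 / real N) *\<^sub>R snd b) \<notin> int_lattice"
    proof
      assume "node N l - (node N k - (1 / real N) *\<^sub>R snd b) \<in> int_lattice"
      from int_lattice_diff[OF this l(2)] have "node N j - node N k \<in> int_lattice" by simp
      then show False using node_diff_int_lattice[OF N j k] False by simp
    qed
    then show ?thesis using False by (simp add: weyl_matrix_def)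
  qed
  finally show ?thesis .
qed

definition weyl_op :: "nat \<Rightarrow> (real ^ 'd) \<times> (real ^ 'd) \<Rightarrow> ('d::finite \<Rightarrow> nat) opm" where
  "weyl_op N b = opm_of (grid N) (weyl_matrix N b)"

lemma weyl_op_mult:
  assumes N: "N \<ge> 1" and b: "b \<in> int_lattice" and c: "c \<in> int_lattice"
  shows "weyl_op N b * weyl_op N c = cscale (cis (- pi * symplectic b c / real N)) (weyl_op N (b + c))"
proof -
  have "weyl_op N b * weyl_op N c = opm_of (grid N) (mat_mul (grid N) (weyl_matrix N b) (weyl_matrix N c))"
    by (simp add: weyl_op_def opm_of_mult)
  also have "\<dots> = opm_of (grid N) (\<lambda>j k. cis (- pi * symplectic b c / real N) * weyl_matrix N (b + c) j k)"
    by (rule opm_of_cong) (simp only: mat_mul_def weyl_matrix_mult[OF assms])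
  finally show ?thesis by (simp add: opm_of_cscale weyl_op_def)
qed

lemma abs_symplectic_le: "\<bar>symplectic b c\<bar> \<le> 2 * l1_norm b * l1_norm c"
proof -
  have l1: "norm x \<le> l1_norm x" for x :: "(real ^ 'd) \<times> (real ^ 'd)"
    unfolding l1_norm_def by (rule norm_le_l1)
  have *: "\<bar>fst x \<bullet> snd y\<bar> \<le> l1_norm x * l1_norm y" for x y :: "(real ^ 'd) \<times> (real ^ 'd)"
  proof -
    have "norm (fst x) \<le> l1_norm x" "norm (snd y) \<le> l1_norm y"
      using norm_fst_le[of "fst x" "snd x"] norm_snd_le[of "snd y" "fst y"] l1[of x] l1[of y] by auto
    then have "norm (fst x) * norm (snd y) \<le> l1_norm x * l1_norm y" by (intro mult_mono l1_norm_nonneg) auto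
    with Cauchy_Schwarz_ineq2[of "fst x" "snd y"] show ?thesis by linarith
  qed
  have "\<bar>fst b \<bullet> snd c\<bar> \<le> l1_norm b * l1_norm c" "\<bar>fst c \<bullet> snd b\<bar> \<le> l1_norm b * l1_norm c"
    using *[of b c] *[of c b] by (simp_all add: mult.commute)
  then have "\<bar>symplectic b c\<bar> \<le> 2 * (l1_norm b * l1_norm c)"
    unfolding symplectic_def by linarith
  then show ?thesis by (simp only: mult.assoc)
qed

text \<open>The two orders of multiplication differ by twice the sine of pi times the symplectic
  form over N, up to a factor of modulus 1. With the sine at most its argument and the form at most
  2 |b| |c|, this is at most 4 pi/N = 8 pi^2 h times |b| |c|, whence the value of
  \<open>\<kappa>\<close>.\<close>

lemma weyl_algebra_weyl_op:
  assumes N: "N \<ge> 1"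
  shows "weyl_algebra cscale (weyl_op N :: (real ^ 'd) \<times> (real ^ 'd) \<Rightarrow> ('d::finite \<Rightarrow> nat) opm) (planck N) (8 * pi\<^sup>2)"
proof
  show "planck N > 0" using N by (simp add: planck_def)
  fix b c :: "(real ^ 'd) \<times> (real ^ 'd)"
  assume b: "b \<in> int_lattice"
  show "norm (weyl_op N b) \<le> 1"
    unfolding weyl_op_def norm_opm_of[OF finite_grid]
    by (rule spectral_norm_isometry[OF finite_grid weyl_matrix_isometry[OF N b]])
  assume c: "c \<in> int_lattice"
  let ?s = "symplectic b c / real N"
  have "cis (pi * ?s) * cis (- pi * ?s) = 1" by (simp add: cis_mult)
  then have "weyl_op N (b + c) = cscale (cis (pi * ?s)) (weyl_op N b * weyl_op N c)"
    unfolding weyl_op_mult[OF N b c] cscale_cscale by (intro opm_eqI) simp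
  then show "\<exists>\<theta>. norm \<theta> = 1 \<and> weyl_op N (b + c) = cscale \<theta> (weyl_op N b * weyl_op N c)"
    by (intro exI[of _ "cis (pi * ?s)"]) simp
  define l where "l = cis (- pi * ?s) - cis (pi * ?s)"
  have "symplectic c b = - symplectic b c" by (simp add: symplectic_def)
  then have commutator: "commutator (weyl_op N b) (weyl_op N c) = cscale l (weyl_op N (b + c))"
    unfolding commutator_def weyl_op_mult[OF N b c] weyl_op_mult[OF N c b] l_def
    by (intro opm_eqI) (simp add: entry_minus add.commute left_diff_distrib)
  have "l = - (2 * \<i> * complex_of_real (sin (pi * ?s)))"
    by (simp add: l_def complex_eq_iff)
  then have "norm l = 2 * \<bar>sin (pi * ?s)\<bar>" by (simp add: norm_mult)
  also have "\<dots> \<le> 2 * \<bar>pi * ?s\<bar>" by (intro mult_left_mono abs_sin_x_le_abs_x) auto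
  also have "\<dots> = 2 * pi / real N * \<bar>symplectic b c\<bar>" by (simp add: abs_mult)
  also have "\<dots> \<le> 2 * pi / real N * (2 * l1_norm b * l1_norm c)"
    by (intro mult_left_mono abs_symplectic_le) auto
  also have "\<dots> = planck N * (8 * pi\<^sup>2) * l1_norm b * l1_norm c"
    using N by (simp add: planck_def power2_eq_square field_simps)
  finally show "\<exists>l. norm l \<le> planck N * (8 * pi\<^sup>2) * l1_norm b * l1_norm c \<and>
      commutator (weyl_op N b) (weyl_op N c) = cscale l (weyl_op N (b + c))" using commutator by blast
qed (auto simp: cscale_mult_left cscale_mult_right cscale_add cscale_of_real cscale_cscale cscale_plus_left norm_cscale_opm)

context weyl_algebra
begin

lemma symbol_mono: "symbol S X \<Longrightarrow> S \<le> S' \<Longrightarrow> symbol S' X"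
  unfolding symbol_def by (meson order_trans)

lemma symbol_single:
  assumes b: "b \<in> int_lattice"
  shows "symbol (norm c * weight b ^ 4) (cscale c (U b))"
proof -
  let ?f = "\<lambda>b'. if b' = b then c else 0"
  have cs0: "cscale 0 X = 0" for X using norm_cscale[of 0 X] by simp
  have "((\<lambda>b'. cscale (?f b') (U b')) has_sum (\<Sum>b'\<in>{b}. cscale (?f b') (U b'))) int_lattice"
    by (rule has_sum_finite_neutralI[where B = "{b}"]) (use b cs0 in auto)
  moreover have "((\<lambda>b'. norm (?f b') * weight b' ^ 4) has_sum (\<Sum>b'\<in>{b}. norm (?f b') * weight b' ^ 4)) int_lattice"
    by (rule has_sum_finite_neutralI[where B = "{b}"]) (use b in auto)
  ultimately show ?thesis unfolding symbol_def by (intro exI[of _ ?f] exI[of _ "norm c * weight b ^ 4"]) simp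
qed

lemma symbol_zero: "symbol 0 0"
  unfolding symbol_def
proof (intro exI conjI)
  have cs0: "cscale 0 X = 0" for X using norm_cscale[of 0 X] by simp
  show "((\<lambda>b. cscale ((\<lambda>_. 0) b) (U b)) has_sum 0) int_lattice" by (simp add: cs0)
  show "((\<lambda>b. norm ((\<lambda>_. 0 :: complex) b) * weight b ^ 4) has_sum 0) (int_lattice :: 'v set)" by simp
qed simp

lemma symbol_sum:
  assumes "finite J" "\<And>i. i \<in> J \<Longrightarrow> symbol (S i) (X i)"
  shows "symbol (\<Sum>i\<in>J. S i) (\<Sum>i\<in>J. X i)"
  using assms by (induction J rule: finite_induct) (auto intro: symbol_zero symbol_add)

lemma symbol_cscale:
  assumes "symbol S X"
  shows "symbol (norm c * S) (cscale c X)"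
proof -
  obtain f T where f: "((\<lambda>b. cscale (f b) (U b)) has_sum X) int_lattice"
    "((\<lambda>b. norm (f b) * weight b ^ 4) has_sum T) int_lattice" "T \<le> S"
    using assms by (auto simp: symbol_def)
  have "((\<lambda>b. cscale (c * f b) (U b)) has_sum cscale c X) int_lattice"
    using has_sum_bounded_linear[OF bounded_linear_cscale f(1), of c] by (simp add: cscale_cscale)
  moreover have "((\<lambda>b. norm (c * f b) * weight b ^ 4) has_sum norm c * T) int_lattice"
    using has_sum_cmult_right[OF f(2), of "norm c"] by (simp add: norm_mult mult.assoc)
  moreover have "norm c * T \<le> norm c * S" using f(3) by (intro mult_left_mono) auto
  ultimately show ?thesis unfolding symbol_def by (intro exI conjI)
qed

end

section \<open>Observable, potential and kinetic term as sums of Weyl operators\<close>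

abbreviation op_symbol :: "nat \<Rightarrow> real \<Rightarrow> ('d::finite \<Rightarrow> nat) opm \<Rightarrow> bool" where
  "op_symbol N S X \<equiv> weyl_algebra.symbol cscale (weyl_op N :: (real ^ 'd) \<times> (real ^ 'd) \<Rightarrow> ('d \<Rightarrow> nat) opm) S X"

lemma op_symbolI:
  fixes M :: "('d::finite \<Rightarrow> nat) cmatrix" and f :: "(real ^ 'd) \<times> (real ^ 'd) \<Rightarrow> complex"
  assumes N: "N \<ge> 1"
    and entries: "\<And>j k. j \<in> grid N \<Longrightarrow> k \<in> grid N \<Longrightarrow> ((\<lambda>b. f b * weyl_matrix N b j k) has_sum M j k) int_lattice"
    and T: "((\<lambda>b. norm (f b) * weight b ^ 4) has_sum T) int_lattice"
  shows "op_symbol N T (opm_of (grid N) M)"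
proof -
  interpret weyl_algebra cscale "weyl_op N :: (real ^ 'd) \<times> (real ^ 'd) \<Rightarrow> ('d \<Rightarrow> nat) opm" "planck N" "8 * pi\<^sup>2"
    by (rule weyl_algebra_weyl_op[OF N])
  have "((\<lambda>b. cscale (f b) (weyl_op N b)) has_sum opm_of (grid N) M) int_lattice"
  proof (rule opm_has_sum[OF finite_grid])
    have s: "supp (cscale c X) \<subseteq> supp X" for c and X :: "('d \<Rightarrow> nat) opm" by (auto simp: supp_def)
    show "supp (cscale (f b) (weyl_op N b)) \<subseteq> grid N" for b
      unfolding weyl_op_def by (rule order_trans[OF s supp_opm_of[OF finite_grid]])
  qed (use entries in \<open>auto simp: supp_opm_of entry_opm_of weyl_op_def\<close>)
  with T show ?thesis unfolding symbol_def by blast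
qed

text \<open>The quantifier over N comes after the bound: the Fourier coefficients belong to the
  function on the torus, and only the Weyl matrices change with N.\<close>

lemma observable_symbol:
  fixes a :: "(real ^ 'd) \<times> (real ^ 'd) \<Rightarrow> complex"
  assumes a: "smooth a" "torus_periodic a"
  shows "\<exists>S. \<forall>N\<ge>1. op_symbol N S (opm_of (grid N) (torus_quantization N a))"
proof -
  let ?T = "\<Sum>\<^sub>\<infinity>b\<in>int_lattice. norm (fourier_coeff a b) * weight b ^ 4"
  have "op_symbol N ?T (opm_of (grid N) (torus_quantization N a))" if N: "N \<ge> 1" for N
  proof (rule op_symbolI[OF N])
    show "((\<lambda>b. norm (fourier_coeff a b) * weight b ^ 4) has_sum ?T) int_lattice"
      by (rule has_sum_infsum[OF smooth_fourier_coeff_summable[OF a]])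
    fix j k :: "'d \<Rightarrow> nat"
    have "(\<lambda>b. fourier_coeff a b * weyl_matrix N b j k) summable_on int_lattice"
    proof (rule abs_summable_summable, rule summable_on_comparison_test)
      show "(\<lambda>b. norm (fourier_coeff a b)) summable_on int_lattice"
        using smooth_fourier_coeff_summable[OF a, of 0] by simp
      show "norm (fourier_coeff a b * weyl_matrix N b j k) \<le> norm (fourier_coeff a b)" for b
        using norm_weyl_matrix[of N b j k] by (simp add: norm_mult mult_left_le)
    qed simp
    then show "((\<lambda>b. fourier_coeff a b * weyl_matrix N b j k) has_sum torus_quantization N a j k) int_lattice"
      unfolding torus_quantization_fourier[OF N a] by (rule has_sum_infsum)
  qed
  then show ?thesis by blast
qed

lemma smooth_of_real:
  fixes V :: "'a::euclidean_space \<Rightarrow> real"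
  assumes "smooth V"
  shows "smooth (\<lambda>x. complex_of_real (V x))"
proof -
  have *: "iter_deriv vs (\<lambda>x. complex_of_real (V x)) = (\<lambda>x. complex_of_real (iter_deriv vs V x))" if "set vs \<subseteq> Basis" for vs
    using that
  proof (induction vs)
    case (Cons v vs)
    have "((\<lambda>x. complex_of_real (iter_deriv vs V x)) has_derivative
        (\<lambda>h. complex_of_real (frechet_derivative (iter_deriv vs V) (at x) h))) (at x)" for x
      using smooth_iter_deriv_differentiable[OF assms, of vs x] Cons.prems
      by (intro has_derivative_of_real) (simp add: frechet_derivative_works)
    note d = frechet_derivative_at[OF this, symmetric]
    have IH: "iter_deriv vs (\<lambda>x. complex_of_real (V x)) = (\<lambda>x. complex_of_real (iter_deriv vs V x))"
      using Cons by simp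
    show ?case by (simp add: IH d)
  qed simp
  show ?thesis
    unfolding smooth_def
  proof (intro allI impI)
    fix vs x assume vs: "set vs \<subseteq> (Basis :: 'a set)"
    have "iter_deriv vs V differentiable at x" by (rule smooth_iter_deriv_differentiable[OF assms vs])
    then show "iter_deriv vs (\<lambda>x. complex_of_real (V x)) differentiable at x"
      unfolding *[OF vs] differentiable_def by (auto intro: has_derivative_of_real)
  qed
qed

lemma l1_norm_Pair: "l1_norm (p, q) = l1_norm p + l1_norm q"
  unfolding l1_norm_def Basis_prod_def
  by (subst sum.union_disjoint) (auto simp: sum.reindex inj_on_def inner_prod_def)

lemma potential_symbol:
  fixes V :: "real ^ 'd \<Rightarrow> real"
  assumes V: "smooth V" "torus_periodic V"
  shows "\<exists>S. \<forall>N\<ge>1. op_symbol N S (opm_of (grid N) (potential V N))"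
proof -
  let ?V = "\<lambda>x. complex_of_real (V x)"
  have V': "smooth ?V" "torus_periodic ?V"
    using V by (auto intro: smooth_of_real simp: torus_periodic_def)
  define f where "f b = (if snd b = 0 then fourier_coeff ?V (fst b) else 0)" for b :: "(real ^ 'd) \<times> (real ^ 'd)"
  let ?T = "\<Sum>\<^sub>\<infinity>p\<in>int_lattice. norm (fourier_coeff ?V p) * weight p ^ 4"
  \<comment> \<open>A function of position alone has frequencies (p,0) only, so sums over the
    lattice of phase space reduce to sums over p.\<close>
  have reindex: "(g has_sum s) int_lattice"
    if "((\<lambda>p. g (p, 0)) has_sum s) int_lattice" "\<And>p q. q \<noteq> 0 \<Longrightarrow> g (p, q) = 0"
    for g :: "(real ^ 'd) \<times> (real ^ 'd) \<Rightarrow> 'e::{comm_monoid_add,topological_space}" and s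
  proof -
    have "(g has_sum s) ((\<lambda>p. (p, 0)) ` int_lattice)"
      using that(1) by (subst has_sum_reindex) (auto simp: inj_on_def o_def)
    then show ?thesis
      by (rule has_sum_cong_neutral[THEN iffD1, rotated -1])
         (use that(2) in \<open>force simp: int_lattice_Pair_iff\<close>)+
  qed
  have "op_symbol N ?T (opm_of (grid N) (potential V N))" if N: "N \<ge> 1" for N
  proof (rule op_symbolI[OF N, where f = f])
    show "((\<lambda>b. norm (f b) * weight b ^ 4) has_sum ?T) int_lattice"
    proof (rule reindex)
      have "l1_norm (p, 0 :: real ^ 'd) = l1_norm p" for p :: "real ^ 'd" by (simp add: l1_norm_Pair) (simp add: l1_norm_def)
      then show "((\<lambda>p. norm (f (p, 0)) * weight (p, 0 :: real ^ 'd) ^ 4) has_sum ?T) int_lattice"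
        using has_sum_infsum[OF smooth_fourier_coeff_summable[OF V']] by (simp add: f_def)
    qed (simp add: f_def)
    fix j k :: "'d \<Rightarrow> nat" assume jk: "j \<in> grid N" "k \<in> grid N"
    show "((\<lambda>b. f b * weyl_matrix N b j k) has_sum potential V N j k) int_lattice"
    proof (rule reindex)
      have "((\<lambda>p. fourier_coeff ?V p * character p (node N k) * of_bool (j = k)) has_sum ?V (node N k) * of_bool (j = k)) int_lattice"
        by (intro has_sum_cmult_left smooth_fourier_series V')
      moreover have "?V (node N k) * of_bool (j = k) = potential V N j k" by (simp add: potential_def)
      moreover have "f (p, 0) * weyl_matrix N (p, 0) j k = fourier_coeff ?V p * character p (node N k) * of_bool (j = k)" for p
        using jk by (simp add: f_def weyl_matrix_def node_diff_int_lattice[OF N])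
      ultimately show "((\<lambda>p. f (p, 0) * weyl_matrix N (p, 0) j k) has_sum potential V N j k) int_lattice" by simp
    qed (simp add: f_def)
  qed
  then show ?thesis by blast
qed

lemma nat_diff_div_Ints:
  fixes u v N :: nat
  assumes "N \<ge> 1" "v < N"
  shows "(real u - real v) / real N \<in> \<int> \<longleftrightarrow> u mod N = v"
proof
  assume "(real u - real v) / real N \<in> \<int>"
  then obtain z where "(real u - real v) / real N = of_int z" by (rule Ints_cases)
  then have "real u = real v + of_int z * real N" using assms by (simp add: field_simps)
  then have "real_of_int (int u) = real_of_int (int v + z * int N)" by simp
  then have "int u = int v + z * int N" by (simp only: of_int_eq_iff)
  then have "int u mod int N = int v" using assms by simp
  then show "u mod N = v" by (simp only: of_nat_mod[symmetric] of_nat_eq_iff)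
next
  assume "u mod N = v"
  then have "u = v + N * (u div N)" using mod_mult_div_eq[of u N] by simp
  then have "real u = real (v + N * (u div N))" by (simp only:)
  then have "real u = real v + real N * real (u div N)" by simp
  then have "(real u - real v) / real N = real (u div N)" using assms by simp
  then show "(real u - real v) / real N \<in> \<int>" by simp
qed

text \<open>For p = 0 there is no phase and the Weyl matrix is a cyclic shift in one coordinate. The
  conditions are phrased as in \<open>second_difference\<close> and kept as two separate operators,
  so that for N at most 2 coinciding entries add up on both sides.\<close>

lemma weyl_matrix_shift:
  fixes j k :: "'d::finite \<Rightarrow> nat"
  assumes N: "N \<ge> 1" and j: "j \<in> grid N" and k: "k \<in> grid N"
  shows "weyl_matrix N (0, axis i 1) j k = of_bool ((\<forall>l. l \<noteq> i \<longrightarrow> j l = k l) \<and> k i = (j i + 1) mod N)"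
    and "weyl_matrix N (0, - axis i 1) j k = of_bool ((\<forall>l. l \<noteq> i \<longrightarrow> j l = k l) \<and> (k i + 1) mod N = j i)"
proof -
  have jk: "j l < N" "k l < N" for l using j k by (auto simp: grid_def)
  have comp: "(node N j - (node N k - (1 / real N) *\<^sub>R x)) $ l = (real (j l) - real (k l) + x $ l) / real N" for x l
    using N by (simp add: node_def field_simps)
  have sgn: "(- y) / real N \<in> \<int> \<longleftrightarrow> y / real N \<in> \<int>" for y by simp
  have "node N j - (node N k - (1 / real N) *\<^sub>R axis i 1) \<in> int_lattice \<longleftrightarrow>
      (\<forall>l. l \<noteq> i \<longrightarrow> j l = k l) \<and> k i = (j i + 1) mod N"
  proof -
    have "node N j - (node N k - (1 / real N) *\<^sub>R axis i 1) \<in> int_lattice \<longleftrightarrow>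
        (\<forall>l. l \<noteq> i \<longrightarrow> (real (j l) - real (k l)) / real N \<in> \<int>) \<and> (real (j i + 1) - real (k i)) / real N \<in> \<int>"
      unfolding vec_in_int_lattice_iff comp by (auto simp: axis_def algebra_simps split: if_splits)
    then show ?thesis unfolding nat_diff_div_Ints[OF N jk(2)] by (auto simp: mod_less[OF jk(1)])
  qed
  then show "weyl_matrix N (0, axis i 1) j k = of_bool ((\<forall>l. l \<noteq> i \<longrightarrow> j l = k l) \<and> k i = (j i + 1) mod N)"
    using j k by (simp add: weyl_matrix_def)
  have "node N j - (node N k - (1 / real N) *\<^sub>R (- axis i 1)) \<in> int_lattice \<longleftrightarrow>
      (\<forall>l. l \<noteq> i \<longrightarrow> j l = k l) \<and> (k i + 1) mod N = j i"
  proof -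
    have "(real (j i) - real (k i) + (- axis i 1 :: real ^ 'd) $ i) / real N = (- (real (k i + 1) - real (j i))) / real N"
      by (simp add: axis_def)
    then have "node N j - (node N k - (1 / real N) *\<^sub>R (- axis i 1)) \<in> int_lattice \<longleftrightarrow>
        (\<forall>l. l \<noteq> i \<longrightarrow> (real (j l) - real (k l)) / real N \<in> \<int>) \<and> (real (k i + 1) - real (j i)) / real N \<in> \<int>"
      unfolding vec_in_int_lattice_iff comp sgn[symmetric, of "real (k i + 1) - real (j i)"]
      by (auto simp: axis_def algebra_simps split: if_splits)
    then show ?thesis
      unfolding nat_diff_div_Ints[OF N jk(2)] nat_diff_div_Ints[OF N jk(1)] by (auto simp: mod_less[OF jk(1)])
  qed
  then show "weyl_matrix N (0, - axis i 1) j k = of_bool ((\<forall>l. l \<noteq> i \<longrightarrow> j l = k l) \<and> (k i + 1) mod N = j i)"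
    using j k by (simp add: weyl_matrix_def)
qed

lemma kinetic_entry:
  fixes j k :: "'d::finite \<Rightarrow> nat"
  assumes N: "N \<ge> 1"
  shows "kinetic N j k = (\<Sum>i\<in>UNIV. complex_of_real (1 / (8 * pi\<^sup>2)) *
    (2 * of_bool (j = k) - of_bool ((\<forall>l. l \<noteq> i \<longrightarrow> j l = k l) \<and> (k i + 1) mod N = j i)
      - of_bool ((\<forall>l. l \<noteq> i \<longrightarrow> j l = k l) \<and> k i = (j i + 1) mod N)))"
  unfolding kinetic_def
proof (rule sum.cong[OF refl])
  fix i :: 'd
  have c: "(planck N)\<^sup>2 * (real N)\<^sup>2 / 2 = 1 / (8 * pi\<^sup>2)"
    using N by (simp add: planck_def power2_eq_square field_simps)
  have "tensor (\<lambda>l. if l = i then kinetic_1d N else mat_id) j k =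
      kinetic_1d N (j i) (k i) * (\<Prod>l\<in>UNIV - {i}. of_bool (j l = k l))"
    unfolding tensor_def by (subst prod.remove[of UNIV i]) (auto simp: mat_id_def intro!: prod.cong)
  also have "(\<Prod>l\<in>UNIV - {i}. of_bool (j l = k l) :: complex) = of_bool (\<forall>l. l \<noteq> i \<longrightarrow> j l = k l)"
  proof (cases "\<forall>l. l \<noteq> i \<longrightarrow> j l = k l")
    case False
    then obtain l where "l \<noteq> i" "j l \<noteq> k l" by blast
    then have "(\<Prod>l\<in>UNIV - {i}. of_bool (j l = k l) :: complex) = 0" by (intro prod_zero) auto
    then show ?thesis using False by simp
  qed (auto intro: prod.neutral)
  also have "kinetic_1d N (j i) (k i) * of_bool (\<forall>l. l \<noteq> i \<longrightarrow> j l = k l) = complex_of_real (1 / (8 * pi\<^sup>2)) *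
      (2 * of_bool (j = k) - of_bool ((\<forall>l. l \<noteq> i \<longrightarrow> j l = k l) \<and> (k i + 1) mod N = j i)
      - of_bool ((\<forall>l. l \<noteq> i \<longrightarrow> j l = k l) \<and> k i = (j i + 1) mod N))"
  proof -
    have "j = k \<longleftrightarrow> (\<forall>l. l \<noteq> i \<longrightarrow> j l = k l) \<and> k i = j i" by (metis ext)
    then show ?thesis
      unfolding kinetic_1d_def c second_difference_def by (cases "\<forall>l. l \<noteq> i \<longrightarrow> j l = k l") auto
  qed
  finally show "tensor (\<lambda>l. if l = i then kinetic_1d N else mat_id) j k = \<dots>" .
qed

text \<open>The prefactor of the second difference is 1/(8 pi^2) for every N, and shifts by one node
  are the Weyl operators of the unit momentum frequencies. The symbol is therefore a trigonometric
  polynomial with finitely many fixed coefficients.\<close>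

lemma kinetic_symbol: "\<exists>S. \<forall>N\<ge>1. op_symbol N S (opm_of (grid N) (kinetic N :: ('d::finite \<Rightarrow> nat) cmatrix))"
proof -
  let ?c = "1 / (8 * pi\<^sup>2) :: real"
  let ?e = "\<lambda>i. (0, axis i 1) :: (real ^ 'd) \<times> (real ^ 'd)"
  have lat: "?e i \<in> int_lattice" "- ?e i \<in> int_lattice" for i
    by (auto simp: int_lattice_Pair_iff int_lattice_minus vec_in_int_lattice_iff axis_def)
  let ?S = "\<Sum>i\<in>(UNIV :: 'd set). norm (2 * complex_of_real ?c) * weight (0 :: (real ^ 'd) \<times> (real ^ 'd)) ^ 4
      + (norm (- complex_of_real ?c) * weight (?e i) ^ 4 + norm (- complex_of_real ?c) * weight (- ?e i) ^ 4)"
  have "op_symbol N ?S (opm_of (grid N) (kinetic N :: ('d \<Rightarrow> nat) cmatrix))" if N: "N \<ge> 1" for N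
  proof -
    interpret weyl_algebra cscale "weyl_op N :: (real ^ 'd) \<times> (real ^ 'd) \<Rightarrow> ('d \<Rightarrow> nat) opm" "planck N" "8 * pi\<^sup>2"
      by (rule weyl_algebra_weyl_op[OF N])
    have "opm_of (grid N) (kinetic N :: ('d \<Rightarrow> nat) cmatrix) = (\<Sum>i\<in>UNIV. cscale (2 * complex_of_real ?c) (weyl_op N 0) +
        (cscale (- complex_of_real ?c) (weyl_op N (?e i)) + cscale (- complex_of_real ?c) (weyl_op N (- ?e i))))"
    proof (rule opm_eqI)
      fix j k :: "'d \<Rightarrow> nat"
      show "entry (opm_of (grid N) (kinetic N)) j k = entry (\<Sum>i\<in>UNIV. cscale (2 * complex_of_real ?c) (weyl_op N 0) +
        (cscale (- complex_of_real ?c) (weyl_op N (?e i)) + cscale (- complex_of_real ?c) (weyl_op N (- ?e i)))) j k"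
      proof (cases "j \<in> grid N \<and> k \<in> grid N")
        case True
        have alg: "c * (2 * x - y - w) = 2 * c * x + (- c * w + - c * y)" for c x y w :: complex
          by (simp add: algebra_simps)
        from True have z: "weyl_matrix N 0 j k = of_bool (j = k)"
          by (simp add: weyl_matrix_def node_diff_int_lattice[OF N])
        have "weyl_matrix N (- ?e i) j k = of_bool ((\<forall>l. l \<noteq> i \<longrightarrow> j l = k l) \<and> (k i + 1) mod N = j i)" for i
          using weyl_matrix_shift(2)[OF N, of j k i] True by simp
        then show ?thesis
          using True weyl_matrix_shift(1)[OF N, of j k]
          unfolding entry_opm_of[OF finite_grid] entry_sum entry_plus entry_cscale weyl_op_def z kinetic_entry[OF N]
          by (simp only: if_True simp_thms alg)
      qed (auto simp: entry_opm_of entry_sum entry_plus weyl_op_def)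
    qed
    moreover have "symbol ?S (\<Sum>i\<in>UNIV. cscale (2 * complex_of_real ?c) (weyl_op N 0) +
        (cscale (- complex_of_real ?c) (weyl_op N (?e i)) + cscale (- complex_of_real ?c) (weyl_op N (- ?e i))))"
      by (intro symbol_sum symbol_add symbol_single lat zero_in_int_lattice) auto
    ultimately show ?thesis by simp
  qed
  then show ?thesis by blast
qed

lemma second_difference_symmetric: "second_difference N j k = second_difference N k j"
  by (simp add: second_difference_def eq_commute algebra_simps)

lemma kinetic_hermitian:
  fixes j k :: "'d::finite \<Rightarrow> nat"
  shows "kinetic N k j = cnj (kinetic N j k)"
  unfolding kinetic_def cnj_sum
proof (rule sum.cong[OF refl])
  fix i :: 'd
  have kin: "kinetic_1d N a b = cnj (kinetic_1d N b a)" for a b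
    unfolding kinetic_1d_def second_difference_symmetric[of N a b] by (simp add: second_difference_def)
  have "(if l = i then kinetic_1d N else mat_id) a b = cnj ((if l = i then kinetic_1d N else mat_id) b a)" for l a b
  proof (cases "l = i")
    case True
    then show ?thesis using kin[of a b] by simp
  qed (auto simp: mat_id_def)
  then show "tensor (\<lambda>l. if l = i then kinetic_1d N else mat_id) k j = cnj (tensor (\<lambda>l. if l = i then kinetic_1d N else mat_id) j k)"
    unfolding tensor_def cnj_prod by (rule prod.cong[OF refl])
qed

lemma potential_hermitian: "potential V N k j = cnj (potential V N j k)"
  by (simp add: potential_def)

section \<open>Uniform error bounds and the number of time steps\<close>

lemma generator_eq: "generator I h X = (1 / h) *\<^sub>R cscale \<i> (opm_of I X)"
  unfolding generator_def cscale_of_real[symmetric] cscale_cscale by (simp add: mult.commute)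

text \<open>The factor 1/h stays outside the symbol: what must have a bound independent of N is i
  times the Hamiltonian, while 1/h is absorbed by the commutators.\<close>

lemma weyl_flow_propagator:
  fixes X :: "('d::finite \<Rightarrow> nat) cmatrix"
  assumes N: "N \<ge> 1" and X: "op_symbol N S (opm_of (grid N) X)" and herm: "\<And>j k. X k j = cnj (X j k)"
  shows "weyl_flow cscale (weyl_op N :: (real ^ 'd) \<times> (real ^ 'd) \<Rightarrow> ('d \<Rightarrow> nat) opm) (planck N) (8 * pi\<^sup>2)
    (\<lambda>s. opm_of (grid N) (propagator (grid N) (planck N) X s)) (cscale \<i> (opm_of (grid N) X)) (opm_of (grid N) mat_id) S"
proof -
  interpret weyl_algebra cscale "weyl_op N :: (real ^ 'd) \<times> (real ^ 'd) \<Rightarrow> ('d \<Rightarrow> nat) opm" "planck N" "8 * pi\<^sup>2"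
    by (rule weyl_algebra_weyl_op[OF N])
  interpret unitary_flow "\<lambda>s. opm_of (grid N) (propagator (grid N) (planck N) X s)"
    "(1 / planck N) *\<^sub>R cscale \<i> (opm_of (grid N) X)" "opm_of (grid N) mat_id"
    unfolding generator_eq[symmetric] by (rule unitary_flow_propagator[OF _ herm]) simp
  show ?thesis
  proof
    show "symbol S (cscale \<i> (opm_of (grid N) X))" using symbol_cscale[OF X, of \<i>] by simp
  qed (simp_all add: weyl_op_def opm_of_id_left opm_of_id_right supp_opm_of)
qed

text \<open>Iterated conjugation multiplies by \<open>Q'\<close> on the right, whereas the powers
  are built by multiplication on the left. The two agree because powers of \<open>Q'\<close> commute
  with \<open>Q'\<close>.\<close>

lemma funpow_conjugation:
  fixes Q Q' Y :: "'a::ring"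
  assumes "e * Y = Y" "Y * e = Y" "e * Q' = Q'" "Q' * e = Q'"
  shows "((\<lambda>Y. Q * Y * Q') ^^ n) Y = ((*) Q ^^ n) e * Y * ((*) Q' ^^ n) e"
proof -
  have comm: "((*) Q' ^^ n) e * Q' = Q' * ((*) Q' ^^ n) e" for n
    by (induction n) (simp_all add: assms mult.assoc)
  show ?thesis
  proof (induction n)
    case 0
    then show ?case by (simp add: assms)
  next
    case (Suc n)
    have "((\<lambda>Y. Q * Y * Q') ^^ Suc n) Y = Q * (((*) Q ^^ n) e * Y * ((*) Q' ^^ n) e) * Q'"
      by (simp add: Suc)
    also have "\<dots> = (Q * ((*) Q ^^ n) e) * Y * (((*) Q' ^^ n) e * Q')" by (simp only: mult.assoc)
    finally show ?case by (simp only: comm funpow.simps o_apply)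
  qed
qed

text \<open>Uniformity is a matter of order: the symbol bounds, the number of doublings and hence
  \<open>K\<close> are fixed before N and n appear. The interpretation of the abstract locale
  happens afterwards, for each N separately.\<close>

lemma trotter_errors_uniform:
  fixes V :: "real ^ 'd \<Rightarrow> real" and obs :: "(real ^ 'd) \<times> (real ^ 'd) \<Rightarrow> complex"
  assumes V: "smooth V" "torus_periodic V" and obs: "smooth obs" "torus_periodic obs" and t: "t > 0"
  shows "\<exists>K. \<forall>N\<ge>1. \<forall>n\<ge>1. trotter_error1 V obs t N n \<le> K / real n \<and> trotter_error2 V obs t N n \<le> K / (real n)\<^sup>2"
proof -
  obtain SA where SA: "\<And>N. N \<ge> 1 \<Longrightarrow> op_symbol N SA (opm_of (grid N) (kinetic N :: ('d \<Rightarrow> nat) cmatrix))"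
    using kinetic_symbol by blast
  obtain SB where SB: "\<And>N. N \<ge> 1 \<Longrightarrow> op_symbol N SB (opm_of (grid N) (potential V N))"
    using potential_symbol[OF V] by blast
  obtain SO where SO: "\<And>N. N \<ge> 1 \<Longrightarrow> op_symbol N SO (opm_of (grid N) (torus_quantization N obs))"
    using observable_symbol[OF obs] by blast
  define S where "S = max SA (max SB SO)"
  define \<kappa> :: real where "\<kappa> = 8 * pi\<^sup>2"
  define C where "C = step_const TYPE((real ^ 'd) \<times> (real ^ 'd)) \<kappa> (2 * S)"
  \<comment> \<open>The number of doubling intervals in Egorov's theorem for the total time t, taken
    with the growth constant of the full Hamiltonian.\<close>
  define m where "m = nat \<lceil>t * (2 * growth_const TYPE((real ^ 'd) \<times> (real ^ 'd)) \<kappa> (2 * S))\<rceil>"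
  define K where "K = max (4 * t\<^sup>2 * C ^ 3 * 2 ^ m) (11 * t ^ 3 * C ^ 4 * 2 ^ m)"
  have m: "t * (2 * growth_const TYPE((real ^ 'd) \<times> (real ^ 'd)) \<kappa> (2 * S)) \<le> real m"
    unfolding m_def by (rule real_nat_ceiling_ge)
  have "trotter_error1 V obs t N n \<le> K / real n \<and> trotter_error2 V obs t N n \<le> K / (real n)\<^sup>2"
    if N: "N \<ge> 1" and n: "n \<ge> 1" for N n
  proof -
    define I where "I = (grid N :: ('d \<Rightarrow> nat) set)"
    have I: "finite I" by (simp add: I_def)
    let ?h = "planck N"
    let ?A = "kinetic N :: ('d \<Rightarrow> nat) cmatrix" and ?B = "potential V N" and ?Ob = "torus_quantization N obs"
    let ?U = "weyl_op N :: (real ^ 'd) \<times> (real ^ 'd) \<Rightarrow> ('d \<Rightarrow> nat) opm"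
    define PA where "PA s = opm_of I (propagator I ?h ?A s)" for s
    define PB where "PB s = opm_of I (propagator I ?h ?B s)" for s
    define PH where "PH s = opm_of I (propagator I ?h (\<lambda>j k. ?A j k + ?B j k) s)" for s
    define Ob where "Ob = opm_of I ?Ob"
    define e where "e = opm_of I mat_id"
    interpret weyl_algebra cscale ?U ?h \<kappa>
      unfolding \<kappa>_def by (rule weyl_algebra_weyl_op[OF N])
    have sA: "op_symbol N S (opm_of I ?A)" and sB: "op_symbol N S (opm_of I ?B)" and sO: "op_symbol N S Ob"
      unfolding I_def Ob_def S_def
      by (rule symbol_mono[OF SA[OF N]] symbol_mono[OF SB[OF N]] symbol_mono[OF SO[OF N]], simp)+
    have sH: "op_symbol N (2 * S) (opm_of I (\<lambda>j k. ?A j k + ?B j k))"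
      using symbol_add[OF sA sB] by (simp add: opm_of_add[OF I])
    have hermH: "?A k j + ?B k j = cnj (?A j k + ?B j k)" for j k
      using kinetic_hermitian[of N k j] potential_hermitian[of V N k j] by simp
    interpret T: weyl_trotter cscale ?U ?h \<kappa> PA PB PH "cscale \<i> (opm_of I ?A)" "cscale \<i> (opm_of I ?B)" e S C
    proof (intro weyl_trotter.intro weyl_trotter_axioms.intro)
      show "weyl_algebra cscale ?U ?h \<kappa>" ..
      show "weyl_flow cscale ?U ?h \<kappa> PA (cscale \<i> (opm_of I ?A)) e S"
        using weyl_flow_propagator[OF N sA[unfolded I_def] kinetic_hermitian]
        by (simp add: PA_def[abs_def] e_def \<kappa>_def I_def)
      show "weyl_flow cscale ?U ?h \<kappa> PB (cscale \<i> (opm_of I ?B)) e S"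
        using weyl_flow_propagator[OF N sB[unfolded I_def] potential_hermitian]
        by (simp add: PB_def[abs_def] e_def \<kappa>_def I_def)
      show "weyl_flow cscale ?U ?h \<kappa> PH (cscale \<i> (opm_of I ?A) + cscale \<i> (opm_of I ?B)) e (2 * S)"
        using weyl_flow_propagator[OF N sH[unfolded I_def] hermH]
        by (simp add: PH_def[abs_def] e_def \<kappa>_def I_def cscale_add opm_of_add)
      show "C = step_const TYPE((real ^ 'd) \<times> (real ^ 'd)) \<kappa> (2 * S)" by (rule C_def)
    qed
    have unit: "e * X = X" "X * e = X" if "supp X \<subseteq> I" for X
      using opm_of_id_left[OF I that] opm_of_id_right[OF I that] by (simp_all add: e_def)
    have sP: "supp (PA s) \<subseteq> I" "supp (PB s) \<subseteq> I" "supp Ob \<subseteq> I" for s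
      by (simp_all add: PA_def PB_def Ob_def supp_opm_of[OF I])
    have ObK: "Ob \<in> T.A.K" unfolding T.A.K_def using unit[OF sP(3)] by simp
    have heis: "opm_of I (heisenberg I ?h ?A ?B ?Ob t) = T.H.E t Ob"
      by (simp add: heisenberg_def Let_def opm_of_mult[OF I] T.H.E_def PH_def Ob_def)
    let ?s = "t / real n"
    have t1: "opm_of I (trotter1 I ?h ?A ?B ?Ob n ?s) = ((\<lambda>Y. T.A.E ?s (T.B.E ?s Y)) ^^ n) Ob"
    proof -
      let ?Q = "PA ?s * PB ?s" and ?Q' = "PB (- ?s) * PA (- ?s)"
      have "(\<lambda>Y. T.A.E ?s (T.B.E ?s Y)) = (\<lambda>Y. ?Q * Y * ?Q')"
        by (simp add: T.A.E_def T.B.E_def mult.assoc)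
      moreover have "opm_of I (trotter1 I ?h ?A ?B ?Ob n ?s) = ((*) ?Q ^^ n) e * Ob * ((*) ?Q' ^^ n) e"
        by (simp add: trotter1_def Let_def opm_of_mult[OF I] opm_of_pow[OF I] PA_def PB_def Ob_def e_def)
      ultimately show ?thesis
        using funpow_conjugation[where e = e and Y = Ob and Q = ?Q and Q' = ?Q' and n = n] unit[OF sP(3)] unit[OF supp_mult[OF sP(2,1)]] by simp
    qed
    have t2: "opm_of I (trotter2 I ?h ?A ?B ?Ob n ?s) = ((\<lambda>Y. T.A.E (?s / 2) (T.B.E ?s (T.A.E (?s / 2) Y))) ^^ n) Ob"
    proof -
      let ?Q = "PA (?s / 2) * PB ?s * PA (?s / 2)" and ?Q' = "PA (- (?s / 2)) * PB (- ?s) * PA (- (?s / 2))"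
      have "(\<lambda>Y. T.A.E (?s / 2) (T.B.E ?s (T.A.E (?s / 2) Y))) = (\<lambda>Y. ?Q * Y * ?Q')"
        by (simp add: T.A.E_def T.B.E_def mult.assoc)
      moreover have "- ?s / 2 = - (?s / 2)" by simp
      then have "opm_of I (trotter2 I ?h ?A ?B ?Ob n ?s) = ((*) ?Q ^^ n) e * Ob * ((*) ?Q' ^^ n) e"
        unfolding trotter2_def Let_def by (simp only: opm_of_mult[OF I] opm_of_pow[OF I] PA_def PB_def Ob_def e_def)
      ultimately show ?thesis
        using funpow_conjugation[where e = e and Y = Ob and Q = ?Q and Q' = ?Q' and n = n] unit[OF sP(3)] unit[OF supp_mult[OF supp_mult[OF sP(1,2)] sP(1)]] by simp
    qed
    have "trotter_error1 V obs t N n = norm (((\<lambda>Y. T.A.E ?s (T.B.E ?s Y)) ^^ n) Ob - T.H.E t Ob)"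
      unfolding t1[symmetric] heis[symmetric] opm_of_diff[OF I, symmetric] norm_opm_of[OF I]
      by (simp add: trotter_error1_def Let_def I_def)
    also have "\<dots> \<le> 4 * t\<^sup>2 * C ^ 3 * 2 ^ m / real n"
      by (rule T.trotter_error1[OF sO ObK n t m])
    also have "\<dots> \<le> K / real n" by (intro divide_right_mono) (auto simp: K_def)
    finally have 1: "trotter_error1 V obs t N n \<le> K / real n" .
    have "trotter_error2 V obs t N n = norm (((\<lambda>Y. T.A.E (?s / 2) (T.B.E ?s (T.A.E (?s / 2) Y))) ^^ n) Ob - T.H.E t Ob)"
      unfolding t2[symmetric] heis[symmetric] opm_of_diff[OF I, symmetric] norm_opm_of[OF I]
      by (simp add: trotter_error2_def Let_def I_def)
    also have "\<dots> \<le> 11 * t ^ 3 * C ^ 4 * 2 ^ m / (real n)\<^sup>2"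
      by (rule T.trotter_error2[OF sO ObK n t m])
    also have "\<dots> \<le> K / (real n)\<^sup>2" by (intro divide_right_mono) (auto simp: K_def)
    finally have 2: "trotter_error2 V obs t N n \<le> K / (real n)\<^sup>2" .
    from 1 2 show ?thesis ..
  qed
  then show ?thesis by (intro exI[of _ K] allI impI)
qed

lemma required_steps_le:
  assumes "n \<ge> 1" "err n \<le> \<epsilon>" "real n \<le> c"
  shows "ereal_of_enat (required_steps err \<epsilon>) \<le> ereal c"
proof -
  have "required_steps err \<epsilon> \<le> enat n"
    unfolding required_steps_def by (rule Inf_lower) (use assms in auto)
  then have "ereal_of_enat (required_steps err \<epsilon>) \<le> ereal_of_enat (enat n)"
    by (simp only: ereal_of_enat_le_iff)
  also have "\<dots> \<le> ereal c" using assms(3) by simp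
  finally show ?thesis .
qed

theorem corollary12:
  fixes V :: "real ^ 'd \<Rightarrow> real"
    and obs :: "(real ^ 'd) \<times> (real ^ 'd) \<Rightarrow> complex"
    and t :: real
  assumes "smooth V" and "torus_periodic V"
    and "smooth obs" and "torus_periodic obs"
    and "t > 0"
  shows "\<exists>C > 0. \<exists>\<epsilon>\<^sub>0 > 0. \<forall>N \<ge> 1. \<forall>\<epsilon>::real. 0 < \<epsilon> \<and> \<epsilon> \<le> \<epsilon>\<^sub>0 \<longrightarrow>
    ereal_of_enat (required_steps (trotter_error1 V obs t N) \<epsilon>) \<le> ereal (C * \<epsilon> powr (-1)) \<and>
    ereal_of_enat (required_steps (trotter_error2 V obs t N) \<epsilon>) \<le> ereal (C * \<epsilon> powr (-1/2))"
proof -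
  obtain K0 where all: "\<forall>N\<ge>1. \<forall>n\<ge>1. trotter_error1 V obs t N n \<le> K0 / real n \<and> trotter_error2 V obs t N n \<le> K0 / (real n)\<^sup>2"
    using trotter_errors_uniform[OF assms] ..
  have K0: "trotter_error1 V obs t N n \<le> K0 / real n" "trotter_error2 V obs t N n \<le> K0 / (real n)\<^sup>2"
    if "N \<ge> 1" "n \<ge> 1" for N n
    using all that by simp_all
  \<comment> \<open>With \<open>K\<close> at least 1 and \<open>\<epsilon>\<close> at most 1, the
    real number of steps required is at least 1, so rounding up to an integer costs at most a factor
    2. This explains the choices \<open>2 * K\<close> and 1 for the two constants.\<close>
  define K where "K = max K0 1"
  have K: "1 \<le> K" "K0 \<le> K" by (auto simp: K_def)
  have ceil: "\<exists>n::nat. n \<ge> 1 \<and> y \<le> real n \<and> real n \<le> 2 * y" if "1 \<le> y" for y :: real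
  proof (intro exI conjI)
    show "y \<le> real (nat \<lceil>y\<rceil>)" by (rule real_nat_ceiling_ge)
    then show "1 \<le> nat \<lceil>y\<rceil>" using that by linarith
    show "real (nat \<lceil>y\<rceil>) \<le> 2 * y" using that by linarith
  qed
  show ?thesis
  proof (rule exI[of _ "2 * K"], rule conjI, use K in simp, rule exI[of _ 1], intro conjI allI impI)
    fix N :: nat and \<epsilon> :: real
    assume N: "N \<ge> 1" and "0 < \<epsilon> \<and> \<epsilon> \<le> 1"
    then have \<epsilon>: "0 < \<epsilon>" "\<epsilon> \<le> 1" by auto
    have K\<epsilon>: "1 \<le> K / \<epsilon>" using K \<epsilon> by simp
    obtain n where n: "n \<ge> 1" "K / \<epsilon> \<le> real n" "real n \<le> 2 * (K / \<epsilon>)" using ceil[OF K\<epsilon>] by blast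
    show "ereal_of_enat (required_steps (trotter_error1 V obs t N) \<epsilon>) \<le> ereal (2 * K * \<epsilon> powr (-1))"
    proof (rule required_steps_le[OF n(1)])
      have "K0 / real n \<le> K / real n" using K by (intro divide_right_mono) auto
      also have "\<dots> \<le> \<epsilon>" using n \<epsilon> by (simp add: field_simps)
      finally show "trotter_error1 V obs t N n \<le> \<epsilon>" using K0(1)[OF N n(1)] by simp
      show "real n \<le> 2 * K * \<epsilon> powr (-1)" using n(3) \<epsilon> by (simp add: powr_minus divide_inverse)
    qed
    have s1: "1 \<le> sqrt (K / \<epsilon>)" using K\<epsilon> by simp
    obtain n' where n': "n' \<ge> 1" "sqrt (K / \<epsilon>) \<le> real n'" "real n' \<le> 2 * sqrt (K / \<epsilon>)" using ceil[OF s1] by blast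
    show "ereal_of_enat (required_steps (trotter_error2 V obs t N) \<epsilon>) \<le> ereal (2 * K * \<epsilon> powr (-1/2))"
    proof (rule required_steps_le[OF n'(1)])
      have "K / \<epsilon> \<le> (real n')\<^sup>2" using n'(2) by (rule sqrt_le_D)
      then have "K / (real n')\<^sup>2 \<le> \<epsilon>" using n'(1) \<epsilon> by (simp add: field_simps)
      moreover have "K0 / (real n')\<^sup>2 \<le> K / (real n')\<^sup>2" using K by (intro divide_right_mono) auto
      ultimately show "trotter_error2 V obs t N n' \<le> \<epsilon>" using K0(2)[OF N n'(1)] by linarith
      \<comment> \<open>The second-order formula needs only the root of \<open>K\<close>; enlarging
        it lets both bounds share one constant.\<close>
      have "sqrt K \<le> K" using K(1) by (simp add: real_le_lsqrt power2_eq_square)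
      then have "2 * sqrt (K / \<epsilon>) \<le> 2 * K * (1 / sqrt \<epsilon>)"
        using \<epsilon> by (simp add: real_sqrt_divide divide_right_mono)
      also have "1 / sqrt \<epsilon> = \<epsilon> powr (-1/2)" using \<epsilon> by (simp add: powr_half_sqrt[symmetric] powr_minus_divide[symmetric])
      finally show "real n' \<le> 2 * K * \<epsilon> powr (-1/2)" using n'(3) by simp
    qed
  qed simp
qed

end
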